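(* Let $(M,\Delta,\mathbf g)$ be a three-dimensional contact sub-Riemannian manifold, with local orthonormal frame $f_1,f_2$ of $\Delta$, Reeb field $f_0$ and structure coefficients $c_{ij}^k$. There are just two nonzero linearly independent entries in the Weyl tensor of the associated Fefferman metric. They are \begin{align*} \alpha={}&-\tfrac{(c_{12}^1)^2c_{10}^2}{12}+\tfrac{(c_{12}^2)^2c_{10}^2}{12}-\tfrac{3(c_{10}^2)^2}{8}+\tfrac{(c_{12}^1)^2c_{20}^1}{12}-\tfrac{(c_{12}^2)^2c_{20}^1}{12}+\tfrac{3(c_{20}^1)^2}{8}\\ &-\tfrac{f_0(f_1(c_{12}^1))}{3}+\tfrac{f_0(f_2(c_{12}^2))}{3}+\tfrac{c_{12}^2f_0(c_{12}^1)}{6}+\tfrac{c_{12}^1f_0(c_{12}^2)}{6}-\tfrac{f_0(c_{10}^1)}{2}+\tfrac{f_0(c_{20}^2)}{2}\\ &-\tfrac{f_1(f_1(f_1(c_{12}^2)))}{12}+\tfrac{f_1(f_1(f_2(c_{12}^1)))}{12}-\tfrac{c_{12}^1f_1(f_1(c_{12}^1))}{6}-\tfrac{c_{12}^2f_1(f_1(c_{12}^2))}{12}\\ &+\tfrac{f_1(f_1(c_{20}^1))}{8}-\tfrac{c_{12}^2f_1(f_2(c_{12}^1))}{12}+\tfrac{c_{12}^1c_{12}^2f_1(c_{12}^1)}{6}-\tfrac{2c_{10}^1f_1(c_{12}^1)}{3}-\tfrac{f_1(c_{12}^1)^2}{6}\\ &+\tfrac{(c_{12}^2)^2f_1(c_{12}^2)}{6}-\tfrac{7c_{10}^2f_1(c_{12}^2)}{12}+\tfrac{c_{20}^1f_1(c_{12}^2)}{12}-\tfrac{f_1(c_{12}^2)^2}{6}-\tfrac{c_{12}^1f_1(c_{10}^1)}{3}\\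 &+\tfrac{c_{12}^2f_1(c_{20}^1)}{24}+\tfrac{c_{12}^1f_1(c_{20}^2)}{6}+\tfrac{c_{12}^1f_2(f_1(c_{12}^2))}{12}+\tfrac{f_2(f_2(f_1(c_{12}^2)))}{12}\\ &+\tfrac{c_{12}^1f_2(f_2(c_{12}^1))}{12}+\tfrac{c_{12}^2f_2(f_2(c_{12}^2))}{6}+\tfrac{f_2(f_2(c_{10}^2))}{8}-\tfrac{f_2(f_2(c_{20}^1))}{8}\\ &-\tfrac{c_{10}^2f_2(c_{12}^1)}{12}+\tfrac{7c_{20}^1f_2(c_{12}^1)}{12}+\tfrac{f_2(c_{12}^1)^2}{6}+\tfrac{c_{12}^1c_{12}^2f_2(c_{12}^2)}{6}+\tfrac{2c_{20}^2f_2(c_{12}^2)}{3}\\ &-\tfrac{f_1(f_1(c_{10}^2))}{8}-\tfrac{5c_{12}^2f_1(c_{10}^2)}{24}-\tfrac{f_2(f_2(f_2(c_{12}^1)))}{12}+\tfrac{(c_{12}^1)^2f_2(c_{12}^1)}{6}\\ &-\tfrac{c_{12}^2f_2(c_{10}^1)}{6}-\tfrac{c_{12}^1f_2(c_{10}^2)}{24}+\tfrac{5c_{12}^1f_2(c_{20}^1)}{24}+\tfrac{c_{12}^2f_2(c_{20}^2)}{3}+\tfrac{f_2(c_{12}^2)^2}{6}, \end{align*} \begin{align*} \beta={}&-\tfrac{c_{12}^1c_{12}^2c_{10}^2}{6}-\tfrac{c_{10}^1c_{10}^2}{8}+\tfrac{c_{12}^1c_{12}^2c_{20}^1}{6}-\tfrac{7c_{10}^1c_{20}^1}{8}-\tfrac{7c_{10}^2c_{20}^2}{8}-\tfrac{c_{20}^1c_{20}^2}{8}\\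 &-\tfrac{f_0(f_2(c_{12}^1))}{3}-\tfrac{c_{12}^1f_0(c_{12}^1)}{6}+\tfrac{c_{12}^2f_0(c_{12}^2)}{6}-\tfrac{f_0(c_{10}^2)}{2}-\tfrac{f_1(c_{12}^1)f_2(c_{12}^1)}{3}\\ &-\tfrac{f_1(f_2(f_1(c_{12}^2)))}{12}+\tfrac{f_1(f_2(f_2(c_{12}^1)))}{12}-\tfrac{c_{12}^1f_1(f_2(c_{12}^1))}{12}-\tfrac{c_{12}^2f_1(f_2(c_{12}^2))}{6}\\ &+\tfrac{f_1(f_2(c_{20}^1))}{8}-\tfrac{(c_{12}^1)^2f_1(c_{12}^1)}{6}-\tfrac{2c_{20}^1f_1(c_{12}^1)}{3}-\tfrac{c_{12}^1c_{12}^2f_1(c_{12}^2)}{6}-\tfrac{c_{10}^1f_1(c_{12}^2)}{12}\\ &-\tfrac{7c_{20}^2f_1(c_{12}^2)}{12}-\tfrac{c_{12}^1f_1(c_{10}^2)}{8}-\tfrac{3c_{12}^1f_1(c_{20}^1)}{8}-\tfrac{c_{12}^2f_1(c_{20}^2)}{6}-\tfrac{f_2(f_1(f_1(c_{12}^2)))}{12}\\ &+\tfrac{f_2(f_1(f_2(c_{12}^1)))}{12}-\tfrac{c_{12}^1f_2(f_1(c_{12}^1))}{6}-\tfrac{c_{12}^2f_2(f_1(c_{12}^2))}{12}-\tfrac{f_2(f_1(c_{10}^2))}{8}\\ &-\tfrac{c_{12}^2f_2(f_2(c_{12}^1))}{12}+\tfrac{c_{12}^1c_{12}^2f_2(c_{12}^1)}{6}-\tfrac{7c_{10}^1f_2(c_{12}^1)}{12}-\tfrac{c_{20}^2f_2(c_{12}^1)}{12}-\tfrac{f_0(c_{20}^1)}{2}\\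 &+\tfrac{(c_{12}^2)^2f_2(c_{12}^2)}{6}-\tfrac{2c_{10}^2f_2(c_{12}^2)}{3}-\tfrac{f_1(c_{12}^2)f_2(c_{12}^2)}{3}-\tfrac{c_{12}^1f_2(c_{10}^1)}{6}-\tfrac{3c_{12}^2f_2(c_{10}^2)}{8}\\ &-\tfrac{c_{12}^2f_2(c_{20}^1)}{8}-\tfrac{f_0(f_1(c_{12}^2))}{3}-\tfrac{c_{12}^1f_1(f_1(c_{12}^2))}{12}-\tfrac{f_1(f_2(c_{10}^2))}{8}+\tfrac{f_2(f_1(c_{20}^1))}{8}. \end{align*} Under a conformal rescaling $\mathbf g\mapsto e^{2\varphi}\mathbf g$, each of $\alpha$ and $\beta$ rescales by a factor $e^{-4\varphi}$. Their ratio is the (scalar differential) conformal invariant associated to the contact three-dimensional structure.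
   Context: A three-dimensional contact sub-Riemannian manifold $(M,\Delta,\mathbf g)$ consists of a smooth connected 3-manifold $M$, a smooth rank-two distribution $\Delta\subset TM$ which is locally the kernel of a one-form $\omega$ with $d\omega\wedge\omega\neq0$, and a Euclidean metric $\mathbf g_q$ on each $\Delta_q$ varying smoothly with $q$. The planes $\Delta_q$ are oriented and $\omega$ is normalized so that $d\omega|_\Delta$ is the area form. The Reeb field $f_0$ is defined by $\iota_{f_0}\omega=1$, $\iota_{f_0}d\omega=0$. For a local (oriented) orthonormal frame $f_1,f_2$ of $\Delta$ the structure coefficients $c_{ij}^k$ are the functions defined by $$[f_2,f_1]=f_0+c_{12}^1f_1+c_{12}^2f_2,\quad [f_1,f_0]=c_{10}^1f_1+c_{10}^2f_2,\quad [f_2,f_0]=c_{20}^1f_1+c_{20}^2f_2.$$ In the formulas, $f_i(u)$ denotes the derivative of the function $u$ along $f_i$, and $f_i(u)^2=(f_i(u))^2$. Fefferman metric: locally let $Z=M\times S^1$, with $\gamma$ the angular coordinate on $S^1$ and $f_\infty=\partial_\gamma$; the $f_i$ and $c_{ij}^k$ are extended to $Z$ constantly in $\gamma$. The Fefferman metric is the Lorentzian metric $g$ on $Z$ with components in the frame $(f_0,f_1,f_2,f_\infty)$ $g_{00}=\frac{c_{10}^2-c_{20}^1}{2}+\frac{(c_{12}^1)^2+(c_{12}^2)^2+f_1(c_{12}^2)-f_2(c_{12}^1)}{3}$, $g_{01}=-\frac{2c_{12}^1}{3}$, $g_{02}=-\frac{2c_{12}^2}{3}$, $g_{0\infty}=\frac23$,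 $g_{11}=g_{22}=1$, $g_{12}=g_{1\infty}=g_{2\infty}=g_{\infty\infty}=0$. It does not depend on the choice of the orthonormal frame, and rescaling $\mathbf g$ to $e^{2\varphi}\mathbf g$ rescales $g$ to $e^{2\varphi}g$. With $\nabla$ the Levi-Civita connection of $g$, $R(X,Y)W=[\nabla_X,\nabla_Y]W-\nabla_{[X,Y]}W$, $R^i{}_{jkl}=\langle R(f_k,f_l)f_j,\nu^i\rangle$ ($\nu^i$ the dual coframe), $R_{ij}=R^k{}_{ikj}$, $R=R^i{}_i$, the Weyl tensor is $W_{ijkl}=R_{ijkl}-\frac12(g_{ik}R_{jl}-g_{il}R_{jk}-g_{jk}R_{il}+g_{jl}R_{ik})+\frac R6(g_{ik}g_{jl}-g_{il}g_{jk})$. Under a rescaling of $\mathbf g$ by $e^{2\varphi}$, with $\varphi$ a smooth (local) function on $M$, the frame becomes $f_{1,\varphi}=e^{-\varphi}f_1$, $f_{2,\varphi}=e^{-\varphi}f_2$, $f_{0,\varphi}=e^{-2\varphi}(f_0+2f_2(\varphi)f_1-2f_1(\varphi)f_2)$. A conformal invariant is meant to be independent of the choice of coordinates, of the rotation of the frame $f_1,f_2$, and of the rescaling function $\varphi$.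
   Formalization: The ratio of α and β is not independent of the rotation of f_1, f_2; instead rotating the frame by t is shown to rotate (α, β) by 2t, and the ratio (where β ≠ 0) is invariant under coordinates, rescaling and changing the sign of both f_1 and f_2. *)

theory Defs
  imports "HOL-Analysis.Analysis"
begin

section \<open>Smooth manifolds\<close>

primrec Ck_on :: "nat \<Rightarrow> 'e::euclidean_space set \<Rightarrow> ('e \<Rightarrow> 'f::real_normed_vector) \<Rightarrow> bool" where
  "Ck_on 0 S f \<longleftrightarrow> continuous_on S f"
| "Ck_on (Suc k) S f \<longleftrightarrow>
     f differentiable_on S \<and> (\<forall>h. Ck_on k S (\<lambda>x. frechet_derivative f (at x) h))"

text \<open>Only used on open sets \<open>S\<close>.\<close>

definition smooth_on :: "'e::euclidean_space set \<Rightarrow> ('e \<Rightarrow> 'f::real_normed_vector) \<Rightarrow> bool" where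
  "smooth_on S f \<longleftrightarrow> (\<forall>k. Ck_on k S f)"

record ('a, 'e) manifold =
  mtop :: "'a topology"
  charts :: "('a set \<times> ('a \<Rightarrow> 'e)) set"

definition smooth_manifold :: "('a, 'e::euclidean_space) manifold \<Rightarrow> bool" where
  "smooth_manifold M \<longleftrightarrow>
     Hausdorff_space (mtop M) \<and> second_countable (mtop M) \<and>
     (\<Union>(V, \<phi>)\<in>charts M. V) = topspace (mtop M) \<and>
     (\<forall>(V, \<phi>)\<in>charts M. openin (mtop M) V \<and> open (\<phi> ` V) \<and>
        homeomorphic_map (subtopology (mtop M) V) (top_of_set (\<phi> ` V)) \<phi>) \<and>
     (\<forall>(V, \<phi>)\<in>charts M. \<forall>(V', \<phi>')\<in>charts M.
        smooth_on (\<phi> ` (V \<inter> V')) (\<phi>' \<circ> inv_into V \<phi>))"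

definition smooth_fun :: "('a, 'e::euclidean_space) manifold \<Rightarrow> 'a set \<Rightarrow> ('a \<Rightarrow> real) \<Rightarrow> bool" where
  "smooth_fun M U u \<longleftrightarrow>
     (\<forall>(V, \<phi>)\<in>charts M. smooth_on (\<phi> ` (U \<inter> V)) (u \<circ> inv_into V \<phi>))"

definition smooth_near :: "('a, 'e::euclidean_space) manifold \<Rightarrow> 'a \<Rightarrow> ('a \<Rightarrow> real) \<Rightarrow> bool" where
  "smooth_near M p u \<longleftrightarrow> (\<exists>U. openin (mtop M) U \<and> p \<in> U \<and> smooth_fun M U u)"

definition diffeomorphism ::
  "('a, 'e::euclidean_space) manifold \<Rightarrow> 'a set \<Rightarrow> ('b, 'f::euclidean_space) manifold \<Rightarrow> 'b set
    \<Rightarrow> ('a \<Rightarrow> 'b) \<Rightarrow> bool" where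
  "diffeomorphism M U N V \<Psi> \<longleftrightarrow>
     homeomorphic_map (subtopology (mtop M) U) (subtopology (mtop N) V) \<Psi> \<and>
     (\<forall>W u. openin (mtop N) W \<and> W \<subseteq> V \<longrightarrow>
        (smooth_fun N W u \<longleftrightarrow> smooth_fun M {p \<in> U. \<Psi> p \<in> W} (u \<circ> \<Psi>)))"

definition prod_manifold ::
  "('a, 'e::euclidean_space) manifold \<Rightarrow> ('b, 'f::euclidean_space) manifold
    \<Rightarrow> ('a \<times> 'b, 'e \<times> 'f) manifold" where
  "prod_manifold M N =
     \<lparr>mtop = prod_topology (mtop M) (mtop N),
      charts = {(V \<times> W, \<lambda>(p, q). (\<phi> p, \<psi> q)) |V \<phi> W \<psi>. (V, \<phi>) \<in> charts M \<and> (W, \<psi>) \<in> charts N}\<rparr>"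

text \<open>The charts of the unit circle are the continuous branches of the angle.\<close>

definition circle :: "(complex, real) manifold" where
  "circle =
     \<lparr>mtop = top_of_set (sphere 0 1),
      charts = {(W, \<psi>). openin (top_of_set (sphere 0 1)) W \<and> continuous_on W \<psi> \<and>
                        (\<forall>z\<in>W. cis (\<psi> z) = z)}\<rparr>"

section \<open>Tangent vectors, vector fields and one-forms\<close>

text \<open>A tangent vector at \<open>p\<close> is a directional derivative \<open>\<partial>\<^sub>h\<close> in a chart, acting on the
  functions that are smooth near \<open>p\<close>. It is \<open>0\<close> on all other functions, so that equality of tangent
  vectors is equality of HOL functions.\<close>

type_synonym 'a tvec = "('a \<Rightarrow> real) \<Rightarrow> real"
type_synonym 'a vfield = "'a \<Rightarrow> 'a tvec"

definition tangent_space :: "('a, 'e::euclidean_space) manifold \<Rightarrow> 'a \<Rightarrow> 'a tvec set" where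
  "tangent_space M p =
     {\<lambda>u. if smooth_near M p u then frechet_derivative (u \<circ> inv_into V \<phi>) (at (\<phi> p)) h else 0
       |V \<phi> h. (V, \<phi>) \<in> charts M \<and> p \<in> V}"

definition lincomb :: "real \<Rightarrow> 'a tvec \<Rightarrow> real \<Rightarrow> 'a tvec \<Rightarrow> 'a tvec" where
  "lincomb a v b w = (\<lambda>u. a * v u + b * w u)"

definition vector_field :: "('a, 'e::euclidean_space) manifold \<Rightarrow> 'a set \<Rightarrow> 'a vfield \<Rightarrow> bool" where
  "vector_field M U X \<longleftrightarrow>
     (\<forall>p\<in>U. X p \<in> tangent_space M p) \<and>
     (\<forall>V u. openin (mtop M) V \<and> V \<subseteq> U \<and> smooth_fun M V u \<longrightarrow> smooth_fun M V (\<lambda>p. X p u))"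

definition lie :: "('a, 'e::euclidean_space) manifold \<Rightarrow> 'a vfield \<Rightarrow> 'a vfield \<Rightarrow> 'a vfield" where
  "lie M X Y =
     (\<lambda>p u. if smooth_near M p u then X p (\<lambda>q. Y q u) - Y p (\<lambda>q. X q u) else 0)"

definition coframe :: "('n::finite \<Rightarrow> 'a vfield) \<Rightarrow> 'a \<Rightarrow> 'a tvec \<Rightarrow> real ^ 'n" where
  "coframe F p v = (THE a. v = (\<lambda>u. \<Sum>i\<in>UNIV. a $ i * F i p u))"

definition one_form ::
  "('a, 'e::euclidean_space) manifold \<Rightarrow> 'a set \<Rightarrow> ('a \<Rightarrow> 'a tvec \<Rightarrow> real) \<Rightarrow> bool" where
  "one_form M U \<omega> \<longleftrightarrow>
     (\<forall>p\<in>U. \<forall>v\<in>tangent_space M p. \<forall>w\<in>tangent_space M p. \<forall>a b.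
        \<omega> p (lincomb a v b w) = a * \<omega> p v + b * \<omega> p w) \<and>
     (\<forall>V X. openin (mtop M) V \<and> V \<subseteq> U \<and> vector_field M V X \<longrightarrow> smooth_fun M V (\<lambda>p. \<omega> p (X p)))"

definition ext_deriv ::
  "('a, 'e::euclidean_space) manifold \<Rightarrow> ('a \<Rightarrow> 'a tvec \<Rightarrow> real) \<Rightarrow> 'a vfield \<Rightarrow> 'a vfield \<Rightarrow> 'a \<Rightarrow> real"
  where
  "ext_deriv M \<omega> X Y p =
     X p (\<lambda>q. \<omega> q (Y q)) - Y p (\<lambda>q. \<omega> q (X q)) - \<omega> p (lie M X Y p)"

definition ext_deriv_wedge ::
  "('a, 'e::euclidean_space) manifold \<Rightarrow> ('a \<Rightarrow> 'a tvec \<Rightarrow> real)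
    \<Rightarrow> 'a vfield \<Rightarrow> 'a vfield \<Rightarrow> 'a vfield \<Rightarrow> 'a \<Rightarrow> real" where
  "ext_deriv_wedge M \<omega> X Y W p =
     ext_deriv M \<omega> X Y p * \<omega> p (W p) + ext_deriv M \<omega> Y W p * \<omega> p (X p)
     + ext_deriv M \<omega> W X p * \<omega> p (Y p)"

section \<open>Contact sub-Riemannian structures\<close>

definition section_on ::
  "('a, 'e::euclidean_space) manifold \<Rightarrow> ('a \<Rightarrow> 'a tvec set) \<Rightarrow> 'a set \<Rightarrow> 'a vfield \<Rightarrow> bool" where
  "section_on M \<Delta> U X \<longleftrightarrow> vector_field M U X \<and> (\<forall>p\<in>U. X p \<in> \<Delta> p)"

definition rank_two_distribution ::
  "('a, 'e::euclidean_space) manifold \<Rightarrow> ('a \<Rightarrow> 'a tvec set) \<Rightarrow> bool" where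
  "rank_two_distribution M \<Delta> \<longleftrightarrow>
     (\<forall>p\<in>topspace (mtop M). \<exists>V X Y. openin (mtop M) V \<and> p \<in> V \<and>
        vector_field M V X \<and> vector_field M V Y \<and>
        (\<forall>q\<in>V. \<Delta> q = {lincomb a (X q) b (Y q) |a b. True} \<and>
           (\<forall>a b. lincomb a (X q) b (Y q) = (\<lambda>u. 0) \<longrightarrow> a = 0 \<and> b = 0)))"

definition contact_distribution ::
  "('a, 'e::euclidean_space) manifold \<Rightarrow> ('a \<Rightarrow> 'a tvec set) \<Rightarrow> bool" where
  "contact_distribution M \<Delta> \<longleftrightarrow>
     rank_two_distribution M \<Delta> \<and>
     (\<forall>p\<in>topspace (mtop M). \<exists>V \<omega>. openin (mtop M) V \<and> p \<in> V \<and> one_form M V \<omega> \<and>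
        (\<forall>q\<in>V. \<Delta> q = {v \<in> tangent_space M q. \<omega> q v = 0} \<and>
           (\<exists>W X Y Z. openin (mtop M) W \<and> q \<in> W \<and> W \<subseteq> V \<and>
              vector_field M W X \<and> vector_field M W Y \<and> vector_field M W Z \<and>
              ext_deriv_wedge M \<omega> X Y Z q \<noteq> 0)))"

type_synonym 'a form2 = "'a \<Rightarrow> 'a tvec \<Rightarrow> 'a tvec \<Rightarrow> real"

definition smooth_form_on ::
  "('a, 'e::euclidean_space) manifold \<Rightarrow> ('a \<Rightarrow> 'a tvec set) \<Rightarrow> 'a form2 \<Rightarrow> bool" where
  "smooth_form_on M \<Delta> b \<longleftrightarrow>
     (\<forall>p\<in>topspace (mtop M). \<forall>x\<in>\<Delta> p. \<forall>y\<in>\<Delta> p. \<forall>z\<in>\<Delta> p. \<forall>s t.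
        b p (lincomb s x t y) z = s * b p x z + t * b p y z \<and>
        b p z (lincomb s x t y) = s * b p z x + t * b p z y) \<and>
     (\<forall>V X Y. openin (mtop M) V \<and> section_on M \<Delta> V X \<and> section_on M \<Delta> V Y \<longrightarrow>
        smooth_fun M V (\<lambda>p. b p (X p) (Y p)))"

definition euclidean_metric ::
  "('a, 'e::euclidean_space) manifold \<Rightarrow> ('a \<Rightarrow> 'a tvec set) \<Rightarrow> 'a form2 \<Rightarrow> bool" where
  "euclidean_metric M \<Delta> g \<longleftrightarrow>
     smooth_form_on M \<Delta> g \<and>
     (\<forall>p\<in>topspace (mtop M). \<forall>v\<in>\<Delta> p. \<forall>w\<in>\<Delta> p.
        g p v w = g p w v \<and> (v \<noteq> (\<lambda>u. 0) \<longrightarrow> g p v v > 0))"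

text \<open>The orientation of the planes \<open>\<Delta> p\<close> is given by their area form; the Gram identity
  determines the latter up to sign.\<close>

definition area_form ::
  "('a, 'e::euclidean_space) manifold \<Rightarrow> ('a \<Rightarrow> 'a tvec set) \<Rightarrow> 'a form2 \<Rightarrow> 'a form2 \<Rightarrow> bool" where
  "area_form M \<Delta> g \<mu> \<longleftrightarrow>
     smooth_form_on M \<Delta> \<mu> \<and>
     (\<forall>p\<in>topspace (mtop M). \<forall>v\<in>\<Delta> p. \<forall>w\<in>\<Delta> p.
        \<mu> p v w = - \<mu> p w v \<and> (\<mu> p v w)\<^sup>2 = g p v v * g p w w - (g p v w)\<^sup>2)"

definition contact_sub_Riemannian ::
  "('a, real ^ 3) manifold \<Rightarrow> ('a \<Rightarrow> 'a tvec set) \<Rightarrow> 'a form2 \<Rightarrow> 'a form2 \<Rightarrow> bool" where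
  "contact_sub_Riemannian M \<Delta> g \<mu> \<longleftrightarrow>
     smooth_manifold M \<and> connected_space (mtop M) \<and>
     contact_distribution M \<Delta> \<and> euclidean_metric M \<Delta> g \<and> area_form M \<Delta> g \<mu>"

definition normalized_contact_form ::
  "('a, real ^ 3) manifold \<Rightarrow> ('a \<Rightarrow> 'a tvec set) \<Rightarrow> 'a form2 \<Rightarrow> 'a set
    \<Rightarrow> ('a \<Rightarrow> 'a tvec \<Rightarrow> real) \<Rightarrow> bool" where
  "normalized_contact_form M \<Delta> \<mu> U \<omega> \<longleftrightarrow>
     one_form M U \<omega> \<and>
     (\<forall>p\<in>U. \<Delta> p = {v \<in> tangent_space M p. \<omega> p v = 0}) \<and>
     (\<forall>V X Y. openin (mtop M) V \<and> V \<subseteq> U \<and> section_on M \<Delta> V X \<and> section_on M \<Delta> V Y \<longrightarrow>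
        (\<forall>p\<in>V. ext_deriv M \<omega> X Y p = \<mu> p (X p) (Y p)))"

definition Reeb_field ::
  "('a, real ^ 3) manifold \<Rightarrow> 'a set \<Rightarrow> ('a \<Rightarrow> 'a tvec \<Rightarrow> real) \<Rightarrow> 'a vfield \<Rightarrow> bool" where
  "Reeb_field M U \<omega> f0 \<longleftrightarrow>
     vector_field M U f0 \<and> (\<forall>p\<in>U. \<omega> p (f0 p) = 1) \<and>
     (\<forall>V X. openin (mtop M) V \<and> V \<subseteq> U \<and> vector_field M V X \<longrightarrow>
        (\<forall>p\<in>V. ext_deriv M \<omega> f0 X p = 0))"

definition oriented_orthonormal_frame ::
  "('a, real ^ 3) manifold \<Rightarrow> ('a \<Rightarrow> 'a tvec set) \<Rightarrow> 'a form2 \<Rightarrow> 'a form2 \<Rightarrow> 'a set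
    \<Rightarrow> 'a vfield \<Rightarrow> 'a vfield \<Rightarrow> bool" where
  "oriented_orthonormal_frame M \<Delta> g \<mu> U f1 f2 \<longleftrightarrow>
     section_on M \<Delta> U f1 \<and> section_on M \<Delta> U f2 \<and>
     (\<forall>p\<in>U. g p (f1 p) (f1 p) = 1 \<and> g p (f2 p) (f2 p) = 1 \<and> g p (f1 p) (f2 p) = 0 \<and>
        \<mu> p (f1 p) (f2 p) = 1)"

text \<open>The index type \<open>3\<close> has the elements \<open>0\<close>, \<open>1\<close>, \<open>2\<close>.\<close>

definition adapted_frame ::
  "('a, real ^ 3) manifold \<Rightarrow> ('a \<Rightarrow> 'a tvec set) \<Rightarrow> 'a form2 \<Rightarrow> 'a form2 \<Rightarrow> 'a set
    \<Rightarrow> (3 \<Rightarrow> 'a vfield) \<Rightarrow> bool" where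
  "adapted_frame M \<Delta> g \<mu> U f \<longleftrightarrow>
     openin (mtop M) U \<and> oriented_orthonormal_frame M \<Delta> g \<mu> U (f 1) (f 2) \<and>
     (\<exists>\<omega>. normalized_contact_form M \<Delta> \<mu> U \<omega> \<and> Reeb_field M U \<omega> (f 0))"

definition c12 :: "('a, 'e::euclidean_space) manifold \<Rightarrow> (3 \<Rightarrow> 'a vfield) \<Rightarrow> 3 \<Rightarrow> 'a \<Rightarrow> real" where
  "c12 M f k p = coframe f p (lie M (f 2) (f 1) p) $ k"

definition c10 :: "('a, 'e::euclidean_space) manifold \<Rightarrow> (3 \<Rightarrow> 'a vfield) \<Rightarrow> 3 \<Rightarrow> 'a \<Rightarrow> real" where
  "c10 M f k p = coframe f p (lie M (f 1) (f 0) p) $ k"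

definition c20 :: "('a, 'e::euclidean_space) manifold \<Rightarrow> (3 \<Rightarrow> 'a vfield) \<Rightarrow> 3 \<Rightarrow> 'a \<Rightarrow> real" where
  "c20 M f k p = coframe f p (lie M (f 2) (f 0) p) $ k"

definition rescale_form :: "('a \<Rightarrow> real) \<Rightarrow> 'a form2 \<Rightarrow> 'a form2" where
  "rescale_form \<phi> b = (\<lambda>p v w. exp (2 * \<phi> p) * b p v w)"

definition rescale_frame :: "('a \<Rightarrow> real) \<Rightarrow> (3 \<Rightarrow> 'a vfield) \<Rightarrow> 3 \<Rightarrow> 'a vfield" where
  "rescale_frame \<phi> f i =
     (if i = 0
      then (\<lambda>p u. exp (- 2 * \<phi> p) * (f 0 p u + 2 * f 2 p \<phi> * f 1 p u - 2 * f 1 p \<phi> * f 2 p u))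
      else (\<lambda>p u. exp (- \<phi> p) * f i p u))"

section \<open>Levi-Civita connection and Weyl tensor\<close>

definition levi_civita ::
  "('a, 'e::euclidean_space) manifold \<Rightarrow> 'a set \<Rightarrow> 'a form2
    \<Rightarrow> ('a vfield \<Rightarrow> 'a vfield \<Rightarrow> 'a vfield) \<Rightarrow> bool" where
  "levi_civita N U g D \<longleftrightarrow>
     (\<forall>X Y. vector_field N U X \<and> vector_field N U Y \<longrightarrow> vector_field N U (D X Y)) \<and>
     (\<forall>X Y W h. vector_field N U X \<and> vector_field N U Y \<and> vector_field N U W \<and> smooth_fun N U h \<longrightarrow>
        (\<forall>p\<in>U.
          D (\<lambda>q u. h q * X q u + Y q u) W p = (\<lambda>u. h p * D X W p u + D Y W p u) \<and>
          D W (\<lambda>q u. h q * X q u + Y q u) p = (\<lambda>u. W p h * X p u + h p * D W X p u + D W Y p u) \<and>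
          W p (\<lambda>q. g q (X q) (Y q)) = g p (D W X p) (Y p) + g p (X p) (D W Y p) \<and>
          (\<lambda>u. D X Y p u - D Y X p u) = lie N X Y p))"

definition curvature ::
  "('a, 'e::euclidean_space) manifold \<Rightarrow> ('a vfield \<Rightarrow> 'a vfield \<Rightarrow> 'a vfield)
    \<Rightarrow> 'a vfield \<Rightarrow> 'a vfield \<Rightarrow> 'a vfield \<Rightarrow> 'a vfield" where
  "curvature N D X Y W p = (\<lambda>u. D X (D Y W) p u - D Y (D X W) p u - D (lie N X Y) W p u)"

definition metric_comp :: "'a form2 \<Rightarrow> ('n::finite \<Rightarrow> 'a vfield) \<Rightarrow> 'a \<Rightarrow> real ^ 'n ^ 'n" where
  "metric_comp g F p = (\<chi> i j. g p (F i p) (F j p))"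

definition Riemann_up ::
  "('a, 'e::euclidean_space) manifold \<Rightarrow> ('a vfield \<Rightarrow> 'a vfield \<Rightarrow> 'a vfield)
    \<Rightarrow> ('n::finite \<Rightarrow> 'a vfield) \<Rightarrow> 'a \<Rightarrow> 'n \<Rightarrow> 'n \<Rightarrow> 'n \<Rightarrow> 'n \<Rightarrow> real" where
  "Riemann_up N D F p i j k l = coframe F p (curvature N D (F k) (F l) (F j) p) $ i"

definition Riemann ::
  "('a, 'e::euclidean_space) manifold \<Rightarrow> 'a form2 \<Rightarrow> ('a vfield \<Rightarrow> 'a vfield \<Rightarrow> 'a vfield)
    \<Rightarrow> ('n::finite \<Rightarrow> 'a vfield) \<Rightarrow> 'a \<Rightarrow> 'n \<Rightarrow> 'n \<Rightarrow> 'n \<Rightarrow> 'n \<Rightarrow> real" where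
  "Riemann N g D F p i j k l = (\<Sum>m\<in>UNIV. metric_comp g F p $ i $ m * Riemann_up N D F p m j k l)"

definition Ricci ::
  "('a, 'e::euclidean_space) manifold \<Rightarrow> ('a vfield \<Rightarrow> 'a vfield \<Rightarrow> 'a vfield)
    \<Rightarrow> ('n::finite \<Rightarrow> 'a vfield) \<Rightarrow> 'a \<Rightarrow> 'n \<Rightarrow> 'n \<Rightarrow> real" where
  "Ricci N D F p i j = (\<Sum>k\<in>UNIV. Riemann_up N D F p k i k j)"

definition scalar_curvature ::
  "('a, 'e::euclidean_space) manifold \<Rightarrow> 'a form2 \<Rightarrow> ('a vfield \<Rightarrow> 'a vfield \<Rightarrow> 'a vfield)
    \<Rightarrow> ('n::finite \<Rightarrow> 'a vfield) \<Rightarrow> 'a \<Rightarrow> real" where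
  "scalar_curvature N g D F p =
     (\<Sum>i\<in>UNIV. \<Sum>j\<in>UNIV. matrix_inv (metric_comp g F p) $ i $ j * Ricci N D F p j i)"

text \<open>The coefficients are those of dimension four.\<close>

definition Weyl ::
  "('a, 'e::euclidean_space) manifold \<Rightarrow> 'a form2 \<Rightarrow> ('a vfield \<Rightarrow> 'a vfield \<Rightarrow> 'a vfield)
    \<Rightarrow> ('n::finite \<Rightarrow> 'a vfield) \<Rightarrow> 'a \<Rightarrow> 'n \<Rightarrow> 'n \<Rightarrow> 'n \<Rightarrow> 'n \<Rightarrow> real" where
  "Weyl N g D F p i j k l =
     (let G = (\<lambda>i j. metric_comp g F p $ i $ j); Rc = Ricci N D F p in
      Riemann N g D F p i j k l
      - (G i k * Rc j l - G i l * Rc j k - G j k * Rc i l + G j l * Rc i k) / 2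
      + scalar_curvature N g D F p / 6 * (G i k * G j l - G i l * G j k))"

section \<open>The Fefferman metric\<close>

definition circle_bundle :: "('a, 'e::euclidean_space) manifold \<Rightarrow> ('a \<times> complex, 'e \<times> real) manifold"
  where "circle_bundle M = prod_manifold M circle"

definition lift_vfield :: "('a, 'e::euclidean_space) manifold \<Rightarrow> 'a vfield \<Rightarrow> ('a \<times> complex) vfield"
  where
  "lift_vfield M X =
     (\<lambda>(q, z) u. if smooth_near (circle_bundle M) (q, z) u then X q (\<lambda>q'. u (q', z)) else 0)"

definition d_gamma :: "('a, 'e::euclidean_space) manifold \<Rightarrow> ('a \<times> complex) vfield" where
  "d_gamma M =
     (\<lambda>(q, z) u. if smooth_near (circle_bundle M) (q, z) u
                 then deriv (\<lambda>t::real. u (q, z * cis t)) 0 else 0)"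

text \<open>The index \<open>None\<close> stands for \<open>\<infinity>\<close>.\<close>

definition fefferman_frame ::
  "('a, 'e::euclidean_space) manifold \<Rightarrow> (3 \<Rightarrow> 'a vfield) \<Rightarrow> 3 option \<Rightarrow> ('a \<times> complex) vfield" where
  "fefferman_frame M f i = (case i of Some k \<Rightarrow> lift_vfield M (f k) | None \<Rightarrow> d_gamma M)"

definition fefferman_comp ::
  "('a, 'e::euclidean_space) manifold \<Rightarrow> (3 \<Rightarrow> 'a vfield) \<Rightarrow> 'a \<Rightarrow> 3 option \<Rightarrow> 3 option \<Rightarrow> real" where
  "fefferman_comp M f q i j =
     (case (i, j) of
        (Some a, Some b) \<Rightarrow>
          (if a = 0 \<and> b = 0 then
             (c10 M f 2 q - c20 M f 1 q) / 2
             + ((c12 M f 1 q)\<^sup>2 + (c12 M f 2 q)\<^sup>2 + f 1 q (c12 M f 2) - f 2 q (c12 M f 1)) / 3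
           else if a = 0 then - (2 * c12 M f b q) / 3
           else if b = 0 then - (2 * c12 M f a q) / 3
           else if a = b then 1 else 0)
      | (Some a, None) \<Rightarrow> (if a = 0 then 2 / 3 else 0)
      | (None, Some b) \<Rightarrow> (if b = 0 then 2 / 3 else 0)
      | (None, None) \<Rightarrow> 0)"

definition fefferman_metric ::
  "('a, 'e::euclidean_space) manifold \<Rightarrow> (3 \<Rightarrow> 'a vfield) \<Rightarrow> ('a \<times> complex) form2" where
  "fefferman_metric M f p v w =
     (\<Sum>i\<in>UNIV. \<Sum>j\<in>UNIV. fefferman_comp M f (fst p) i j
        * coframe (fefferman_frame M f) p v $ i * coframe (fefferman_frame M f) p w $ j)"

definition fef_alpha :: "('a, 'e::euclidean_space) manifold \<Rightarrow> (3 \<Rightarrow> 'a vfield) \<Rightarrow> 'a \<Rightarrow> real" where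
  "fef_alpha M f p =
    (let f0 = (\<lambda>u q. f 0 q u); f1 = (\<lambda>u q. f 1 q u); f2 = (\<lambda>u q. f 2 q u);
         c121 = c12 M f 1; c122 = c12 M f 2; c101 = c10 M f 1; c102 = c10 M f 2;
         c201 = c20 M f 1; c202 = c20 M f 2
     in
       - ((c121 p)\<^sup>2 * c102 p / 12) + (c122 p)\<^sup>2 * c102 p / 12 - 3 * (c102 p)\<^sup>2 / 8
       + (c121 p)\<^sup>2 * c201 p / 12 - (c122 p)\<^sup>2 * c201 p / 12 + 3 * (c201 p)\<^sup>2 / 8
       - f0 (f1 c121) p / 3 + f0 (f2 c122) p / 3 + c122 p * f0 c121 p / 6
       + c121 p * f0 c122 p / 6 - f0 c101 p / 2 + f0 c202 p / 2 - f1 (f1 (f1 c122)) p / 12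
       + f1 (f1 (f2 c121)) p / 12 - c121 p * f1 (f1 c121) p / 6 - c122 p * f1 (f1 c122) p / 12
       + f1 (f1 c201) p / 8 - c122 p * f1 (f2 c121) p / 12 + c121 p * c122 p * f1 c121 p / 6
       - 2 * c101 p * f1 c121 p / 3 - (f1 c121 p)\<^sup>2 / 6 + (c122 p)\<^sup>2 * f1 c122 p / 6
       - 7 * c102 p * f1 c122 p / 12 + c201 p * f1 c122 p / 12 - (f1 c122 p)\<^sup>2 / 6
       - c121 p * f1 c101 p / 3 + c122 p * f1 c201 p / 24 + c121 p * f1 c202 p / 6
       + c121 p * f2 (f1 c122) p / 12 + f2 (f2 (f1 c122)) p / 12 + c121 p * f2 (f2 c121) p / 12
       + c122 p * f2 (f2 c122) p / 6 + f2 (f2 c102) p / 8 - f2 (f2 c201) p / 8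
       - c102 p * f2 c121 p / 12 + 7 * c201 p * f2 c121 p / 12 + (f2 c121 p)\<^sup>2 / 6
       + c121 p * c122 p * f2 c122 p / 6 + 2 * c202 p * f2 c122 p / 3 - f1 (f1 c102) p / 8
       - 5 * c122 p * f1 c102 p / 24 - f2 (f2 (f2 c121)) p / 12 + (c121 p)\<^sup>2 * f2 c121 p / 6
       - c122 p * f2 c101 p / 6 - c121 p * f2 c102 p / 24 + 5 * c121 p * f2 c201 p / 24
       + c122 p * f2 c202 p / 3 + (f2 c122 p)\<^sup>2 / 6)"

definition fef_beta :: "('a, 'e::euclidean_space) manifold \<Rightarrow> (3 \<Rightarrow> 'a vfield) \<Rightarrow> 'a \<Rightarrow> real" where
  "fef_beta M f p =
    (let f0 = (\<lambda>u q. f 0 q u); f1 = (\<lambda>u q. f 1 q u); f2 = (\<lambda>u q. f 2 q u);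
         c121 = c12 M f 1; c122 = c12 M f 2; c101 = c10 M f 1; c102 = c10 M f 2;
         c201 = c20 M f 1; c202 = c20 M f 2
     in
       - (c121 p * c122 p * c102 p / 6) - c101 p * c102 p / 8 + c121 p * c122 p * c201 p / 6
       - 7 * c101 p * c201 p / 8 - 7 * c102 p * c202 p / 8 - c201 p * c202 p / 8
       - f0 (f2 c121) p / 3 - c121 p * f0 c121 p / 6 + c122 p * f0 c122 p / 6 - f0 c102 p / 2
       - f1 c121 p * f2 c121 p / 3 - f1 (f2 (f1 c122)) p / 12 + f1 (f2 (f2 c121)) p / 12
       - c121 p * f1 (f2 c121) p / 12 - c122 p * f1 (f2 c122) p / 6 + f1 (f2 c201) p / 8
       - (c121 p)\<^sup>2 * f1 c121 p / 6 - 2 * c201 p * f1 c121 p / 3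
       - c121 p * c122 p * f1 c122 p / 6 - c101 p * f1 c122 p / 12 - 7 * c202 p * f1 c122 p / 12
       - c121 p * f1 c102 p / 8 - 3 * c121 p * f1 c201 p / 8 - c122 p * f1 c202 p / 6
       - f2 (f1 (f1 c122)) p / 12 + f2 (f1 (f2 c121)) p / 12 - c121 p * f2 (f1 c121) p / 6
       - c122 p * f2 (f1 c122) p / 12 - f2 (f1 c102) p / 8 - c122 p * f2 (f2 c121) p / 12
       + c121 p * c122 p * f2 c121 p / 6 - 7 * c101 p * f2 c121 p / 12 - c202 p * f2 c121 p / 12
       - f0 c201 p / 2 + (c122 p)\<^sup>2 * f2 c122 p / 6 - 2 * c102 p * f2 c122 p / 3
       - f1 c122 p * f2 c122 p / 3 - c121 p * f2 c101 p / 6 - 3 * c122 p * f2 c102 p / 8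
       - c122 p * f2 c201 p / 8 - f0 (f1 c122) p / 3 - c121 p * f1 (f1 c122) p / 12
       - f1 (f2 c102) p / 8 + f2 (f1 c201) p / 8)"

section \<open>Conformal equivalences\<close>

definition pushforward :: "('a \<Rightarrow> 'b) \<Rightarrow> 'a tvec \<Rightarrow> 'b tvec" where
  "pushforward \<Psi> v = (\<lambda>u. v (u \<circ> \<Psi>))"

definition conformal_equivalence ::
  "('a, real ^ 3) manifold \<Rightarrow> ('a \<Rightarrow> 'a tvec set) \<Rightarrow> 'a form2 \<Rightarrow> 'a form2 \<Rightarrow> 'a set
    \<Rightarrow> ('b, real ^ 3) manifold \<Rightarrow> ('b \<Rightarrow> 'b tvec set) \<Rightarrow> 'b form2 \<Rightarrow> 'b form2 \<Rightarrow> 'b set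
    \<Rightarrow> ('a \<Rightarrow> 'b) \<Rightarrow> ('a \<Rightarrow> real) \<Rightarrow> bool" where
  "conformal_equivalence M \<Delta> g \<mu> U M' \<Delta>' g' \<mu>' U' \<Psi> \<phi> \<longleftrightarrow>
     diffeomorphism M U M' U' \<Psi> \<and> smooth_fun M U \<phi> \<and>
     (\<forall>p\<in>U. \<Delta>' (\<Psi> p) = pushforward \<Psi> ` \<Delta> p \<and>
        (\<forall>v\<in>\<Delta> p. \<forall>w\<in>\<Delta> p.
           g' (\<Psi> p) (pushforward \<Psi> v) (pushforward \<Psi> w) = exp (2 * \<phi> p) * g p v w \<and>
           \<mu>' (\<Psi> p) (pushforward \<Psi> v) (pushforward \<Psi> w) = exp (2 * \<phi> p) * \<mu> p v w))"

end

theory Submission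
  imports Defs "HOL-Library.Function_Algebras"
begin

text \<open>
  The theorem has three independent parts: a curvature computation, a covariance property and an
  example.

  \<^emph>\<open>The Weyl tensor.\<close> The Fefferman metric has components that do not depend on the fibre coordinate,
  and the frame of the circle bundle has the brackets of the contact frame, with \<open>\<partial>\<^sub>\<gamma>\<close> central. By the
  Koszul formula (\<open>koszul\<close>, \<open>Riemann_eq\<close>) the Levi-Civita connection and its curvature are then given by
  differential expressions in the structure coefficients on the base (\<open>Weyl_Wm\<close>). These are elements of
  an algebra with a normal form: the commutation relations order the derivatives, and the Jacobi
  identity eliminates the derivatives of \<open>c12\<close> along the Reeb field. Up to symmetry there are 36
  components; comparing normal forms shows that 32 vanish and that the other four are \<open>\<alpha>\<close>,
  \<open>- \<alpha>\<close> and, twice, \<open>\<beta>\<close> (\<open>Weyl_components\<close>). The value of the component \<open>G0\<close> of the metric is only needed in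
  the last step.

  \<^emph>\<open>Covariance.\<close> The oriented conformal structure on the contact planes is a CR structure, and
  \<open>- 24 (\<alpha> - \<i> \<beta>)\<close> is its Cartan tensor. In terms of \<open>Z = f\<^sub>1 - \<i> f\<^sub>2\<close> it is
  \<open>P\<^sub>1 P\<^sub>0 \<rho> - 6 R\<^sub>2 B + 4 P\<^sub>1 N\<^sub>2 B + 3 \<rho> B\<close>, where \<open>\<rho>\<close> and \<open>B\<close> are the curvature and the torsion of the
  contact frame and \<open>P\<close>, \<open>N\<close>, \<open>R\<close> are derivatives along \<open>Z\<close>, its conjugate and the Reeb field that are
  covariant under rotations of the frame (\<open>cartan_eq\<close>). The expression has weight \<open>2\<close> under rotations
  (\<open>cartan_rotate\<close>), and under a change of scale all terms with derivatives of the scale cancel, by the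
  commutators of the covariant derivatives (\<open>cartan_rescale\<close>). The proof is purely algebraic and takes
  place in a commutative ring with three derivations. A conformal equivalence carries an adapted
  frame to a rescaled and rotated adapted frame, since the Reeb field is determined by the other two
  (\<open>reeb_unique\<close>), and this gives the formula with the angle \<open>2 t\<close> (\<open>conformal_covariance\<close>).

  \<^emph>\<open>Independence.\<close> On the group of motions of the plane there is a contact frame with constant
  structure coefficients for which \<open>\<alpha> \<noteq> 0 = \<beta>\<close>; a rotation of the frame turns \<open>\<alpha>\<close> into \<open>\<beta>\<close>
  (\<open>invariants_independent\<close>).
\<close>

section \<open>The weighted calculus of a contact frame\<close>

text \<open>Pointwise formulas for a contact frame become short once the frame is complexified: the intended
  interpretation is \<open>Z = f\<^sub>1 - \<i> f\<^sub>2\<close>, \<open>Zb = f\<^sub>1 + \<i> f\<^sub>2\<close>, \<open>T = 2 \<i> f\<^sub>0\<close>, and with the structure coefficients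
  \<open>x, y\<close> of \<open>[f\<^sub>2, f\<^sub>1]\<close>, \<open>a, b\<close> of \<open>[f\<^sub>1, f\<^sub>0]\<close> and \<open>d, - a\<close> of \<open>[f\<^sub>2, f\<^sub>0]\<close>, \<open>w = \<i> (x + \<i> y)\<close>, \<open>wb = \<i> (x - \<i> y)\<close>,
  \<open>B = (b + d) + 2 \<i> a\<close> and \<open>\<kappa> = b - d\<close>. The factors \<open>\<i>\<close> are absorbed in \<open>T\<close>, \<open>w\<close>, \<open>wb\<close>, \<open>B\<close>, so that the
  calculus makes sense in any commutative ring. The set \<open>S\<close> stands for the smooth functions; the last
  three axioms are the commutation relations and a consequence of the Jacobi identity.\<close>

locale contact_calculus =
  fixes S :: "'r::comm_ring_1 set" and Z Zb T :: "'r \<Rightarrow> 'r" and w wb B \<kappa> :: 'r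
  assumes S_add: "u \<in> S \<Longrightarrow> v \<in> S \<Longrightarrow> u + v \<in> S"
    and S_mult: "u \<in> S \<Longrightarrow> v \<in> S \<Longrightarrow> u * v \<in> S"
    and S_uminus: "u \<in> S \<Longrightarrow> - u \<in> S"
    and S_1: "1 \<in> S" and S_w: "w \<in> S" and S_wb: "wb \<in> S" and S_B: "B \<in> S" and S_kap: "\<kappa> \<in> S"
    and S_Z: "u \<in> S \<Longrightarrow> Z u \<in> S" and S_Zb: "u \<in> S \<Longrightarrow> Zb u \<in> S" and S_T: "u \<in> S \<Longrightarrow> T u \<in> S"
    and Z_add: "u \<in> S \<Longrightarrow> v \<in> S \<Longrightarrow> Z (u + v) = Z u + Z v"
    and Zb_add: "u \<in> S \<Longrightarrow> v \<in> S \<Longrightarrow> Zb (u + v) = Zb u + Zb v"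
    and T_add: "u \<in> S \<Longrightarrow> v \<in> S \<Longrightarrow> T (u + v) = T u + T v"
    and Z_mult: "u \<in> S \<Longrightarrow> v \<in> S \<Longrightarrow> Z (u * v) = Z u * v + u * Z v"
    and Zb_mult: "u \<in> S \<Longrightarrow> v \<in> S \<Longrightarrow> Zb (u * v) = Zb u * v + u * Zb v"
    and T_mult: "u \<in> S \<Longrightarrow> v \<in> S \<Longrightarrow> T (u * v) = T u * v + u * T v"
    and Z_Zb: "u \<in> S \<Longrightarrow> Z (Zb u) = Zb (Z u) - T u - w * Z u - wb * Zb u"
    and Z_T: "u \<in> S \<Longrightarrow> Z (T u) = T (Z u) - \<kappa> * Z u + B * Zb u"
    and T_wb: "T wb = Z \<kappa> - Zb B + w * B + \<kappa> * wb"
begin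

text \<open>A rotation of the frame multiplies \<open>Z\<close> by a unit \<open>e\<close>; an element that is multiplied by \<open>e\<close> to the
  power \<open>k\<close> has weight \<open>k\<close>. The terms with \<open>k\<close> make \<open>P\<close>, \<open>N\<close> and \<open>R\<close> covariant: they raise, lower and
  preserve the weight. The curvature \<open>\<rho>\<close> has weight \<open>0\<close>, the torsion \<open>B\<close> has weight \<open>2\<close>, and \<open>cartan\<close>,
  of weight \<open>2\<close>, is the Cartan tensor of the CR structure that the oriented conformal structure defines.\<close>

definition P :: "int \<Rightarrow> 'r \<Rightarrow> 'r" where "P k u = Z u - of_int k * (wb * u)"
definition N :: "int \<Rightarrow> 'r \<Rightarrow> 'r" where "N k u = Zb u - of_int k * (w * u)"
definition R :: "int \<Rightarrow> 'r \<Rightarrow> 'r" where "R k u = T u - of_int k * (\<kappa> * u)"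
definition \<rho> :: 'r where "\<rho> = Zb wb - Z w - \<kappa> - 2 * (w * wb)"
definition cartan :: 'r
  where "cartan = P 1 (P 0 \<rho>) - 6 * R 2 B + 4 * P 1 (N 2 B) + 3 * (\<rho> * B)"

lemma S_0: "0 \<in> S" using S_add[OF S_1 S_uminus[OF S_1]] by simp
lemma S_diff: "u \<in> S \<Longrightarrow> v \<in> S \<Longrightarrow> u - v \<in> S"
  using S_add[of u "- v"] S_uminus by simp
lemma S_of_nat: "of_nat n \<in> S" by (induction n) (auto simp: S_0 S_1 intro: S_add)
lemma S_of_int: "of_int k \<in> S" by (cases k) (auto simp: S_of_nat intro: S_uminus S_add S_1 simp del: of_nat_Suc)
lemma S_numeral: "numeral n \<in> S" using S_of_nat[of "numeral n"] by simp
lemmas S_rules = S_0 S_1 S_numeral S_of_int S_w S_wb S_B S_kap S_Z S_Zb S_T S_add S_diff S_mult S_uminus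

lemma deriv_const:
  assumes add: "\<And>u v. u \<in> S \<Longrightarrow> v \<in> S \<Longrightarrow> D (u + v) = D u + D v"
    and mult: "\<And>u v. u \<in> S \<Longrightarrow> v \<in> S \<Longrightarrow> D (u * v) = D u * v + u * D v"
  shows "D 0 = 0" "D 1 = 0" "u \<in> S \<Longrightarrow> D (- u) = - D u"
    "u \<in> S \<Longrightarrow> v \<in> S \<Longrightarrow> D (u - v) = D u - D v" "D (of_int k) = 0" "D (numeral n) = 0"
proof -
  show z: "D 0 = 0" using add[OF S_0 S_0] by simp
  show o: "D 1 = 0" using mult[OF S_1 S_1] by simp
  show um: "D (- u) = - D u" if "u \<in> S" for u
    using add[OF that S_uminus[OF that]] z by (simp add: eq_neg_iff_add_eq_0 add.commute)
  show "D (u - v) = D u - D v" if "u \<in> S" "v \<in> S"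
    using add[OF that(1) S_uminus[OF that(2)]] um that by simp
  have n: "D (of_nat n) = 0" for n
    by (induction n) (auto simp: z add S_1 S_of_nat o)
  show "D (of_int k) = 0"
    by (cases k rule: int_cases2) (simp_all add: n um S_of_nat)
  show "D (numeral n) = 0" using n[of "numeral n"] by simp
qed

lemmas D_rules =
  Z_add Zb_add T_add Z_mult Zb_mult T_mult
  deriv_const[of Z, OF Z_add Z_mult] deriv_const[of Zb, OF Zb_add Zb_mult]
  deriv_const[of T, OF T_add T_mult]

text \<open>The commutators of the covariant derivatives contain only \<open>\<rho>\<close> and \<open>B\<close>, so that \<open>w\<close>, \<open>wb\<close> and
  \<open>\<kappa>\<close> disappear from all further computations with covariant derivatives.\<close>

lemma P_N:
  assumes "u \<in> S" shows "P (k - 1) (N k u) = N (k + 1) (P k u) - R k u + of_int k * (\<rho> * u)"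
  unfolding P_def N_def R_def \<rho>_def
  apply (simp add: D_rules S_rules assms Z_Zb)
  by (simp add: algebra_simps)

lemma P_R:
  assumes "u \<in> S" shows "P k (R k u) = R (k + 1) (P k u) + B * N k u - of_int k * (N 2 B * u)"
  unfolding P_def N_def R_def
  apply (simp add: D_rules S_rules assms Z_T T_wb)
  by (simp add: algebra_simps)

lemma cov_mult:
  assumes "u \<in> S" "v \<in> S"
  shows "P (k + l) (u * v) = P k u * v + u * P l v"
    "N (k + l) (u * v) = N k u * v + u * N l v"
    "R (k + l) (u * v) = R k u * v + u * R l v"
  unfolding P_def N_def R_def by (simp_all add: D_rules assms algebra_simps)

lemma cov_add:
  assumes "u \<in> S" "v \<in> S"
  shows "P k (u + v) = P k u + P k v" "N k (u + v) = N k u + N k v" "R k (u + v) = R k u + R k v"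
    "P k (u - v) = P k u - P k v" "N k (u - v) = N k u - N k v" "R k (u - v) = R k u - R k v"
  unfolding P_def N_def R_def by (simp_all add: D_rules assms algebra_simps)

lemma cov_scale:
  assumes "u \<in> S"
  shows "P k (numeral n * u) = numeral n * P k u" "N k (numeral n * u) = numeral n * N k u"
    "R k (numeral n * u) = numeral n * R k u"
  unfolding P_def N_def R_def by (simp_all add: D_rules assms S_rules algebra_simps)

lemma cov_S: "u \<in> S \<Longrightarrow> P k u \<in> S" "u \<in> S \<Longrightarrow> N k u \<in> S" "u \<in> S \<Longrightarrow> R k u \<in> S" "\<rho> \<in> S"
  unfolding P_def N_def R_def \<rho>_def by (auto intro!: S_rules)

text \<open>The conformal change of \<open>cartan\<close> after the common factor has been split off: \<open>r\<close> and \<open>b\<close> are the new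
  \<open>\<rho>\<close> and \<open>B\<close>, and \<open>f\<close> is the logarithm of the scale. Moving all derivatives of \<open>f\<close> into one order by
  the commutators makes every term that contains \<open>f\<close> cancel.\<close>

lemma cartan_invariant:
  assumes f: "f \<in> S"
  defines "p \<equiv> P 0 f" and "q \<equiv> N 0 f" and "t \<equiv> R 0 f"
  defines "r \<equiv> \<rho> + 4 * (P (-1) q + N 1 p) + 8 * (p * q)"
  defines "b \<equiv> B - 2 * P 1 p + 4 * (p * p)"
  defines "n \<equiv> N 2 b + 4 * (q * b)"
  shows "P 1 (P 0 r - 2 * (p * r)) - 6 * (p * (P 0 r - 2 * (p * r)))
     - 6 * (R 2 b - 2 * (t * b) + 2 * (q * P 2 b) - 2 * (p * N 2 b) + 2 * ((P (-1) q + N 1 p - 4 * (p * q)) * b))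
     + 4 * (P 1 n - 6 * (p * n)) + 3 * (r * b) = cartan"
proof -
  have S: "p \<in> S" "q \<in> S" "t \<in> S" "B \<in> S" "\<rho> \<in> S"
    using f by (auto simp: p_def q_def t_def intro: cov_S S_B)
  note SS = S cov_S(1-3) S_add S_diff S_mult S_numeral
  have pq: "P (-1) q = N 1 p - t" using P_N[OF f, of 0] by (simp add: p_def q_def t_def)
  have pt: "P 0 t = R 1 p + B * q" using P_R[OF f, of 0] by (simp add: p_def q_def t_def)
  have pnp: "P 0 (N 1 p) = N 2 (P 1 p) - R 1 p + \<rho> * p" using P_N[OF S(1), of 1] by simp
  have prp: "P 1 (R 1 p) = R 2 (P 1 p) + B * N 1 p - N 2 B * p" using P_R[OF S(1), of 1] by simp
  have r: "r = \<rho> + 8 * N 1 p - 4 * t + 8 * (p * q)"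
    unfolding r_def pq by (simp add: algebra_simps)
  have p_pq: "P 0 (p * q) = P 1 p * q + p * (N 1 p - t)"
    using cov_mult(1)[of p q 1 "-1"] S pq by simp
  have pr: "P 0 r = P 0 \<rho> + 8 * N 2 (P 1 p) - 12 * R 1 p + 8 * (\<rho> * p) - 4 * (B * q)
      + 8 * (P 1 p * q) + 8 * (p * N 1 p) - 8 * (p * t)"
    unfolding r by (simp add: cov_add cov_scale SS pt pnp p_pq) (simp add: algebra_simps)
  have m1: "P 1 (\<rho> * p) = P 0 \<rho> * p + \<rho> * P 1 p" using cov_mult(1)[of \<rho> p 0 1] S by simp
  have m2: "P 1 (B * q) = P 2 B * q + B * (N 1 p - t)" using cov_mult(1)[of B q 2 "-1"] S pq by simp
  have m3: "P 1 (P 1 p * q) = P 2 (P 1 p) * q + P 1 p * (N 1 p - t)"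
    using cov_mult(1)[of "P 1 p" q 2 "-1"] S pq cov_S by simp
  have m4: "P 1 (p * N 1 p) = P 1 p * N 1 p + p * (N 2 (P 1 p) - R 1 p + \<rho> * p)"
    using cov_mult(1)[of p "N 1 p" 1 0] S pnp cov_S by simp
  have m5: "P 1 (p * t) = P 1 p * t + p * (R 1 p + B * q)"
    using cov_mult(1)[of p t 1 0] S pt by simp
  have ppr: "P 1 (P 0 r) = P 1 (P 0 \<rho>) + 8 * P 1 (N 2 (P 1 p)) - 12 * (R 2 (P 1 p) + B * N 1 p - N 2 B * p)
      + 8 * (P 0 \<rho> * p + \<rho> * P 1 p) - 4 * (P 2 B * q + B * (N 1 p - t))
      + 8 * (P 2 (P 1 p) * q + P 1 p * (N 1 p - t)) + 8 * (P 1 p * N 1 p + p * (N 2 (P 1 p) - R 1 p + \<rho> * p))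
      - 8 * (P 1 p * t + p * (R 1 p + B * q))"
    unfolding pr by (simp add: cov_add cov_scale SS m1 m2 m3 m4 m5 prp)
  have m6: "P 1 (p * r) = P 1 p * r + p * P 0 r"
    using cov_mult(1)[of p r 1 0] S by (simp add: r SS)
  have m7: "P 2 (p * p) = 2 * (p * P 1 p)" "R 2 (p * p) = 2 * (p * R 1 p)" "N 2 (p * p) = 2 * (p * N 1 p)"
    using cov_mult[of p p 1 1] S by (simp_all add: algebra_simps)
  have Pb: "P 2 b = P 2 B - 2 * P 2 (P 1 p) + 8 * (p * P 1 p)"
   and Nb: "N 2 b = N 2 B - 2 * N 2 (P 1 p) + 8 * (p * N 1 p)"
   and Rb: "R 2 b = R 2 B - 2 * R 2 (P 1 p) + 8 * (p * R 1 p)"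
    unfolding b_def by (simp_all add: cov_add cov_scale SS m7)
  have bS: "b \<in> S" unfolding b_def by (intro SS)
  have m8: "P 1 (q * b) = (N 1 p - t) * b + q * P 2 b"
    using cov_mult(1)[of q b "-1" 2] S bS pq by simp
  have Pn: "P 1 n = P 1 (N 2 B) - 2 * P 1 (N 2 (P 1 p))
      + 8 * (P 1 p * N 1 p + p * (N 2 (P 1 p) - R 1 p + \<rho> * p)) + 4 * ((N 1 p - t) * b + q * P 2 b)"
    unfolding n_def Nb by (simp add: cov_add cov_scale SS bS m8 m4)
  have rS: "r \<in> S" unfolding r by (intro SS)
  have e: "P 1 (P 0 r - 2 * (p * r)) = P 1 (P 0 r) - 2 * (P 1 p * r + p * P 0 r)"
    by (simp add: cov_add cov_scale SS rS m6)
  show ?thesis unfolding e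
    unfolding ppr Pn
    unfolding n_def
    unfolding pr Nb Rb Pb pq cartan_def
    unfolding r b_def
    by (simp add: algebra_simps)
qed

text \<open>For the scale \<open>E = exp (- f)\<close>, a new covariant derivative of \<open>E\<close> to the power \<open>s\<close> times \<open>v\<close> is a power of
  \<open>E\<close> times the old derivative of \<open>v\<close>, corrected by derivatives of \<open>f\<close> with coefficients that depend on \<open>s\<close>
  and on the weight. Applied to the new \<open>\<rho>\<close> and \<open>B\<close>, this reduces the claim to \<open>cartan_invariant\<close>.\<close>

lemma cartan_rescale:
  assumes f: "f \<in> S" and E: "E \<in> S"
    and dE: "Z E = - (E * Z f)" "Zb E = - (E * Zb f)" "T E = - (E * T f)"
    and Z': "\<And>u. u \<in> S \<Longrightarrow> Z' u = E * Z u" and Zb': "\<And>u. u \<in> S \<Longrightarrow> Zb' u = E * Zb u"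
    and T': "\<And>u. u \<in> S \<Longrightarrow> T' u = E * E * (T u + 2 * (Zb f * Z u) - 2 * (Z f * Zb u))"
    and w': "w' = E * (w - 3 * Zb f)" and wb': "wb' = E * (wb + 3 * Z f)"
    and B': "B' = E * E * (B - 2 * P 1 (Z f) + 4 * (Z f * Z f))"
    and \<kappa>': "\<kappa>' = E * E * (\<kappa> - P (-1) (Zb f) - N 1 (Z f) + 4 * (Z f * Zb f) + 2 * (wb * Zb f - w * Z f))"
    and c': "contact_calculus S Z' Zb' T' w' wb' B' \<kappa>'"
  shows "contact_calculus.cartan Z' Zb' T' w' wb' B' \<kappa>' = E ^ 4 * cartan"
proof -
  interpret c': contact_calculus S Z' Zb' T' w' wb' B' \<kappa>' by (rule c')
  define p q t where pqt: "p = P 0 f" "q = N 0 f" "t = R 0 f"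
  have pz: "p = Z f" "q = Zb f" "t = T f" by (simp_all add: pqt P_def N_def R_def)
  define r where "r = \<rho> + 4 * (P (-1) q + N 1 p) + 8 * (p * q)"
  define b where "b = B - 2 * P 1 p + 4 * (p * p)"
  define n where "n = N 2 b + 4 * (q * b)"
  have S: "p \<in> S" "q \<in> S" "t \<in> S" "B \<in> S" "\<rho> \<in> S" "E \<in> S"
    using f E by (auto simp: pz intro: cov_S S_rules)
  note SS = S cov_S(1-3) S_add S_diff S_mult S_numeral
  have rS: "r \<in> S" and bS: "b \<in> S" unfolding r_def b_def by (intro SS)+
  have nS: "n \<in> S" unfolding n_def using bS by (intro SS) 
  have rho': "c'.\<rho> = E * E * r"
    unfolding c'.\<rho>_def unfolding w' wb' \<kappa>' r_def \<rho>_def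
    by (simp add: Z' Zb' SS S_rules f D_rules dE P_def N_def pz Z_Zb) (simp add: algebra_simps)
  have P'2: "c'.P k (E * E * v) = E * (E * E) * (P k v - of_int (2 + 3 * k) * (p * v))" if "v \<in> S" for k v
    unfolding c'.P_def P_def unfolding wb' using that
    by (simp add: Z' SS S_rules D_rules dE pz[symmetric]) (simp add: algebra_simps)
  have P'3: "c'.P k (E * (E * E) * v) = E * E * (E * E) * (P k v - of_int (3 + 3 * k) * (p * v))" if "v \<in> S" for k v
    unfolding c'.P_def P_def unfolding wb' using that
    by (simp add: Z' SS S_rules D_rules dE pz[symmetric]) (simp add: algebra_simps)
  have N'2: "c'.N k (E * E * v) = E * (E * E) * (N k v - of_int (2 - 3 * k) * (q * v))" if "v \<in> S" for k v
    unfolding c'.N_def N_def unfolding w' using that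
    by (simp add: Zb' SS S_rules D_rules dE pz[symmetric]) (simp add: algebra_simps)
  have R'2: "c'.R 2 (E * E * v) = E * E * (E * E) * (R 2 v - 2 * (t * v) + 2 * (q * P 2 v) - 2 * (p * N 2 v)
      + 2 * ((P (-1) q + N 1 p - 4 * (p * q)) * v))" if "v \<in> S" for v
    unfolding c'.R_def R_def P_def[of 2] N_def[of 2] unfolding \<kappa>' using that
    by (simp add: T' SS S_rules D_rules dE pz[symmetric]) (simp add: algebra_simps)
  have B'': "B' = E * E * b" unfolding B' b_def pz ..
  have c: "c'.cartan = E * E * (E * E) * (P 1 (P 0 r - 2 * (p * r)) - 6 * (p * (P 0 r - 2 * (p * r)))
     - 6 * (R 2 b - 2 * (t * b) + 2 * (q * P 2 b) - 2 * (p * N 2 b) + 2 * ((P (-1) q + N 1 p - 4 * (p * q)) * b))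
     + 4 * (P 1 n - 6 * (p * n)) + 3 * (r * b))"
  proof -
    have n': "c'.N 2 B' = E * (E * E) * n" unfolding B'' N'2[OF bS] n_def by simp
    have 1: "c'.P 1 (c'.N 2 B') = E * E * (E * E) * (P 1 n - 6 * (p * n))"
      unfolding n' P'3[OF nS] by simp
    have 2: "c'.P 1 (c'.P 0 c'.\<rho>) = E * E * (E * E) * (P 1 (P 0 r - 2 * (p * r)) - 6 * (p * (P 0 r - 2 * (p * r))))"
      unfolding rho' P'2[OF rS] using rS by (simp add: P'3 SS)
    have 3: "c'.R 2 B' = E * E * (E * E) * (R 2 b - 2 * (t * b) + 2 * (q * P 2 b) - 2 * (p * N 2 b)
        + 2 * ((P (-1) q + N 1 p - 4 * (p * q)) * b))"
      unfolding B'' by (rule R'2[OF bS])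
    show ?thesis unfolding c'.cartan_def 1 2 3 unfolding rho' B''
      by (simp add: distrib_left right_diff_distrib mult.assoc mult.left_commute)
  qed
  have "E ^ 4 = E * E * (E * E)" by (simp add: power4_eq_xxxx mult.assoc)
  then show ?thesis
    unfolding c using cartan_invariant[OF f] by (simp add: pqt r_def b_def n_def)
qed

text \<open>All constituents of \<open>cartan\<close> are covariant, so its weight gives the factor.\<close>

lemma cartan_rotate:
  assumes S: "e \<in> S" "eb \<in> S" and eeb: "e * eb = 1"
    and Z': "\<And>u. u \<in> S \<Longrightarrow> Z' u = e * Z u" and Zb': "\<And>u. u \<in> S \<Longrightarrow> Zb' u = eb * Zb u"
    and T': "\<And>u. u \<in> S \<Longrightarrow> T' u = T u"
    and w': "w' = eb * (w + eb * Zb e)" and wb': "wb' = e * (wb + eb * Z e)"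
    and B': "B' = e * e * B" and \<kappa>': "\<kappa>' = \<kappa> + eb * T e"
    and c': "contact_calculus S Z' Zb' T' w' wb' B' \<kappa>'"
  shows "contact_calculus.cartan Z' Zb' T' w' wb' B' \<kappa>' = e ^ 2 * cartan"
proof -
  interpret c': contact_calculus S Z' Zb' T' w' wb' B' \<kappa>' by (rule c')
  have ee: "e * (eb * x) = x" "eb * (e * x) = x" "eb * e = 1" for x
    using eeb by (simp_all add: mult.assoc[symmetric] mult.commute)
  have deb: "Z eb = - (eb * (eb * Z e))" "Zb eb = - (eb * (eb * Zb e))"
  proof -
    have "Z (e * eb) = 0" "Zb (e * eb) = 0" unfolding eeb by (simp_all add: D_rules S_rules)
    then have "Z e * eb + e * Z eb = 0" "Zb e * eb + e * Zb eb = 0" using S by (simp_all add: D_rules)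
    then have "eb * (Z e * eb + e * Z eb) = 0" "eb * (Zb e * eb + e * Zb eb) = 0" by simp_all
    then show "Z eb = - (eb * (eb * Z e))" "Zb eb = - (eb * (eb * Zb e))"
      by (simp_all add: distrib_left ee) (simp_all add: eq_neg_iff_add_eq_0 algebra_simps)
  qed
  have rho': "c'.\<rho> = \<rho>"
    unfolding c'.\<rho>_def unfolding w' wb' \<kappa>' \<rho>_def
    using S by (simp add: Z' Zb' S_rules D_rules deb Z_Zb) (simp add: algebra_simps ee eeb)
  have P0: "c'.P 0 v = e * P 0 v" if "v \<in> S" for v
    using that by (simp add: c'.P_def P_def Z')
  have P1: "c'.P 1 (e * v) = e * e * P 1 v" if "v \<in> S" for v
    using that S unfolding c'.P_def unfolding P_def wb' by (simp add: Z' D_rules S_rules) (simp add: algebra_simps ee eeb)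
  have N2: "c'.N 2 (e * e * v) = e * N 2 v" if "v \<in> S" for v
    using that S unfolding c'.N_def unfolding N_def w' by (simp add: Zb' D_rules S_rules) (simp add: algebra_simps ee eeb)
  have R2: "c'.R 2 (e * e * v) = e * e * R 2 v" if "v \<in> S" for v
    using that S unfolding c'.R_def unfolding R_def \<kappa>' by (simp add: T' D_rules S_rules) (simp add: algebra_simps ee eeb)
  show ?thesis
    unfolding c'.cartan_def cartan_def unfolding B'
    by (simp add: rho' P0 P1 N2 R2 S_B cov_S) (simp add: algebra_simps power2_eq_square)
qed

end

section \<open>Calculus of \<open>C\<^sup>k\<close> functions\<close>

lemma Ck_on_Suc_open:
  assumes "open S"
  shows "Ck_on (Suc k) S f \<longleftrightarrow>
    (\<forall>x\<in>S. f differentiable (at x)) \<and> (\<forall>h. Ck_on k S (\<lambda>x. frechet_derivative f (at x) h))"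
  using assms by (simp add: differentiable_on_eq_differentiable_at)

lemma frechet_derivative_cong:
  assumes "open S" "x \<in> S" "\<And>y. y \<in> S \<Longrightarrow> f y = g y"
  shows "frechet_derivative f (at x) = frechet_derivative g (at x)"
    "f differentiable (at x) \<longleftrightarrow> g differentiable (at x)"
proof -
  have "(f has_derivative D) (at x) \<longleftrightarrow> (g has_derivative D) (at x)" for D
    using has_derivative_transform_within_open[OF _ assms(1,2)] assms(3) by metis
  then show "frechet_derivative f (at x) = frechet_derivative g (at x)"
    "f differentiable (at x) \<longleftrightarrow> g differentiable (at x)"
    by (simp_all add: frechet_derivative_def differentiable_def)
qed

lemma Ck_on_cong:
  assumes "open S" "\<And>y. y \<in> S \<Longrightarrow> f y = g y"
  shows "Ck_on k S f \<longleftrightarrow> Ck_on k S g"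
  using assms(2)
proof (induction k arbitrary: f g)
  case 0
  then show ?case by (simp cong: continuous_on_cong)
next
  case (Suc k)
  have "Ck_on k S (\<lambda>x. frechet_derivative f (at x) h) \<longleftrightarrow> Ck_on k S (\<lambda>x. frechet_derivative g (at x) h)" for h
    by (rule Suc.IH) (simp add: frechet_derivative_cong[OF assms(1) _ Suc.prems])
  then show ?case
    using frechet_derivative_cong(2)[OF assms(1) _ Suc.prems] assms(1)
    by (auto simp: Ck_on_Suc_open simp del: Ck_on.simps)
qed

lemma Ck_on_SucI:
  assumes "open S" and d: "\<And>x. x \<in> S \<Longrightarrow> (f has_derivative D x) (at x)" and "\<And>h. Ck_on k S (\<lambda>x. D x h)"
  shows "Ck_on (Suc k) S f"
proof -
  have "Ck_on k S (\<lambda>x. frechet_derivative f (at x) h)" for h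
    using assms(3)[of h] Ck_on_cong[OF assms(1), of "\<lambda>x. frechet_derivative f (at x) h" "\<lambda>x. D x h"]
    by (simp add: frechet_derivative_at[OF d, symmetric])
  then show ?thesis using d assms(1) by (auto simp: Ck_on_Suc_open differentiable_def simp del: Ck_on.simps)
qed

lemma Ck_on_subset:
  assumes "open S" "open T" "T \<subseteq> S" "Ck_on k S f"
  shows "Ck_on k T f"
  using assms(4)
proof (induction k arbitrary: f)
  case 0 then show ?case using assms(3) by (auto intro: continuous_on_subset)
next
  case (Suc k) then show ?case
    using assms(1-3) by (auto simp: Ck_on_Suc_open simp del: Ck_on.simps)
qed

lemma Ck_on_local:
  assumes "open S" "\<And>x. x \<in> S \<Longrightarrow> \<exists>T. open T \<and> x \<in> T \<and> T \<subseteq> S \<and> Ck_on k T f"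
  shows "Ck_on k S f"
  using assms(2)
proof (induction k arbitrary: f)
  case 0
  have "isCont f x" if "x \<in> S" for x
    using 0[OF that] continuous_on_eq_continuous_at[of _ f] by auto
  then show ?case using assms(1) by (simp add: continuous_on_eq_continuous_at)
next
  case (Suc k)
  have "f differentiable (at x)" if "x \<in> S" for x
    using Suc.prems[OF that] by (auto simp: Ck_on_Suc_open simp del: Ck_on.simps)
  moreover have "Ck_on k S (\<lambda>x. frechet_derivative f (at x) h)" for h
  proof (rule Suc.IH)
    fix x assume "x \<in> S"
    then obtain T where "open T" "x \<in> T" "T \<subseteq> S" "Ck_on (Suc k) T f" using Suc.prems by blast
    then show "\<exists>T. open T \<and> x \<in> T \<and> T \<subseteq> S \<and> Ck_on k T (\<lambda>x. frechet_derivative f (at x) h)"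
      by (auto simp: Ck_on_Suc_open simp del: Ck_on.simps)
  qed
  ultimately show ?case using assms(1) by (simp add: Ck_on_Suc_open del: Ck_on.simps)
qed

lemma Ck_on_continuous: "open S \<Longrightarrow> Ck_on k S f \<Longrightarrow> continuous_on S f"
  by (cases k) (auto intro: differentiable_imp_continuous_on)

lemma Ck_on_Suc_imp: "open S \<Longrightarrow> Ck_on (Suc k) S f \<Longrightarrow> Ck_on k S f"
proof (induction k arbitrary: f)
  case 0 then show ?case using Ck_on_continuous[OF 0(1), of "Suc 0" f] by simp
next
  case (Suc k)
  have "Ck_on k S (\<lambda>x. frechet_derivative f (at x) h)" for h
    by (rule Suc.IH[OF Suc.prems(1)]) (use Suc.prems Ck_on_Suc_open in blast)
  moreover have "\<forall>x\<in>S. f differentiable (at x)" using Suc.prems Ck_on_Suc_open by blast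
  ultimately show ?case using Suc.prems(1) by (simp add: Ck_on_Suc_open del: Ck_on.simps)
qed

lemma Ck_on_const: "open S \<Longrightarrow> Ck_on k S (\<lambda>x. c)"
proof (induction k arbitrary: c)
  case (Suc k) then show ?case by (simp add: Ck_on_Suc_open del: Ck_on.simps)
qed simp

lemma Ck_on_linear:
  assumes "open S" "bounded_linear L" shows "Ck_on k S L"
proof (cases k)
  case 0 then show ?thesis using assms by (simp add: linear_continuous_on)
next
  case (Suc n)
  have d: "(L has_derivative L) (at x)" for x using assms(2) by (rule bounded_linear_imp_has_derivative)
  then have "frechet_derivative L (at x) = L" for x using frechet_derivative_at by metis
  then show ?thesis using assms d
    by (auto simp: Suc Ck_on_Suc_open differentiable_def Ck_on_const simp del: Ck_on.simps)
qed

lemma Ck_on_bounded_linear: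
  assumes "open S" "bounded_linear L" "Ck_on k S f" shows "Ck_on k S (\<lambda>x. L (f x))"
  using assms(3)
proof (induction k arbitrary: f)
  case 0 then show ?case
    using assms(2) by (simp add: bounded_linear.continuous_on)
next
  case (Suc k)
  have d: "((\<lambda>x. L (f x)) has_derivative (\<lambda>h. L (frechet_derivative f (at x) h))) (at x)" if "x \<in> S" for x
    using Suc.prems assms that
    by (intro bounded_linear.has_derivative[OF assms(2)]) (auto simp: Ck_on_Suc_open frechet_derivative_works simp del: Ck_on.simps)
  have D: "Ck_on k S (\<lambda>x. L (frechet_derivative f (at x) h))" for h
    by (rule Suc.IH) (use Suc.prems in simp)
  show ?case by (rule Ck_on_SucI[OF assms(1) d D])
qed

lemma Ck_on_add:
  assumes "open S" "Ck_on k S f" "Ck_on k S g" shows "Ck_on k S (\<lambda>x. f x + g x)"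
  using assms(2,3)
proof (induction k arbitrary: f g)
  case 0 then show ?case by (simp add: continuous_on_add)
next
  case (Suc k)
  have d: "((\<lambda>x. f x + g x) has_derivative
      (\<lambda>h. frechet_derivative f (at x) h + frechet_derivative g (at x) h)) (at x)" if "x \<in> S" for x
    using Suc.prems assms(1) that
    by (intro has_derivative_add) (auto simp: Ck_on_Suc_open frechet_derivative_works simp del: Ck_on.simps)
  have D: "Ck_on k S (\<lambda>x. frechet_derivative f (at x) h + frechet_derivative g (at x) h)" for h
    by (rule Suc.IH) (use Suc.prems in simp_all)
  show ?case by (rule Ck_on_SucI[OF assms(1) d D])
qed

lemma Ck_on_mult:
  fixes f g :: "'e::euclidean_space \<Rightarrow> real"
  assumes "open S" "Ck_on k S f" "Ck_on k S g" shows "Ck_on k S (\<lambda>x. f x * g x)"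
  using assms(2,3)
proof (induction k arbitrary: f g)
  case 0 then show ?case by (simp add: continuous_on_mult)
next
  case (Suc k)
  have d: "((\<lambda>x. f x * g x) has_derivative
      (\<lambda>h. f x * frechet_derivative g (at x) h + frechet_derivative f (at x) h * g x)) (at x)" if "x \<in> S" for x
    using Suc.prems assms(1) that
    by (intro has_derivative_mult) (auto simp: Ck_on_Suc_open frechet_derivative_works simp del: Ck_on.simps)
  have fg: "Ck_on k S f" "Ck_on k S g" using Suc.prems by (auto intro: Ck_on_Suc_imp[OF assms(1)] simp del: Ck_on.simps)
  have D: "Ck_on k S (\<lambda>x. f x * frechet_derivative g (at x) h + frechet_derivative f (at x) h * g x)" for h
    using Suc.prems by (intro Ck_on_add[OF assms(1)] Suc.IH fg) simp_all
  show ?case by (rule Ck_on_SucI[OF assms(1) d D])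
qed

text \<open>A one-variable function all of whose derivatives exist is given with them as a sequence.\<close>

lemma Ck_on_compose_real:
  fixes f :: "'e::euclidean_space \<Rightarrow> real"
  assumes "open S" and G: "\<And>n t. (G n has_real_derivative G (Suc n) t) (at t)" and "Ck_on k S f"
  shows "Ck_on k S (\<lambda>x. G n (f x))"
  using assms(3)
proof (induction k arbitrary: n)
  case 0
  have "continuous_on UNIV (G n)" using G DERIV_continuous_on by blast
  then show ?case using 0 by (auto intro: continuous_on_compose2)
next
  case (Suc k)
  have d: "((\<lambda>x. G n (f x)) has_derivative (\<lambda>h. G (Suc n) (f x) * frechet_derivative f (at x) h)) (at x)" if "x \<in> S" for x
  proof -
    have "(f has_derivative frechet_derivative f (at x)) (at x)" 
      using Suc.prems assms(1) that by (auto simp: Ck_on_Suc_open frechet_derivative_works simp del: Ck_on.simps)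
    from has_derivative_compose[OF this G[unfolded has_field_derivative_def]] show ?thesis .
  qed
  have fk: "Ck_on k S f" using Suc.prems by (auto intro: Ck_on_Suc_imp[OF assms(1)] simp del: Ck_on.simps)
  have D: "Ck_on k S (\<lambda>x. G (Suc n) (f x) * frechet_derivative f (at x) h)" for h
    using Suc.prems by (intro Ck_on_mult[OF assms(1)] Suc.IH fk) simp_all
  show ?case by (rule Ck_on_SucI[OF assms(1) d D])
qed

lemma Ck_on_affine:
  fixes L :: "'e::euclidean_space \<Rightarrow> 'f::euclidean_space"
  assumes "open S" "open T" "bounded_linear L" "\<And>x. x \<in> T \<Longrightarrow> L x + c \<in> S" "Ck_on k S f"
  shows "Ck_on k T (\<lambda>x. f (L x + c))"
  using assms(5)
proof (induction k arbitrary: f)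
  case 0
  have "continuous_on T (\<lambda>x. L x + c)" using assms(3) by (intro continuous_intros linear_continuous_on)
  then show ?case using 0 assms(4) by (auto intro: continuous_on_compose2)
next
  case (Suc k)
  have d: "((\<lambda>x. f (L x + c)) has_derivative (\<lambda>h. frechet_derivative f (at (L x + c)) (L h))) (at x)" if "x \<in> T" for x
  proof -
    have 1: "(f has_derivative frechet_derivative f (at (L x + c))) (at (L x + c))" 
      using Suc.prems assms(1,4) that by (auto simp: Ck_on_Suc_open frechet_derivative_works simp del: Ck_on.simps)
    have "((\<lambda>x. L x + c) has_derivative (\<lambda>h. L h + 0)) (at x)"
      using assms(3) by (intro has_derivative_add bounded_linear_imp_has_derivative) auto
    from has_derivative_compose[OF this 1] show ?thesis by simp
  qed
  have D: "Ck_on k T (\<lambda>x. frechet_derivative f (at (L x + c)) (L h))" for h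
    by (rule Suc.IH[of "\<lambda>y. frechet_derivative f (at y) (L h)"]) (use Suc.prems in simp)
  show ?case by (rule Ck_on_SucI[OF assms(2) d D])
qed

text \<open>Schwarz: by the mean value theorem the second difference quotient is close to both iterated
  derivatives.\<close>

lemma second_difference:
  fixes f :: "'e::euclidean_space \<Rightarrow> real"
  assumes "open S" "x \<in> S" and C: "Ck_on 2 S f" and "e > 0"
  shows "\<exists>d>0. \<forall>t. 0 < t \<and> t < d \<longrightarrow>
    \<bar>(f (x + t *\<^sub>R h + t *\<^sub>R k) - f (x + t *\<^sub>R h) - f (x + t *\<^sub>R k) + f x) / t\<^sup>2
      - frechet_derivative (\<lambda>y. frechet_derivative f (at y) h) (at x) k\<bar> < e"
proof -
  let ?D = "\<lambda>y. frechet_derivative f (at y) h"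
  let ?DD = "\<lambda>y. frechet_derivative ?D (at y) k"
  have f: "\<And>y. y \<in> S \<Longrightarrow> f differentiable (at y)" and D: "Ck_on 1 S ?D"
    using C assms(1) by (auto simp: Ck_on_Suc_open numeral_2_eq_2 simp del: Ck_on.simps)
  have Dd: "\<And>y. y \<in> S \<Longrightarrow> ?D differentiable (at y)" and DD: "continuous_on S ?DD"
    using D assms(1) by (auto simp: Ck_on_Suc_open One_nat_def simp del: Ck_on.simps) simp
  have "continuous (at x) ?DD" using DD assms(1,2) continuous_on_eq_continuous_at by blast
  then obtain d1 where d1: "d1 > 0" "\<And>y. dist y x < d1 \<Longrightarrow> \<bar>?DD y - ?DD x\<bar> < e"
    using \<open>e > 0\<close> unfolding continuous_at_eps_delta dist_real_def by metis
  obtain d2 where d2: "d2 > 0" "ball x d2 \<subseteq> S" using assms(1,2) open_contains_ball by blast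
  define m where "m = norm h + norm k + 1"
  have m: "m > 0" by (simp add: m_def add_nonneg_pos)
  define d where "d = min d1 d2 / m"
  have "d > 0" using d1 d2 m by (simp add: d_def)
  moreover have "\<bar>(f (x + t *\<^sub>R h + t *\<^sub>R k) - f (x + t *\<^sub>R h) - f (x + t *\<^sub>R k) + f x) / t\<^sup>2 - ?DD x\<bar> < e"
    if t: "0 < t" "t < d" for t
  proof -
    have near: "dist (x + a *\<^sub>R h + b *\<^sub>R k) x < min d1 d2" if "0 \<le> a" "a \<le> t" "0 \<le> b" "b \<le> t" for a b
    proof -
      have "dist (x + a *\<^sub>R h + b *\<^sub>R k) x = norm (a *\<^sub>R h + b *\<^sub>R k)" by (simp add: dist_norm add.assoc)
      also have "\<dots> \<le> a * norm h + b * norm k" using that norm_triangle_ineq[of "a *\<^sub>R h" "b *\<^sub>R k"] by simp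
      also have "\<dots> \<le> t * norm h + t * norm k" using that by (intro add_mono mult_right_mono) auto
      also have "\<dots> \<le> t * m" using t by (simp add: m_def algebra_simps)
      also have "\<dots> < d * m" using t m by simp
      finally show ?thesis using m by (simp add: d_def)
    qed
    have inS: "x + a *\<^sub>R h + b *\<^sub>R k \<in> S" if "0 \<le> a" "a \<le> t" "0 \<le> b" "b \<le> t" for a b
      using near[OF that] d2 by (auto simp: dist_commute)
    define g where "g = (\<lambda>a. f (x + a *\<^sub>R h + t *\<^sub>R k) - f (x + a *\<^sub>R h))"
    have line: "((\<lambda>a. u (y + a *\<^sub>R z)) has_real_derivative frechet_derivative u (at (y + a *\<^sub>R z)) z) (at a)"
      if "u differentiable (at (y + a *\<^sub>R z))" for u :: "'e \<Rightarrow> real" and y z a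
    proof -
      have 1: "(u has_derivative frechet_derivative u (at (y + a *\<^sub>R z))) (at (y + a *\<^sub>R z))"
        using that frechet_derivative_works by blast
      have 2: "((\<lambda>a. y + a *\<^sub>R z) has_derivative (\<lambda>s. s *\<^sub>R z)) (at a)"
        by (auto intro!: derivative_eq_intros)
      have "frechet_derivative u (at (y + a *\<^sub>R z)) (s *\<^sub>R z) = s * frechet_derivative u (at (y + a *\<^sub>R z)) z" for s
        using linear_frechet_derivative[OF that] linear_scale by (metis real_scaleR_def)
      with has_derivative_compose[OF 2 1] show ?thesis
        by (simp add: has_field_derivative_def mult_commute_abs)
    qed
    have gd: "(g has_real_derivative (?D (x + a *\<^sub>R h + t *\<^sub>R k) - ?D (x + a *\<^sub>R h))) (at a)" if "0 \<le> a" "a \<le> t" for a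
    proof -
      have s: "x + a *\<^sub>R h + t *\<^sub>R k \<in> S" "x + a *\<^sub>R h \<in> S"
        using inS[of a t] inS[of a 0] that t by auto
      have "((\<lambda>a. f ((x + t *\<^sub>R k) + a *\<^sub>R h)) has_real_derivative ?D (x + t *\<^sub>R k + a *\<^sub>R h)) (at a)"
        by (rule line) (use s f in \<open>simp add: add_ac\<close>)
      moreover have "((\<lambda>a. f (x + a *\<^sub>R h)) has_real_derivative ?D (x + a *\<^sub>R h)) (at a)"
        by (rule line) (use s f in simp)
      ultimately show ?thesis unfolding g_def by (auto intro!: DERIV_diff simp: add_ac)
    qed
    obtain a where a: "0 < a" "a < t" "g t - g 0 = (t - 0) * (?D (x + a *\<^sub>R h + t *\<^sub>R k) - ?D (x + a *\<^sub>R h))"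
      using MVT2[of 0 t g "\<lambda>a. ?D (x + a *\<^sub>R h + t *\<^sub>R k) - ?D (x + a *\<^sub>R h)"] gd t by auto
    have "((\<lambda>b. ?D (x + a *\<^sub>R h + b *\<^sub>R k)) has_real_derivative ?DD (x + a *\<^sub>R h + b *\<^sub>R k)) (at b)"
      if "0 \<le> b" "b \<le> t" for b
      by (rule line) (use inS[of a b] a that Dd in auto)
    then obtain b where b: "0 < b" "b < t"
      "?D (x + a *\<^sub>R h + t *\<^sub>R k) - ?D (x + a *\<^sub>R h + 0 *\<^sub>R k) = (t - 0) * ?DD (x + a *\<^sub>R h + b *\<^sub>R k)"
      using MVT2[of 0 t "\<lambda>b. ?D (x + a *\<^sub>R h + b *\<^sub>R k)" "\<lambda>b. ?DD (x + a *\<^sub>R h + b *\<^sub>R k)"] t by auto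
    have "g t - g 0 = t\<^sup>2 * ?DD (x + a *\<^sub>R h + b *\<^sub>R k)"
      using a b by (simp add: power2_eq_square)
    then have "(f (x + t *\<^sub>R h + t *\<^sub>R k) - f (x + t *\<^sub>R h) - f (x + t *\<^sub>R k) + f x) / t\<^sup>2 = ?DD (x + a *\<^sub>R h + b *\<^sub>R k)"
      using t by (simp add: g_def field_simps)
    then show ?thesis using d1(2)[of "x + a *\<^sub>R h + b *\<^sub>R k"] near[of a b] a b by simp
  qed
  ultimately show ?thesis by blast
qed

lemma frechet_derivative_commute:
  fixes f :: "'e::euclidean_space \<Rightarrow> real"
  assumes "open S" "x \<in> S" "Ck_on 2 S f"
  shows "frechet_derivative (\<lambda>y. frechet_derivative f (at y) h) (at x) k
       = frechet_derivative (\<lambda>y. frechet_derivative f (at y) k) (at x) h" (is "?a = ?b")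
proof (rule ccontr)
  assume "?a \<noteq> ?b"
  define e where "e = \<bar>?a - ?b\<bar> / 2"
  have e: "e > 0" using \<open>?a \<noteq> ?b\<close> by (simp add: e_def)
  obtain d where d: "d > 0" "\<And>t. 0 < t \<Longrightarrow> t < d \<Longrightarrow>
    \<bar>(f (x + t *\<^sub>R h + t *\<^sub>R k) - f (x + t *\<^sub>R h) - f (x + t *\<^sub>R k) + f x) / t\<^sup>2 - ?a\<bar> < e"
    using second_difference[OF assms e, of h k] by blast
  obtain d' where d': "d' > 0" "\<And>t. 0 < t \<Longrightarrow> t < d' \<Longrightarrow>
    \<bar>(f (x + t *\<^sub>R k + t *\<^sub>R h) - f (x + t *\<^sub>R k) - f (x + t *\<^sub>R h) + f x) / t\<^sup>2 - ?b\<bar> < e"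
    using second_difference[OF assms e, of k h] by blast
  define t where "t = min d d' / 2"
  have t: "0 < t" "t < d" "t < d'" using d(1) d'(1) by (auto simp: t_def)
  define s where "s = (f (x + t *\<^sub>R h + t *\<^sub>R k) - f (x + t *\<^sub>R h) - f (x + t *\<^sub>R k) + f x) / t\<^sup>2"
  have s2: "s = (f (x + t *\<^sub>R k + t *\<^sub>R h) - f (x + t *\<^sub>R k) - f (x + t *\<^sub>R h) + f x) / t\<^sup>2"
    unfolding s_def add.assoc[of x] add.commute[of "t *\<^sub>R k" "t *\<^sub>R h"] by (simp add: algebra_simps)
  have "\<bar>s - ?a\<bar> < e" unfolding s_def by (rule d(2)[OF t(1,2)])
  moreover have "\<bar>s - ?b\<bar> < e" unfolding s2 by (rule d'(2)[OF t(1,3)])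
  ultimately show False by (simp add: e_def abs_if split: if_splits)
qed

section \<open>Charts, smooth functions and tangent vectors\<close>

lemma smooth_on_cong: "open S \<Longrightarrow> (\<And>y. y \<in> S \<Longrightarrow> f y = g y) \<Longrightarrow> smooth_on S f \<longleftrightarrow> smooth_on S g"
  unfolding smooth_on_def using Ck_on_cong by metis

lemma smooth_on_subset: "smooth_on S f \<Longrightarrow> open S \<Longrightarrow> open T \<Longrightarrow> T \<subseteq> S \<Longrightarrow> smooth_on T f"
  unfolding smooth_on_def using Ck_on_subset by metis

lemma smooth_on_local:
  assumes "open S" "\<And>x. x \<in> S \<Longrightarrow> \<exists>T. open T \<and> x \<in> T \<and> T \<subseteq> S \<and> smooth_on T f"
  shows "smooth_on S f"
  unfolding smooth_on_def
proof
  fix k show "Ck_on k S f"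
  proof (rule Ck_on_local[OF assms(1)])
    fix x assume "x \<in> S"
    then obtain T where "open T" "x \<in> T" "T \<subseteq> S" "smooth_on T f" using assms(2) by blast
    then show "\<exists>T. open T \<and> x \<in> T \<and> T \<subseteq> S \<and> Ck_on k T f" unfolding smooth_on_def by blast
  qed
qed

lemma smooth_on_differentiable: "smooth_on S f \<Longrightarrow> open S \<Longrightarrow> x \<in> S \<Longrightarrow> f differentiable (at x)"
  unfolding smooth_on_def using Ck_on_Suc_open by blast

lemma smooth_on_has_derivative:
  "smooth_on S f \<Longrightarrow> open S \<Longrightarrow> x \<in> S \<Longrightarrow> (f has_derivative frechet_derivative f (at x)) (at x)"
  using smooth_on_differentiable frechet_derivative_works by blast

lemma smooth_on_frechet: "smooth_on S f \<Longrightarrow> open S \<Longrightarrow> smooth_on S (\<lambda>x. frechet_derivative f (at x) h)"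
  unfolding smooth_on_def using Ck_on_Suc_open by blast

lemma smooth_on_sum:
  assumes "open S" "finite A" "\<And>a. a \<in> A \<Longrightarrow> smooth_on S (f a)"
  shows "smooth_on S (\<lambda>x. \<Sum>a\<in>A. f a x)"
  using assms(2,3)
proof (induction A rule: finite_induct)
  case empty then show ?case using assms(1) by (simp add: smooth_on_def Ck_on_const)
next
  case (insert a A) then show ?case using assms(1) by (simp add: smooth_on_def Ck_on_add)
qed

lemma smooth_on_mult:
  fixes f g :: "'e::euclidean_space \<Rightarrow> real"
  shows "open S \<Longrightarrow> smooth_on S f \<Longrightarrow> smooth_on S g \<Longrightarrow> smooth_on S (\<lambda>x. f x * g x)"
  by (simp add: smooth_on_def Ck_on_mult)

text \<open>These axioms concern one chart at a time. They carry over from the base to the circle bundle,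
  where smooth functions and tangent vectors are studied in product charts.\<close>

locale chart_system =
  fixes M :: "('a, 'e::euclidean_space) manifold"
  assumes chart_openin: "(V, \<phi>) \<in> charts M \<Longrightarrow> openin (mtop M) V"
    and chart_image: "(V, \<phi>) \<in> charts M \<Longrightarrow> open (\<phi> ` V)"
    and chart_homeo: "(V, \<phi>) \<in> charts M \<Longrightarrow>
      homeomorphic_map (subtopology (mtop M) V) (top_of_set (\<phi> ` V)) \<phi>"
begin

lemma chart_inj: assumes "(V, \<phi>) \<in> charts M" shows "inj_on \<phi> V"
proof -
  have "topspace (subtopology (mtop M) V) = V"
    using chart_openin[OF assms] openin_subset by (auto simp: topspace_subtopology)
  then show ?thesis using chart_homeo[OF assms] homeomorphic_imp_injective_map by metis
qed

lemma inv_chart: "(V, \<phi>) \<in> charts M \<Longrightarrow> p \<in> V \<Longrightarrow> inv_into V \<phi> (\<phi> p) = p"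
  using chart_inj inv_into_f_f by metis

lemma chart_inv: "x \<in> \<phi> ` V \<Longrightarrow> \<phi> (inv_into V \<phi> x) = x" "x \<in> \<phi> ` V \<Longrightarrow> inv_into V \<phi> x \<in> V"
  by (simp_all add: f_inv_into_f inv_into_into)

lemma inv_chart_mem: "(V, \<phi>) \<in> charts M \<Longrightarrow> x \<in> \<phi> ` (U \<inter> V) \<Longrightarrow> inv_into V \<phi> x \<in> U \<inter> V"
  using inv_chart by auto

lemma open_chart_image:
  assumes "(V, \<phi>) \<in> charts M" "openin (mtop M) U" shows "open (\<phi> ` (U \<inter> V))"
proof -
  have "openin (subtopology (mtop M) V) (U \<inter> V)" using assms(2) by (simp add: openin_subtopology_Int)
  then have "openin (top_of_set (\<phi> ` V)) (\<phi> ` (U \<inter> V))"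
    using chart_homeo[OF assms(1)] homeomorphic_imp_open_map open_map_def by blast
  then show ?thesis using chart_image[OF assms(1)] openin_open_eq by blast
qed

lemma smooth_funD: "smooth_fun M U u \<Longrightarrow> (V, \<phi>) \<in> charts M \<Longrightarrow> smooth_on (\<phi> ` (U \<inter> V)) (u \<circ> inv_into V \<phi>)"
  unfolding smooth_fun_def by blast

lemma smooth_funI:
  "(\<And>V \<phi>. (V, \<phi>) \<in> charts M \<Longrightarrow> smooth_on (\<phi> ` (U \<inter> V)) (u \<circ> inv_into V \<phi>)) \<Longrightarrow> smooth_fun M U u"
  unfolding smooth_fun_def by blast

lemma smooth_fun_subset:
  assumes "smooth_fun M U u" "openin (mtop M) U" "openin (mtop M) W" "W \<subseteq> U"
  shows "smooth_fun M W u"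
  by (rule smooth_funI, rule smooth_on_subset[OF smooth_funD[OF assms(1)]])
    (use assms open_chart_image in auto)

lemma smooth_fun_cong:
  assumes "openin (mtop M) U" "\<And>q. q \<in> U \<Longrightarrow> u q = v q"
  shows "smooth_fun M U u \<longleftrightarrow> smooth_fun M U v"
proof -
  have "smooth_on (\<phi> ` (U \<inter> V)) (u \<circ> inv_into V \<phi>) \<longleftrightarrow> smooth_on (\<phi> ` (U \<inter> V)) (v \<circ> inv_into V \<phi>)"
    if c: "(V, \<phi>) \<in> charts M" for V \<phi>
    by (rule smooth_on_cong[OF open_chart_image[OF c assms(1)]])
      (use assms(2) inv_chart_mem[OF c] in auto)
  then show ?thesis unfolding smooth_fun_def by blast
qed

lemma smooth_fun_const: "openin (mtop M) U \<Longrightarrow> smooth_fun M U (\<lambda>q. c)"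
  by (rule smooth_funI) (simp add: smooth_on_def comp_def Ck_on_const open_chart_image)

lemma smooth_fun_add:
  assumes "openin (mtop M) U" "smooth_fun M U u" "smooth_fun M U v" shows "smooth_fun M U (\<lambda>q. u q + v q)"
proof (rule smooth_funI)
  fix V \<phi> assume c: "(V, \<phi>) \<in> charts M"
  show "smooth_on (\<phi> ` (U \<inter> V)) ((\<lambda>q. u q + v q) \<circ> inv_into V \<phi>)"
    using smooth_funD[OF assms(2) c] smooth_funD[OF assms(3) c]
    by (simp add: smooth_on_def comp_def Ck_on_add[OF open_chart_image[OF c assms(1)]])
qed

lemma smooth_fun_mult:
  assumes "openin (mtop M) U" "smooth_fun M U u" "smooth_fun M U v" shows "smooth_fun M U (\<lambda>q. u q * v q)"
proof (rule smooth_funI)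
  fix V \<phi> assume c: "(V, \<phi>) \<in> charts M"
  show "smooth_on (\<phi> ` (U \<inter> V)) ((\<lambda>q. u q * v q) \<circ> inv_into V \<phi>)"
    using smooth_funD[OF assms(2) c] smooth_funD[OF assms(3) c]
    by (simp add: smooth_on_def comp_def Ck_on_mult[OF open_chart_image[OF c assms(1)]])
qed

lemma smooth_fun_compose:
  assumes "openin (mtop M) U" "smooth_fun M U u" "\<And>n t. (G n has_real_derivative G (Suc n) t) (at t)"
  shows "smooth_fun M U (\<lambda>q. G n (u q))"
proof (rule smooth_funI)
  fix V \<phi> assume c: "(V, \<phi>) \<in> charts M"
  show "smooth_on (\<phi> ` (U \<inter> V)) ((\<lambda>q. G n (u q)) \<circ> inv_into V \<phi>)"
    using smooth_funD[OF assms(2) c]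
    by (simp add: smooth_on_def comp_def Ck_on_compose_real[where G=G, OF open_chart_image[OF c assms(1)] assms(3)])
qed

lemma smooth_fun_uminus: "openin (mtop M) U \<Longrightarrow> smooth_fun M U u \<Longrightarrow> smooth_fun M U (\<lambda>q. - u q)"
  using smooth_fun_mult[of U "\<lambda>q. - 1" u] smooth_fun_const[of U "- 1"] by simp

lemma smooth_fun_diff:
  "openin (mtop M) U \<Longrightarrow> smooth_fun M U u \<Longrightarrow> smooth_fun M U v \<Longrightarrow> smooth_fun M U (\<lambda>q. u q - v q)"
  using smooth_fun_add[of U u "\<lambda>q. - v q"] smooth_fun_uminus by simp

lemma smooth_fun_exp: "openin (mtop M) U \<Longrightarrow> smooth_fun M U u \<Longrightarrow> smooth_fun M U (\<lambda>q. exp (u q))"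
  by (rule smooth_fun_compose[where G="\<lambda>n. exp"]) (auto intro: derivative_eq_intros)

lemma smooth_fun_sum:
  assumes "openin (mtop M) U" "finite A" "\<And>a. a \<in> A \<Longrightarrow> smooth_fun M U (f a)"
  shows "smooth_fun M U (\<lambda>q. \<Sum>a\<in>A. f a q)"
  using assms(2,3) by (induction A rule: finite_induct) (auto simp: assms(1) smooth_fun_const smooth_fun_add)

lemmas smooth_fun_intros = smooth_fun_const smooth_fun_add smooth_fun_mult smooth_fun_uminus
  smooth_fun_diff smooth_fun_exp

lemma smooth_nearI: "smooth_fun M U u \<Longrightarrow> openin (mtop M) U \<Longrightarrow> p \<in> U \<Longrightarrow> smooth_near M p u"
  unfolding smooth_near_def by blast

lemma smooth_near_within:
  assumes "smooth_near M p u" "openin (mtop M) U" "p \<in> U"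
  obtains W where "openin (mtop M) W" "p \<in> W" "W \<subseteq> U" "smooth_fun M W u"
proof -
  obtain W where W: "openin (mtop M) W" "p \<in> W" "smooth_fun M W u"
    using assms(1) unfolding smooth_near_def by blast
  show thesis
    by (rule that[of "W \<inter> U"]) (use W assms smooth_fun_subset[OF W(3,1)] in auto)
qed

lemma smooth_near_local:
  assumes "openin (mtop M) U" "p \<in> U" "\<And>q. q \<in> U \<Longrightarrow> u q = v q" "smooth_near M p u"
  shows "smooth_near M p v"
proof -
  obtain W where W: "openin (mtop M) W" "p \<in> W" "W \<subseteq> U" "smooth_fun M W u"
    using smooth_near_within[OF assms(4,1,2)] .
  then have "smooth_fun M W v" using smooth_fun_cong[OF W(1)] assms(3) by (metis subsetD)
  then show ?thesis using W smooth_nearI by blast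
qed

lemma smooth_near2:
  assumes "smooth_near M p u" "smooth_near M p v"
  obtains W where "openin (mtop M) W" "p \<in> W" "smooth_fun M W u" "smooth_fun M W v"
proof -
  obtain U where U: "openin (mtop M) U" "p \<in> U" "smooth_fun M U u"
    using assms(1) unfolding smooth_near_def by blast
  obtain W where "openin (mtop M) W" "p \<in> W" "W \<subseteq> U" "smooth_fun M W v"
    using smooth_near_within[OF assms(2) U(1,2)] .
  then show thesis using that smooth_fun_subset[OF U(3,1)] by blast
qed

lemma smooth_near_add:
  assumes "smooth_near M p u" "smooth_near M p v" shows "smooth_near M p (\<lambda>q. u q + v q)"
proof -
  obtain W where W: "openin (mtop M) W" "p \<in> W" "smooth_fun M W u" "smooth_fun M W v"
    by (rule smooth_near2[OF assms])
  show ?thesis by (rule smooth_nearI[OF smooth_fun_add[OF W(1,3,4)] W(1,2)])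
qed

lemma smooth_near_mult:
  assumes "smooth_near M p u" "smooth_near M p v" shows "smooth_near M p (\<lambda>q. u q * v q)"
proof -
  obtain W where W: "openin (mtop M) W" "p \<in> W" "smooth_fun M W u" "smooth_fun M W v"
    by (rule smooth_near2[OF assms])
  show ?thesis by (rule smooth_nearI[OF smooth_fun_mult[OF W(1,3,4)] W(1,2)])
qed

lemma chart_has_derivative:
  assumes "smooth_near M p u" "(V, \<phi>) \<in> charts M" "p \<in> V"
  shows "((u \<circ> inv_into V \<phi>) has_derivative frechet_derivative (u \<circ> inv_into V \<phi>) (at (\<phi> p))) (at (\<phi> p))"
proof -
  obtain W where W: "openin (mtop M) W" "p \<in> W" "smooth_fun M W u"
    using assms(1) unfolding smooth_near_def by blast
  show ?thesis
    by (rule smooth_on_has_derivative[OF smooth_funD[OF W(3) assms(2)] open_chart_image[OF assms(2) W(1)]])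
      (use W assms in auto)
qed

lemma tangent_cases:
  assumes "v \<in> tangent_space M p"
  obtains V \<phi> h where "(V, \<phi>) \<in> charts M" "p \<in> V"
    "v = (\<lambda>u. if smooth_near M p u then frechet_derivative (u \<circ> inv_into V \<phi>) (at (\<phi> p)) h else 0)"
  using assms unfolding tangent_space_def by blast

lemma tangent_not_smooth: "v \<in> tangent_space M p \<Longrightarrow> \<not> smooth_near M p u \<Longrightarrow> v u = 0"
  by (erule tangent_cases) simp

lemma tangent_local:
  assumes v: "v \<in> tangent_space M p" and U: "openin (mtop M) U" "p \<in> U" "\<And>q. q \<in> U \<Longrightarrow> u q = w q"
  shows "v u = v w"
proof -
  obtain V \<phi> h where c: "(V, \<phi>) \<in> charts M" "p \<in> V"
    and v: "v = (\<lambda>u. if smooth_near M p u then frechet_derivative (u \<circ> inv_into V \<phi>) (at (\<phi> p)) h else 0)"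
    by (rule tangent_cases[OF v])
  have "smooth_near M p u \<longleftrightarrow> smooth_near M p w"
    using smooth_near_local[OF U(1,2)] U(3) by metis
  moreover have "frechet_derivative (u \<circ> inv_into V \<phi>) (at (\<phi> p)) = frechet_derivative (w \<circ> inv_into V \<phi>) (at (\<phi> p))"
    by (rule frechet_derivative_cong(1)[OF open_chart_image[OF c(1) U(1)]])
      (use U c inv_chart_mem[OF c(1)] in auto)
  ultimately show ?thesis by (simp add: v)
qed

lemma tangent_topspace: "v \<in> tangent_space M p \<Longrightarrow> p \<in> topspace (mtop M)"
  by (erule tangent_cases) (use chart_openin openin_subset in blast)

lemma tangent_add:
  assumes v: "v \<in> tangent_space M p" and s: "smooth_near M p u" "smooth_near M p w"
  shows "v (\<lambda>q. u q + w q) = v u + v w"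
proof -
  obtain V \<phi> h where c: "(V, \<phi>) \<in> charts M" "p \<in> V"
    and v: "v = (\<lambda>u. if smooth_near M p u then frechet_derivative (u \<circ> inv_into V \<phi>) (at (\<phi> p)) h else 0)"
    by (rule tangent_cases[OF v])
  have "(((\<lambda>q. u q + w q) \<circ> inv_into V \<phi>) has_derivative (\<lambda>h. frechet_derivative (u \<circ> inv_into V \<phi>) (at (\<phi> p)) h
      + frechet_derivative (w \<circ> inv_into V \<phi>) (at (\<phi> p)) h)) (at (\<phi> p))"
    using has_derivative_add[OF chart_has_derivative[OF s(1) c] chart_has_derivative[OF s(2) c]]
    by (simp add: comp_def)
  from frechet_derivative_at[OF this, symmetric] show ?thesis
    using s smooth_near_add by (simp add: v)
qed

lemma tangent_mult:
  assumes v: "v \<in> tangent_space M p" and s: "smooth_near M p u" "smooth_near M p w"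
  shows "v (\<lambda>q. u q * w q) = v u * w p + u p * v w"
proof -
  obtain V \<phi> h where c: "(V, \<phi>) \<in> charts M" "p \<in> V"
    and v: "v = (\<lambda>u. if smooth_near M p u then frechet_derivative (u \<circ> inv_into V \<phi>) (at (\<phi> p)) h else 0)"
    by (rule tangent_cases[OF v])
  have "(((\<lambda>q. u q * w q) \<circ> inv_into V \<phi>) has_derivative (\<lambda>h. u p * frechet_derivative (w \<circ> inv_into V \<phi>) (at (\<phi> p)) h
      + frechet_derivative (u \<circ> inv_into V \<phi>) (at (\<phi> p)) h * w p)) (at (\<phi> p))"
    using has_derivative_mult[OF chart_has_derivative[OF s(1) c] chart_has_derivative[OF s(2) c]]
    by (simp add: comp_def inv_chart[OF c])
  from frechet_derivative_at[OF this, symmetric] show ?thesis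
    using s smooth_near_mult by (simp add: v)
qed

lemma smooth_near_const: "p \<in> topspace (mtop M) \<Longrightarrow> smooth_near M p (\<lambda>q. c)"
  by (rule smooth_nearI[of "topspace (mtop M)"]) (auto intro: smooth_fun_const)

lemma tangent_const: "v \<in> tangent_space M p \<Longrightarrow> v (\<lambda>q. c) = 0"
  by (erule tangent_cases) (simp add: comp_def)

lemma tangent_compose:
  assumes v: "v \<in> tangent_space M p" and s: "smooth_near M p u" "smooth_near M p (\<lambda>q. G (u q))"
    and G: "(G has_real_derivative G') (at (u p))"
  shows "v (\<lambda>q. G (u q)) = G' * v u"
proof -
  obtain V \<phi> h where c: "(V, \<phi>) \<in> charts M" "p \<in> V"
    and v: "v = (\<lambda>u. if smooth_near M p u then frechet_derivative (u \<circ> inv_into V \<phi>) (at (\<phi> p)) h else 0)"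
    by (rule tangent_cases[OF v])
  have "(G has_derivative (*) G') (at ((u \<circ> inv_into V \<phi>) (\<phi> p)))"
    using G by (simp add: has_field_derivative_def inv_chart[OF c])
  from has_derivative_compose[OF chart_has_derivative[OF s(1) c] this]
  have "(((\<lambda>q. G (u q)) \<circ> inv_into V \<phi>) has_derivative
      (\<lambda>h. G' * frechet_derivative (u \<circ> inv_into V \<phi>) (at (\<phi> p)) h)) (at (\<phi> p))"
    by (simp add: comp_def)
  from frechet_derivative_at[OF this, symmetric] show ?thesis using s by (simp add: v)
qed

lemma vector_fieldI:
  assumes "\<And>p. p \<in> U \<Longrightarrow> X p \<in> tangent_space M p"
    and "\<And>V u. openin (mtop M) V \<Longrightarrow> V \<subseteq> U \<Longrightarrow> smooth_fun M V u \<Longrightarrow> smooth_fun M V (\<lambda>p. X p u)"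
  shows "vector_field M U X"
  using assms unfolding vector_field_def by blast

lemma vector_field_tangent: "vector_field M U X \<Longrightarrow> p \<in> U \<Longrightarrow> X p \<in> tangent_space M p"
  unfolding vector_field_def by blast

lemma vector_field_smooth:
  "vector_field M U X \<Longrightarrow> openin (mtop M) V \<Longrightarrow> V \<subseteq> U \<Longrightarrow> smooth_fun M V u \<Longrightarrow> smooth_fun M V (\<lambda>p. X p u)"
  unfolding vector_field_def by blast

lemma vector_field_subset: "vector_field M U X \<Longrightarrow> V \<subseteq> U \<Longrightarrow> vector_field M V X"
  unfolding vector_field_def by (meson subset_iff)

lemma vector_field_cong:
  assumes "openin (mtop M) U" "\<And>p. p \<in> U \<Longrightarrow> X p = Y p" "vector_field M U X"
  shows "vector_field M U Y"
proof (rule vector_fieldI)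
  fix p assume "p \<in> U" then show "Y p \<in> tangent_space M p" using assms vector_field_tangent by metis
next
  fix V u assume V: "openin (mtop M) V" "V \<subseteq> U" "smooth_fun M V u"
  then show "smooth_fun M V (\<lambda>p. Y p u)"
    using vector_field_smooth[OF assms(3) V] smooth_fun_cong[OF V(1), of "\<lambda>p. X p u" "\<lambda>p. Y p u"] assms(2)
    by (simp add: subset_iff)
qed

end

locale smooth_atlas = chart_system M for M :: "('a, 'e::euclidean_space) manifold" +
  assumes transition: "(V, \<phi>) \<in> charts M \<Longrightarrow> (V', \<phi>') \<in> charts M \<Longrightarrow>
      smooth_on (\<phi> ` (V \<inter> V')) (\<phi>' \<circ> inv_into V \<phi>)"
    and chart_cover: "p \<in> topspace (mtop M) \<Longrightarrow> \<exists>V \<phi>. (V, \<phi>) \<in> charts M \<and> p \<in> V"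
begin

lemma smooth_coordinate:
  assumes "(V, \<phi>) \<in> charts M" shows "smooth_fun M V (\<lambda>q. \<phi> q \<bullet> b)"
proof (rule smooth_funI)
  fix V' \<phi>' assume c: "(V', \<phi>') \<in> charts M"
  have o: "open (\<phi>' ` (V' \<inter> V))"
    using open_chart_image[OF c chart_openin[OF assms]] by (simp add: Int_commute)
  have "smooth_on (\<phi>' ` (V' \<inter> V)) (\<lambda>x. (\<phi> \<circ> inv_into V' \<phi>') x \<bullet> b)"
    using transition[OF c assms] Ck_on_bounded_linear[OF o bounded_linear_inner_left[of b]]
    unfolding smooth_on_def by blast
  then show "smooth_on (\<phi>' ` (V \<inter> V')) ((\<lambda>q. \<phi> q \<bullet> b) \<circ> inv_into V' \<phi>')"
    by (simp add: Int_commute comp_def)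
qed

lemma tangent_in_chart:
  assumes v: "v \<in> tangent_space M p" and c: "(V, \<phi>) \<in> charts M" "p \<in> V"
  obtains h where
    "v = (\<lambda>u. if smooth_near M p u then frechet_derivative (u \<circ> inv_into V \<phi>) (at (\<phi> p)) h else 0)"
proof -
  obtain V' \<phi>' h where c': "(V', \<phi>') \<in> charts M" "p \<in> V'"
    and v: "v = (\<lambda>u. if smooth_near M p u then frechet_derivative (u \<circ> inv_into V' \<phi>') (at (\<phi>' p)) h else 0)"
    by (rule tangent_cases[OF v])
  define \<tau> where "\<tau> = \<phi> \<circ> inv_into V' \<phi>'"
  have o: "open (\<phi>' ` (V \<inter> V'))" using open_chart_image[OF c'(1) chart_openin[OF c(1)]] .
  have \<tau>: "(\<tau> has_derivative frechet_derivative \<tau> (at (\<phi>' p))) (at (\<phi>' p))"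
    unfolding \<tau>_def by (rule smooth_on_has_derivative[of "\<phi>' ` (V' \<inter> V)"])
      (use transition[OF c'(1) c(1)] o c c' in \<open>auto simp: Int_commute\<close>)
  have "frechet_derivative (u \<circ> inv_into V' \<phi>') (at (\<phi>' p)) h
      = frechet_derivative (u \<circ> inv_into V \<phi>) (at (\<phi> p)) (frechet_derivative \<tau> (at (\<phi>' p)) h)"
    if u: "smooth_near M p u" for u
  proof -
    have "(u \<circ> inv_into V \<phi> has_derivative frechet_derivative (u \<circ> inv_into V \<phi>) (at (\<phi> p))) (at (\<tau> (\<phi>' p)))"
      using chart_has_derivative[OF u c] by (simp add: \<tau>_def inv_chart[OF c'])
    from has_derivative_compose[OF \<tau> this]
    have "((\<lambda>x. (u \<circ> inv_into V \<phi>) (\<tau> x)) has_derivative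
      (\<lambda>h. frechet_derivative (u \<circ> inv_into V \<phi>) (at (\<phi> p)) (frechet_derivative \<tau> (at (\<phi>' p)) h))) (at (\<phi>' p))" .
    then have "((u \<circ> inv_into V' \<phi>') has_derivative
      (\<lambda>h. frechet_derivative (u \<circ> inv_into V \<phi>) (at (\<phi> p)) (frechet_derivative \<tau> (at (\<phi>' p)) h))) (at (\<phi>' p))"
      by (rule has_derivative_transform_within_open[OF _ o])
        (use c c' in \<open>auto simp: \<tau>_def inv_chart\<close>)
    from frechet_derivative_at[OF this] show ?thesis by metis
  qed
  then show thesis by (intro that[of "frechet_derivative \<tau> (at (\<phi>' p)) h"]) (auto simp: v)
qed

lemma tangent_lincomb:
  assumes "v \<in> tangent_space M p" "w \<in> tangent_space M p"
  shows "lincomb a v b w \<in> tangent_space M p"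
proof -
  obtain V \<phi> where c: "(V, \<phi>) \<in> charts M" "p \<in> V" using chart_cover tangent_topspace[OF assms(1)] by blast
  obtain h where h: "v = (\<lambda>u. if smooth_near M p u then frechet_derivative (u \<circ> inv_into V \<phi>) (at (\<phi> p)) h else 0)"
    by (rule tangent_in_chart[OF assms(1) c])
  obtain k where k: "w = (\<lambda>u. if smooth_near M p u then frechet_derivative (u \<circ> inv_into V \<phi>) (at (\<phi> p)) k else 0)"
    by (rule tangent_in_chart[OF assms(2) c])
  have "frechet_derivative (u \<circ> inv_into V \<phi>) (at (\<phi> p)) (a *\<^sub>R h + b *\<^sub>R k)
      = a * frechet_derivative (u \<circ> inv_into V \<phi>) (at (\<phi> p)) h + b * frechet_derivative (u \<circ> inv_into V \<phi>) (at (\<phi> p)) k"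
    if "smooth_near M p u" for u
  proof -
    have "linear (frechet_derivative (u \<circ> inv_into V \<phi>) (at (\<phi> p)))"
      using chart_has_derivative[OF that c] has_derivative_linear by blast
    then show ?thesis by (simp add: linear_add linear_scale)
  qed
  then have "lincomb a v b w = (\<lambda>u. if smooth_near M p u then
      frechet_derivative (u \<circ> inv_into V \<phi>) (at (\<phi> p)) (a *\<^sub>R h + b *\<^sub>R k) else 0)"
    by (auto simp: lincomb_def h k)
  then show ?thesis using c unfolding tangent_space_def by blast
qed

lemma tangent_coordinates:
  assumes v: "v \<in> tangent_space M p" and c: "(V, \<phi>) \<in> charts M" "p \<in> V" and u: "smooth_near M p u"
  shows "v u = (\<Sum>b\<in>Basis. v (\<lambda>q. \<phi> q \<bullet> b) * frechet_derivative (u \<circ> inv_into V \<phi>) (at (\<phi> p)) b)"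
proof -
  obtain h where h: "v = (\<lambda>u. if smooth_near M p u then frechet_derivative (u \<circ> inv_into V \<phi>) (at (\<phi> p)) h else 0)"
    by (rule tangent_in_chart[OF v c])
  have hb: "v (\<lambda>q. \<phi> q \<bullet> b) = h \<bullet> b" for b
  proof -
    have "frechet_derivative ((\<lambda>q. \<phi> q \<bullet> b) \<circ> inv_into V \<phi>) (at (\<phi> p)) = frechet_derivative (\<lambda>x. x \<bullet> b) (at (\<phi> p))"
      by (rule frechet_derivative_cong(1)[OF chart_image[OF c(1)]]) (use c inv_chart[OF c(1)] in auto)
    also have "\<dots> = (\<lambda>x. x \<bullet> b)"
      by (rule frechet_derivative_at[symmetric]) (auto intro!: derivative_eq_intros)
    finally show ?thesis
      using smooth_nearI[OF smooth_coordinate[OF c(1)] chart_openin[OF c(1)] c(2)] by (simp add: h)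
  qed
  have l: "linear (frechet_derivative (u \<circ> inv_into V \<phi>) (at (\<phi> p)))"
    using chart_has_derivative[OF u c] has_derivative_linear by blast
  have "v u = frechet_derivative (u \<circ> inv_into V \<phi>) (at (\<phi> p)) (\<Sum>b\<in>Basis. (h \<bullet> b) *\<^sub>R b)"
    using u by (simp add: h euclidean_representation)
  also have "\<dots> = (\<Sum>b\<in>Basis. (h \<bullet> b) * frechet_derivative (u \<circ> inv_into V \<phi>) (at (\<phi> p)) b)"
    by (simp add: linear_sum[OF l] linear_scale[OF l])
  finally show ?thesis by (simp add: hb)
qed

lemma tangentI:
  assumes c: "(V, \<phi>) \<in> charts M" "p \<in> V"
    and "\<And>u. \<not> smooth_near M p u \<Longrightarrow> v u = 0"
    and "\<And>u. smooth_near M p u \<Longrightarrow> v u = (\<Sum>b\<in>Basis. a b * frechet_derivative (u \<circ> inv_into V \<phi>) (at (\<phi> p)) b)"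
  shows "v \<in> tangent_space M p"
proof -
  have "frechet_derivative (u \<circ> inv_into V \<phi>) (at (\<phi> p)) (\<Sum>b\<in>Basis. a b *\<^sub>R b)
      = (\<Sum>b\<in>Basis. a b * frechet_derivative (u \<circ> inv_into V \<phi>) (at (\<phi> p)) b)"
    if "smooth_near M p u" for u
  proof -
    have l: "linear (frechet_derivative (u \<circ> inv_into V \<phi>) (at (\<phi> p)))"
      using chart_has_derivative[OF that c] has_derivative_linear by blast
    show ?thesis by (simp add: linear_sum[OF l] linear_scale[OF l])
  qed
  then have "v = (\<lambda>u. if smooth_near M p u then
      frechet_derivative (u \<circ> inv_into V \<phi>) (at (\<phi> p)) (\<Sum>b\<in>Basis. a b *\<^sub>R b) else 0)"
    using assms(3,4) by auto
  then show ?thesis using c unfolding tangent_space_def by blast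
qed

lemma vector_field_lincomb:
  assumes "openin (mtop M) U" "vector_field M U X" "vector_field M U Y" "smooth_fun M U h" "smooth_fun M U k"
  shows "vector_field M U (\<lambda>q u. h q * X q u + k q * Y q u)"
proof (rule vector_fieldI)
  fix p assume "p \<in> U"
  then show "(\<lambda>u. h p * X p u + k p * Y p u) \<in> tangent_space M p"
    using tangent_lincomb[OF vector_field_tangent[OF assms(2)] vector_field_tangent[OF assms(3)]]
    by (simp add: lincomb_def)
next
  fix V u assume V: "openin (mtop M) V" "V \<subseteq> U" "smooth_fun M V u"
  then show "smooth_fun M V (\<lambda>p. h p * X p u + k p * Y p u)"
    using smooth_fun_subset[OF assms(4,1) V(1,2)] smooth_fun_subset[OF assms(5,1) V(1,2)]
      vector_field_smooth[OF assms(2) V] vector_field_smooth[OF assms(3) V]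
    by (intro smooth_fun_add[OF V(1)] smooth_fun_mult[OF V(1)])
qed

text \<open>The second order part is symmetric in \<open>X\<close> and \<open>Y\<close>, which is what makes the bracket a vector field.\<close>

lemma second_derivative:
  assumes X: "vector_field M U X" and Y: "vector_field M U Y" and U: "openin (mtop M) U" "p \<in> U"
    and c: "(V, \<phi>) \<in> charts M" "p \<in> V" and u: "smooth_near M p u"
  defines "\<delta> \<equiv> \<lambda>w b x. frechet_derivative w (at x) b" and "U' \<equiv> u \<circ> inv_into V \<phi>"
  shows "X p (\<lambda>q. Y q u) = (\<Sum>b\<in>Basis. X p (\<lambda>q. Y q (\<lambda>q. \<phi> q \<bullet> b)) * \<delta> U' b (\<phi> p))
     + (\<Sum>a\<in>Basis. \<Sum>b\<in>Basis. X p (\<lambda>q. \<phi> q \<bullet> a) * Y p (\<lambda>q. \<phi> q \<bullet> b) * \<delta> (\<delta> U' b) a (\<phi> p))"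
proof -
  obtain W0 where W0: "openin (mtop M) W0" "p \<in> W0" "W0 \<subseteq> U" "smooth_fun M W0 u"
    using smooth_near_within[OF u U] .
  define W where "W = W0 \<inter> V"
  have W: "openin (mtop M) W" "p \<in> W" "W \<subseteq> U" "W \<subseteq> V" "smooth_fun M W u"
    using W0 c chart_openin[OF c(1)] smooth_fun_subset[OF W0(4,1)] by (auto simp: W_def)
  define S where "S = \<phi> ` W"
  have S: "open S" "\<phi> p \<in> S" "\<And>x. x \<in> S \<Longrightarrow> inv_into V \<phi> x \<in> W \<and> \<phi> (inv_into V \<phi> x) = x"
    using open_chart_image[OF c(1) W(1)] W inv_chart[OF c(1)] by (auto simp: S_def Int_absorb2)
  have sm: "smooth_on S (w \<circ> inv_into V \<phi>)" if "smooth_fun M W w" for w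
    using smooth_funD[OF that c(1)] W(4) by (simp add: S_def Int_absorb2)
  have su: "smooth_on S U'" unfolding U'_def using sm[OF W(5)] .
  define Yc where "Yc = (\<lambda>b. (\<lambda>q. Y q (\<lambda>q. \<phi> q \<bullet> b)))"
  have "smooth_fun M W (Yc b)" for b
    unfolding Yc_def by (rule vector_field_smooth[OF Y W(1,3)])
      (rule smooth_fun_subset[OF smooth_coordinate[OF c(1)] chart_openin[OF c(1)] W(1,4)])
  note sYM = this
  have sY: "smooth_on S (Yc b \<circ> inv_into V \<phi>)" for b using sm[OF sYM] .
  have Yu: "((\<lambda>q. Y q u) \<circ> inv_into V \<phi>) x = (\<Sum>b\<in>Basis. (Yc b \<circ> inv_into V \<phi>) x * \<delta> U' b x)" if "x \<in> S" for x
    using tangent_coordinates[OF vector_field_tangent[OF Y] c(1) _ smooth_nearI[OF W(5,1)], of "inv_into V \<phi> x"]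
      S(3)[OF that] W by (auto simp: Yc_def U'_def \<delta>_def)
  have d: "((\<lambda>x. \<Sum>b\<in>Basis. (Yc b \<circ> inv_into V \<phi>) x * \<delta> U' b x) has_derivative
      (\<lambda>h. \<Sum>b\<in>Basis. (Yc b \<circ> inv_into V \<phi>) (\<phi> p) * \<delta> (\<delta> U' b) h (\<phi> p)
          + \<delta> (Yc b \<circ> inv_into V \<phi>) h (\<phi> p) * \<delta> U' b (\<phi> p))) (at (\<phi> p))"
    unfolding \<delta>_def
    by (intro has_derivative_sum has_derivative_mult smooth_on_has_derivative[OF _ S(1,2)] sY
        smooth_on_frechet su S(1))
  have "((\<lambda>q. Y q u) \<circ> inv_into V \<phi> has_derivative
      (\<lambda>h. \<Sum>b\<in>Basis. (Yc b \<circ> inv_into V \<phi>) (\<phi> p) * \<delta> (\<delta> U' b) h (\<phi> p)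
          + \<delta> (Yc b \<circ> inv_into V \<phi>) h (\<phi> p) * \<delta> U' b (\<phi> p))) (at (\<phi> p))"
    by (rule has_derivative_transform_within_open[OF d S(1,2)]) (rule Yu[symmetric])
  note dY = frechet_derivative_at[OF this, symmetric]
  have nY: "smooth_near M p (\<lambda>q. Y q u)"
    using vector_field_smooth[OF Y W(1,3,5)] W smooth_nearI by blast
  have Xp: "X p \<in> tangent_space M p" using vector_field_tangent[OF X U(2)] .
  have XY: "X p (Yc b) = (\<Sum>a\<in>Basis. X p (\<lambda>q. \<phi> q \<bullet> a) * \<delta> (Yc b \<circ> inv_into V \<phi>) a (\<phi> p))" for b
    using tangent_coordinates[OF Xp c smooth_nearI[OF sYM W(1,2)]] by (simp add: \<delta>_def)
  have "X p (\<lambda>q. Y q u) = (\<Sum>a\<in>Basis. X p (\<lambda>q. \<phi> q \<bullet> a) *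
      (\<Sum>b\<in>Basis. (Yc b \<circ> inv_into V \<phi>) (\<phi> p) * \<delta> (\<delta> U' b) a (\<phi> p)
          + \<delta> (Yc b \<circ> inv_into V \<phi>) a (\<phi> p) * \<delta> U' b (\<phi> p)))"
    unfolding tangent_coordinates[OF Xp c nY] dY ..
  also have "\<dots> = (\<Sum>a\<in>Basis. \<Sum>b\<in>Basis. X p (\<lambda>q. \<phi> q \<bullet> a) * Yc b p * \<delta> (\<delta> U' b) a (\<phi> p))
      + (\<Sum>a\<in>Basis. \<Sum>b\<in>Basis. X p (\<lambda>q. \<phi> q \<bullet> a) * \<delta> (Yc b \<circ> inv_into V \<phi>) a (\<phi> p) * \<delta> U' b (\<phi> p))"
    by (simp add: sum_distrib_left sum.distrib distrib_left inv_chart[OF c] mult.assoc)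
  also have "(\<Sum>a\<in>Basis. \<Sum>b\<in>Basis. X p (\<lambda>q. \<phi> q \<bullet> a) * \<delta> (Yc b \<circ> inv_into V \<phi>) a (\<phi> p) * \<delta> U' b (\<phi> p))
      = (\<Sum>b\<in>Basis. X p (Yc b) * \<delta> U' b (\<phi> p))"
    unfolding XY by (subst sum.swap) (simp add: sum_distrib_right)
  finally show ?thesis by (simp add: Yc_def)
qed

lemma lie_vector_field:
  assumes X: "vector_field M U X" and Y: "vector_field M U Y" and U: "openin (mtop M) U"
  shows "vector_field M U (lie M X Y)"
proof (rule vector_fieldI)
  fix p assume p: "p \<in> U"
  then obtain V \<phi> where c: "(V, \<phi>) \<in> charts M" "p \<in> V" using chart_cover U openin_subset by blast
  show "lie M X Y p \<in> tangent_space M p"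
  proof (rule tangentI[OF c, where a = "\<lambda>b. X p (\<lambda>q. Y q (\<lambda>q. \<phi> q \<bullet> b)) - Y p (\<lambda>q. X q (\<lambda>q. \<phi> q \<bullet> b))"])
    fix u assume u: "smooth_near M p u"
    let ?u = "u \<circ> inv_into V \<phi>"
    obtain W where W: "openin (mtop M) W" "p \<in> W" "smooth_fun M W u"
      using u unfolding smooth_near_def by blast
    have "frechet_derivative (\<lambda>x. frechet_derivative ?u (at x) b) (at (\<phi> p)) a
        = frechet_derivative (\<lambda>x. frechet_derivative ?u (at x) a) (at (\<phi> p)) b" for a b
      by (rule frechet_derivative_commute[OF open_chart_image[OF c(1) W(1)]])
        (use smooth_funD[OF W(3) c(1)] W c in \<open>auto simp: smooth_on_def\<close>)
    then have "(\<Sum>a\<in>Basis. \<Sum>b\<in>Basis. X p (\<lambda>q. \<phi> q \<bullet> a) * Y p (\<lambda>q. \<phi> q \<bullet> b)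
          * frechet_derivative (\<lambda>x. frechet_derivative ?u (at x) b) (at (\<phi> p)) a)
      = (\<Sum>b\<in>Basis. \<Sum>a\<in>Basis. Y p (\<lambda>q. \<phi> q \<bullet> b) * X p (\<lambda>q. \<phi> q \<bullet> a)
          * frechet_derivative (\<lambda>x. frechet_derivative ?u (at x) a) (at (\<phi> p)) b)"
      by (subst sum.swap) (simp add: mult_ac)
    then show "lie M X Y p u = (\<Sum>b\<in>Basis. (X p (\<lambda>q. Y q (\<lambda>q. \<phi> q \<bullet> b)) - Y p (\<lambda>q. X q (\<lambda>q. \<phi> q \<bullet> b)))
          * frechet_derivative ?u (at (\<phi> p)) b)"
      using second_derivative[OF X Y U p c u] second_derivative[OF Y X U p c u] u
      by (simp add: lie_def left_diff_distrib sum_subtractf)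
  qed (simp add: lie_def)
next
  fix V u assume V: "openin (mtop M) V" "V \<subseteq> U" "smooth_fun M V u"
  have "smooth_fun M V (\<lambda>p. X p (\<lambda>q. Y q u) - Y p (\<lambda>q. X q u))"
    using vector_field_smooth[OF X V(1,2) vector_field_smooth[OF Y V]]
      vector_field_smooth[OF Y V(1,2) vector_field_smooth[OF X V]] by (rule smooth_fun_diff[OF V(1)])
  moreover have "lie M X Y p u = X p (\<lambda>q. Y q u) - Y p (\<lambda>q. X q u)" if "p \<in> V" for p
    using V that smooth_nearI unfolding lie_def by auto
  ultimately show "smooth_fun M V (\<lambda>p. lie M X Y p u)"
    using smooth_fun_cong[OF V(1), of "\<lambda>p. lie M X Y p u"] by simp
qed

lemma lie_antisym: "lie M X Y p u = - lie M Y X p u" by (simp add: lie_def)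

end

lemma smooth_manifold_atlas: "smooth_manifold M \<Longrightarrow> smooth_atlas M"
  unfolding smooth_manifold_def smooth_atlas_def chart_system_def smooth_atlas_axioms_def by blast

section \<open>Frames\<close>

locale frame_field = chart_system M for M :: "('a, 'e::euclidean_space) manifold" +
  fixes U :: "'a set" and F :: "'n::finite \<Rightarrow> 'a vfield"
  assumes U_open: "openin (mtop M) U"
    and F_tangent: "p \<in> U \<Longrightarrow> F i p \<in> tangent_space M p"
    and F_span: "p \<in> U \<Longrightarrow> v \<in> tangent_space M p \<Longrightarrow> \<exists>a. v = (\<lambda>u. \<Sum>i\<in>UNIV. a $ i * F i p u)"
    and F_indep: "p \<in> U \<Longrightarrow> (\<And>u. smooth_near M p u \<Longrightarrow> (\<Sum>i\<in>UNIV. a $ i * F i p u) = 0) \<Longrightarrow> a = 0"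
begin

lemma coframe_eqI:
  assumes "p \<in> U" "\<And>u. smooth_near M p u \<Longrightarrow> v u = (\<Sum>i\<in>UNIV. a $ i * F i p u)"
    and "\<And>u. \<not> smooth_near M p u \<Longrightarrow> v u = 0"
  shows "coframe F p v = a"
proof -
  have v: "v = (\<lambda>u. \<Sum>i\<in>UNIV. a $ i * F i p u)"
  proof
    fix u show "v u = (\<Sum>i\<in>UNIV. a $ i * F i p u)"
      using assms(2,3)[of u] tangent_not_smooth[OF F_tangent[OF assms(1)], of u]
      by (cases "smooth_near M p u") simp_all
  qed
  have "b = a" if "v = (\<lambda>u. \<Sum>i\<in>UNIV. b $ i * F i p u)" for b
  proof -
    have "(\<Sum>i\<in>UNIV. (b - a) $ i * F i p u) = 0" for u
      using fun_cong[OF v[symmetric, unfolded that], of u] by (simp add: left_diff_distrib sum_subtractf)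
    then show ?thesis using F_indep[OF assms(1), of "b - a"] by simp
  qed
  then show ?thesis
    unfolding coframe_def by (rule the_equality[of "\<lambda>a. v = (\<lambda>u. \<Sum>i\<in>UNIV. a $ i * F i p u)" a, OF v])
qed

lemma coframe_expand:
  assumes "p \<in> U" "v \<in> tangent_space M p"
  shows "v u = (\<Sum>i\<in>UNIV. coframe F p v $ i * F i p u)"
proof -
  obtain a where a: "v = (\<lambda>u. \<Sum>i\<in>UNIV. a $ i * F i p u)" using F_span[OF assms] by blast
  have "coframe F p v = a"
    by (rule coframe_eqI[OF assms(1)]) (use a tangent_not_smooth[OF assms(2)] in auto)
  then show ?thesis by (simp add: a)
qed

lemma coframe_lincomb:
  assumes "p \<in> U" "v \<in> tangent_space M p" "w \<in> tangent_space M p"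
  shows "coframe F p (\<lambda>u. a * v u + b * w u) = a *\<^sub>R coframe F p v + b *\<^sub>R coframe F p w"
proof (rule coframe_eqI[OF assms(1)])
  fix u
  show "a * v u + b * w u = (\<Sum>i\<in>UNIV. (a *\<^sub>R coframe F p v + b *\<^sub>R coframe F p w) $ i * F i p u)"
    using coframe_expand[OF assms(1,2), of u] coframe_expand[OF assms(1,3), of u]
    by (simp add: distrib_right sum.distrib sum_distrib_left mult.assoc)
qed (simp add: tangent_not_smooth[OF assms(2)] tangent_not_smooth[OF assms(3)])

lemma coframe_F: "p \<in> U \<Longrightarrow> coframe F p (F j p) = axis j 1"
  by (rule coframe_eqI) (auto simp: axis_def if_distrib[of "\<lambda>x. x * _"] tangent_not_smooth[OF F_tangent] cong: if_cong)

end

locale smooth_frame = smooth_atlas M + frame_field M U F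
  for M :: "('a, 'e::euclidean_space) manifold" and U :: "'a set" and F :: "'n::finite \<Rightarrow> 'a vfield" +
  assumes F_field: "vector_field M U (F i)"
    and coframe_smooth: "openin (mtop M) V \<Longrightarrow> V \<subseteq> U \<Longrightarrow> vector_field M V X \<Longrightarrow>
      smooth_fun M V (\<lambda>p. coframe F p (X p) $ i)"

lemma UNIV_3': "(UNIV :: 3 set) = {0, 1, 2}"
proof -
  have "x = 0 \<or> x = 1 \<or> x = 2" for x :: 3 using exhaust_3[of x] by auto
  then show ?thesis by auto
qed

lemma sum_3': "(\<Sum>i\<in>(UNIV::3 set). t i) = t 0 + t 1 + t 2"
proof -
  have "(\<Sum>i\<in>(UNIV::3 set). t i) = (\<Sum>i\<in>{0, 1, 2::3}. t i)" by (simp only: UNIV_3')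
  also have "\<dots> = t 0 + t 1 + t 2" by (simp add: add.assoc)
  finally show ?thesis .
qed

lemma forall_3': "(\<forall>i::3. P i) \<longleftrightarrow> P 0 \<and> P 1 \<and> P 2"
proof -
  have "(\<forall>i::3. P i) \<longleftrightarrow> (\<forall>i\<in>{0, 1, 2}. P i)" unfolding UNIV_3'[symmetric] by simp
  then show ?thesis by simp
qed

definition vec3 :: "real \<Rightarrow> real \<Rightarrow> real \<Rightarrow> real ^ 3" where
  "vec3 a b c = (\<chi> i. if i = 0 then a else if i = 1 then b else c)"

lemma vec3_nth [simp]: "vec3 a b c $ 0 = a" "vec3 a b c $ 1 = b" "vec3 a b c $ 2 = c"
  by (simp_all add: vec3_def)

text \<open>The three conditions on brackets are what remains of the contact form, its normalization and the
  Reeb equations when these are expressed by the frame alone.\<close>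

locale contact_frame = smooth_frame M U f for M :: "('a, real ^ 3) manifold" and U and f :: "3 \<Rightarrow> 'a vfield" +
  assumes br21: "p \<in> U \<Longrightarrow> coframe f p (lie M (f 2) (f 1) p) $ 0 = 1"
    and br10: "p \<in> U \<Longrightarrow> coframe f p (lie M (f 1) (f 0) p) $ 0 = 0"
    and br20: "p \<in> U \<Longrightarrow> coframe f p (lie M (f 2) (f 0) p) $ 0 = 0"
begin

lemma c_smooth: "smooth_fun M U (c12 M f k)" "smooth_fun M U (c10 M f k)" "smooth_fun M U (c20 M f k)"
  unfolding c12_def[abs_def] c10_def[abs_def] c20_def[abs_def]
  by (intro coframe_smooth U_open lie_vector_field F_field order_refl)+

lemma lie_tangent: "p \<in> U \<Longrightarrow> lie M (f i) (f j) p \<in> tangent_space M p"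
  by (rule vector_field_tangent[OF lie_vector_field[OF F_field F_field U_open]])

lemma brackets:
  assumes "p \<in> U"
  shows "lie M (f 2) (f 1) p u = f 0 p u + c12 M f 1 p * f 1 p u + c12 M f 2 p * f 2 p u"
    "lie M (f 1) (f 0) p u = c10 M f 1 p * f 1 p u + c10 M f 2 p * f 2 p u"
    "lie M (f 2) (f 0) p u = c20 M f 1 p * f 1 p u + c20 M f 2 p * f 2 p u"
  using coframe_expand[OF assms lie_tangent[OF assms, of 2 1], of u]
    coframe_expand[OF assms lie_tangent[OF assms, of 1 0], of u]
    coframe_expand[OF assms lie_tangent[OF assms, of 2 0], of u] br21[OF assms] br10[OF assms] br20[OF assms]
  by (simp_all add: sum_3' c12_def c10_def c20_def)

lemma commute:
  assumes "p \<in> U" "smooth_near M p u"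
  shows "f 2 p (\<lambda>q. f 1 q u) = f 1 p (\<lambda>q. f 2 q u) + f 0 p u + c12 M f 1 p * f 1 p u + c12 M f 2 p * f 2 p u"
    "f 1 p (\<lambda>q. f 0 q u) = f 0 p (\<lambda>q. f 1 q u) + c10 M f 1 p * f 1 p u + c10 M f 2 p * f 2 p u"
    "f 2 p (\<lambda>q. f 0 q u) = f 0 p (\<lambda>q. f 2 q u) + c20 M f 1 p * f 1 p u + c20 M f 2 p * f 2 p u"
  using brackets[OF assms(1), of u] assms(2) by (simp_all add: lie_def)

lemma f_near:
  assumes "p \<in> U" "smooth_near M p u" shows "smooth_near M p (\<lambda>q. f i q u)"
proof -
  obtain W where W: "openin (mtop M) W" "p \<in> W" "W \<subseteq> U" "smooth_fun M W u"
    using smooth_near_within[OF assms(2) U_open assms(1)] .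
  show ?thesis by (rule smooth_nearI[OF vector_field_smooth[OF F_field W(1,3,4)] W(1,2)])
qed

text \<open>The Jacobi identity of \<open>f 0, f 1, f 2\<close>, component by component.\<close>

lemma jacobi:
  assumes p: "p \<in> U"
  shows "c20 M f 2 p = - c10 M f 1 p"
    "f 0 p (c12 M f 1) = c12 M f 1 p * c10 M f 1 p + c12 M f 2 p * c20 M f 1 p - f 2 p (c10 M f 1) + f 1 p (c20 M f 1)"
    "f 0 p (c12 M f 2) = c12 M f 1 p * c10 M f 2 p + c12 M f 2 p * c20 M f 2 p - f 2 p (c10 M f 2) + f 1 p (c20 M f 2)"
proof -
  let ?x = "c12 M f 1" and ?y = "c12 M f 2" and ?a = "c10 M f 1" and ?b = "c10 M f 2" and ?d = "c20 M f 1" and ?e = "c20 M f 2"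
  have cn: "smooth_near M p (c12 M f k)" "smooth_near M p (c10 M f k)" "smooth_near M p (c20 M f k)" for k
    using smooth_nearI[OF c_smooth(1) U_open p] smooth_nearI[OF c_smooth(2) U_open p] smooth_nearI[OF c_smooth(3) U_open p] by auto
  have lin: "(?a p + ?e p) * f 0 p u
      + (f 0 p ?x - ?x p * ?a p - ?y p * ?d p + f 2 p ?a - f 1 p ?d + (?a p + ?e p) * ?x p) * f 1 p u
      + (f 0 p ?y - ?x p * ?b p - ?y p * ?e p + f 2 p ?b - f 1 p ?e + (?a p + ?e p) * ?y p) * f 2 p u = 0"
    if u: "smooth_near M p u" for u
  proof -
    obtain W where W: "openin (mtop M) W" "p \<in> W" "W \<subseteq> U" "smooth_fun M W u"
      using smooth_near_within[OF u U_open p] .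
    have sn: "smooth_near M q u" if "q \<in> W" for q using W that smooth_nearI by blast
    note ft = F_tangent[OF p]
    note nr = f_near[OF p] u cn smooth_near_add smooth_near_mult
    note ap = tangent_add[OF ft] tangent_mult[OF ft] nr
    have 1: "f i p (\<lambda>q. f 2 q (\<lambda>r. f 1 r u)) = f i p (\<lambda>q. f 1 q (\<lambda>r. f 2 r u) + f 0 q u + ?x q * f 1 q u + ?y q * f 2 q u)" for i
      by (rule tangent_local[OF ft W(1,2)]) (use commute(1) sn W in auto)
    have 2: "f i p (\<lambda>q. f 1 q (\<lambda>r. f 0 r u)) = f i p (\<lambda>q. f 0 q (\<lambda>r. f 1 r u) + ?a q * f 1 q u + ?b q * f 2 q u)" for i
      by (rule tangent_local[OF ft W(1,2)]) (use commute(2) sn W in auto)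
    have 3: "f i p (\<lambda>q. f 2 q (\<lambda>r. f 0 r u)) = f i p (\<lambda>q. f 0 q (\<lambda>r. f 2 r u) + ?d q * f 1 q u + ?e q * f 2 q u)" for i
      by (rule tangent_local[OF ft W(1,2)]) (use commute(3) sn W in auto)
    have c1: "f 2 p (\<lambda>q. f 1 q v) = f 1 p (\<lambda>q. f 2 q v) + f 0 p v + ?x p * f 1 p v + ?y p * f 2 p v"
      and c2: "f 1 p (\<lambda>q. f 0 q v) = f 0 p (\<lambda>q. f 1 q v) + ?a p * f 1 p v + ?b p * f 2 p v"
      and c3: "f 2 p (\<lambda>q. f 0 q v) = f 0 p (\<lambda>q. f 2 q v) + ?d p * f 1 p v + ?e p * f 2 p v" if "smooth_near M p v" for v
      using commute[OF p that] by auto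
    have e1: "f 0 p (\<lambda>q. f 2 q (\<lambda>r. f 1 r u)) = f 0 p (\<lambda>q. f 1 q (\<lambda>r. f 2 r u)) + f 0 p (\<lambda>q. f 0 q u)
        + (f 0 p ?x * f 1 p u + ?x p * f 0 p (\<lambda>q. f 1 q u)) + (f 0 p ?y * f 2 p u + ?y p * f 0 p (\<lambda>q. f 2 q u))"
      unfolding 1 by (simp add: ap)
    have e2: "f 2 p (\<lambda>q. f 1 q (\<lambda>r. f 0 r u)) = f 2 p (\<lambda>q. f 0 q (\<lambda>r. f 1 r u))
        + (f 2 p ?a * f 1 p u + ?a p * f 2 p (\<lambda>q. f 1 q u)) + (f 2 p ?b * f 2 p u + ?b p * f 2 p (\<lambda>q. f 2 q u))"
      unfolding 2 by (simp add: ap)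
    have e3: "f 1 p (\<lambda>q. f 2 q (\<lambda>r. f 0 r u)) = f 1 p (\<lambda>q. f 0 q (\<lambda>r. f 2 r u))
        + (f 1 p ?d * f 1 p u + ?d p * f 1 p (\<lambda>q. f 1 q u)) + (f 1 p ?e * f 2 p u + ?e p * f 1 p (\<lambda>q. f 2 q u))"
      unfolding 3 by (simp add: ap)
    note s = c1[OF f_near[OF p u, of 0]] c2[OF f_near[OF p u, of 2]] c3[OF f_near[OF p u, of 1]]
      c1[OF u] c2[OF u] c3[OF u]
    show ?thesis using e1 e2 e3 s by algebra
  qed
  have "vec3 (?a p + ?e p)
      (f 0 p ?x - ?x p * ?a p - ?y p * ?d p + f 2 p ?a - f 1 p ?d + (?a p + ?e p) * ?x p)
      (f 0 p ?y - ?x p * ?b p - ?y p * ?e p + f 2 p ?b - f 1 p ?e + (?a p + ?e p) * ?y p) = 0"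
    by (rule F_indep[OF p]) (simp add: sum_3' lin)
  then have "\<forall>i. vec3 (?a p + ?e p)
      (f 0 p ?x - ?x p * ?a p - ?y p * ?d p + f 2 p ?a - f 1 p ?d + (?a p + ?e p) * ?x p)
      (f 0 p ?y - ?x p * ?b p - ?y p * ?e p + f 2 p ?b - f 1 p ?e + (?a p + ?e p) * ?y p) $ i = 0" by simp
  then have "?a p + ?e p = 0"
      "f 0 p ?x - ?x p * ?a p - ?y p * ?d p + f 2 p ?a - f 1 p ?d + (?a p + ?e p) * ?x p = 0"
      "f 0 p ?y - ?x p * ?b p - ?y p * ?e p + f 2 p ?b - f 1 p ?e + (?a p + ?e p) * ?y p = 0"
    unfolding forall_3' vec3_nth by blast+
  then show "?e p = - ?a p" "f 0 p ?x = ?x p * ?a p + ?y p * ?d p - f 2 p ?a + f 1 p ?d"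
    "f 0 p ?y = ?x p * ?b p + ?y p * ?e p - f 2 p ?b + f 1 p ?e" by simp_all
qed

end

lemma lincomb_apply: "lincomb a v b w u = a * v u + b * w u" by (simp add: lincomb_def)

text \<open>The coframe component \<open>0\<close> is the normalized contact form \<open>\<omega>\<close>, and evaluating its exterior derivative
  on pairs of the frame gives the \<open>f 0\<close>-components of the brackets. The coframe is smooth because its
  other components are inner products with \<open>f 1\<close> and \<open>f 2\<close>.\<close>

lemma adapted_contact_frame:
  assumes cs: "contact_sub_Riemannian M \<Delta> g \<mu>" and ad: "adapted_frame M \<Delta> g \<mu> U f"
  shows "contact_frame M U f"
    and "p \<in> U \<Longrightarrow> \<Delta> p = {lincomb a (f 1 p) b (f 2 p) |a b. True}"
    and "p \<in> U \<Longrightarrow> v \<in> \<Delta> p \<Longrightarrow> v = lincomb (g p v (f 1 p)) (f 1 p) (g p v (f 2 p)) (f 2 p)"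
proof -
  have sm: "smooth_manifold M" and rk: "rank_two_distribution M \<Delta>" and eg: "euclidean_metric M \<Delta> g"
    and am: "area_form M \<Delta> g \<mu>"
    using cs by (simp_all add: contact_sub_Riemannian_def contact_distribution_def)
  interpret smooth_atlas M by (rule smooth_manifold_atlas[OF sm])
  obtain \<omega> where U: "openin (mtop M) U" and on: "oriented_orthonormal_frame M \<Delta> g \<mu> U (f 1) (f 2)"
    and nc: "normalized_contact_form M \<Delta> \<mu> U \<omega>" and rb: "Reeb_field M U \<omega> (f 0)"
    using ad unfolding adapted_frame_def by blast
  have UT: "U \<subseteq> topspace (mtop M)" using U openin_subset by blast
  have f12: "section_on M \<Delta> U (f 1)" "section_on M \<Delta> U (f 2)" using on by (simp_all add: oriented_orthonormal_frame_def)
  have fv: "vector_field M U (f i)" for i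
  proof -
    have "\<forall>i. vector_field M U (f i)"
      using f12 rb unfolding forall_3' by (simp add: section_on_def Reeb_field_def)
    then show ?thesis by blast
  qed
  have om: "one_form M U \<omega>" and ker: "\<And>p. p \<in> U \<Longrightarrow> \<Delta> p = {v \<in> tangent_space M p. \<omega> p v = 0}"
    and nrm: "\<And>V X Y p. openin (mtop M) V \<Longrightarrow> V \<subseteq> U \<Longrightarrow> section_on M \<Delta> V X \<Longrightarrow> section_on M \<Delta> V Y \<Longrightarrow> p \<in> V \<Longrightarrow>
      ext_deriv M \<omega> X Y p = \<mu> p (X p) (Y p)"
    using nc unfolding normalized_contact_form_def by blast+
  have \<omega>0: "\<And>p. p \<in> U \<Longrightarrow> \<omega> p (f 0 p) = 1"
    and reeb: "\<And>V X p. openin (mtop M) V \<Longrightarrow> V \<subseteq> U \<Longrightarrow> vector_field M V X \<Longrightarrow> p \<in> V \<Longrightarrow> ext_deriv M \<omega> (f 0) X p = 0"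
    using rb unfolding Reeb_field_def by blast+
  have \<omega>_lin: "\<omega> p (lincomb a v b w) = a * \<omega> p v + b * \<omega> p w"
    if "p \<in> U" "v \<in> tangent_space M p" "w \<in> tangent_space M p" for p v w a b
    using om that unfolding one_form_def by blast
  have \<Delta>f: "f 1 p \<in> \<Delta> p" "f 2 p \<in> \<Delta> p" if "p \<in> U" for p
    using f12 that by (simp_all add: section_on_def)
  have \<Delta>t: "v \<in> \<Delta> p \<Longrightarrow> v \<in> tangent_space M p" "v \<in> \<Delta> p \<Longrightarrow> \<omega> p v = 0" if "p \<in> U" for p v
    using ker[OF that] by auto
  have \<omega>12: "\<omega> p (f 1 p) = 0" "\<omega> p (f 2 p) = 0" if "p \<in> U" for p using \<Delta>t(2)[OF that] \<Delta>f[OF that] by auto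
  have \<Delta>lin: "lincomb a v b w \<in> \<Delta> p" if "p \<in> U" "v \<in> \<Delta> p" "w \<in> \<Delta> p" for p v w a b
    unfolding ker[OF that(1)]
    using tangent_lincomb[OF \<Delta>t(1)[OF that(1,2)] \<Delta>t(1)[OF that(1,3)]]
      \<omega>_lin[OF that(1) \<Delta>t(1)[OF that(1,2)] \<Delta>t(1)[OF that(1,3)]] \<Delta>t(2)[OF that(1,2)] \<Delta>t(2)[OF that(1,3)]
    by simp
  have \<mu>_lin: "\<mu> p (lincomb a v b w) z = a * \<mu> p v z + b * \<mu> p w z" "\<mu> p z (lincomb a v b w) = a * \<mu> p z v + b * \<mu> p z w"
    and g_lin: "g p (lincomb a v b w) z = a * g p v z + b * g p w z"
    and \<mu>_alt: "\<mu> p v w = - \<mu> p w v" and g_sym: "g p v w = g p w v"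
    if "p \<in> U" "v \<in> \<Delta> p" "w \<in> \<Delta> p" "z \<in> \<Delta> p" for p v w z a b
  proof -
    have pT: "p \<in> topspace (mtop M)" using that UT by blast
    have sf: "smooth_form_on M \<Delta> \<mu>" "smooth_form_on M \<Delta> g"
      using am eg unfolding area_form_def euclidean_metric_def by (blast, blast)
    note l = sf[unfolded smooth_form_on_def, THEN conjunct1, THEN bspec, OF pT, THEN bspec, OF that(2),
        THEN bspec, OF that(3), THEN bspec, OF that(4), THEN spec, THEN spec]
    show "\<mu> p (lincomb a v b w) z = a * \<mu> p v z + b * \<mu> p w z" "\<mu> p z (lincomb a v b w) = a * \<mu> p z v + b * \<mu> p z w"
      "g p (lincomb a v b w) z = a * g p v z + b * g p w z"
      by (rule l(1)[THEN conjunct1] l(1)[THEN conjunct2] l(2)[THEN conjunct1])+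
    show "\<mu> p v w = - \<mu> p w v"
      using am[unfolded area_form_def, THEN conjunct2, THEN bspec, OF pT, THEN bspec, OF that(2), THEN bspec, OF that(3)]
      by (rule conjunct1)
    show "g p v w = g p w v" 
      using eg[unfolded euclidean_metric_def, THEN conjunct2, THEN bspec, OF pT, THEN bspec, OF that(2), THEN bspec, OF that(3)]
      by (rule conjunct1)
  qed
  have on': "g p (f 1 p) (f 1 p) = 1" "g p (f 2 p) (f 2 p) = 1" "g p (f 1 p) (f 2 p) = 0" "\<mu> p (f 1 p) (f 2 p) = 1"
    if "p \<in> U" for p using on that by (simp_all add: oriented_orthonormal_frame_def)
  have comb: "\<exists>s t. v = lincomb s (f 1 p) t (f 2 p)" if p: "p \<in> U" and v: "v \<in> \<Delta> p" for p v
  proof -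
    have pT: "p \<in> topspace (mtop M)" using p UT by blast
    obtain V X Y where pV: "p \<in> V" and
      D0: "\<forall>q\<in>V. \<Delta> q = {lincomb a (X q) b (Y q) |a b. True} \<and>
           (\<forall>a b. lincomb a (X q) b (Y q) = (\<lambda>u. 0) \<longrightarrow> a = 0 \<and> b = 0)"
      using rk[unfolded rank_two_distribution_def, THEN bspec, OF pT] by (elim exE conjE) (rule that)
    have D: "\<Delta> p = {lincomb a (X p) b (Y p) |a b. True}" using D0[THEN bspec, OF pV] by (rule conjunct1)
    have ex: "\<exists>a b. v = lincomb a (X p) b (Y p)" if "v \<in> \<Delta> p" for v using that unfolding D by simp
    obtain a b where ab1: "f 1 p = lincomb a (X p) b (Y p)" using ex[OF \<Delta>f(1)[OF p]] by (elim exE) (rule that)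
    obtain c d where ab2: "f 2 p = lincomb c (X p) d (Y p)" using ex[OF \<Delta>f(2)[OF p]] by (elim exE) (rule that)
    obtain e f' where ab3: "v = lincomb e (X p) f' (Y p)" using ex[OF v] by (elim exE) (rule that)
    note ab = ab1 ab2 ab3
    have XY: "X p \<in> \<Delta> p" "Y p \<in> \<Delta> p"
    proof -
      have "X p = lincomb 1 (X p) 0 (Y p)" "Y p = lincomb 0 (X p) 1 (Y p)" by (simp_all add: lincomb_def)
      then show "X p \<in> \<Delta> p" "Y p \<in> \<Delta> p" unfolding D by blast+
    qed
    have z: "\<mu> p (X p) (X p) = 0" "\<mu> p (Y p) (Y p) = 0" "\<mu> p (Y p) (X p) = - \<mu> p (X p) (Y p)"
      using \<mu>_alt[OF p XY(1) XY(1) XY(1)] \<mu>_alt[OF p XY(2) XY(2) XY(1)] \<mu>_alt[OF p XY(2) XY(1) XY(1)] by auto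
    have "1 = (a * d - b * c) * \<mu> p (X p) (Y p)"
      using on'(4)[OF p] \<Delta>lin[OF p XY]
      by (simp add: ab(1,2) \<mu>_lin[OF p XY(1) XY(2)] XY z algebra_simps)
    then have n: "a * d - b * c \<noteq> 0" by auto
    define k where "k = 1 / (a * d - b * c)"
    have k: "k * (a * d - b * c) = 1" using n by (simp add: k_def)
    have "v = lincomb ((e * d - f' * c) * k) (f 1 p) ((f' * a - e * b) * k) (f 2 p)"
    proof
      fix u show "v u = lincomb ((e * d - f' * c) * k) (f 1 p) ((f' * a - e * b) * k) (f 2 p) u"
        unfolding ab lincomb_apply using k by algebra
    qed
    then show ?thesis by blast
  qed
  show dec: "v = lincomb (g p v (f 1 p)) (f 1 p) (g p v (f 2 p)) (f 2 p)" if p: "p \<in> U" and v: "v \<in> \<Delta> p" for p v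
  proof -
    obtain s t where v': "v = lincomb s (f 1 p) t (f 2 p)" using comb[OF p v] by blast
    have "g p v (f 1 p) = s" "g p v (f 2 p) = t"
      unfolding v' using on'[OF p] \<Delta>f[OF p] g_lin[OF p \<Delta>f[OF p]] g_sym[OF p \<Delta>f(2,1)[OF p] \<Delta>f(1)[OF p]] by simp_all
    then show ?thesis using v' by simp
  qed
  show "\<Delta> p = {lincomb a (f 1 p) b (f 2 p) |a b. True}" if p: "p \<in> U" for p
    using comb[OF p] \<Delta>lin[OF p \<Delta>f[OF p]] by blast
  have rest: "lincomb 1 v (- \<omega> p v) (f 0 p) \<in> \<Delta> p" if p: "p \<in> U" and v: "v \<in> tangent_space M p" for p v
    using tangent_lincomb[OF v vector_field_tangent[OF fv p]] \<omega>_lin[OF p v vector_field_tangent[OF fv p]] \<omega>0[OF p]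
    by (simp add: ker[OF p])
  have coef: "v = (\<lambda>u. \<Sum>i\<in>UNIV. vec3 (\<omega> p v) (g p (lincomb 1 v (- \<omega> p v) (f 0 p)) (f 1 p))
      (g p (lincomb 1 v (- \<omega> p v) (f 0 p)) (f 2 p)) $ i * f i p u)" if p: "p \<in> U" and v: "v \<in> tangent_space M p" for p v
  proof
    fix u
    show "v u = (\<Sum>i\<in>UNIV. vec3 (\<omega> p v) (g p (lincomb 1 v (- \<omega> p v) (f 0 p)) (f 1 p))
      (g p (lincomb 1 v (- \<omega> p v) (f 0 p)) (f 2 p)) $ i * f i p u)"
      using fun_cong[OF dec[OF p rest[OF p v]], of u]
      unfolding lincomb_apply sum_3' vec3_nth by simp
  qed
  interpret frame_field M U f
  proof
    show "openin (mtop M) U" by fact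
    show "f i p \<in> tangent_space M p" if "p \<in> U" for i p using vector_field_tangent[OF fv that] .
    show "\<exists>a. v = (\<lambda>u. \<Sum>i\<in>UNIV. a $ i * f i p u)" if "p \<in> U" "v \<in> tangent_space M p" for p v
      using coef[OF that] by blast
    show "a = 0" if p: "p \<in> U" and a: "\<And>u. smooth_near M p u \<Longrightarrow> (\<Sum>i\<in>UNIV. a $ i * f i p u) = 0" for p and a :: "real ^ 3"
    proof -
      have ft: "f i p \<in> tangent_space M p" for i using vector_field_tangent[OF fv p] .
      have z: "lincomb (a $ 0) (f 0 p) 1 (lincomb (a $ 1) (f 1 p) (a $ 2) (f 2 p)) u = 0" for u
        using a[of u] tangent_not_smooth[OF ft, of u] by (cases "smooth_near M p u") (auto simp: sum_3' lincomb_def)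
      then have z': "lincomb (a $ 0) (f 0 p) 1 (lincomb (a $ 1) (f 1 p) (a $ 2) (f 2 p)) = lincomb 0 (f 1 p) 0 (f 1 p)"
        by (auto simp: lincomb_def)
      have "a $ 0 = 0"
        using arg_cong[OF z', of "\<omega> p"]
        by (simp add: \<omega>_lin[OF p ft tangent_lincomb[OF ft ft]] \<omega>_lin[OF p ft ft] \<omega>0[OF p] \<omega>12[OF p])
      then have "lincomb (a $ 1) (f 1 p) (a $ 2) (f 2 p) = lincomb 0 (f 1 p) 0 (f 1 p)"
        using z by (auto simp: lincomb_def)
      from arg_cong[OF this, of "\<lambda>v. g p v (f 1 p)"] arg_cong[OF this, of "\<lambda>v. g p v (f 2 p)"]
      have "a $ 1 = 0 \<and> a $ 2 = 0"
        using \<Delta>f[OF p] on'[OF p] g_sym[OF p \<Delta>f(2,1)[OF p] \<Delta>f(1)[OF p]] by (simp add: g_lin[OF p])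
      with \<open>a $ 0 = 0\<close> show ?thesis by (simp add: vec_eq_iff forall_3')
    qed
  qed
  have cf: "coframe f p v = vec3 (\<omega> p v) (g p (lincomb 1 v (- \<omega> p v) (f 0 p)) (f 1 p))
      (g p (lincomb 1 v (- \<omega> p v) (f 0 p)) (f 2 p))" if "p \<in> U" "v \<in> tangent_space M p" for p v
    by (rule coframe_eqI[OF that(1)])
      (rule fun_cong[OF coef[OF that]], rule tangent_not_smooth[OF that(2)])
  interpret smooth_frame M U f
  proof
    show "vector_field M U (f i)" for i by (rule fv)
    fix V X i assume V: "openin (mtop M) V" "V \<subseteq> U" and X: "vector_field M V X"
    let ?R = "\<lambda>p u. 1 * X p u + (- \<omega> p (X p)) * f 0 p u"
    have s0: "smooth_fun M V (\<lambda>p. \<omega> p (X p))" using om V X unfolding one_form_def by blast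
    have R: "section_on M \<Delta> V ?R"
      unfolding section_on_def
      using vector_field_lincomb[OF V(1) X vector_field_subset[OF fv V(2)] smooth_fun_const[OF V(1), of 1] smooth_fun_uminus[OF V(1) s0]]
        rest[OF _ vector_field_tangent[OF X]] V(2) by (auto simp: lincomb_def)
    have f12V: "section_on M \<Delta> V (f 1)" "section_on M \<Delta> V (f 2)"
      using f12 V vector_field_subset by (auto simp: section_on_def)
    have sg: "smooth_fun M V (\<lambda>p. g p (?R p) (f 1 p))" "smooth_fun M V (\<lambda>p. g p (?R p) (f 2 p))"
      using eg V(1) R f12V unfolding euclidean_metric_def smooth_form_on_def by blast+
    have "\<forall>i. smooth_fun M V (\<lambda>p. vec3 (\<omega> p (X p)) (g p (?R p) (f 1 p)) (g p (?R p) (f 2 p)) $ i)"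
      unfolding forall_3' using s0 sg by simp
    moreover have "coframe f p (X p) $ i = vec3 (\<omega> p (X p)) (g p (?R p) (f 1 p)) (g p (?R p) (f 2 p)) $ i" if "p \<in> V" for p
      using cf[OF _ vector_field_tangent[OF X that]] that V by (auto simp: lincomb_def)
    ultimately show "smooth_fun M V (\<lambda>p. coframe f p (X p) $ i)"
      using smooth_fun_cong[OF V(1), of "\<lambda>p. coframe f p (X p) $ i"] by simp
  qed
  have lt: "lie M (f i) (f j) p \<in> tangent_space M p" if "p \<in> U" for i j p
    by (rule vector_field_tangent[OF lie_vector_field[OF fv fv U] that])
  have zero: "f i p (\<lambda>q. \<omega> q (f j q)) = 0" if p: "p \<in> U" for i j p
  proof -
    have "\<forall>j. \<exists>c. \<forall>q\<in>U. \<omega> q (f j q) = c" unfolding forall_3' using \<omega>0 \<omega>12 by blast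
    then obtain c where "\<And>q. q \<in> U \<Longrightarrow> \<omega> q (f j q) = c" by blast
    from tangent_local[OF vector_field_tangent[OF fv p] U p this] tangent_const[OF vector_field_tangent[OF fv p]]
    show ?thesis by simp
  qed
  have neg: "\<omega> p (lie M X Y p) = - \<omega> p (lie M Y X p)" if "p \<in> U" "lie M Y X p \<in> tangent_space M p" for p X Y
  proof -
    have "lie M X Y p = lincomb (-1) (lie M Y X p) 0 (lie M Y X p)" by (auto simp: lincomb_def lie_def)
    then show ?thesis using \<omega>_lin[OF that(1,2,2)] by simp
  qed
  show "contact_frame M U f"
  proof
    fix p assume p: "p \<in> U"
    have "ext_deriv M \<omega> (f 1) (f 2) p = 1" using nrm[OF U order_refl f12 p] on'[OF p] by simp
    then show "coframe f p (lie M (f 2) (f 1) p) $ 0 = 1"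
      using zero[OF p] neg[OF p lt[OF p], of 1 2] by (simp add: ext_deriv_def cf[OF p lt[OF p]])
    show "coframe f p (lie M (f 1) (f 0) p) $ 0 = 0" "coframe f p (lie M (f 2) (f 0) p) $ 0 = 0"
      using reeb[OF U order_refl fv p, of 1] reeb[OF U order_refl fv p, of 2] zero[OF p]
        neg[OF p lt[OF p], of 0 1] neg[OF p lt[OF p], of 0 2] by (simp_all add: ext_deriv_def cf[OF p lt[OF p]])
  qed
qed

section \<open>Changes of frame\<close>

context smooth_atlas
begin

lemma vector_field_sum:
  assumes "openin (mtop M) U" "\<And>a. a \<in> A \<Longrightarrow> vector_field M U (X a)" "finite A" "A \<noteq> {}"
    "\<And>a. a \<in> A \<Longrightarrow> smooth_fun M U (h a)"
  shows "vector_field M U (\<lambda>p u. \<Sum>a\<in>A. h a p * X a p u)"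
  using assms(3,4,2,5)
proof (induction A rule: finite_ne_induct)
  case (singleton a)
  show ?case
    using vector_field_lincomb[OF assms(1) singleton(1)[of a] singleton(1)[of a] singleton(2)[of a] smooth_fun_const[OF assms(1), of 0]]
    by simp
next
  case (insert a A)
  have "vector_field M U (\<lambda>p u. h a p * X a p u + 1 * (\<Sum>a\<in>A. h a p * X a p u))"
    by (rule vector_field_lincomb[OF assms(1) _ _ _ smooth_fun_const[OF assms(1)]]) (use insert in auto)
  then show ?case using insert by simp
qed

lemma smooth_frame_change:
  assumes sf: "smooth_frame M U F"
    and A: "\<And>i k. smooth_fun M U (A i k)" and B: "\<And>i k. smooth_fun M U (B i k)"
    and AB: "\<And>p i k. p \<in> U \<Longrightarrow> (\<Sum>j\<in>UNIV. A i j p * B j k p) = (if i = k then 1 else 0)"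
    and BA: "\<And>p i k. p \<in> U \<Longrightarrow> (\<Sum>j\<in>UNIV. B i j p * A j k p) = (if i = k then 1 else 0)"
    and G: "\<And>i p u. p \<in> U \<Longrightarrow> G i p u = (\<Sum>k\<in>UNIV. A i k p * F k p u)"
  shows "smooth_frame M U (G :: 'n::finite \<Rightarrow> _)"
    and "p \<in> U \<Longrightarrow> v \<in> tangent_space M p \<Longrightarrow> coframe G p v $ i = (\<Sum>k\<in>UNIV. coframe F p v $ k * B k i p)"
proof -
  interpret F: smooth_frame M U F by (rule sf)
  have Gv: "vector_field M U (G i)" for i
  proof (rule vector_field_cong[OF F.U_open])
    show "vector_field M U (\<lambda>p u. \<Sum>k\<in>UNIV. A i k p * F k p u)"
      by (rule vector_field_sum[OF F.U_open F.F_field]) (simp_all add: A)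
  qed (simp add: G fun_eq_iff)
  have FG: "F k p u = (\<Sum>i\<in>UNIV. B k i p * G i p u)" if "p \<in> U" for k p u
  proof -
    have "(\<Sum>i\<in>UNIV. B k i p * G i p u) = (\<Sum>i\<in>UNIV. \<Sum>j\<in>UNIV. B k i p * A i j p * F j p u)"
      using that by (simp add: G sum_distrib_left mult.assoc)
    also have "\<dots> = (\<Sum>j\<in>UNIV. (\<Sum>i\<in>UNIV. B k i p * A i j p) * F j p u)"
      by (subst sum.swap) (simp add: sum_distrib_right)
    also have "\<dots> = F k p u" using that by (simp add: BA if_distrib[of "\<lambda>x. x * _"] cong: if_cong)
    finally show ?thesis by simp
  qed
  have ex: "v u = (\<Sum>i\<in>UNIV. (\<chi> i. \<Sum>k\<in>UNIV. coframe F p v $ k * B k i p) $ i * G i p u)"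
    if "p \<in> U" "v \<in> tangent_space M p" for p v u
  proof -
    have "v u = (\<Sum>k\<in>UNIV. coframe F p v $ k * (\<Sum>i\<in>UNIV. B k i p * G i p u))"
      using F.coframe_expand[OF that] FG[OF that(1)] by simp
    also have "\<dots> = (\<Sum>i\<in>UNIV. \<Sum>k\<in>UNIV. coframe F p v $ k * B k i p * G i p u)"
      by (subst sum.swap) (simp add: sum_distrib_left mult.assoc)
    finally show ?thesis by (simp add: sum_distrib_right)
  qed
  interpret G: frame_field M U G
  proof
    show "openin (mtop M) U" by (rule F.U_open)
    show "G i p \<in> tangent_space M p" if "p \<in> U" for i p by (rule vector_field_tangent[OF Gv that])
    show "\<exists>a. v = (\<lambda>u. \<Sum>i\<in>UNIV. a $ i * G i p u)" if "p \<in> U" "v \<in> tangent_space M p" for p v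
      by (rule exI, rule ext, rule ex[OF that])
    show "a = 0" if p: "p \<in> U" and a: "\<And>u. smooth_near M p u \<Longrightarrow> (\<Sum>i\<in>UNIV. a $ i * G i p u) = 0"
      for p and a :: "real ^ 'n"
    proof -
      have "(\<chi> k. \<Sum>i\<in>UNIV. a $ i * A i k p) = 0"
      proof (rule F.F_indep[OF p])
        fix u assume u: "smooth_near M p u"
        have "(\<Sum>k\<in>UNIV. (\<Sum>i\<in>UNIV. a $ i * A i k p) * F k p u) = (\<Sum>i\<in>UNIV. a $ i * (\<Sum>k\<in>UNIV. A i k p * F k p u))"
          by (simp only: sum_distrib_right sum_distrib_left, subst sum.swap) (simp add: mult.assoc)
        also have "\<dots> = 0" using a[OF u] by (simp add: G[OF p])
        finally show "(\<Sum>k\<in>UNIV. (\<chi> k. \<Sum>i\<in>UNIV. a $ i * A i k p) $ k * F k p u) = 0" by simp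
      qed
      then have z: "(\<Sum>i\<in>UNIV. a $ i * A i k p) = 0" for k by (simp add: vec_eq_iff)
      have "a $ m = 0" for m
      proof -
        have "a $ m = (\<Sum>i\<in>UNIV. a $ i * (\<Sum>k\<in>UNIV. A i k p * B k m p))"
          by (simp add: AB[OF p] if_distrib[of "\<lambda>x. _ * x"] cong: if_cong)
        also have "\<dots> = (\<Sum>k\<in>UNIV. (\<Sum>i\<in>UNIV. a $ i * A i k p) * B k m p)"
          by (simp only: sum_distrib_right sum_distrib_left, subst sum.swap) (simp add: mult.assoc)
        finally show ?thesis by (simp add: z)
      qed
      then show ?thesis by (simp add: vec_eq_iff)
    qed
  qed
  have cf: "coframe G p v = (\<chi> i. \<Sum>k\<in>UNIV. coframe F p v $ k * B k i p)"
    if "p \<in> U" "v \<in> tangent_space M p" for p v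
    by (rule G.coframe_eqI[OF that(1)]) (rule ex[OF that], rule tangent_not_smooth[OF that(2)])
  show "coframe G p v $ i = (\<Sum>k\<in>UNIV. coframe F p v $ k * B k i p)" if "p \<in> U" "v \<in> tangent_space M p"
    using cf[OF that] by simp
  show "smooth_frame M U G"
  proof
    show "vector_field M U (G i)" for i by (rule Gv)
    fix V X i assume V: "openin (mtop M) V" "V \<subseteq> U" and X: "vector_field M V X"
    have "smooth_fun M V (\<lambda>p. \<Sum>k\<in>UNIV. coframe F p (X p) $ k * B k i p)"
      by (intro smooth_fun_sum V smooth_fun_mult F.coframe_smooth X smooth_fun_subset[OF B F.U_open V]) simp
    moreover have "(\<Sum>k\<in>UNIV. coframe F p (X p) $ k * B k i p) = coframe G p (X p) $ i" if "p \<in> V" for p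
      using cf[OF _ vector_field_tangent[OF X that]] V that by auto
    ultimately show "smooth_fun M V (\<lambda>p. coframe G p (X p) $ i)"
      using smooth_fun_cong[OF V(1), of "\<lambda>p. \<Sum>k\<in>UNIV. coframe F p (X p) $ k * B k i p"] by simp
  qed
qed

end

text \<open>Structure coefficients are read off from any expression of the commutators in the frame; this is
  how they are computed for every frame below.\<close>

lemma contact_frame_coefficients:
  fixes f :: "3 \<Rightarrow> 'a vfield"
  assumes "smooth_frame M U f"
    and "\<And>p u. p \<in> U \<Longrightarrow> smooth_near M p u \<Longrightarrow>
      f 2 p (\<lambda>q. f 1 q u) - f 1 p (\<lambda>q. f 2 q u) = f 0 p u + x p * f 1 p u + y p * f 2 p u"
    and "\<And>p u. p \<in> U \<Longrightarrow> smooth_near M p u \<Longrightarrow>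
      f 1 p (\<lambda>q. f 0 q u) - f 0 p (\<lambda>q. f 1 q u) = a p * f 1 p u + b p * f 2 p u"
    and "\<And>p u. p \<in> U \<Longrightarrow> smooth_near M p u \<Longrightarrow>
      f 2 p (\<lambda>q. f 0 q u) - f 0 p (\<lambda>q. f 2 q u) = d p * f 1 p u + e p * f 2 p u"
  shows "contact_frame M U f"
    and "p \<in> U \<Longrightarrow> c12 M f 1 p = x p" "p \<in> U \<Longrightarrow> c12 M f 2 p = y p"
      "p \<in> U \<Longrightarrow> c10 M f 1 p = a p" "p \<in> U \<Longrightarrow> c10 M f 2 p = b p"
      "p \<in> U \<Longrightarrow> c20 M f 1 p = d p" "p \<in> U \<Longrightarrow> c20 M f 2 p = e p"
proof -
  interpret F: smooth_frame M U f by (rule assms(1))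
  have c: "coframe f p (lie M (f 2) (f 1) p) = vec3 1 (x p) (y p)"
    "coframe f p (lie M (f 1) (f 0) p) = vec3 0 (a p) (b p)"
    "coframe f p (lie M (f 2) (f 0) p) = vec3 0 (d p) (e p)" if "p \<in> U" for p
    using assms(2-4)[OF that] by (intro F.coframe_eqI[OF that]; simp add: lie_def sum_3')+
  show "contact_frame M U f" by unfold_locales (simp_all add: c)
  show "p \<in> U \<Longrightarrow> c12 M f 1 p = x p" "p \<in> U \<Longrightarrow> c12 M f 2 p = y p"
      "p \<in> U \<Longrightarrow> c10 M f 1 p = a p" "p \<in> U \<Longrightarrow> c10 M f 2 p = b p"
      "p \<in> U \<Longrightarrow> c20 M f 1 p = d p" "p \<in> U \<Longrightarrow> c20 M f 2 p = e p"
    by (simp_all add: c12_def c10_def c20_def c)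
qed

context contact_frame
begin

lemma f_compose:
  assumes p: "p \<in> U" and u: "smooth_near M p u" and G: "\<And>n t. (G n has_real_derivative G (Suc n) t) (at t)"
  shows "f i p (\<lambda>q. G n (u q)) = G (Suc n) (u p) * f i p u" "smooth_near M p (\<lambda>q. G n (u q))"
proof -
  obtain W where W: "openin (mtop M) W" "p \<in> W" "smooth_fun M W u"
    using u unfolding smooth_near_def by blast
  show n: "smooth_near M p (\<lambda>q. G n (u q))"
    by (rule smooth_nearI[OF smooth_fun_compose[where G=G, OF W(1,3) G] W(1,2)])
  show "f i p (\<lambda>q. G n (u q)) = G (Suc n) (u p) * f i p u"
    by (rule tangent_compose[OF F_tangent[OF p] u n G])
qed

lemma f_exp:
  assumes p: "p \<in> U" and u: "smooth_near M p u"
  shows "f i p (\<lambda>q. exp (u q)) = exp (u p) * f i p u" "smooth_near M p (\<lambda>q. exp (u q))"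
  using f_compose[OF p u, of "\<lambda>n. exp"] by (simp_all add: DERIV_exp)

lemma near_const: "p \<in> U \<Longrightarrow> smooth_near M p (\<lambda>q. c)"
  using smooth_near_const U_open openin_subset by blast

lemma near_uminus: "p \<in> U \<Longrightarrow> smooth_near M p u \<Longrightarrow> smooth_near M p (\<lambda>q. - u q)"
  using smooth_near_mult[OF near_const[of p "- 1"], of u] by simp

lemma near_diff: "p \<in> U \<Longrightarrow> smooth_near M p u \<Longrightarrow> smooth_near M p v \<Longrightarrow> smooth_near M p (\<lambda>q. u q - v q)"
  using smooth_near_add[of p u "\<lambda>q. - v q"] near_uminus by simp

lemma f_rules:
  assumes "p \<in> U"
  shows "f i p (\<lambda>q. c) = 0"
    "smooth_near M p u \<Longrightarrow> f i p (\<lambda>q. - u q) = - f i p u"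
    "smooth_near M p u \<Longrightarrow> smooth_near M p v \<Longrightarrow> f i p (\<lambda>q. u q + v q) = f i p u + f i p v"
    "smooth_near M p u \<Longrightarrow> smooth_near M p v \<Longrightarrow> f i p (\<lambda>q. u q - v q) = f i p u - f i p v"
    "smooth_near M p u \<Longrightarrow> smooth_near M p v \<Longrightarrow> f i p (\<lambda>q. u q * v q) = f i p u * v p + u p * f i p v"
proof -
  note t = F_tangent[OF assms, of i]
  show 1: "f i p (\<lambda>q. c) = 0" for c by (rule tangent_const[OF t])
  show 2: "f i p (\<lambda>q. - u q) = - f i p u" if "smooth_near M p u" for u
    using tangent_mult[OF t near_const[OF assms, of "- 1"] that] 1[of "- 1"] by simp
  show "smooth_near M p u \<Longrightarrow> smooth_near M p v \<Longrightarrow> f i p (\<lambda>q. u q + v q) = f i p u + f i p v"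
    "smooth_near M p u \<Longrightarrow> smooth_near M p v \<Longrightarrow> f i p (\<lambda>q. u q * v q) = f i p u * v p + u p * f i p v"
    by (rule tangent_add[OF t] tangent_mult[OF t]; assumption)+
  show "f i p (\<lambda>q. u q - v q) = f i p u - f i p v" if "smooth_near M p u" "smooth_near M p v"
    using tangent_add[OF t that(1) near_uminus[OF assms that(2)]] 2[OF that(2)] by simp
qed

lemmas near_rules = near_const near_uminus near_diff f_near

definition rotated :: "('a \<Rightarrow> real) \<Rightarrow> ('a \<Rightarrow> real) \<Rightarrow> 3 \<Rightarrow> 'a vfield" where
  "rotated C S i = (\<lambda>p u. if i = 1 then C p * f 1 p u + S p * f 2 p u
     else if i = 2 then - S p * f 1 p u + C p * f 2 p u else f 0 p u)"

lemma rotated: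
  assumes C: "smooth_fun M U C" and S: "smooth_fun M U S" and CS: "\<And>p. p \<in> U \<Longrightarrow> C p * C p + S p * S p = 1"
  shows "contact_frame M U (rotated C S)"
    and "p \<in> U \<Longrightarrow> c12 M (rotated C S) 1 p = C p * c12 M f 1 p + S p * c12 M f 2 p
        + C p * (C p * f 1 p S - S p * f 1 p C) + S p * (C p * f 2 p S - S p * f 2 p C)"
    and "p \<in> U \<Longrightarrow> c12 M (rotated C S) 2 p = C p * c12 M f 2 p - S p * c12 M f 1 p
        + C p * (C p * f 2 p S - S p * f 2 p C) - S p * (C p * f 1 p S - S p * f 1 p C)"
    and "p \<in> U \<Longrightarrow> c10 M (rotated C S) 1 p = C p * (C p * c10 M f 1 p + S p * c20 M f 1 p - f 0 p C)
        + S p * (C p * c10 M f 2 p + S p * c20 M f 2 p - f 0 p S)"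
    and "p \<in> U \<Longrightarrow> c10 M (rotated C S) 2 p = C p * (C p * c10 M f 2 p + S p * c20 M f 2 p - f 0 p S)
        - S p * (C p * c10 M f 1 p + S p * c20 M f 1 p - f 0 p C)"
    and "p \<in> U \<Longrightarrow> c20 M (rotated C S) 1 p = C p * (C p * c20 M f 1 p - S p * c10 M f 1 p + f 0 p S)
        + S p * (C p * c20 M f 2 p - S p * c10 M f 2 p - f 0 p C)"
    and "p \<in> U \<Longrightarrow> c20 M (rotated C S) 2 p = C p * (C p * c20 M f 2 p - S p * c10 M f 2 p - f 0 p C)
        - S p * (C p * c20 M f 1 p - S p * c10 M f 1 p + f 0 p S)"
proof -
  define A where "A = (\<lambda>(i::3) (k::3) p. if i = 0 then (if k = 0 then 1 else 0)
    else if i = 1 then (if k = 0 then 0 else if k = 1 then C p else S p)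
    else (if k = 0 then 0 else if k = 1 then - S p else C p))"
  have ex3: "P i k" if "P 0 0" "P 0 1" "P 0 2" "P 1 0" "P 1 1" "P 1 2" "P 2 0" "P 2 1" "P 2 2"
    for P :: "3 \<Rightarrow> 3 \<Rightarrow> bool" and i k
    using that forall_3'[of "\<lambda>i. \<forall>k. P i k"] forall_3' by metis
  have sA: "smooth_fun M U (A i k)" for i k
    by (rule ex3[of "\<lambda>i k. smooth_fun M U (A i k)"])
      (simp_all add: A_def smooth_fun_const[OF U_open] smooth_fun_uminus[OF U_open S] C S)
  have sf: "smooth_frame M U (rotated C S)"
  proof (rule smooth_frame_change(1)[OF smooth_frame_axioms sA, where B = "\<lambda>i k. A k i"])
    show "smooth_fun M U (A k i)" for i k by (rule sA)
    show "(\<Sum>j\<in>UNIV. A i j p * A k j p) = (if i = k then 1 else 0)" if "p \<in> U" for p i k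
      by (rule ex3[of "\<lambda>i k. (\<Sum>j\<in>UNIV. A i j p * A k j p) = (if i = k then 1 else 0)"])
        (use CS[OF that] in \<open>simp_all add: sum_3' A_def algebra_simps\<close>)
    show "(\<Sum>j\<in>UNIV. A j i p * A j k p) = (if i = k then 1 else 0)" if "p \<in> U" for p i k
      by (rule ex3[of "\<lambda>i k. (\<Sum>j\<in>UNIV. A j i p * A j k p) = (if i = k then 1 else 0)"])
        (use CS[OF that] in \<open>simp_all add: sum_3' A_def algebra_simps\<close>)
    have "\<forall>i. rotated C S i p u = (\<Sum>k\<in>UNIV. A i k p * f k p u)" for p u
      unfolding forall_3' by (simp add: sum_3' A_def rotated_def)
    then show "rotated C S i p u = (\<Sum>k\<in>UNIV. A i k p * f k p u)" for i p u by blast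
  qed
  have n: "smooth_near M p C" "smooth_near M p S" if "p \<in> U" for p
    using smooth_nearI[OF C U_open that] smooth_nearI[OF S U_open that] by auto
  have dCS: "C p * f i p C + S p * f i p S = 0" if "p \<in> U" for p i
  proof -
    have "f i p (\<lambda>q. C q * C q + S q * S q) = f i p (\<lambda>q. 1)"
      by (rule tangent_local[OF F_tangent[OF that] U_open that]) (rule CS)
    then show ?thesis using n[OF that] by (simp add: f_rules[OF that] near_rules[OF that] smooth_near_add smooth_near_mult mult.commute)
  qed
  note main = contact_frame_coefficients[OF sf,
    where x = "\<lambda>p. C p * c12 M f 1 p + S p * c12 M f 2 p
        + C p * (C p * f 1 p S - S p * f 1 p C) + S p * (C p * f 2 p S - S p * f 2 p C)"
    and y = "\<lambda>p. C p * c12 M f 2 p - S p * c12 M f 1 p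
        + C p * (C p * f 2 p S - S p * f 2 p C) - S p * (C p * f 1 p S - S p * f 1 p C)"
    and a = "\<lambda>p. C p * (C p * c10 M f 1 p + S p * c20 M f 1 p - f 0 p C)
        + S p * (C p * c10 M f 2 p + S p * c20 M f 2 p - f 0 p S)"
    and b = "\<lambda>p. C p * (C p * c10 M f 2 p + S p * c20 M f 2 p - f 0 p S)
        - S p * (C p * c10 M f 1 p + S p * c20 M f 1 p - f 0 p C)"
    and d = "\<lambda>p. C p * (C p * c20 M f 1 p - S p * c10 M f 1 p + f 0 p S)
        + S p * (C p * c20 M f 2 p - S p * c10 M f 2 p - f 0 p C)"
    and e = "\<lambda>p. C p * (C p * c20 M f 2 p - S p * c10 M f 2 p - f 0 p C)
        - S p * (C p * c20 M f 1 p - S p * c10 M f 1 p + f 0 p S)"]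
  have b1: "rotated C S 2 p (\<lambda>q. rotated C S 1 q u) - rotated C S 1 p (\<lambda>q. rotated C S 2 q u)
      = rotated C S 0 p u + (C p * c12 M f 1 p + S p * c12 M f 2 p
        + C p * (C p * f 1 p S - S p * f 1 p C) + S p * (C p * f 2 p S - S p * f 2 p C)) * rotated C S 1 p u
      + (C p * c12 M f 2 p - S p * c12 M f 1 p
        + C p * (C p * f 2 p S - S p * f 2 p C) - S p * (C p * f 1 p S - S p * f 1 p C)) * rotated C S 2 p u"
    if p: "p \<in> U" and u: "smooth_near M p u" for p u
    using CS[OF p] dCS[OF p, of 1] dCS[OF p, of 2] commute[OF p u]
    apply (simp add: rotated_def f_rules[OF p] near_rules[OF p] smooth_near_add smooth_near_mult n[OF p] u)
    by algebra
  have b2: "rotated C S 1 p (\<lambda>q. rotated C S 0 q u) - rotated C S 0 p (\<lambda>q. rotated C S 1 q u)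
      = (C p * (C p * c10 M f 1 p + S p * c20 M f 1 p - f 0 p C)
        + S p * (C p * c10 M f 2 p + S p * c20 M f 2 p - f 0 p S)) * rotated C S 1 p u
      + (C p * (C p * c10 M f 2 p + S p * c20 M f 2 p - f 0 p S)
        - S p * (C p * c10 M f 1 p + S p * c20 M f 1 p - f 0 p C)) * rotated C S 2 p u"
    if p: "p \<in> U" and u: "smooth_near M p u" for p u
    using CS[OF p] commute[OF p u]
    apply (simp add: rotated_def f_rules[OF p] near_rules[OF p] smooth_near_add smooth_near_mult n[OF p] u)
    by algebra
  have b3: "rotated C S 2 p (\<lambda>q. rotated C S 0 q u) - rotated C S 0 p (\<lambda>q. rotated C S 2 q u)
      = (C p * (C p * c20 M f 1 p - S p * c10 M f 1 p + f 0 p S)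
        + S p * (C p * c20 M f 2 p - S p * c10 M f 2 p - f 0 p C)) * rotated C S 1 p u
      + (C p * (C p * c20 M f 2 p - S p * c10 M f 2 p - f 0 p C)
        - S p * (C p * c20 M f 1 p - S p * c10 M f 1 p + f 0 p S)) * rotated C S 2 p u"
    if p: "p \<in> U" and u: "smooth_near M p u" for p u
    using CS[OF p] commute[OF p u]
    apply (simp add: rotated_def f_rules[OF p] near_rules[OF p] smooth_near_add smooth_near_mult n[OF p] u)
    by algebra
  note main' = main[OF b1 b2 b3]
  show "contact_frame M U (rotated C S)" by (rule main'(1))
  show "p \<in> U \<Longrightarrow> c12 M (rotated C S) 1 p = C p * c12 M f 1 p + S p * c12 M f 2 p
        + C p * (C p * f 1 p S - S p * f 1 p C) + S p * (C p * f 2 p S - S p * f 2 p C)"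
    by (rule main'(2))
  show "p \<in> U \<Longrightarrow> c12 M (rotated C S) 2 p = C p * c12 M f 2 p - S p * c12 M f 1 p
        + C p * (C p * f 2 p S - S p * f 2 p C) - S p * (C p * f 1 p S - S p * f 1 p C)"
    by (rule main'(3))
  show "p \<in> U \<Longrightarrow> c10 M (rotated C S) 1 p = C p * (C p * c10 M f 1 p + S p * c20 M f 1 p - f 0 p C)
        + S p * (C p * c10 M f 2 p + S p * c20 M f 2 p - f 0 p S)"
    by (rule main'(4))
  show "p \<in> U \<Longrightarrow> c10 M (rotated C S) 2 p = C p * (C p * c10 M f 2 p + S p * c20 M f 2 p - f 0 p S)
        - S p * (C p * c10 M f 1 p + S p * c20 M f 1 p - f 0 p C)"
    by (rule main'(5))
  show "p \<in> U \<Longrightarrow> c20 M (rotated C S) 1 p = C p * (C p * c20 M f 1 p - S p * c10 M f 1 p + f 0 p S)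
        + S p * (C p * c20 M f 2 p - S p * c10 M f 2 p - f 0 p C)"
    by (rule main'(6))
  show "p \<in> U \<Longrightarrow> c20 M (rotated C S) 2 p = C p * (C p * c20 M f 2 p - S p * c10 M f 2 p - f 0 p C)
        - S p * (C p * c20 M f 1 p - S p * c10 M f 1 p + f 0 p S)"
    by (rule main'(7))
qed

lemma rescaled:
  assumes \<phi>: "smooth_fun M U \<phi>"
  defines "E \<equiv> \<lambda>p. exp (- \<phi> p)" and "g \<equiv> rescale_frame \<phi> f"
  shows "contact_frame M U g"
    and "p \<in> U \<Longrightarrow> c12 M g 1 p = E p * (c12 M f 1 p - 3 * f 2 p \<phi>)"
    and "p \<in> U \<Longrightarrow> c12 M g 2 p = E p * (c12 M f 2 p + 3 * f 1 p \<phi>)"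
    and "p \<in> U \<Longrightarrow> c10 M g 1 p = E p * E p * (c10 M f 1 p + f 0 p \<phi> + 2 * f 1 p (\<lambda>q. f 2 q \<phi>)
        - 4 * (f 1 p \<phi> * f 2 p \<phi>) + 2 * (f 1 p \<phi> * c12 M f 1 p))"
    and "p \<in> U \<Longrightarrow> c10 M g 2 p = E p * E p * (c10 M f 2 p - 2 * f 1 p (\<lambda>q. f 1 q \<phi>)
        + 4 * (f 1 p \<phi> * f 1 p \<phi>) + 2 * (f 1 p \<phi> * c12 M f 2 p))"
    and "p \<in> U \<Longrightarrow> c20 M g 1 p = E p * E p * (c20 M f 1 p + 2 * f 2 p (\<lambda>q. f 2 q \<phi>)
        - 4 * (f 2 p \<phi> * f 2 p \<phi>) + 2 * (f 2 p \<phi> * c12 M f 1 p))"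
proof -
  have n: "smooth_near M p \<phi>" if "p \<in> U" for p by (rule smooth_nearI[OF \<phi> U_open that])
  have E: "f i p E = - (E p * f i p \<phi>)" "smooth_near M p E" if "p \<in> U" for i p
    using f_exp[OF that near_uminus[OF that n[OF that]]] f_rules(2)[OF that n[OF that]] by (simp_all add: E_def)
  have E2: "exp (- (2 * \<phi> p)) = E p * E p" for p by (simp add: E_def mult_exp_exp)
  have g: "g 0 p u = E p * E p * (f 0 p u + 2 * (f 2 p \<phi> * f 1 p u) - 2 * (f 1 p \<phi> * f 2 p u))"
    "g 1 p u = E p * f 1 p u" "g 2 p u = E p * f 2 p u" for p u
    by (simp_all add: g_def rescale_frame_def E2 mult.assoc) (simp_all add: E_def)
  define A where "A = (\<lambda>(i::3) (k::3) p. if i = 0 then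
      (if k = 0 then E p * E p else if k = 1 then E p * E p * (2 * f 2 p \<phi>) else - (E p * E p * (2 * f 1 p \<phi>)))
    else if i = k then E p else 0)"
  define I where "I = (\<lambda>p. exp (\<phi> p))"
  define B where "B = (\<lambda>(i::3) (k::3) p. if i = 0 then
      (if k = 0 then I p * I p else if k = 1 then - (I p * (2 * f 2 p \<phi>)) else I p * (2 * f 1 p \<phi>))
    else if i = k then I p else 0)"
  have IE: "I p * E p = 1" for p by (simp add: I_def E_def exp_minus)
  have ex3: "P i k" if "P 0 0" "P 0 1" "P 0 2" "P 1 0" "P 1 1" "P 1 2" "P 2 0" "P 2 1" "P 2 2"
    for P :: "3 \<Rightarrow> 3 \<Rightarrow> bool" and i k
    using that forall_3'[of "\<lambda>i. \<forall>k. P i k"] forall_3' by metis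
  note vs = vector_field_smooth[OF F_field U_open order_refl \<phi>]
  have sE: "smooth_fun M U E" "smooth_fun M U I" unfolding E_def I_def using \<phi>
    by (intro smooth_fun_exp smooth_fun_uminus U_open; assumption)+
  note srules = smooth_fun_const[OF U_open] smooth_fun_mult[OF U_open] smooth_fun_uminus[OF U_open] sE vs
  have sf: "smooth_frame M U g"
  proof (rule smooth_frame_change(1)[OF smooth_frame_axioms, where A = A and B = B])
    show "smooth_fun M U (A i k)" for i k
      by (rule ex3[of "\<lambda>i k. smooth_fun M U (A i k)"]) (simp_all add: A_def srules)
    show "smooth_fun M U (B i k)" for i k
      by (rule ex3[of "\<lambda>i k. smooth_fun M U (B i k)"]) (simp_all add: B_def srules)
    show "(\<Sum>j\<in>UNIV. A i j p * B j k p) = (if i = k then 1 else 0)" for p i k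
      by (rule ex3[of "\<lambda>i k. (\<Sum>j\<in>UNIV. A i j p * B j k p) = (if i = k then 1 else 0)"]; insert IE[of p];
          simp add: sum_3' A_def B_def; algebra?)
    show "(\<Sum>j\<in>UNIV. B i j p * A j k p) = (if i = k then 1 else 0)" for p i k
      by (rule ex3[of "\<lambda>i k. (\<Sum>j\<in>UNIV. B i j p * A j k p) = (if i = k then 1 else 0)"]; insert IE[of p];
          simp add: sum_3' A_def B_def; algebra?)
    have "\<forall>i. g i p u = (\<Sum>k\<in>UNIV. A i k p * f k p u)" for p u
      unfolding forall_3' by (simp add: sum_3' A_def g algebra_simps)
    then show "g i p u = (\<Sum>k\<in>UNIV. A i k p * f k p u)" for i p u by blast
  qed
  have b1: "g 2 p (\<lambda>q. g 1 q u) - g 1 p (\<lambda>q. g 2 q u)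
      = g 0 p u + (E p * (c12 M f 1 p - 3 * f 2 p \<phi>)) * g 1 p u + (E p * (c12 M f 2 p + 3 * f 1 p \<phi>)) * g 2 p u"
    if p: "p \<in> U" and u: "smooth_near M p u" for p u
    apply (simp add: commute[OF p u] g f_rules[OF p] near_rules[OF p] smooth_near_add smooth_near_mult n[OF p] E[OF p] u
        del: mult_cancel_left mult_cancel_right)
    by (simp add: algebra_simps)
  have b2: "g 1 p (\<lambda>q. g 0 q u) - g 0 p (\<lambda>q. g 1 q u)
      = (E p * E p * (c10 M f 1 p + f 0 p \<phi> + 2 * f 1 p (\<lambda>q. f 2 q \<phi>)
        - 4 * (f 1 p \<phi> * f 2 p \<phi>) + 2 * (f 1 p \<phi> * c12 M f 1 p))) * g 1 p u
      + (E p * E p * (c10 M f 2 p - 2 * f 1 p (\<lambda>q. f 1 q \<phi>)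
        + 4 * (f 1 p \<phi> * f 1 p \<phi>) + 2 * (f 1 p \<phi> * c12 M f 2 p))) * g 2 p u"
    if p: "p \<in> U" and u: "smooth_near M p u" for p u
    apply (simp add: commute[OF p u] commute[OF p n[OF p]] g f_rules[OF p] near_rules[OF p] smooth_near_add smooth_near_mult n[OF p] E[OF p] u
        del: mult_cancel_left mult_cancel_right)
    by (simp add: algebra_simps)
  have b3: "g 2 p (\<lambda>q. g 0 q u) - g 0 p (\<lambda>q. g 2 q u)
      = (E p * E p * (c20 M f 1 p + 2 * f 2 p (\<lambda>q. f 2 q \<phi>)
        - 4 * (f 2 p \<phi> * f 2 p \<phi>) + 2 * (f 2 p \<phi> * c12 M f 1 p))) * g 1 p u
      + (E p * E p * (c20 M f 2 p + f 0 p \<phi> - 2 * f 2 p (\<lambda>q. f 1 q \<phi>)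
        + 4 * (f 1 p \<phi> * f 2 p \<phi>) + 2 * (f 2 p \<phi> * c12 M f 2 p))) * g 2 p u"
    if p: "p \<in> U" and u: "smooth_near M p u" for p u
    apply (simp add: commute[OF p u] commute[OF p n[OF p]] g f_rules[OF p] near_rules[OF p] smooth_near_add smooth_near_mult n[OF p] E[OF p] u
        del: mult_cancel_left mult_cancel_right)
    by (simp add: algebra_simps)
  note main = contact_frame_coefficients[OF sf b1 b2 b3]
  show "contact_frame M U g" by (rule main(1))
  show "p \<in> U \<Longrightarrow> c12 M g 1 p = E p * (c12 M f 1 p - 3 * f 2 p \<phi>)" by (rule main(2))
  show "p \<in> U \<Longrightarrow> c12 M g 2 p = E p * (c12 M f 2 p + 3 * f 1 p \<phi>)" by (rule main(3))
  show "p \<in> U \<Longrightarrow> c10 M g 1 p = E p * E p * (c10 M f 1 p + f 0 p \<phi> + 2 * f 1 p (\<lambda>q. f 2 q \<phi>)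
        - 4 * (f 1 p \<phi> * f 2 p \<phi>) + 2 * (f 1 p \<phi> * c12 M f 1 p))" by (rule main(4))
  show "p \<in> U \<Longrightarrow> c10 M g 2 p = E p * E p * (c10 M f 2 p - 2 * f 1 p (\<lambda>q. f 1 q \<phi>)
        + 4 * (f 1 p \<phi> * f 1 p \<phi>) + 2 * (f 1 p \<phi> * c12 M f 2 p))" by (rule main(5))
  show "p \<in> U \<Longrightarrow> c20 M g 1 p = E p * E p * (c20 M f 1 p + 2 * f 2 p (\<lambda>q. f 2 q \<phi>)
        - 4 * (f 2 p \<phi> * f 2 p \<phi>) + 2 * (f 2 p \<phi> * c12 M f 1 p))" by (rule main(6))
qed

end

section \<open>The covariant calculus of a contact frame\<close>

context contact_frame
begin

text \<open>Cut off outside \<open>U\<close>, the frame acts by derivations of the algebra of all functions, and the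
  commutation relations become equations between functions.\<close>

definition D :: "3 \<Rightarrow> ('a \<Rightarrow> real) \<Rightarrow> 'a \<Rightarrow> real" where "D i u = (\<lambda>p. if p \<in> U then f i p u else 0)"
definition x :: "'a \<Rightarrow> real" where "x = (\<lambda>p. if p \<in> U then c12 M f 1 p else 0)"
definition y :: "'a \<Rightarrow> real" where "y = (\<lambda>p. if p \<in> U then c12 M f 2 p else 0)"
definition a :: "'a \<Rightarrow> real" where "a = (\<lambda>p. if p \<in> U then c10 M f 1 p else 0)"
definition b :: "'a \<Rightarrow> real" where "b = (\<lambda>p. if p \<in> U then c10 M f 2 p else 0)"
definition d :: "'a \<Rightarrow> real" where "d = (\<lambda>p. if p \<in> U then c20 M f 1 p else 0)"

abbreviation sm :: "('a \<Rightarrow> real) \<Rightarrow> bool" where "sm \<equiv> smooth_fun M U"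

lemma sm_near: "p \<in> U \<Longrightarrow> sm u \<Longrightarrow> smooth_near M p u" using smooth_nearI U_open by blast

lemma D_cong: "(\<And>q. q \<in> U \<Longrightarrow> u q = v q) \<Longrightarrow> D i u = D i v"
  unfolding D_def by (intro ext if_cong refl tangent_local[OF F_tangent U_open]) assumption+

lemma sm_D [simp]: assumes "sm u" shows "sm (D i u)"
  using vector_field_smooth[OF F_field U_open order_refl assms, of i]
    smooth_fun_cong[OF U_open, of "\<lambda>p. f i p u" "D i u"] by (simp add: D_def)

lemma sm_coef [simp]: "sm x" "sm y" "sm a" "sm b" "sm d"
proof -
  have "sm (\<lambda>p. if p \<in> U then u p else 0)" if "sm u" for u
    using that smooth_fun_cong[OF U_open, of u "\<lambda>p. if p \<in> U then u p else 0"] by simp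
  then show "sm x" "sm y" "sm a" "sm b" "sm d"
    unfolding x_def y_def a_def b_def d_def using c_smooth by blast+
qed

lemmas sm_rules [simp] = smooth_fun_intros[OF U_open]

lemma D_simps:
  "D i (\<lambda>q. c) = (\<lambda>q. 0)"
  "sm u \<Longrightarrow> D i (\<lambda>q. - u q) = (\<lambda>q. - D i u q)"
  "sm u \<Longrightarrow> sm v \<Longrightarrow> D i (\<lambda>q. u q + v q) = (\<lambda>q. D i u q + D i v q)"
  "sm u \<Longrightarrow> sm v \<Longrightarrow> D i (\<lambda>q. u q - v q) = (\<lambda>q. D i u q - D i v q)"
  "sm u \<Longrightarrow> sm v \<Longrightarrow> D i (\<lambda>q. u q * v q) = (\<lambda>q. D i u q * v q + u q * D i v q)"
  unfolding D_def by (auto simp: f_rules sm_near)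

lemma f_D: "p \<in> U \<Longrightarrow> f i p u = D i u p" "D i (\<lambda>q. f j q u) = D i (D j u)"
  by (simp add: D_def) (rule D_cong, simp add: D_def)

lemma c_D:
  "p \<in> U \<Longrightarrow> c12 M f 1 p = x p" "p \<in> U \<Longrightarrow> c12 M f 2 p = y p" "p \<in> U \<Longrightarrow> c10 M f 1 p = a p"
  "p \<in> U \<Longrightarrow> c10 M f 2 p = b p" "p \<in> U \<Longrightarrow> c20 M f 1 p = d p" "p \<in> U \<Longrightarrow> c20 M f 2 p = - a p"
  "D i (c12 M f 1) = D i x" "D i (c12 M f 2) = D i y" "D i (c10 M f 1) = D i a"
  "D i (c10 M f 2) = D i b" "D i (c20 M f 1) = D i d" "D i (c20 M f 2) = D i (\<lambda>q. - a q)"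
  by (simp_all add: x_def y_def a_def b_def d_def jacobi(1)) (rule D_cong, simp add: x_def y_def a_def b_def d_def jacobi(1))+

lemma D_commute:
  assumes "sm u"
  shows "D 2 (D 1 u) = (\<lambda>q. D 1 (D 2 u) q + D 0 u q + x q * D 1 u q + y q * D 2 u q)"
    "D 0 (D 1 u) = (\<lambda>q. D 1 (D 0 u) q - a q * D 1 u q - b q * D 2 u q)"
    "D 0 (D 2 u) = (\<lambda>q. D 2 (D 0 u) q - d q * D 1 u q + a q * D 2 u q)"
proof -
  have "D 2 (D 1 u) p = D 1 (D 2 u) p + D 0 u p + x p * D 1 u p + y p * D 2 u p"
    "D 0 (D 1 u) p = D 1 (D 0 u) p - a p * D 1 u p - b p * D 2 u p"
    "D 0 (D 2 u) p = D 2 (D 0 u) p - d p * D 1 u p + a p * D 2 u p" for p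
  proof -
    show "D 2 (D 1 u) p = D 1 (D 2 u) p + D 0 u p + x p * D 1 u p + y p * D 2 u p"
    proof (cases "p \<in> U")
      case True then show ?thesis
        using commute(1)[OF True sm_near[OF True assms]] by (simp only: f_D c_D)
    qed (simp add: D_def)
    show "D 0 (D 1 u) p = D 1 (D 0 u) p - a p * D 1 u p - b p * D 2 u p"
    proof (cases "p \<in> U")
      case True then show ?thesis
        using commute(2)[OF True sm_near[OF True assms]] by (simp only: f_D c_D)
    qed (simp add: D_def)
    show "D 0 (D 2 u) p = D 2 (D 0 u) p - d p * D 1 u p + a p * D 2 u p"
    proof (cases "p \<in> U")
      case True then show ?thesis
        using commute(3)[OF True sm_near[OF True assms]] by (simp only: f_D c_D)
    qed (simp add: D_def)
  qed
  then show "D 2 (D 1 u) = (\<lambda>q. D 1 (D 2 u) q + D 0 u q + x q * D 1 u q + y q * D 2 u q)"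
    "D 0 (D 1 u) = (\<lambda>q. D 1 (D 0 u) q - a q * D 1 u q - b q * D 2 u q)"
    "D 0 (D 2 u) = (\<lambda>q. D 2 (D 0 u) q - d q * D 1 u q + a q * D 2 u q)"
    by (auto intro!: ext)
qed

lemma D_jacobi:
  "D 0 x = (\<lambda>q. x q * a q + y q * d q - D 2 a q + D 1 d q)"
  "D 0 y = (\<lambda>q. x q * b q - y q * a q - D 2 b q - D 1 a q)"
proof -
  have "D 0 x p = x p * a p + y p * d p - D 2 a p + D 1 d p \<and>
      D 0 y p = x p * b p - y p * a p - D 2 b p - D 1 a p" for p
  proof (cases "p \<in> U")
    case True then show ?thesis
      using jacobi(2,3)[OF True] by (simp add: f_D c_D D_simps)
  qed (simp add: D_def x_def y_def)
  then show "D 0 x = (\<lambda>q. x q * a q + y q * d q - D 2 a q + D 1 d q)"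
    "D 0 y = (\<lambda>q. x q * b q - y q * a q - D 2 b q - D 1 a q)" by auto
qed

definition smC :: "('a \<Rightarrow> complex) set" where "smC = {u. sm (\<lambda>p. Re (u p)) \<and> sm (\<lambda>p. Im (u p))}"
definition Z :: "('a \<Rightarrow> complex) \<Rightarrow> 'a \<Rightarrow> complex" where
  "Z u = (\<lambda>p. Complex (D 1 (\<lambda>q. Re (u q)) p + D 2 (\<lambda>q. Im (u q)) p) (D 1 (\<lambda>q. Im (u q)) p - D 2 (\<lambda>q. Re (u q)) p))"
definition Zb :: "('a \<Rightarrow> complex) \<Rightarrow> 'a \<Rightarrow> complex" where
  "Zb u = (\<lambda>p. Complex (D 1 (\<lambda>q. Re (u q)) p - D 2 (\<lambda>q. Im (u q)) p) (D 1 (\<lambda>q. Im (u q)) p + D 2 (\<lambda>q. Re (u q)) p))"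
definition T :: "('a \<Rightarrow> complex) \<Rightarrow> 'a \<Rightarrow> complex" where
  "T u = (\<lambda>p. Complex (- 2 * D 0 (\<lambda>q. Im (u q)) p) (2 * D 0 (\<lambda>q. Re (u q)) p))"
definition w :: "'a \<Rightarrow> complex" where "w = (\<lambda>p. Complex (- y p) (x p))"
definition wb :: "'a \<Rightarrow> complex" where "wb = (\<lambda>p. Complex (y p) (x p))"
definition B :: "'a \<Rightarrow> complex" where "B = (\<lambda>p. Complex (b p + d p) (2 * a p))"
definition \<kappa> :: "'a \<Rightarrow> complex" where "\<kappa> = (\<lambda>p. Complex (b p - d p) 0)"

lemmas op_defs = Z_def Zb_def T_def w_def wb_def B_def \<kappa>_def smC_def

text \<open>The axiom \<open>T_wb\<close> is a complex combination of the two identities \<open>D_jacobi\<close>.\<close>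

lemma calculus: "contact_calculus smC Z Zb T w wb B \<kappa>"
proof
  show "T wb = Z \<kappa> - Zb B + w * B + \<kappa> * wb"
    by (rule ext) (simp add: op_defs complex_eq_iff D_simps D_jacobi algebra_simps)
  show "Z (Zb u) = Zb (Z u) - T u - w * Z u - wb * Zb u" if "u \<in> smC" for u
    using that by (intro ext) (simp add: op_defs complex_eq_iff D_simps D_commute algebra_simps)
  show "Z (T u) = T (Z u) - \<kappa> * Z u + B * Zb u" if "u \<in> smC" for u
    using that by (intro ext) (simp add: op_defs complex_eq_iff D_simps D_commute algebra_simps)
qed (simp_all add: op_defs complex_eq_iff fun_eq_iff D_simps algebra_simps)

text \<open>The two polynomials are the real and imaginary parts of one complex expression. This is seen by
  bringing both sides to a normal form, in which derivatives stand in the order \<open>f\<^sub>1, f\<^sub>2, f\<^sub>0\<close> and the derivatives of \<open>x\<close> and \<open>y\<close> along \<open>f\<^sub>0\<close> have been eliminated by the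
  Jacobi identity.\<close>

lemma cartan_eq:
  assumes p: "p \<in> U"
  shows "contact_calculus.cartan Z Zb T w wb B \<kappa> p = Complex (- 24 * fef_alpha M f p) (24 * fef_beta M f p)"
proof -
  interpret contact_calculus smC Z Zb T w wb B \<kappa> by (rule calculus)
  have rho: "\<rho> = (\<lambda>p. Complex (2 * (D 1 y p - D 2 x p + x p * x p + y p * y p) - b p + d p) 0)"
    unfolding \<rho>_def by (rule ext) (simp add: op_defs complex_eq_iff D_simps algebra_simps)
  have "Re (cartan p) = - 24 * fef_alpha M f p"
    unfolding cartan_def P_def N_def R_def rho fef_alpha_def Let_def power2_eq_square
    apply (simp only: f_D c_D p)
    apply (simp add: D_simps D_commute D_jacobi op_defs)
    by (simp add: field_simps)
  moreover have "Im (cartan p) = 24 * fef_beta M f p"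
    unfolding cartan_def P_def N_def R_def rho fef_beta_def Let_def power2_eq_square
    apply (simp only: f_D c_D p)
    apply (simp add: D_simps D_commute D_jacobi op_defs)
    by (simp add: field_simps)
  ultimately show ?thesis by (simp add: complex_eq_iff)
qed

end

section \<open>Rescaling and rotating the frame\<close>

context contact_frame
begin

lemma rescaled_invariants:
  assumes \<phi>: "sm \<phi>" and p: "p \<in> U"
  shows "fef_alpha M (rescale_frame \<phi> f) p = exp (- 4 * \<phi> p) * fef_alpha M f p"
    "fef_beta M (rescale_frame \<phi> f) p = exp (- 4 * \<phi> p) * fef_beta M f p"
proof -
  define h where "h = rescale_frame \<phi> f"
  define \<epsilon> where "\<epsilon> = (\<lambda>p. exp (- \<phi> p))"
  note r = rescaled[OF \<phi>, folded h_def \<epsilon>_def]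
  interpret h: contact_frame M U h by (rule r(1))
  have E2: "exp (- (2 * \<phi> p)) = \<epsilon> p * \<epsilon> p" for p by (simp add: \<epsilon>_def mult_exp_exp)
  have hf: "h 0 p u = \<epsilon> p * \<epsilon> p * (f 0 p u + 2 * (f 2 p \<phi> * f 1 p u) - 2 * (f 1 p \<phi> * f 2 p u))"
    "h 1 p u = \<epsilon> p * f 1 p u" "h 2 p u = \<epsilon> p * f 2 p u" for p u
    by (simp_all add: h_def rescale_frame_def E2 mult.assoc) (simp_all add: \<epsilon>_def)
  have hD: "h.D 0 u = (\<lambda>p. \<epsilon> p * \<epsilon> p * (D 0 u p + 2 * (D 2 \<phi> p * D 1 u p) - 2 * (D 1 \<phi> p * D 2 u p)))"
    "h.D 1 u = (\<lambda>p. \<epsilon> p * D 1 u p)" "h.D 2 u = (\<lambda>p. \<epsilon> p * D 2 u p)" for u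
    by (simp_all add: h.D_def D_def hf fun_eq_iff)
  have hc: "h.x = (\<lambda>p. \<epsilon> p * (x p - 3 * D 2 \<phi> p))" "h.y = (\<lambda>p. \<epsilon> p * (y p + 3 * D 1 \<phi> p))"
    "h.a = (\<lambda>p. \<epsilon> p * \<epsilon> p * (a p + D 0 \<phi> p + 2 * D 1 (D 2 \<phi>) p - 4 * (D 1 \<phi> p * D 2 \<phi> p) + 2 * (D 1 \<phi> p * x p)))"
    "h.b = (\<lambda>p. \<epsilon> p * \<epsilon> p * (b p - 2 * D 1 (D 1 \<phi>) p + 4 * (D 1 \<phi> p * D 1 \<phi> p) + 2 * (D 1 \<phi> p * y p)))"
    "h.d = (\<lambda>p. \<epsilon> p * \<epsilon> p * (d p + 2 * D 2 (D 2 \<phi>) p - 4 * (D 2 \<phi> p * D 2 \<phi> p) + 2 * (D 2 \<phi> p * x p)))"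
  proof -
    have z: "p \<notin> U \<Longrightarrow> D i u p = 0" "p \<notin> U \<Longrightarrow> x p = 0" "p \<notin> U \<Longrightarrow> y p = 0" "p \<notin> U \<Longrightarrow> a p = 0"
        "p \<notin> U \<Longrightarrow> b p = 0" "p \<notin> U \<Longrightarrow> d p = 0" for i u p
      by (simp_all add: D_def x_def y_def a_def b_def d_def)
    have e: "p \<in> U \<Longrightarrow> c12 M h 1 p = \<epsilon> p * (x p - 3 * D 2 \<phi> p)"
      "p \<in> U \<Longrightarrow> c12 M h 2 p = \<epsilon> p * (y p + 3 * D 1 \<phi> p)"
      "p \<in> U \<Longrightarrow> c10 M h 1 p = \<epsilon> p * \<epsilon> p * (a p + D 0 \<phi> p + 2 * D 1 (D 2 \<phi>) p - 4 * (D 1 \<phi> p * D 2 \<phi> p) + 2 * (D 1 \<phi> p * x p))"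
      "p \<in> U \<Longrightarrow> c10 M h 2 p = \<epsilon> p * \<epsilon> p * (b p - 2 * D 1 (D 1 \<phi>) p + 4 * (D 1 \<phi> p * D 1 \<phi> p) + 2 * (D 1 \<phi> p * y p))"
      "p \<in> U \<Longrightarrow> c20 M h 1 p = \<epsilon> p * \<epsilon> p * (d p + 2 * D 2 (D 2 \<phi>) p - 4 * (D 2 \<phi> p * D 2 \<phi> p) + 2 * (D 2 \<phi> p * x p))" for p
      by (simp_all only: r(2-6) f_D c_D \<epsilon>_def)
    show "h.x = (\<lambda>p. \<epsilon> p * (x p - 3 * D 2 \<phi> p))" "h.y = (\<lambda>p. \<epsilon> p * (y p + 3 * D 1 \<phi> p))"
    "h.a = (\<lambda>p. \<epsilon> p * \<epsilon> p * (a p + D 0 \<phi> p + 2 * D 1 (D 2 \<phi>) p - 4 * (D 1 \<phi> p * D 2 \<phi> p) + 2 * (D 1 \<phi> p * x p)))"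
    "h.b = (\<lambda>p. \<epsilon> p * \<epsilon> p * (b p - 2 * D 1 (D 1 \<phi>) p + 4 * (D 1 \<phi> p * D 1 \<phi> p) + 2 * (D 1 \<phi> p * y p)))"
    "h.d = (\<lambda>p. \<epsilon> p * \<epsilon> p * (d p + 2 * D 2 (D 2 \<phi>) p - 4 * (D 2 \<phi> p * D 2 \<phi> p) + 2 * (D 2 \<phi> p * x p)))"
      by (auto simp: h.x_def h.y_def h.a_def h.b_def h.d_def e z)
  qed
  have s\<epsilon>: "sm \<epsilon>" unfolding \<epsilon>_def using \<phi> by simp
  have D\<epsilon>: "D i \<epsilon> = (\<lambda>p. - (\<epsilon> p * D i \<phi> p))" for i
  proof
    fix p
    show "D i \<epsilon> p = - (\<epsilon> p * D i \<phi> p)"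
    proof (cases "p \<in> U")
      case True
      have n: "smooth_near M p \<phi>" by (rule sm_near[OF True \<phi>])
      have "f i p (\<lambda>q. exp (- \<phi> q)) = exp (- \<phi> p) * f i p (\<lambda>q. - \<phi> q)"
        by (rule f_exp(1)[OF True near_uminus[OF True n]])
      then show ?thesis using True f_rules(2)[OF True n, of i] by (simp add: D_def \<epsilon>_def)
    qed (simp add: D_def)
  qed
  have D0: "D i (\<lambda>q. 0) = (\<lambda>q. 0)" for i by (rule D_simps)
  have "contact_calculus.cartan h.Z h.Zb h.T h.w h.wb h.B h.\<kappa>
      = (\<lambda>p. Complex (\<epsilon> p) 0) ^ 4 * contact_calculus.cartan Z Zb T w wb B \<kappa>"
  proof (rule contact_calculus.cartan_rescale[OF calculus _ _ _ _ _ _ _ _ _ _ _ _ h.calculus, where f = "\<lambda>p. Complex (\<phi> p) 0"])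
    interpret contact_calculus smC Z Zb T w wb B \<kappa> by (rule calculus)
    show "(\<lambda>p. Complex (\<phi> p) 0) \<in> smC" "(\<lambda>p. Complex (\<epsilon> p) 0) \<in> smC"
      using \<phi> s\<epsilon> by (simp_all add: smC_def)
    show "Z (\<lambda>p. Complex (\<epsilon> p) 0) = - ((\<lambda>p. Complex (\<epsilon> p) 0) * Z (\<lambda>p. Complex (\<phi> p) 0))"
      "Zb (\<lambda>p. Complex (\<epsilon> p) 0) = - ((\<lambda>p. Complex (\<epsilon> p) 0) * Zb (\<lambda>p. Complex (\<phi> p) 0))"
      "T (\<lambda>p. Complex (\<epsilon> p) 0) = - ((\<lambda>p. Complex (\<epsilon> p) 0) * T (\<lambda>p. Complex (\<phi> p) 0))"
      by (simp_all add: op_defs fun_eq_iff complex_eq_iff D\<epsilon> D0)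
    show "h.Z u = (\<lambda>p. Complex (\<epsilon> p) 0) * Z u" "h.Zb u = (\<lambda>p. Complex (\<epsilon> p) 0) * Zb u" for u
      by (simp_all add: op_defs h.op_defs fun_eq_iff complex_eq_iff hD algebra_simps)
    show "h.T u = (\<lambda>p. Complex (\<epsilon> p) 0) * (\<lambda>p. Complex (\<epsilon> p) 0) *
         (T u + 2 * (Zb (\<lambda>p. Complex (\<phi> p) 0) * Z u) - 2 * (Z (\<lambda>p. Complex (\<phi> p) 0) * Zb u))" for u
      by (simp add: op_defs h.op_defs fun_eq_iff complex_eq_iff hD D0 algebra_simps)
    show "h.w = (\<lambda>p. Complex (\<epsilon> p) 0) * (w - 3 * Zb (\<lambda>p. Complex (\<phi> p) 0))"
      "h.wb = (\<lambda>p. Complex (\<epsilon> p) 0) * (wb + 3 * Z (\<lambda>p. Complex (\<phi> p) 0))"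
      by (simp_all add: op_defs h.op_defs fun_eq_iff complex_eq_iff hc D0 algebra_simps)
    show "h.B = (\<lambda>p. Complex (\<epsilon> p) 0) * (\<lambda>p. Complex (\<epsilon> p) 0) *
      (B - 2 * P 1 (Z (\<lambda>p. Complex (\<phi> p) 0)) + 4 * (Z (\<lambda>p. Complex (\<phi> p) 0) * Z (\<lambda>p. Complex (\<phi> p) 0)))"
      unfolding P_def using \<phi>
      by (simp add: op_defs h.op_defs fun_eq_iff complex_eq_iff hc D0 D_simps D_commute) (simp add: algebra_simps)
    show "h.\<kappa> = (\<lambda>p. Complex (\<epsilon> p) 0) * (\<lambda>p. Complex (\<epsilon> p) 0) *
      (\<kappa> - P (- 1) (Zb (\<lambda>p. Complex (\<phi> p) 0)) - N 1 (Z (\<lambda>p. Complex (\<phi> p) 0))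
        + 4 * (Z (\<lambda>p. Complex (\<phi> p) 0) * Zb (\<lambda>p. Complex (\<phi> p) 0))
        + 2 * (wb * Zb (\<lambda>p. Complex (\<phi> p) 0) - w * Z (\<lambda>p. Complex (\<phi> p) 0)))"
      unfolding P_def N_def using \<phi>
      by (simp add: op_defs h.op_defs fun_eq_iff complex_eq_iff hc D0 D_simps D_commute) (simp add: algebra_simps)
  qed
  from fun_cong[OF this, of p]
  have "Complex (- 24 * fef_alpha M h p) (24 * fef_beta M h p)
      = Complex (\<epsilon> p ^ 4) 0 * Complex (- 24 * fef_alpha M f p) (24 * fef_beta M f p)"
    by (simp add: cartan_eq[OF p] h.cartan_eq[OF p] power4_eq_xxxx complex_eq_iff)
  moreover have "\<epsilon> p ^ 4 = exp (- 4 * \<phi> p)" by (simp add: \<epsilon>_def exp_of_nat_mult[symmetric])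
  ultimately show "fef_alpha M (rescale_frame \<phi> f) p = exp (- 4 * \<phi> p) * fef_alpha M f p"
    "fef_beta M (rescale_frame \<phi> f) p = exp (- 4 * \<phi> p) * fef_beta M f p"
    by (simp_all add: complex_eq_iff h_def)
qed

lemma rotated_invariants:
  assumes C: "sm C" and S: "sm S" and CS: "\<And>p. p \<in> U \<Longrightarrow> C p * C p + S p * S p = 1" and p: "p \<in> U"
  shows "fef_alpha M (rotated C S) p = (C p * C p - S p * S p) * fef_alpha M f p + 2 * (C p * S p) * fef_beta M f p"
    "fef_beta M (rotated C S) p = (C p * C p - S p * S p) * fef_beta M f p - 2 * (C p * S p) * fef_alpha M f p"
proof -
  define h where "h = rotated C S"
  note r = rotated[OF C S CS, folded h_def]
  interpret h: contact_frame M U h by (rule r(1))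
  \<comment> \<open>outside \<open>U\<close> the rotation is replaced by the identity, to have a unit of the function ring\<close>
  define c where "c = (\<lambda>p. if p \<in> U then C p else 1)"
  define s where "s = (\<lambda>p. if p \<in> U then S p else 0)"
  have cs: "sm c" "sm s"
    using C S smooth_fun_cong[OF U_open, of C c] smooth_fun_cong[OF U_open, of S s] by (simp_all add: c_def s_def)
  have c1: "c p * c p + s p * s p = 1" for p using CS by (simp add: c_def s_def)
  have DC: "D i C = D i c" "D i S = D i s" for i by (rule D_cong, simp add: c_def s_def)+
  have z: "p \<notin> U \<Longrightarrow> D i u p = 0" for i u p by (simp add: D_def)
  have hD: "h.D 0 u = D 0 u" "h.D 1 u = (\<lambda>p. c p * D 1 u p + s p * D 2 u p)"
    "h.D 2 u = (\<lambda>p. - s p * D 1 u p + c p * D 2 u p)" for u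
    unfolding h.D_def D_def by (auto simp: h_def rotated_def c_def s_def)
  have e: "(if p \<in> U then c12 M h 1 p else 0) = c p * x p + s p * y p
        + c p * (c p * D 1 s p - s p * D 1 c p) + s p * (c p * D 2 s p - s p * D 2 c p)"
    "(if p \<in> U then c12 M h 2 p else 0) = c p * y p - s p * x p
        + c p * (c p * D 2 s p - s p * D 2 c p) - s p * (c p * D 1 s p - s p * D 1 c p)"
    "(if p \<in> U then c10 M h 1 p else 0) = c p * (c p * a p + s p * d p - D 0 c p) + s p * (c p * b p + s p * - a p - D 0 s p)"
    "(if p \<in> U then c10 M h 2 p else 0) = c p * (c p * b p + s p * - a p - D 0 s p) - s p * (c p * a p + s p * d p - D 0 c p)"
    "(if p \<in> U then c20 M h 1 p else 0) = c p * (c p * d p - s p * a p + D 0 s p) + s p * (c p * - a p - s p * b p - D 0 c p)" for p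
  proof -
    have "c p = C p" "s p = S p" if "p \<in> U" using that by (simp_all add: c_def s_def)
    then show "(if p \<in> U then c12 M h 1 p else 0) = c p * x p + s p * y p
        + c p * (c p * D 1 s p - s p * D 1 c p) + s p * (c p * D 2 s p - s p * D 2 c p)"
    "(if p \<in> U then c12 M h 2 p else 0) = c p * y p - s p * x p
        + c p * (c p * D 2 s p - s p * D 2 c p) - s p * (c p * D 1 s p - s p * D 1 c p)"
    "(if p \<in> U then c10 M h 1 p else 0) = c p * (c p * a p + s p * d p - D 0 c p) + s p * (c p * b p + s p * - a p - D 0 s p)"
    "(if p \<in> U then c10 M h 2 p else 0) = c p * (c p * b p + s p * - a p - D 0 s p) - s p * (c p * a p + s p * d p - D 0 c p)"
    "(if p \<in> U then c20 M h 1 p else 0) = c p * (c p * d p - s p * a p + D 0 s p) + s p * (c p * - a p - s p * b p - D 0 c p)"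
      by (cases "p \<in> U"; simp only: r(2-6) f_D c_D if_True DC; simp add: z x_def y_def a_def b_def d_def)+
  qed
  have hc: "h.x = (\<lambda>p. c p * x p + s p * y p
        + c p * (c p * D 1 s p - s p * D 1 c p) + s p * (c p * D 2 s p - s p * D 2 c p))"
    "h.y = (\<lambda>p. c p * y p - s p * x p
        + c p * (c p * D 2 s p - s p * D 2 c p) - s p * (c p * D 1 s p - s p * D 1 c p))"
    "h.a = (\<lambda>p. c p * (c p * a p + s p * d p - D 0 c p) + s p * (c p * b p + s p * - a p - D 0 s p))"
    "h.b = (\<lambda>p. c p * (c p * b p + s p * - a p - D 0 s p) - s p * (c p * a p + s p * d p - D 0 c p))"
    "h.d = (\<lambda>p. c p * (c p * d p - s p * a p + D 0 s p) + s p * (c p * - a p - s p * b p - D 0 c p))"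
    unfolding h.x_def h.y_def h.a_def h.b_def h.d_def by (intro ext e)+
  have Dcs: "c p * D i c p + s p * D i s p = 0" for i p
  proof -
    have "D i (\<lambda>p. c p * c p + s p * s p) = (\<lambda>p. 0)" unfolding c1 by (rule D_simps)
    from fun_cong[OF this, of p] show ?thesis using cs by (simp add: D_simps algebra_simps)
  qed
  let ?e = "\<lambda>p. Complex (c p) (s p)" and ?eb = "\<lambda>p. Complex (c p) (- s p)"
  have "contact_calculus.cartan h.Z h.Zb h.T h.w h.wb h.B h.\<kappa> = ?e ^ 2 * contact_calculus.cartan Z Zb T w wb B \<kappa>"
  proof (rule contact_calculus.cartan_rotate[OF calculus _ _ _ _ _ _ _ _ _ _ h.calculus, where eb = ?eb])
    show "?e \<in> smC" "?eb \<in> smC" using cs by (simp_all add: smC_def)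
    show "?e * ?eb = 1" using c1 by (simp add: fun_eq_iff complex_eq_iff)
    show "h.Z u = ?e * Z u" "h.Zb u = ?eb * Zb u" "h.T u = T u" for u
      by (simp_all add: op_defs h.op_defs fun_eq_iff complex_eq_iff hD algebra_simps)
    show "h.w = ?eb * (w + ?eb * Zb ?e)"
    proof
      fix q
      note facts = c1[of q] Dcs[of q 0] Dcs[of q 1] Dcs[of q 2]
      show "h.w q = (?eb * (w + ?eb * Zb ?e)) q"
        by (simp add: op_defs h.op_defs hc complex_eq_iff; (intro conjI)?; insert facts; algebra)
    qed
    show "h.wb = ?e * (wb + ?eb * Z ?e)"
    proof
      fix q
      note facts = c1[of q] Dcs[of q 0] Dcs[of q 1] Dcs[of q 2]
      show "h.wb q = (?e * (wb + ?eb * Z ?e)) q"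
        by (simp add: op_defs h.op_defs hc complex_eq_iff; (intro conjI)?; insert facts; algebra)
    qed
    show "h.B = ?e * ?e * B"
    proof
      fix q
      note facts = c1[of q] Dcs[of q 0] Dcs[of q 1] Dcs[of q 2]
      show "h.B q = (?e * ?e * B) q"
        using facts by (simp add: op_defs h.op_defs hc complex_eq_iff) (intro conjI; simp add: algebra_simps; algebra)
    qed
    show "h.\<kappa> = \<kappa> + ?eb * T ?e"
    proof
      fix q
      note facts = c1[of q] Dcs[of q 0] Dcs[of q 1] Dcs[of q 2]
      show "h.\<kappa> q = (\<kappa> + ?eb * T ?e) q"
        by (simp add: op_defs h.op_defs hc complex_eq_iff; (intro conjI)?; insert facts; algebra)
    qed
  qed
  from fun_cong[OF this, of p]
  have "Complex (- 24 * fef_alpha M h p) (24 * fef_beta M h p)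
      = Complex (C p) (S p) ^ 2 * Complex (- 24 * fef_alpha M f p) (24 * fef_beta M f p)"
    using p by (simp add: cartan_eq[OF p] h.cartan_eq[OF p] power2_eq_square complex_eq_iff c_def s_def)
  then show "fef_alpha M (rotated C S) p = (C p * C p - S p * S p) * fef_alpha M f p + 2 * (C p * S p) * fef_beta M f p"
    "fef_beta M (rotated C S) p = (C p * C p - S p * S p) * fef_beta M f p - 2 * (C p * S p) * fef_alpha M f p"
    by (simp_all add: complex_eq_iff h_def power2_eq_square algebra_simps)
qed

end

section \<open>Adapted frames\<close>

lemma smooth_form_bilinear:
  assumes "smooth_form_on M \<Delta> b" "p \<in> topspace (mtop M)" "v \<in> \<Delta> p" "w \<in> \<Delta> p" "z \<in> \<Delta> p"
  shows "b p (lincomb s v t w) z = s * b p v z + t * b p w z" "b p z (lincomb s v t w) = s * b p z v + t * b p z w"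
  using assms(1)[unfolded smooth_form_on_def, THEN conjunct1, THEN bspec, OF assms(2), THEN bspec, OF assms(3),
      THEN bspec, OF assms(4), THEN bspec, OF assms(5), THEN spec[of _ s], THEN spec[of _ t]]
  by (rule conjunct1, rule conjunct2)

text \<open>An orthonormal oriented basis determines the metric and the area form of the plane it spans.\<close>

lemma adapted_forms:
  assumes cs: "contact_sub_Riemannian M \<Delta> g \<mu>" and ad: "adapted_frame M \<Delta> g \<mu> U f" and p: "p \<in> U"
  shows "\<mu> p (lincomb s (f 1 p) t (f 2 p)) (lincomb s' (f 1 p) t' (f 2 p)) = s * t' - t * s'"
    "g p (lincomb s (f 1 p) t (f 2 p)) (lincomb s' (f 1 p) t' (f 2 p)) = s * s' + t * t'"
proof -
  have eg: "euclidean_metric M \<Delta> g" and am: "area_form M \<Delta> g \<mu>"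
    using cs by (simp_all add: contact_sub_Riemannian_def)
  have U: "openin (mtop M) U" and on: "oriented_orthonormal_frame M \<Delta> g \<mu> U (f 1) (f 2)"
    using ad unfolding adapted_frame_def by blast+
  have pT: "p \<in> topspace (mtop M)" using U p openin_subset by blast
  have D: "f 1 p \<in> \<Delta> p" "f 2 p \<in> \<Delta> p"
    and o: "g p (f 1 p) (f 1 p) = 1" "g p (f 2 p) (f 2 p) = 1" "g p (f 1 p) (f 2 p) = 0" "\<mu> p (f 1 p) (f 2 p) = 1"
    using on p by (simp_all add: oriented_orthonormal_frame_def section_on_def)
  have L: "lincomb s (f 1 p) t (f 2 p) \<in> \<Delta> p" for s t
    using adapted_contact_frame(2)[OF cs ad p] by blast
  have sf: "smooth_form_on M \<Delta> \<mu>" "smooth_form_on M \<Delta> g"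
    using am eg unfolding area_form_def euclidean_metric_def by (blast, blast)
  have alt: "\<mu> p v w = - \<mu> p w v" if "v \<in> \<Delta> p" "w \<in> \<Delta> p" for v w
    using am[unfolded area_form_def, THEN conjunct2, THEN bspec, OF pT, THEN bspec, OF that(1), THEN bspec, OF that(2)]
    by (rule conjunct1)
  have sym: "g p v w = g p w v" if "v \<in> \<Delta> p" "w \<in> \<Delta> p" for v w
    using eg[unfolded euclidean_metric_def, THEN conjunct2, THEN bspec, OF pT, THEN bspec, OF that(1), THEN bspec, OF that(2)]
    by (rule conjunct1)
  note bl = smooth_form_bilinear[OF sf(1) pT D] smooth_form_bilinear[OF sf(2) pT D]
  have "\<mu> p (f 1 p) (f 1 p) = 0" "\<mu> p (f 2 p) (f 2 p) = 0" "\<mu> p (f 2 p) (f 1 p) = - 1"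
    using alt[OF D(1) D(1)] alt[OF D(2) D(2)] alt[OF D(2) D(1)] o(4) by simp_all
  then show "\<mu> p (lincomb s (f 1 p) t (f 2 p)) (lincomb s' (f 1 p) t' (f 2 p)) = s * t' - t * s'"
    by (simp add: bl(1)[OF L] bl(2)[OF D(1)] bl(2)[OF D(2)] o(4))
  show "g p (lincomb s (f 1 p) t (f 2 p)) (lincomb s' (f 1 p) t' (f 2 p)) = s * s' + t * t'"
    by (simp add: bl(3)[OF L] bl(4)[OF D(1)] bl(4)[OF D(2)] o(1-3) sym[OF D(2) D(1)])
qed

context contact_frame
begin

text \<open>The structure equation of the contact form: its derivative is the area form of the coframe, with
  no term containing the component along \<open>f 0\<close>.\<close>

lemma ext_deriv_coframe:
  assumes V: "openin (mtop M) V" "V \<subseteq> U" "p \<in> V" and X: "vector_field M V X" and Y: "vector_field M V Y"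
  shows "ext_deriv M (\<lambda>p v. coframe f p v $ 0) X Y p =
    coframe f p (X p) $ 1 * coframe f p (Y p) $ 2 - coframe f p (X p) $ 2 * coframe f p (Y p) $ 1"
proof -
  have p: "p \<in> U" using V by blast
  define \<xi> where "\<xi> = (\<lambda>i p. coframe f p (X p) $ i)"
  define \<eta> where "\<eta> = (\<lambda>i p. coframe f p (Y p) $ i)"
  have s: "smooth_fun M V (\<xi> i)" "smooth_fun M V (\<eta> i)" for i
    unfolding \<xi>_def \<eta>_def using coframe_smooth[OF V(1,2) X] coframe_smooth[OF V(1,2) Y] by auto
  have n: "smooth_near M p (\<xi> i)" "smooth_near M p (\<eta> i)" for i
    using smooth_nearI[OF s(1) V(1,3)] smooth_nearI[OF s(2) V(1,3)] by auto
  have XY: "X q u = \<xi> 0 q * f 0 q u + \<xi> 1 q * f 1 q u + \<xi> 2 q * f 2 q u"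
    "Y q u = \<eta> 0 q * f 0 q u + \<eta> 1 q * f 1 q u + \<eta> 2 q * f 2 q u" if "q \<in> V" for q u
    using coframe_expand[OF _ vector_field_tangent[OF X that], of u] coframe_expand[OF _ vector_field_tangent[OF Y that], of u]
      that V(2) by (auto simp: sum_3' \<xi>_def \<eta>_def)
  have Xt: "X p \<in> tangent_space M p" "Y p \<in> tangent_space M p"
    using vector_field_tangent[OF X V(3)] vector_field_tangent[OF Y V(3)] by auto
  define k where "k = (\<lambda>j. X p (\<eta> j) - Y p (\<xi> j))"
  have "coframe f p (lie M X Y p) = vec3 (k 0 + (\<xi> 2 p * \<eta> 1 p - \<xi> 1 p * \<eta> 2 p))
    (k 1 + (\<xi> 2 p * \<eta> 1 p - \<xi> 1 p * \<eta> 2 p) * c12 M f 1 p + (\<xi> 1 p * \<eta> 0 p - \<xi> 0 p * \<eta> 1 p) * c10 M f 1 p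
      + (\<xi> 2 p * \<eta> 0 p - \<xi> 0 p * \<eta> 2 p) * c20 M f 1 p)
    (k 2 + (\<xi> 2 p * \<eta> 1 p - \<xi> 1 p * \<eta> 2 p) * c12 M f 2 p + (\<xi> 1 p * \<eta> 0 p - \<xi> 0 p * \<eta> 1 p) * c10 M f 2 p
      + (\<xi> 2 p * \<eta> 0 p - \<xi> 0 p * \<eta> 2 p) * c20 M f 2 p)"
  proof (rule coframe_eqI[OF p])
    fix u assume u: "smooth_near M p u"
    have 1: "X p (\<lambda>q. Y q u) = X p (\<lambda>q. \<eta> 0 q * f 0 q u + \<eta> 1 q * f 1 q u + \<eta> 2 q * f 2 q u)"
      by (rule tangent_local[OF Xt(1) V(1,3)]) (rule XY(2))
    have 2: "Y p (\<lambda>q. X q u) = Y p (\<lambda>q. \<xi> 0 q * f 0 q u + \<xi> 1 q * f 1 q u + \<xi> 2 q * f 2 q u)"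
      by (rule tangent_local[OF Xt(2) V(1,3)]) (rule XY(1))
    note r = tangent_add[OF Xt(1)] tangent_add[OF Xt(2)] tangent_mult[OF Xt(1)] tangent_mult[OF Xt(2)]
      smooth_near_add smooth_near_mult n f_near[OF p u]
    show "lie M X Y p u = (\<Sum>i\<in>UNIV. vec3 (k 0 + (\<xi> 2 p * \<eta> 1 p - \<xi> 1 p * \<eta> 2 p))
      (k 1 + (\<xi> 2 p * \<eta> 1 p - \<xi> 1 p * \<eta> 2 p) * c12 M f 1 p + (\<xi> 1 p * \<eta> 0 p - \<xi> 0 p * \<eta> 1 p) * c10 M f 1 p
        + (\<xi> 2 p * \<eta> 0 p - \<xi> 0 p * \<eta> 2 p) * c20 M f 1 p)
      (k 2 + (\<xi> 2 p * \<eta> 1 p - \<xi> 1 p * \<eta> 2 p) * c12 M f 2 p + (\<xi> 1 p * \<eta> 0 p - \<xi> 0 p * \<eta> 1 p) * c10 M f 2 p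
        + (\<xi> 2 p * \<eta> 0 p - \<xi> 0 p * \<eta> 2 p) * c20 M f 2 p) $ i * f i p u)"
      using u by (simp add: lie_def 1 2 r sum_3' k_def)
        (simp add: XY[OF V(3), of "\<lambda>q. f _ q u"] commute[OF p u] algebra_simps)
  qed (simp add: lie_def)
  then show ?thesis unfolding ext_deriv_def by (simp add: k_def \<xi>_def \<eta>_def)
qed

text \<open>Conversely to the lemma \<open>adapted_contact_frame\<close>, the contact form of an adapted frame can be recovered as the
  coframe component \<open>0\<close>.\<close>

lemma adapted_frameI:
  assumes \<Delta>: "\<And>p. p \<in> U \<Longrightarrow> \<Delta> p = {lincomb s (f 1 p) t (f 2 p) |s t. True}"
    and g: "\<And>p. p \<in> U \<Longrightarrow> g p (f 1 p) (f 1 p) = 1 \<and> g p (f 2 p) (f 2 p) = 1 \<and> g p (f 1 p) (f 2 p) = 0"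
    and \<mu>: "\<And>p s t s' t'. p \<in> U \<Longrightarrow>
      \<mu> p (lincomb s (f 1 p) t (f 2 p)) (lincomb s' (f 1 p) t' (f 2 p)) = s * t' - t * s'"
  shows "adapted_frame M \<Delta> g \<mu> U f"
proof -
  define \<omega> where "\<omega> = (\<lambda>p v. coframe f p v $ 0)"
  have cf: "coframe f p (lincomb s (f 1 p) t (f 2 p)) = vec3 0 s t" if "p \<in> U" for p s t
    by (rule coframe_eqI[OF that]) (simp_all add: lincomb_def sum_3' tangent_not_smooth[OF F_tangent[OF that]])
  have f12: "f 1 p = lincomb 1 (f 1 p) 0 (f 2 p)" "f 2 p = lincomb 0 (f 1 p) 1 (f 2 p)" for p
    by (simp_all add: lincomb_def)
  have \<mu>12: "\<mu> p (f 1 p) (f 2 p) = 1" if "p \<in> U" for p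
    using \<mu>[OF that, of 1 0 0 1] unfolding f12[symmetric] by simp
  have sec: "section_on M \<Delta> U (f 1)" "section_on M \<Delta> U (f 2)"
    unfolding section_on_def using F_field \<Delta> f12 by blast+
  have \<Delta>': "v = lincomb (coframe f p v $ 1) (f 1 p) (coframe f p v $ 2) (f 2 p)" if p: "p \<in> U" and v: "v \<in> \<Delta> p" for p v
  proof -
    obtain s t where "v = lincomb s (f 1 p) t (f 2 p)" using v unfolding \<Delta>[OF p] by blast
    then show ?thesis using cf[OF p] by simp
  qed
  have ker: "\<Delta> p = {v \<in> tangent_space M p. \<omega> p v = 0}" if p: "p \<in> U" for p
  proof (intro equalityI subsetI)
    fix v assume v: "v \<in> \<Delta> p"
    then obtain s t where "v = lincomb s (f 1 p) t (f 2 p)" using p \<Delta> by blast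
    then show "v \<in> {v \<in> tangent_space M p. \<omega> p v = 0}"
      using tangent_lincomb[OF F_tangent[OF p] F_tangent[OF p]] cf[OF p] by (simp add: \<omega>_def)
  next
    fix v assume "v \<in> {v \<in> tangent_space M p. \<omega> p v = 0}"
    then have v: "v \<in> tangent_space M p" "coframe f p v $ 0 = 0" by (simp_all add: \<omega>_def)
    have "v = lincomb (coframe f p v $ 1) (f 1 p) (coframe f p v $ 2) (f 2 p)"
      using coframe_expand[OF p v(1)] v(2) by (simp add: lincomb_def sum_3' fun_eq_iff)
    then show "v \<in> \<Delta> p" unfolding \<Delta>[OF p] by blast
  qed
  have lin: "\<omega> p (lincomb s v t w) = s * \<omega> p v + t * \<omega> p w"
    if "p \<in> U" "v \<in> tangent_space M p" "w \<in> tangent_space M p" for p v w s t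
    using coframe_lincomb[OF that, of s t] by (simp add: \<omega>_def lincomb_def)
  have one: "one_form M U \<omega>"
    unfolding one_form_def using lin coframe_smooth by (auto simp: \<omega>_def)
  have ncf: "normalized_contact_form M \<Delta> \<mu> U \<omega>"
    unfolding normalized_contact_form_def
  proof (intro conjI one ballI allI impI; (elim conjE)?)
    show "\<Delta> p = {v \<in> tangent_space M p. \<omega> p v = 0}" if "p \<in> U" for p by (rule ker[OF that])
    fix V X Y p assume V: "openin (mtop M) V" "V \<subseteq> U" "section_on M \<Delta> V X" "section_on M \<Delta> V Y" "p \<in> V"
    then have p: "p \<in> U" and XY: "vector_field M V X" "vector_field M V Y" "X p \<in> \<Delta> p" "Y p \<in> \<Delta> p"
      by (auto simp: section_on_def)
    show "ext_deriv M \<omega> X Y p = \<mu> p (X p) (Y p)"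
      unfolding \<omega>_def ext_deriv_coframe[OF V(1,2,5) XY(1,2)]
      by (subst (3) \<Delta>'[OF p XY(3)], subst (3) \<Delta>'[OF p XY(4)]) (simp only: \<mu>[OF p])
  qed
  have rb: "Reeb_field M U \<omega> (f 0)"
    unfolding Reeb_field_def
  proof (intro conjI ballI allI impI F_field; (elim conjE)?)
    show "\<omega> p (f 0 p) = 1" if "p \<in> U" for p using coframe_F[OF that] by (simp add: \<omega>_def axis_def)
    fix V X p assume V: "openin (mtop M) V" "V \<subseteq> U" "vector_field M V X" "p \<in> V"
    then have p: "p \<in> U" by blast
    show "ext_deriv M \<omega> (f 0) X p = 0"
      unfolding \<omega>_def ext_deriv_coframe[OF V(1,2,4) vector_field_subset[OF F_field V(2)] V(3)]
      by (simp add: coframe_F[OF p] axis_def)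
  qed
  show ?thesis
    unfolding adapted_frame_def oriented_orthonormal_frame_def using U_open sec g \<mu>12 ncf rb by blast
qed

text \<open>The Reeb field is determined by the other two fields of the frame: a correction in \<open>\<Delta>\<close> would
  be seen in the \<open>f 0\<close>-component of the brackets.\<close>

lemma reeb_unique:
  assumes G0: "vector_field M U (G 0)" and G: "\<And>p. p \<in> U \<Longrightarrow> G 1 p = f 1 p" "\<And>p. p \<in> U \<Longrightarrow> G 2 p = f 2 p"
    and b: "\<And>p u. p \<in> U \<Longrightarrow> smooth_near M p u \<Longrightarrow>
        G 2 p (\<lambda>q. G 1 q u) - G 1 p (\<lambda>q. G 2 q u) = G 0 p u + X p * G 1 p u + Y p * G 2 p u"
      "\<And>p u. p \<in> U \<Longrightarrow> smooth_near M p u \<Longrightarrow>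
        G 1 p (\<lambda>q. G 0 q u) - G 0 p (\<lambda>q. G 1 q u) = a1 p * G 1 p u + a2 p * G 2 p u"
      "\<And>p u. p \<in> U \<Longrightarrow> smooth_near M p u \<Longrightarrow>
        G 2 p (\<lambda>q. G 0 q u) - G 0 p (\<lambda>q. G 2 q u) = b1 p * G 1 p u + b2 p * G 2 p u"
    and p: "p \<in> U"
  shows "G (0::3) p = f 0 p"
proof -
  define s where "s = (\<lambda>p. coframe f p (G 0 p) $ 1)"
  define t where "t = (\<lambda>p. coframe f p (G 0 p) $ 2)"
  have G0t: "G 0 p \<in> tangent_space M p" if "p \<in> U" for p by (rule vector_field_tangent[OF G0 that])
  have Gl: "v (\<lambda>q. G 1 q u) = v (\<lambda>q. f 1 q u)" "v (\<lambda>q. G 2 q u) = v (\<lambda>q. f 2 q u)"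
    if "p \<in> U" "v \<in> tangent_space M p" for p v u
    using tangent_local[OF that(2) U_open that(1), of "\<lambda>q. G 1 q u" "\<lambda>q. f 1 q u"]
      tangent_local[OF that(2) U_open that(1), of "\<lambda>q. G 2 q u" "\<lambda>q. f 2 q u"] G by auto
  have ex: "G 0 p u = f 0 p u + s p * f 1 p u + t p * f 2 p u" if q: "p \<in> U" for p u
  proof -
    have "coframe f p (G 0 p) = vec3 1 (c12 M f 1 p - X p) (c12 M f 2 p - Y p)"
    proof (rule coframe_eqI[OF q])
      fix u assume u: "smooth_near M p u"
      show "G 0 p u = (\<Sum>i\<in>UNIV. vec3 1 (c12 M f 1 p - X p) (c12 M f 2 p - Y p) $ i * f i p u)"
        using b(1)[OF q u] commute(1)[OF q u]
        by (simp add: G[OF q] Gl[OF q F_tangent[OF q]] sum_3' algebra_simps)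
    qed (rule tangent_not_smooth[OF G0t[OF q]])
    then show ?thesis using coframe_expand[OF q G0t[OF q], of u] by (simp add: sum_3' s_def t_def)
  qed
  have sm: "smooth_fun M U s" "smooth_fun M U t"
    unfolding s_def t_def by (rule coframe_smooth[OF U_open order_refl G0])+
  have n: "smooth_near M p s" "smooth_near M p t" using sm smooth_nearI U_open p by blast+
  have l0: "f i p (\<lambda>q. G 0 q u) = f i p (\<lambda>q. f 0 q u + s q * f 1 q u + t q * f 2 q u)" for i u
    by (rule tangent_local[OF F_tangent[OF p] U_open p]) (rule ex)
  have "vec3 (- t p) (c10 M f 1 p - t p * c12 M f 1 p + f 1 p s - a1 p) (c10 M f 2 p - t p * c12 M f 2 p + f 1 p t - a2 p) = 0"
  proof (rule F_indep[OF p])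
    fix u assume u: "smooth_near M p u"
    show "(\<Sum>i\<in>UNIV. vec3 (- t p) (c10 M f 1 p - t p * c12 M f 1 p + f 1 p s - a1 p)
        (c10 M f 2 p - t p * c12 M f 2 p + f 1 p t - a2 p) $ i * f i p u) = 0"
      using b(2)[OF p u] commute[OF p u]
      by (simp add: G[OF p] Gl[OF p G0t[OF p]] ex[OF p] l0 f_rules[OF p] near_rules[OF p] n u smooth_near_add smooth_near_mult sum_3')
        (simp add: algebra_simps)
  qed
  then have "vec3 (- t p) (c10 M f 1 p - t p * c12 M f 1 p + f 1 p s - a1 p) (c10 M f 2 p - t p * c12 M f 2 p + f 1 p t - a2 p) $ 0 = 0"
    by simp
  then have t0: "t p = 0" by simp
  have "vec3 (s p) (c20 M f 1 p + s p * c12 M f 1 p + f 2 p s - b1 p) (c20 M f 2 p + s p * c12 M f 2 p + f 2 p t - b2 p) = 0"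
  proof (rule F_indep[OF p])
    fix u assume u: "smooth_near M p u"
    show "(\<Sum>i\<in>UNIV. vec3 (s p) (c20 M f 1 p + s p * c12 M f 1 p + f 2 p s - b1 p)
        (c20 M f 2 p + s p * c12 M f 2 p + f 2 p t - b2 p) $ i * f i p u) = 0"
      using b(3)[OF p u] commute[OF p u]
      by (simp add: G[OF p] Gl[OF p G0t[OF p]] ex[OF p] l0 f_rules[OF p] near_rules[OF p] n u smooth_near_add smooth_near_mult sum_3')
        (simp add: algebra_simps)
  qed
  then have "vec3 (s p) (c20 M f 1 p + s p * c12 M f 1 p + f 2 p s - b1 p) (c20 M f 2 p + s p * c12 M f 2 p + f 2 p t - b2 p) $ 0 = 0"
    by simp
  then have "s p = 0" by simp
  with t0 show ?thesis using ex[OF p] by (simp add: fun_eq_iff)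
qed

end

text \<open>The invariants are universal expressions in iterated derivatives of structure coefficients along
  the frame, and all of these correspond under \<open>\<Psi>\<close>.\<close>

lemma invariants_natural:
  assumes f: "contact_frame M U f" and k: "contact_frame M' U' k" and \<Psi>: "\<And>p. p \<in> U \<Longrightarrow> \<Psi> p \<in> U'"
    and near: "\<And>p u. p \<in> U \<Longrightarrow> smooth_near M' (\<Psi> p) u \<longleftrightarrow> smooth_near M p (u \<circ> \<Psi>)"
    and kf: "\<And>i p u. p \<in> U \<Longrightarrow> k i (\<Psi> p) u = f i p (u \<circ> \<Psi>)" and p: "p \<in> U"
  shows "fef_alpha M' k (\<Psi> p) = fef_alpha M f p" "fef_beta M' k (\<Psi> p) = fef_beta M f p"
proof -
  interpret f: contact_frame M U f by (rule f)
  interpret k: contact_frame M' U' k by (rule k)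
  define rel where "rel = (\<lambda>u' u. \<forall>q\<in>U. u' (\<Psi> q) = (u q :: real))"
  have relD: "rel (\<lambda>q'. k i q' u') (\<lambda>q. f i q u)" if "rel u' u" for i u' u
    unfolding rel_def
  proof
    fix q assume q: "q \<in> U"
    have "f i q (u' \<circ> \<Psi>) = f i q u"
      by (rule f.tangent_local[OF f.F_tangent[OF q] f.U_open q]) (use that in \<open>simp add: rel_def\<close>)
    then show "k i (\<Psi> q) u' = f i q u" using kf[OF q] by simp
  qed
  have at: "u' (\<Psi> q) = u q" if "rel u' u" "q \<in> U" for u' u q using that by (simp add: rel_def)
  have lie: "lie M' (k i) (k j) (\<Psi> q) u' = lie M (f i) (f j) q (u' \<circ> \<Psi>)" if q: "q \<in> U" for i j q u'
  proof -
    have "rel u' (u' \<circ> \<Psi>)" by (simp add: rel_def)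
    then show ?thesis using at[OF relD[OF relD] q] near[OF q] by (simp add: lie_def)
  qed
  have cof: "coframe k (\<Psi> q) (lie M' (k i) (k j) (\<Psi> q)) = coframe f q (lie M (f i) (f j) q)" if q: "q \<in> U" for i j q
  proof (rule k.coframe_eqI[OF \<Psi>[OF q]])
    fix u'
    show "lie M' (k i) (k j) (\<Psi> q) u' = (\<Sum>m\<in>UNIV. coframe f q (lie M (f i) (f j) q) $ m * k m (\<Psi> q) u')"
      using f.coframe_expand[OF q f.lie_tangent[OF q]] by (simp add: lie[OF q] kf[OF q])
  qed (simp add: lie_def)
  have c: "rel (c12 M' k m) (c12 M f m)" "rel (c10 M' k m) (c10 M f m)" "rel (c20 M' k m) (c20 M f m)" for m
    by (simp_all add: rel_def c12_def c10_def c20_def cof)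
  note r0 = c[THEN at, OF p]
  note r1 = c[THEN relD, THEN at, OF p]
  note r2 = c[THEN relD, THEN relD, THEN at, OF p]
  note r3 = c[THEN relD, THEN relD, THEN relD, THEN at, OF p]
  show "fef_alpha M' k (\<Psi> p) = fef_alpha M f p" "fef_beta M' k (\<Psi> p) = fef_beta M f p"
    unfolding fef_alpha_def fef_beta_def Let_def r0 r1 r2 r3 by (rule refl)+
qed

lemma rescaled_adapted:
  assumes cs: "contact_sub_Riemannian M \<Delta> g \<mu>" and ad: "adapted_frame M \<Delta> g \<mu> U f" and \<phi>: "smooth_fun M U \<phi>"
  shows "adapted_frame M \<Delta> (rescale_form \<phi> g) (rescale_form \<phi> \<mu>) U (rescale_frame \<phi> f)"
proof -
  interpret f: contact_frame M U f by (rule adapted_contact_frame(1)[OF cs ad])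
  interpret h: contact_frame M U "rescale_frame \<phi> f" by (rule f.rescaled(1)[OF \<phi>])
  let ?h = "rescale_frame \<phi> f"
  have h: "?h 1 p = lincomb (exp (- \<phi> p)) (f 1 p) 0 (f 2 p)" "?h 2 p = lincomb 0 (f 1 p) (exp (- \<phi> p)) (f 2 p)" for p
    by (simp_all add: rescale_frame_def lincomb_def)
  have hl: "lincomb s (?h 1 p) t (?h 2 p) = lincomb (s * exp (- \<phi> p)) (f 1 p) (t * exp (- \<phi> p)) (f 2 p)" for s t p
    by (simp add: h lincomb_def mult.assoc)
  have e: "exp (2 * \<phi> p) * (exp (- \<phi> p) * exp (- \<phi> p)) = 1" for p
    by (simp add: exp_add[symmetric])
  show ?thesis
  proof (rule h.adapted_frameI)
    fix p assume p: "p \<in> U"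
    show "\<Delta> p = {lincomb s (?h 1 p) t (?h 2 p) |s t. True}"
      unfolding adapted_contact_frame(2)[OF cs ad p] hl
    proof (intro equalityI subsetI; clarify)
      fix a b
      show "\<exists>s t. lincomb a (f 1 p) b (f 2 p) = lincomb (s * exp (- \<phi> p)) (f 1 p) (t * exp (- \<phi> p)) (f 2 p) \<and> True"
        by (rule exI[of _ "a * exp (\<phi> p)"], rule exI[of _ "b * exp (\<phi> p)"]) (simp add: mult.assoc exp_add[symmetric])
    next
      fix s t
      show "\<exists>a b. lincomb (s * exp (- \<phi> p)) (f 1 p) (t * exp (- \<phi> p)) (f 2 p) = lincomb a (f 1 p) b (f 2 p) \<and> True"
        by blast
    qed
    show "rescale_form \<phi> g p (?h 1 p) (?h 1 p) = 1 \<and> rescale_form \<phi> g p (?h 2 p) (?h 2 p) = 1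
        \<and> rescale_form \<phi> g p (?h 1 p) (?h 2 p) = 0"
      unfolding rescale_form_def h adapted_forms(2)[OF cs ad p] using e by simp
    fix s t s' t'
    show "rescale_form \<phi> \<mu> p (lincomb s (?h 1 p) t (?h 2 p)) (lincomb s' (?h 1 p) t' (?h 2 p)) = s * t' - t * s'"
      unfolding rescale_form_def hl adapted_forms(1)[OF cs ad p]
      using e[of p] by algebra
  qed
qed

text \<open>The pushed-forward frame \<open>k\<close>, rescaled by \<open>\<phi>\<close> on the target, is an oriented orthonormal frame of the
  target structure. It therefore differs from \<open>f'\<close> by a rotation: for \<open>k 1\<close> and \<open>k 2\<close> because both frames are
  orthonormal and oriented, for \<open>k 0\<close> because the Reeb field is determined by them. The angle of the
  rotation at the given point is \<open>t\<close>, and the invariants change by twice this angle.\<close>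

lemma conformal_covariance:
  assumes cs: "contact_sub_Riemannian M \<Delta> g \<mu>" and ad: "adapted_frame M \<Delta> g \<mu> U f"
    and cs': "contact_sub_Riemannian M' \<Delta>' g' \<mu>'" and ad': "adapted_frame M' \<Delta>' g' \<mu>' U' f'"
    and ce: "conformal_equivalence M \<Delta> g \<mu> U M' \<Delta>' g' \<mu>' U' \<Psi> \<phi>" and q: "q \<in> U"
    and t: "pushforward \<Psi> (f 1 q) = lincomb (exp (\<phi> q) * cos t) (f' 1 (\<Psi> q)) (exp (\<phi> q) * sin t) (f' 2 (\<Psi> q))"
  shows "cos (2 * t) * fef_alpha M' f' (\<Psi> q) + sin (2 * t) * fef_beta M' f' (\<Psi> q) = exp (- 4 * \<phi> q) * fef_alpha M f q"
    "cos (2 * t) * fef_beta M' f' (\<Psi> q) - sin (2 * t) * fef_alpha M' f' (\<Psi> q) = exp (- 4 * \<phi> q) * fef_beta M f q"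
proof -
  interpret f: contact_frame M U f by (rule adapted_contact_frame(1)[OF cs ad])
  interpret f': contact_frame M' U' f' by (rule adapted_contact_frame(1)[OF cs' ad'])
  have hm: "homeomorphic_map (subtopology (mtop M) U) (subtopology (mtop M') U') \<Psi>"
    and sf: "\<And>W u. openin (mtop M') W \<Longrightarrow> W \<subseteq> U' \<Longrightarrow> smooth_fun M' W u \<longleftrightarrow> smooth_fun M {p \<in> U. \<Psi> p \<in> W} (u \<circ> \<Psi>)"
    and \<phi>: "smooth_fun M U \<phi>"
    and push: "\<And>p. p \<in> U \<Longrightarrow> \<Delta>' (\<Psi> p) = pushforward \<Psi> ` \<Delta> p"
    and metr: "\<And>p v w. p \<in> U \<Longrightarrow> v \<in> \<Delta> p \<Longrightarrow> w \<in> \<Delta> p \<Longrightarrow>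
      g' (\<Psi> p) (pushforward \<Psi> v) (pushforward \<Psi> w) = exp (2 * \<phi> p) * g p v w"
    and area: "\<And>p v w. p \<in> U \<Longrightarrow> v \<in> \<Delta> p \<Longrightarrow> w \<in> \<Delta> p \<Longrightarrow>
      \<mu>' (\<Psi> p) (pushforward \<Psi> v) (pushforward \<Psi> w) = exp (2 * \<phi> p) * \<mu> p v w"
    using ce unfolding conformal_equivalence_def diffeomorphism_def by blast+
  have tU: "topspace (subtopology (mtop M) U) = U" "topspace (subtopology (mtop M') U') = U'"
    using openin_subset[OF f.U_open] openin_subset[OF f'.U_open] by auto
  have img: "\<Psi> ` U = U'" and inj: "inj_on \<Psi> U"
    using homeomorphic_imp_surjective_map[OF hm] homeomorphic_imp_injective_map[OF hm] tU by auto
  have \<Psi>U: "\<Psi> p \<in> U'" if "p \<in> U" for p using img that by blast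
  define \<Phi> where "\<Phi> = inv_into U \<Psi>"
  have \<Phi>: "\<Phi> (\<Psi> p) = p" if "p \<in> U" for p unfolding \<Phi>_def using inj that by simp
  have \<Phi>': "\<Psi> (\<Phi> p') = p'" "\<Phi> p' \<in> U" if "p' \<in> U'" for p'
    unfolding \<Phi>_def using img that by (auto simp: f_inv_into_f inv_into_into)
  have pre: "openin (mtop M) {p \<in> U. \<Psi> p \<in> W}" if "openin (mtop M') W" "W \<subseteq> U'" for W
  proof -
    have "openin (subtopology (mtop M') U') W" using that f'.U_open by (simp add: openin_open_subtopology)
    then have "openin (subtopology (mtop M) U) {p \<in> topspace (subtopology (mtop M) U). \<Psi> p \<in> W}"
      using homeomorphic_imp_continuous_map[OF hm] by (simp only: continuous_map_def)
    then show ?thesis unfolding tU using f.U_open by (simp add: openin_open_subtopology)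
  qed
  have opn: "openin (mtop M') (\<Psi> ` W)" if "openin (mtop M) W" "W \<subseteq> U" for W
  proof -
    have "openin (subtopology (mtop M) U) W" using that f.U_open by (simp add: openin_open_subtopology)
    then have "openin (subtopology (mtop M') U') (\<Psi> ` W)"
      using homeomorphic_imp_open_map[OF hm] by (simp add: open_map_def)
    then show ?thesis using f'.U_open by (simp add: openin_open_subtopology)
  qed
  have near: "smooth_near M' (\<Psi> p) u \<longleftrightarrow> smooth_near M p (u \<circ> \<Psi>)" if p: "p \<in> U" for p u
  proof
    assume "smooth_near M' (\<Psi> p) u"
    then obtain W where W: "openin (mtop M') W" "\<Psi> p \<in> W" "W \<subseteq> U'" "smooth_fun M' W u"
      using f'.smooth_near_within[OF _ f'.U_open \<Psi>U[OF p]] by blast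
    show "smooth_near M p (u \<circ> \<Psi>)"
      by (rule f.smooth_nearI[OF _ pre[OF W(1,3)]]) (use W sf[OF W(1,3)] p in auto)
  next
    assume "smooth_near M p (u \<circ> \<Psi>)"
    then obtain W where W: "openin (mtop M) W" "p \<in> W" "W \<subseteq> U" "smooth_fun M W (u \<circ> \<Psi>)"
      using f.smooth_near_within[OF _ f.U_open p] by blast
    have "{p \<in> U. \<Psi> p \<in> \<Psi> ` W} = W" using W(3) inj by (auto simp: inj_on_def)
    moreover have "\<Psi> ` W \<subseteq> U'" using W(3) img by blast
    ultimately have "smooth_fun M' (\<Psi> ` W) u" using sf[OF opn[OF W(1,3)]] W(4) by simp
    then show "smooth_near M' (\<Psi> p) u" using f'.smooth_nearI[OF _ opn[OF W(1,3)]] W(2) by blast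
  qed
  define k where "k = (\<lambda>i p' u. f i (\<Phi> p') (u \<circ> \<Psi>))"
  have k\<Psi>: "k i (\<Psi> p) u = f i p (u \<circ> \<Psi>)" if "p \<in> U" for i p u by (simp add: k_def \<Phi>[OF that])
  have k\<Psi>': "k i (\<Psi> p) = pushforward \<Psi> (f i p)" if "p \<in> U" for i p
    by (simp add: k\<Psi>[OF that] pushforward_def fun_eq_iff)
  have ksm: "smooth_fun M' W (\<lambda>p'. k i p' u)" if W: "openin (mtop M') W" "W \<subseteq> U'" "smooth_fun M' W u" for i W u
  proof -
    have "smooth_fun M {p \<in> U. \<Psi> p \<in> W} (\<lambda>p. f i p (u \<circ> \<Psi>))"
      by (rule f.vector_field_smooth[OF f.F_field pre[OF W(1,2)]]) (use sf[OF W(1,2)] W(3) in auto)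
    then have "smooth_fun M {p \<in> U. \<Psi> p \<in> W} ((\<lambda>p'. k i p' u) \<circ> \<Psi>)"
      using f.smooth_fun_cong[OF pre[OF W(1,2)], of "\<lambda>p. f i p (u \<circ> \<Psi>)" "(\<lambda>p'. k i p' u) \<circ> \<Psi>"] k\<Psi> by simp
    then show ?thesis using sf[OF W(1,2)] by simp
  qed
  have \<Delta>t: "v \<in> tangent_space M' p'" if p': "p' \<in> U'" and v: "v \<in> \<Delta>' p'" for p' v
  proof -
    obtain a b where "v = lincomb a (f' 1 p') b (f' 2 p')"
      using v unfolding adapted_contact_frame(2)[OF cs' ad' p'] by blast
    then show ?thesis using f'.tangent_lincomb f'.F_tangent[OF p'] by blast
  qed
  have f\<Delta>: "f 1 p \<in> \<Delta> p" "f 2 p \<in> \<Delta> p" if "p \<in> U" for p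
    using ad that unfolding adapted_frame_def oriented_orthonormal_frame_def section_on_def by auto
  have on: "g p (f 1 p) (f 1 p) = 1" "g p (f 1 p) (f 2 p) = 0" "\<mu> p (f 1 p) (f 2 p) = 1" if "p \<in> U" for p
    using ad that unfolding adapted_frame_def oriented_orthonormal_frame_def by auto
  have k\<Delta>: "k 1 p' \<in> \<Delta>' p'" "k 2 p' \<in> \<Delta>' p'" if "p' \<in> U'" for p'
    using push[OF \<Phi>'(2)[OF that]] f\<Delta>[OF \<Phi>'(2)[OF that]] k\<Psi>'[OF \<Phi>'(2)[OF that]] by (simp_all add: \<Phi>'(1)[OF that])
  have kv12: "vector_field M' U' (k 1)" "vector_field M' U' (k 2)"
    by (rule f'.vector_fieldI; use \<Delta>t k\<Delta> ksm in blast)+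
  have sec: "section_on M' \<Delta>' U' (k 1)" "section_on M' \<Delta>' U' (f' 1)" "section_on M' \<Delta>' U' (f' 2)"
    using kv12 k\<Delta> ad' unfolding section_on_def adapted_frame_def oriented_orthonormal_frame_def by auto
  define \<phi>' where "\<phi>' = \<phi> \<circ> \<Phi>"
  have \<phi>': "smooth_fun M' U' \<phi>'"
  proof -
    have "{p \<in> U. \<Psi> p \<in> U'} = U" using \<Psi>U by auto
    moreover have "smooth_fun M U (\<phi>' \<circ> \<Psi>)"
      using \<phi> f.smooth_fun_cong[OF f.U_open, of \<phi> "\<phi>' \<circ> \<Psi>"] \<Phi> by (simp add: \<phi>'_def)
    ultimately show ?thesis using sf[OF f'.U_open order_refl] by simp
  qed
  have sg: "smooth_form_on M' \<Delta>' g'"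
    using cs' unfolding contact_sub_Riemannian_def euclidean_metric_def by blast
  define C where "C = (\<lambda>p'. exp (- \<phi>' p') * g' p' (k 1 p') (f' 1 p'))"
  define S where "S = (\<lambda>p'. exp (- \<phi>' p') * g' p' (k 1 p') (f' 2 p'))"
  have gs: "smooth_fun M' U' (\<lambda>p'. g' p' (k 1 p') (f' 1 p'))" "smooth_fun M' U' (\<lambda>p'. g' p' (k 1 p') (f' 2 p'))"
    using sg[unfolded smooth_form_on_def, THEN conjunct2, rule_format, of U' "k 1"] sec f'.U_open by auto
  have CSs: "smooth_fun M' U' C" "smooth_fun M' U' S"
    unfolding C_def S_def
    by (intro f'.smooth_fun_mult f'.smooth_fun_exp f'.smooth_fun_uminus f'.U_open \<phi>' gs)+
  have ee: "exp (\<phi>' p') * exp (- \<phi>' p') = 1" "exp (\<phi>' p') * (exp (- \<phi>' p') * z) = z" for p' z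
    by (simp_all add: exp_minus)
  have k1: "k 1 p' = lincomb (exp (\<phi>' p') * C p') (f' 1 p') (exp (\<phi>' p') * S p') (f' 2 p')" if "p' \<in> U'" for p'
    using adapted_contact_frame(3)[OF cs' ad' that k\<Delta>(1)[OF that]] by (simp add: C_def S_def ee)
  note forms = adapted_forms[OF cs' ad']
  have CS: "C p' * C p' + S p' * S p' = 1" and k2: "k 2 p' = lincomb (- (exp (\<phi>' p') * S p')) (f' 1 p') (exp (\<phi>' p') * C p') (f' 2 p')"
    if p': "p' \<in> U'" for p'
  proof -
    define p where "p = \<Phi> p'"
    have p: "p \<in> U" "\<Psi> p = p'" using \<Phi>'[OF p'] by (simp_all add: p_def)
    have \<phi>p: "\<phi> p = \<phi>' p'" by (simp add: \<phi>'_def p_def)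
    define E where "E = exp (\<phi>' p')"
    have E: "E > 0" "exp (2 * \<phi>' p') = E * E" by (simp_all add: E_def exp_double power2_eq_square)
    obtain a b where ab: "k 2 p' = lincomb a (f' 1 p') b (f' 2 p')"
      using k\<Delta>(2)[OF p'] unfolding adapted_contact_frame(2)[OF cs' ad' p'] by blast
    have "g' p' (k 1 p') (k 1 p') = E * E"
      using metr[OF p(1) f\<Delta>(1)[OF p(1)] f\<Delta>(1)[OF p(1)]] on[OF p(1)] k\<Psi>'[OF p(1)] p(2) \<phi>p E by simp
    then have "E * E * (C p' * C p' + S p' * S p') = E * E * 1"
      unfolding k1[OF p'] forms(2)[OF p'] by (simp add: E_def algebra_simps)
    then show cs1: "C p' * C p' + S p' * S p' = 1" using E(1) by simp
    have "g' p' (k 1 p') (k 2 p') = 0"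
      using metr[OF p(1) f\<Delta>(1)[OF p(1)] f\<Delta>(2)[OF p(1)]] on[OF p(1)] k\<Psi>'[OF p(1)] p(2) by simp
    then have "E * (C p' * a + S p' * b) = 0"
      unfolding k1[OF p'] ab forms(2)[OF p'] by (simp add: E_def algebra_simps)
    then have 1: "C p' * a + S p' * b = 0" using E(1) by simp
    have "\<mu>' p' (k 1 p') (k 2 p') = E * E"
      using area[OF p(1) f\<Delta>(1)[OF p(1)] f\<Delta>(2)[OF p(1)]] on[OF p(1)] k\<Psi>'[OF p(1)] p(2) \<phi>p E by simp
    then have "E * (C p' * b - S p' * a) = E * E"
      unfolding k1[OF p'] ab forms(1)[OF p'] by (simp add: E_def algebra_simps)
    then have 2: "C p' * b - S p' * a = E" using E(1) by simp
    have "a = - (E * S p')" "b = E * C p'" using 1 2 cs1 by algebra+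
    then show "k 2 p' = lincomb (- (exp (\<phi>' p') * S p')) (f' 1 p') (exp (\<phi>' p') * C p') (f' 2 p')"
      using ab by (simp add: E_def)
  qed
  interpret h: contact_frame M' U' "f'.rotated C S" by (rule f'.rotated(1)[OF CSs CS])
  have n\<phi>': "smooth_fun M' U' (\<lambda>p'. - \<phi>' p')" by (rule f'.smooth_fun_uminus[OF f'.U_open \<phi>'])
  define l where "l = rescale_frame (\<lambda>p'. - \<phi>' p') (f'.rotated C S)"
  interpret l: contact_frame M' U' l unfolding l_def by (rule h.rescaled(1)[OF n\<phi>'])
  have kl: "k 1 p' = l 1 p'" "k 2 p' = l 2 p'" if "p' \<in> U'" for p'
    unfolding k1[OF that] k2[OF that]
    by (simp_all add: l_def rescale_frame_def f'.rotated_def lincomb_def fun_eq_iff algebra_simps)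
  have kk: "k i (\<Psi> p) (\<lambda>r'. k j r' u) = f i p (\<lambda>r. f j r (u \<circ> \<Psi>))" if "p \<in> U" for i j p u
    unfolding k\<Psi>[OF that]
    by (rule f.tangent_local[OF f.F_tangent[OF that] f.U_open that]) (simp add: k\<Psi>)
  have br: "k 2 p' (\<lambda>q. k 1 q u) - k 1 p' (\<lambda>q. k 2 q u) = k 0 p' u + c12 M f 1 (\<Phi> p') * k 1 p' u + c12 M f 2 (\<Phi> p') * k 2 p' u"
    "k 1 p' (\<lambda>q. k 0 q u) - k 0 p' (\<lambda>q. k 1 q u) = c10 M f 1 (\<Phi> p') * k 1 p' u + c10 M f 2 (\<Phi> p') * k 2 p' u"
    "k 2 p' (\<lambda>q. k 0 q u) - k 0 p' (\<lambda>q. k 2 q u) = c20 M f 1 (\<Phi> p') * k 1 p' u + c20 M f 2 (\<Phi> p') * k 2 p' u"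
    if p': "p' \<in> U'" and u: "smooth_near M' p' u" for p' u
  proof -
    define p where "p = \<Phi> p'"
    have p: "p \<in> U" "\<Psi> p = p'" using \<Phi>'[OF p'] by (simp_all add: p_def)
    have u': "smooth_near M p (u \<circ> \<Psi>)" using near[OF p(1)] u p(2) by simp
    note cm = f.commute[OF p(1) u'] kk[OF p(1), unfolded p(2)] k\<Psi>[OF p(1), unfolded p(2)]
    show "k 2 p' (\<lambda>q. k 1 q u) - k 1 p' (\<lambda>q. k 2 q u) = k 0 p' u + c12 M f 1 (\<Phi> p') * k 1 p' u + c12 M f 2 (\<Phi> p') * k 2 p' u"
      "k 1 p' (\<lambda>q. k 0 q u) - k 0 p' (\<lambda>q. k 1 q u) = c10 M f 1 (\<Phi> p') * k 1 p' u + c10 M f 2 (\<Phi> p') * k 2 p' u"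
      "k 2 p' (\<lambda>q. k 0 q u) - k 0 p' (\<lambda>q. k 2 q u) = c20 M f 1 (\<Phi> p') * k 1 p' u + c20 M f 2 (\<Phi> p') * k 2 p' u"
      unfolding p_def[symmetric] cm by simp_all
  qed
  have kv0: "vector_field M' U' (k 0)"
  proof -
    have cs: "smooth_fun M' U' (\<lambda>p'. c12 M f m (\<Phi> p'))" for m
    proof -
      have "{p \<in> U. \<Psi> p \<in> U'} = U" using \<Psi>U by auto
      moreover have "smooth_fun M U ((\<lambda>p'. c12 M f m (\<Phi> p')) \<circ> \<Psi>)"
        using f.c_smooth(1) f.smooth_fun_cong[OF f.U_open, of "c12 M f m" "(\<lambda>p'. c12 M f m (\<Phi> p')) \<circ> \<Psi>"] \<Phi> by simp
      ultimately show ?thesis using sf[OF f'.U_open order_refl] by simp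
    qed
    have c1: "smooth_fun M' U' (\<lambda>_. c)" for c by (rule f'.smooth_fun_const[OF f'.U_open])
    have v: "vector_field M' U' (\<lambda>p' u. 1 * lie M' (k 2) (k 1) p' u
        + (- 1) * (c12 M f 1 (\<Phi> p') * k 1 p' u + c12 M f 2 (\<Phi> p') * k 2 p' u))"
      by (rule f'.vector_field_lincomb[OF f'.U_open f'.lie_vector_field[OF kv12(2,1) f'.U_open]
          f'.vector_field_lincomb[OF f'.U_open kv12 cs cs] c1 c1])
    show ?thesis
    proof (rule f'.vector_field_cong[OF f'.U_open _ v])
      fix p' assume p': "p' \<in> U'"
      show "(\<lambda>u. 1 * lie M' (k 2) (k 1) p' u + (- 1) * (c12 M f 1 (\<Phi> p') * k 1 p' u + c12 M f 2 (\<Phi> p') * k 2 p' u)) = k 0 p'"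
      proof
        fix u
        show "1 * lie M' (k 2) (k 1) p' u + (- 1) * (c12 M f 1 (\<Phi> p') * k 1 p' u + c12 M f 2 (\<Phi> p') * k 2 p' u) = k 0 p' u"
        proof (cases "smooth_near M' p' u")
          case True then show ?thesis using br(1)[OF p' True] by (simp add: lie_def)
        next
          case False
          have "\<not> smooth_near M (\<Phi> p') (u \<circ> \<Psi>)" using near[OF \<Phi>'(2)[OF p']] False \<Phi>'(1)[OF p'] by simp
          then have "k i p' u = 0" for i
            using f.tangent_not_smooth[OF f.F_tangent[OF \<Phi>'(2)[OF p']]] by (simp add: k_def)
          then show ?thesis using False by (simp add: lie_def)
        qed
      qed
    qed
  qed
  have k0: "k 0 p' = l 0 p'" if "p' \<in> U'" for p'
    by (rule l.reeb_unique[OF kv0 kl br that])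
  have lk: "l i (\<Psi> p) u = f i p (u \<circ> \<Psi>)" if p: "p \<in> U" for i p u
  proof -
    have "\<forall>i. l i (\<Psi> p) = k i (\<Psi> p)" unfolding forall_3' using k0 kl \<Psi>U[OF p] by simp
    then show ?thesis using k\<Psi>[OF p] by simp
  qed
  have nat: "fef_alpha M' l (\<Psi> q) = fef_alpha M f q" "fef_beta M' l (\<Psi> q) = fef_beta M f q"
    by (rule invariants_natural[OF f.contact_frame_axioms l.contact_frame_axioms \<Psi>U near lk q]; assumption)+
  have q': "\<Psi> q \<in> U'" by (rule \<Psi>U[OF q])
  have \<phi>q: "\<phi>' (\<Psi> q) = \<phi> q" by (simp add: \<phi>'_def \<Phi>[OF q])
  have "lincomb (exp (\<phi> q) * C (\<Psi> q)) (f' 1 (\<Psi> q)) (exp (\<phi> q) * S (\<Psi> q)) (f' 2 (\<Psi> q))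
      = lincomb (exp (\<phi> q) * cos t) (f' 1 (\<Psi> q)) (exp (\<phi> q) * sin t) (f' 2 (\<Psi> q))"
    using k1[OF q'] k\<Psi>'[OF q] t \<phi>q by simp
  moreover have "coframe f' (\<Psi> q) (lincomb a (f' 1 (\<Psi> q)) b (f' 2 (\<Psi> q))) = vec3 0 a b" for a b
    by (rule f'.coframe_eqI[OF q']) (simp_all add: lincomb_def sum_3' f'.tangent_not_smooth[OF f'.F_tangent[OF q']])
  ultimately have "vec3 0 (exp (\<phi> q) * C (\<Psi> q)) (exp (\<phi> q) * S (\<Psi> q)) = vec3 0 (exp (\<phi> q) * cos t) (exp (\<phi> q) * sin t)"
    by metis
  then have ct: "C (\<Psi> q) = cos t" "S (\<Psi> q) = sin t"
    using vec3_nth by (metis exp_not_eq_zero mult_cancel_left)+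
  have e4: "exp (- 4 * \<phi> q) * (exp (4 * \<phi> q) * z) = z" for z
    by (simp add: mult.assoc[symmetric] exp_add[symmetric])
  have rot: "fef_alpha M' (f'.rotated C S) (\<Psi> q) = (C (\<Psi> q) * C (\<Psi> q) - S (\<Psi> q) * S (\<Psi> q)) * fef_alpha M' f' (\<Psi> q)
        + 2 * (C (\<Psi> q) * S (\<Psi> q)) * fef_beta M' f' (\<Psi> q)"
    "fef_beta M' (f'.rotated C S) (\<Psi> q) = (C (\<Psi> q) * C (\<Psi> q) - S (\<Psi> q) * S (\<Psi> q)) * fef_beta M' f' (\<Psi> q)
        - 2 * (C (\<Psi> q) * S (\<Psi> q)) * fef_alpha M' f' (\<Psi> q)"
    by (rule f'.rotated_invariants[OF CSs _ q'], rule CS, assumption)+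
  have A: "fef_alpha M f q = exp (4 * \<phi> q) * (cos (2 * t) * fef_alpha M' f' (\<Psi> q) + sin (2 * t) * fef_beta M' f' (\<Psi> q))"
    "fef_beta M f q = exp (4 * \<phi> q) * (cos (2 * t) * fef_beta M' f' (\<Psi> q) - sin (2 * t) * fef_alpha M' f' (\<Psi> q))"
    unfolding nat[symmetric] l_def h.rescaled_invariants[OF n\<phi>' q'] \<phi>q
    unfolding rot ct cos_double sin_double power2_eq_square by (simp_all add: algebra_simps)
  show "cos (2 * t) * fef_alpha M' f' (\<Psi> q) + sin (2 * t) * fef_beta M' f' (\<Psi> q) = exp (- 4 * \<phi> q) * fef_alpha M f q"
    "cos (2 * t) * fef_beta M' f' (\<Psi> q) - sin (2 * t) * fef_alpha M' f' (\<Psi> q) = exp (- 4 * \<phi> q) * fef_beta M f q"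
    unfolding A e4 by simp_all
qed

section \<open>A contact structure with nonvanishing invariants\<close>

text \<open>Rotations are the freedom in the choice of an adapted frame of a given structure.\<close>

lemma rotated_adapted:
  assumes cs: "contact_sub_Riemannian M \<Delta> g \<mu>" and ad: "adapted_frame M \<Delta> g \<mu> U f"
    and C: "smooth_fun M U C" and S: "smooth_fun M U S" and CS: "\<And>p. p \<in> U \<Longrightarrow> C p * C p + S p * S p = 1"
  shows "adapted_frame M \<Delta> g \<mu> U (contact_frame.rotated f C S)"
proof -
  interpret f: contact_frame M U f by (rule adapted_contact_frame(1)[OF cs ad])
  interpret h: contact_frame M U "f.rotated C S" by (rule f.rotated(1)[OF C S CS])
  let ?h = "f.rotated C S"
  have h: "?h 1 p = lincomb (C p) (f 1 p) (S p) (f 2 p)" "?h 2 p = lincomb (- S p) (f 1 p) (C p) (f 2 p)" for p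
    by (simp_all add: f.rotated_def lincomb_def)
  have hl: "lincomb s (?h 1 p) t (?h 2 p) = lincomb (s * C p - t * S p) (f 1 p) (s * S p + t * C p) (f 2 p)" for s t p
    by (simp add: h lincomb_def fun_eq_iff algebra_simps)
  show ?thesis
  proof (rule h.adapted_frameI)
    fix p assume p: "p \<in> U"
    show "\<Delta> p = {lincomb s (?h 1 p) t (?h 2 p) |s t. True}"
      unfolding adapted_contact_frame(2)[OF cs ad p] hl
    proof (intro equalityI subsetI; clarify)
      fix a b
      have "a = (a * C p + b * S p) * C p - (b * C p - a * S p) * S p"
        "b = (a * C p + b * S p) * S p + (b * C p - a * S p) * C p" using CS[OF p] by algebra+
      then show "\<exists>s t. lincomb a (f 1 p) b (f 2 p) = lincomb (s * C p - t * S p) (f 1 p) (s * S p + t * C p) (f 2 p) \<and> True"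
        by metis
    next
      fix s t
      show "\<exists>a b. lincomb (s * C p - t * S p) (f 1 p) (s * S p + t * C p) (f 2 p) = lincomb a (f 1 p) b (f 2 p) \<and> True"
        by blast
    qed
    show "g p (?h 1 p) (?h 1 p) = 1 \<and> g p (?h 2 p) (?h 2 p) = 1 \<and> g p (?h 1 p) (?h 2 p) = 0"
      unfolding h adapted_forms(2)[OF cs ad p] using CS[OF p] by (simp add: algebra_simps)
    fix s t s' t'
    show "\<mu> p (lincomb s (?h 1 p) t (?h 2 p)) (lincomb s' (?h 1 p) t' (?h 2 p)) = s * t' - t * s'"
      unfolding hl adapted_forms(1)[OF cs ad p] using CS[OF p] by algebra
  qed
qed

context contact_frame
begin

definition frame_plane :: "'a \<Rightarrow> 'a tvec set" where "frame_plane p = {lincomb s (f 1 p) t (f 2 p) |s t. True}"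
definition frame_metric :: "'a form2" where
  "frame_metric p v v' = coframe f p v $ 1 * coframe f p v' $ 1 + coframe f p v $ 2 * coframe f p v' $ 2"
definition frame_area :: "'a form2" where
  "frame_area p v v' = coframe f p v $ 1 * coframe f p v' $ 2 - coframe f p v $ 2 * coframe f p v' $ 1"

lemma coframe_plane: "p \<in> U \<Longrightarrow> coframe f p (lincomb s (f 1 p) t (f 2 p)) = vec3 0 s t"
  by (rule coframe_eqI) (simp_all add: lincomb_def sum_3' tangent_not_smooth[OF F_tangent])

lemma plane_tangent: "p \<in> U \<Longrightarrow> v \<in> frame_plane p \<Longrightarrow> v \<in> tangent_space M p"
  unfolding frame_plane_def using tangent_lincomb[OF F_tangent F_tangent] by auto

text \<open>Every contact frame belongs to a contact structure, so that an example can be given by a frame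
  alone.\<close>

lemma global_contact_frame:
  assumes M: "smooth_manifold M" "connected_space (mtop M)" and U: "U = topspace (mtop M)"
  shows "contact_sub_Riemannian M frame_plane frame_metric frame_area"
    and "adapted_frame M frame_plane frame_metric frame_area U f"
proof -
  have f12: "f 1 p = lincomb 1 (f 1 p) 0 (f 2 p)" "f 2 p = lincomb 0 (f 1 p) 1 (f 2 p)" for p
    by (simp_all add: lincomb_def)
  have cl: "coframe f p (lincomb s v t w) = s *\<^sub>R coframe f p v + t *\<^sub>R coframe f p w"
    if "p \<in> U" "v \<in> frame_plane p" "w \<in> frame_plane p" for p v w s t
    using coframe_lincomb[OF that(1) plane_tangent plane_tangent] that by (simp add: lincomb_def)
  have cs: "smooth_fun M V (\<lambda>p. coframe f p (X p) $ i)" if "openin (mtop M) V" "section_on M frame_plane V X" for V X i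
    using coframe_smooth[OF that(1)] that openin_subset[OF that(1)] by (simp add: section_on_def U)
  have sf: "smooth_form_on M frame_plane frame_metric" "smooth_form_on M frame_plane frame_area"
    unfolding smooth_form_on_def frame_metric_def frame_area_def U[symmetric]
    using cs by (auto simp: cl algebra_simps intro!: smooth_fun_add smooth_fun_diff smooth_fun_mult)
  have eu: "euclidean_metric M frame_plane frame_metric"
    unfolding euclidean_metric_def U[symmetric]
  proof (intro conjI sf(1) ballI impI)
    fix p v w assume p: "p \<in> U" and v: "v \<in> frame_plane p" and w: "w \<in> frame_plane p"
    show "frame_metric p v w = frame_metric p w v" by (simp add: frame_metric_def mult.commute)
    assume n: "v \<noteq> (\<lambda>u. 0)"
    obtain s t where st: "v = lincomb s (f 1 p) t (f 2 p)" using v unfolding frame_plane_def by blast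
    then have "s \<noteq> 0 \<or> t \<noteq> 0" using n by (auto simp: lincomb_def)
    then have "s * s + t * t > 0"
      by (metis add_nonneg_pos add_pos_nonneg not_real_square_gt_zero zero_le_square)
    then show "0 < frame_metric p v v" by (simp add: frame_metric_def st coframe_plane[OF p])
  qed
  have ar: "area_form M frame_plane frame_metric frame_area"
    unfolding area_form_def by (auto simp: sf(2) frame_metric_def frame_area_def power2_eq_square algebra_simps)
  have rk: "rank_two_distribution M frame_plane"
    unfolding rank_two_distribution_def U[symmetric]
  proof
    fix p assume p: "p \<in> U"
    have ind: "s = 0 \<and> t = 0" if q: "q \<in> U" and z: "lincomb s (f 1 q) t (f 2 q) = (\<lambda>u. 0)" for q s t
    proof -
      have "(\<lambda>u. 0) = lincomb 0 (f 1 q) 0 (f 2 q)" by (simp add: lincomb_def)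
      then have "vec3 0 s t = vec3 0 0 0" using coframe_plane[OF q] z by metis
      then show ?thesis using vec3_nth by metis
    qed
    show "\<exists>V X Y. openin (mtop M) V \<and> p \<in> V \<and> vector_field M V X \<and> vector_field M V Y \<and>
        (\<forall>q\<in>V. frame_plane q = {lincomb a (X q) b (Y q) |a b. True} \<and>
           (\<forall>a b. lincomb a (X q) b (Y q) = (\<lambda>u. 0) \<longrightarrow> a = 0 \<and> b = 0))"
      by (rule exI[of _ U], rule exI[of _ "f 1"], rule exI[of _ "f 2"],
          intro conjI U_open F_field p ballI allI impI)
        (simp add: frame_plane_def, (drule (1) ind, simp)+)
  qed
  define \<omega> where "\<omega> = (\<lambda>p v. coframe f p v $ 0)"
  have ker: "frame_plane p = {v \<in> tangent_space M p. \<omega> p v = 0}" if p: "p \<in> U" for p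
  proof (intro equalityI subsetI)
    fix v assume v: "v \<in> frame_plane p"
    then show "v \<in> {v \<in> tangent_space M p. \<omega> p v = 0}"
      using plane_tangent[OF p v] coframe_plane[OF p] by (auto simp: \<omega>_def frame_plane_def)
  next
    fix v assume "v \<in> {v \<in> tangent_space M p. \<omega> p v = 0}"
    then have v: "v \<in> tangent_space M p" "coframe f p v $ 0 = 0" by (simp_all add: \<omega>_def)
    have "v = lincomb (coframe f p v $ 1) (f 1 p) (coframe f p v $ 2) (f 2 p)"
      using coframe_expand[OF p v(1)] v(2) by (simp add: lincomb_def sum_3' fun_eq_iff)
    then show "v \<in> frame_plane p" unfolding frame_plane_def by blast
  qed
  have one: "one_form M U \<omega>"
    unfolding one_form_def \<omega>_def using coframe_lincomb coframe_smooth by (auto simp: lincomb_def)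
  have ct: "contact_distribution M frame_plane"
    unfolding contact_distribution_def U[symmetric]
  proof (intro conjI rk, rule ballI, rule exI[of _ U], rule exI[of _ \<omega>], intro conjI U_open one ballI ker)
    fix q assume q: "q \<in> U"
    show "\<exists>W X Y Z. openin (mtop M) W \<and> q \<in> W \<and> W \<subseteq> U \<and> vector_field M W X \<and> vector_field M W Y \<and>
        vector_field M W Z \<and> ext_deriv_wedge M \<omega> X Y Z q \<noteq> 0"
    proof (rule exI[of _ U], rule exI[of _ "f 1"], rule exI[of _ "f 2"], rule exI[of _ "f 0"],
        intro conjI U_open order_refl F_field q)
      show "ext_deriv_wedge M \<omega> (f 1) (f 2) (f 0) q \<noteq> 0"
        unfolding ext_deriv_wedge_def \<omega>_def
        by (simp add: ext_deriv_coframe[OF U_open order_refl q F_field F_field] coframe_F[OF q] axis_def)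
    qed
  qed
  show cs: "contact_sub_Riemannian M frame_plane frame_metric frame_area"
    unfolding contact_sub_Riemannian_def using M ct eu ar by blast
  show "adapted_frame M frame_plane frame_metric frame_area U f"
  proof (rule adapted_frameI)
    fix p assume p: "p \<in> U"
    show "frame_plane p = {lincomb s (f 1 p) t (f 2 p) |s t. True}" by (simp add: frame_plane_def)
    show "frame_metric p (f 1 p) (f 1 p) = 1 \<and> frame_metric p (f 2 p) (f 2 p) = 1 \<and> frame_metric p (f 1 p) (f 2 p) = 0"
      by (simp add: frame_metric_def coframe_F[OF p] axis_def)
    fix s t s' t'
    show "frame_area p (lincomb s (f 1 p) t (f 2 p)) (lincomb s' (f 1 p) t' (f 2 p)) = s * t' - t * s'"
      by (simp add: frame_area_def coframe_plane[OF p])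
  qed
qed

end

definition affine_space :: "(real ^ 3, real ^ 3) manifold" where
  "affine_space = \<lparr>mtop = euclidean, charts = {(UNIV, id)}\<rparr>"

lemma affine_smooth_fun: "smooth_fun affine_space U u \<longleftrightarrow> smooth_on U u"
proof -
  have "u \<circ> inv_into UNIV id = u" by (simp add: fun_eq_iff inv_into_f_f[where f=id and A=UNIV, simplified])
  then show ?thesis by (simp add: smooth_fun_def affine_space_def)
qed

lemma smooth_manifold_affine: "smooth_manifold affine_space"
proof -
  have "second_countable (euclidean :: (real ^ 3) topology)"
  proof -
    obtain B :: "(real ^ 3) set set" where B: "countable B" "\<And>C. C \<in> B \<Longrightarrow> open C"
      "\<And>S. open S \<Longrightarrow> \<exists>U. U \<subseteq> B \<and> S = \<Union>U"
      using univ_second_countable by blast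
    have "\<exists>U\<in>B. x \<in> U \<and> U \<subseteq> S" if "open S" "x \<in> S" for x S using B(3)[OF that(1)] that(2) by blast
    then show ?thesis unfolding second_countable_def using B(1,2) by (intro exI[of _ B]) auto
  qed
  moreover have "id \<circ> inv_into UNIV id = (\<lambda>x :: real ^ 3. x)"
    by (simp add: fun_eq_iff inv_into_f_f[where f=id and A=UNIV, simplified])
  moreover have "Ck_on k UNIV (\<lambda>x :: real ^ 3. x)" for k by (rule Ck_on_linear[OF open_UNIV bounded_linear_ident])
  moreover have "homeomorphic_map euclidean euclidean (\<lambda>x :: real ^ 3. x)"
    using homeomorphic_map_id[of "euclidean :: (real ^ 3) topology" euclidean] by (simp add: id_def)
  ultimately show ?thesis
    by (simp add: smooth_manifold_def affine_space_def smooth_on_def id_def)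
qed

definition coordinate_field :: "3 \<Rightarrow> (real ^ 3) vfield" where
  "coordinate_field i p u = (if smooth_near affine_space p u then frechet_derivative u (at p) (axis i 1) else 0)"

lemma coordinate_frame: "smooth_frame affine_space UNIV coordinate_field"
proof -
  interpret smooth_atlas affine_space by (rule smooth_manifold_atlas[OF smooth_manifold_affine])
  have inv: "inv_into UNIV id = (id :: real ^ 3 \<Rightarrow> _)"
    by (simp add: fun_eq_iff inv_into_f_f[where f=id and A=UNIV, simplified])
  have chs: "charts affine_space = {(UNIV, id)}" by (simp add: affine_space_def)
  then have ch: "(UNIV, id) \<in> charts affine_space" by simp
  have top: "openin (mtop affine_space) U \<longleftrightarrow> open U" for U by (simp add: affine_space_def)
  have tan: "tangent_space affine_space p = {\<lambda>u. if smooth_near affine_space p u then frechet_derivative u (at p) h else 0 |h. True}" for p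
    unfolding tangent_space_def by (simp add: chs inv cong: if_cong)
  have lin: "linear (frechet_derivative u (at p))" if "smooth_near affine_space p u" for p u
    using has_derivative_linear[OF chart_has_derivative[OF that ch UNIV_I]] by (simp add: inv)
  have ex: "frechet_derivative u (at p) h = (\<Sum>i\<in>UNIV. h $ i * frechet_derivative u (at p) (axis i 1))"
    if "smooth_near affine_space p u" for p u and h :: "real ^ 3"
  proof -
    have "h = (\<Sum>i\<in>UNIV. h $ i *\<^sub>R axis i 1)" by (simp add: vec_eq_iff axis_def if_distrib cong: if_cong)
    then have "frechet_derivative u (at p) h = frechet_derivative u (at p) (\<Sum>i\<in>UNIV. h $ i *\<^sub>R axis i 1)" by simp
    then show ?thesis by (simp add: linear_sum[OF lin[OF that]] linear_scale[OF lin[OF that]])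
  qed
  have proj: "smooth_fun affine_space UNIV (\<lambda>p. p $ j)" for j
    unfolding affine_smooth_fun smooth_on_def using Ck_on_linear[OF open_UNIV bounded_linear_vec_nth] by blast
  have dproj: "coordinate_field i p (\<lambda>q. q $ j) = (if i = j then 1 else 0)" for i j p
  proof -
    have "smooth_near affine_space p (\<lambda>q. q $ j)" by (rule smooth_nearI[OF proj]) (simp_all add: top)
    moreover have "frechet_derivative (\<lambda>q. q $ j) (at p) = (\<lambda>h. h $ j)"
      by (rule frechet_derivative_at[symmetric]) (rule bounded_linear_imp_has_derivative[OF bounded_linear_vec_nth])
    ultimately show ?thesis by (simp add: coordinate_field_def axis_def)
  qed
  interpret frame_field affine_space UNIV coordinate_field
  proof
    show "openin (mtop affine_space) UNIV" by (simp add: top)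
    show "coordinate_field i p \<in> tangent_space affine_space p" for i p
      unfolding tan coordinate_field_def[abs_def] by blast
    show "\<exists>a. v = (\<lambda>u. \<Sum>i\<in>UNIV. a $ i * coordinate_field i p u)" if v: "v \<in> tangent_space affine_space p" for v p
    proof -
      obtain h where "v = (\<lambda>u. if smooth_near affine_space p u then frechet_derivative u (at p) h else 0)"
        using v unfolding tan by blast
      then have "v = (\<lambda>u. \<Sum>i\<in>UNIV. h $ i * coordinate_field i p u)" using ex by (auto simp: coordinate_field_def)
      then show ?thesis by blast
    qed
    show "a = 0" if a: "\<And>u. smooth_near affine_space p u \<Longrightarrow> (\<Sum>i\<in>UNIV. a $ i * coordinate_field i p u) = 0"
      for a :: "real ^ 3" and p
    proof -
      have "a $ j = 0" for j
        using a[OF smooth_nearI[OF proj[of j] _ UNIV_I]]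
        by (simp add: top dproj if_distrib[of "\<lambda>x. _ * x"] cong: if_cong)
      then show ?thesis by (simp add: vec_eq_iff)
    qed
  qed
  show ?thesis
  proof
    show "vector_field affine_space UNIV (coordinate_field i)" for i
    proof (rule vector_fieldI)
      show "coordinate_field i p \<in> tangent_space affine_space p" for p by (rule F_tangent) simp
      fix V u assume V: "openin (mtop affine_space) V" "smooth_fun affine_space V u"
      have "smooth_on V (\<lambda>x. frechet_derivative u (at x) (axis i 1))"
        using smooth_on_frechet[of V u "axis i 1"] V by (simp add: affine_smooth_fun top)
      moreover have "coordinate_field i p u = frechet_derivative u (at p) (axis i 1)" if "p \<in> V" for p
        using smooth_nearI[OF V(2,1) that] by (simp add: coordinate_field_def)
      ultimately show "smooth_fun affine_space V (\<lambda>p. coordinate_field i p u)"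
        using smooth_on_cong[of V "\<lambda>x. frechet_derivative u (at x) (axis i 1)" "\<lambda>p. coordinate_field i p u"] V
        by (simp add: affine_smooth_fun top)
    qed
    fix V X i assume V: "openin (mtop affine_space) V" and X: "vector_field affine_space V X"
    have "coframe coordinate_field p (X p) $ i = X p (\<lambda>q. q $ i)" if "p \<in> V" for p
      using coframe_expand[OF _ vector_field_tangent[OF X that], of "\<lambda>q. q $ i"]
      by (simp add: dproj if_distrib[of "\<lambda>x. _ * x"] cong: if_cong)
    moreover have "smooth_fun affine_space V (\<lambda>p. X p (\<lambda>q. q $ i))"
      by (rule vector_field_smooth[OF X V order_refl smooth_fun_subset[OF proj _ V]]) (simp_all add: top)
    ultimately show "smooth_fun affine_space V (\<lambda>p. coframe coordinate_field p (X p) $ i)"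
      using smooth_fun_cong[OF V, of "\<lambda>p. coframe coordinate_field p (X p) $ i" "\<lambda>p. X p (\<lambda>q. q $ i)"] by simp
  qed
qed

text \<open>The Euclidean group of the plane: \<open>f 1\<close> acts on the span of \<open>f 0\<close> and \<open>f 2\<close> as an
  infinitesimal rotation.\<close>

definition motion_frame :: "3 \<Rightarrow> (real ^ 3) vfield" where
  "motion_frame i = (\<lambda>p u. if i = 1 then coordinate_field 0 p u
    else if i = 2 then cos (p $ 0) * coordinate_field 1 p u + sin (p $ 0) * coordinate_field 2 p u
    else sin (p $ 0) * coordinate_field 1 p u - cos (p $ 0) * coordinate_field 2 p u)"

lemma motion_frame:
  shows "contact_frame affine_space UNIV motion_frame"
    and "c12 affine_space motion_frame 1 = (\<lambda>p. 0)" "c12 affine_space motion_frame 2 = (\<lambda>p. 0)"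
    "c10 affine_space motion_frame 1 = (\<lambda>p. 0)" "c10 affine_space motion_frame 2 = (\<lambda>p. 1)"
    "c20 affine_space motion_frame 1 = (\<lambda>p. 0)" "c20 affine_space motion_frame 2 = (\<lambda>p. 0)"
proof -
  interpret K: smooth_frame affine_space UNIV coordinate_field by (rule coordinate_frame)
  have top: "openin (mtop affine_space) U \<longleftrightarrow> open U" for U by (simp add: affine_space_def)
  note UN = K.U_open
  have proj: "smooth_fun affine_space UNIV (\<lambda>p. p $ j)" for j
    unfolding affine_smooth_fun smooth_on_def using Ck_on_linear[OF open_UNIV bounded_linear_vec_nth] by blast
  define trig where "trig n t = (if n mod 4 = 0 then sin t else if n mod 4 = 1 then cos t else if n mod 4 = 2 then - sin t else - cos t)"
    for n :: nat and t :: real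
  have tr: "(trig n has_real_derivative trig (Suc n) t) (at t)" for n t
  proof -
    consider "n mod 4 = 0" | "n mod 4 = 1" | "n mod 4 = 2" | "n mod 4 = 3" by linarith
    then show ?thesis unfolding trig_def[abs_def]
      by cases (auto simp: mod_Suc intro!: derivative_eq_intros)
  qed
  have t01: "trig 0 = sin" "trig (Suc 0) = cos" by (simp_all add: trig_def[abs_def])
  have sc: "smooth_fun affine_space UNIV (\<lambda>p. sin (p $ 0))" "smooth_fun affine_space UNIV (\<lambda>p. cos (p $ 0))"
    using K.smooth_fun_compose[where G=trig, OF UN proj tr, of 0 0] K.smooth_fun_compose[where G=trig, OF UN proj tr, of "Suc 0" 0]
    by (simp_all add: t01)
  have n: "smooth_near affine_space p (\<lambda>p. sin (p $ 0))" "smooth_near affine_space p (\<lambda>p. cos (p $ 0))"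
      "smooth_near affine_space p (\<lambda>p. p $ j)" for p j
    using K.smooth_nearI[OF sc(1) UN] K.smooth_nearI[OF sc(2) UN] K.smooth_nearI[OF proj UN] by auto
  have dproj: "coordinate_field i p (\<lambda>q. q $ 0) = (if i = 0 then 1 else 0)" for i p
  proof -
    have "frechet_derivative (\<lambda>q. q $ 0) (at p) = (\<lambda>h :: real ^ 3. h $ 0)"
      by (rule frechet_derivative_at[symmetric]) (rule bounded_linear_imp_has_derivative[OF bounded_linear_vec_nth])
    then show ?thesis using n(3) by (simp add: coordinate_field_def axis_def)
  qed
  have d: "coordinate_field i p (\<lambda>p. sin (p $ 0)) = (if i = 0 then cos (p $ 0) else 0)"
    "coordinate_field i p (\<lambda>p. cos (p $ 0)) = (if i = 0 then - sin (p $ 0) else 0)" for i p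
    using K.tangent_compose[OF K.F_tangent[of p i] n(3) n(1) DERIV_sin] K.tangent_compose[OF K.F_tangent[of p i] n(3) n(2) DERIV_cos]
    by (simp_all add: dproj)
  have knear: "smooth_near affine_space p (\<lambda>q. coordinate_field i q u)" if u: "smooth_near affine_space p u" for i p u
  proof -
    obtain W where W: "openin (mtop affine_space) W" "p \<in> W" "smooth_fun affine_space W u"
      using u unfolding smooth_near_def by blast
    show ?thesis by (rule K.smooth_nearI[OF K.vector_field_smooth[OF K.F_field W(1) subset_UNIV W(3)] W(1,2)])
  qed
  have com: "coordinate_field i p (\<lambda>q. coordinate_field j q u) = coordinate_field j p (\<lambda>q. coordinate_field i q u)"
    if u: "smooth_near affine_space p u" for i j p u
  proof -
    obtain W where W: "openin (mtop affine_space) W" "p \<in> W" "smooth_fun affine_space W u"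
      using u unfolding smooth_near_def by blast
    have 1: "coordinate_field i p (\<lambda>q. coordinate_field j q u) = frechet_derivative (\<lambda>q. frechet_derivative u (at q) (axis j 1)) (at p) (axis i 1)" for i j
    proof -
      have "coordinate_field j q u = frechet_derivative u (at q) (axis j 1)" if "q \<in> W" for q
        using K.smooth_nearI[OF W(3,1) that] by (simp add: coordinate_field_def)
      then have "frechet_derivative (\<lambda>q. coordinate_field j q u) (at p) = frechet_derivative (\<lambda>q. frechet_derivative u (at q) (axis j 1)) (at p)"
        using frechet_derivative_cong(1)[of W p "\<lambda>q. coordinate_field j q u"] W by (simp add: top)
      then show ?thesis using knear[OF u] by (simp add: coordinate_field_def)
    qed
    show ?thesis unfolding 1
      by (rule frechet_derivative_commute[of W]) (use W in \<open>auto simp: top affine_smooth_fun smooth_on_def\<close>)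
  qed
  have dc: "coordinate_field i p (\<lambda>q. cos (q $ 0) * coordinate_field 1 q u + sin (q $ 0) * coordinate_field 2 q u)
      = cos (p $ 0) * coordinate_field i p (\<lambda>q. coordinate_field 1 q u) + sin (p $ 0) * coordinate_field i p (\<lambda>q. coordinate_field 2 q u)
        + (if i = 0 then cos (p $ 0) * coordinate_field 2 p u - sin (p $ 0) * coordinate_field 1 p u else 0)"
    "coordinate_field i p (\<lambda>q. sin (q $ 0) * coordinate_field 1 q u - cos (q $ 0) * coordinate_field 2 q u)
      = sin (p $ 0) * coordinate_field i p (\<lambda>q. coordinate_field 1 q u) - cos (p $ 0) * coordinate_field i p (\<lambda>q. coordinate_field 2 q u)
        + (if i = 0 then cos (p $ 0) * coordinate_field 1 p u + sin (p $ 0) * coordinate_field 2 p u else 0)"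
    if u: "smooth_near affine_space p u" for i p u
  proof -
    note T = K.F_tangent[of p i, simplified]
    note r = K.tangent_add[OF T] K.tangent_mult[OF T] K.smooth_near_mult n(1,2) knear[OF u] d
    show "coordinate_field i p (\<lambda>q. cos (q $ 0) * coordinate_field 1 q u + sin (q $ 0) * coordinate_field 2 q u)
      = cos (p $ 0) * coordinate_field i p (\<lambda>q. coordinate_field 1 q u) + sin (p $ 0) * coordinate_field i p (\<lambda>q. coordinate_field 2 q u)
        + (if i = 0 then cos (p $ 0) * coordinate_field 2 p u - sin (p $ 0) * coordinate_field 1 p u else 0)"
      by (simp add: r)
    have c: "smooth_near affine_space p (\<lambda>q. - 1)" by (rule K.smooth_near_const) (simp add: affine_space_def)
    have "coordinate_field i p (\<lambda>q. sin (q $ 0) * coordinate_field 1 q u + (- 1) * (cos (q $ 0) * coordinate_field 2 q u))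
      = sin (p $ 0) * coordinate_field i p (\<lambda>q. coordinate_field 1 q u) - cos (p $ 0) * coordinate_field i p (\<lambda>q. coordinate_field 2 q u)
        + (if i = 0 then cos (p $ 0) * coordinate_field 1 p u + sin (p $ 0) * coordinate_field 2 p u else 0)"
      by (simp only: r c K.tangent_const[OF T]) simp
    then show "coordinate_field i p (\<lambda>q. sin (q $ 0) * coordinate_field 1 q u - cos (q $ 0) * coordinate_field 2 q u)
      = sin (p $ 0) * coordinate_field i p (\<lambda>q. coordinate_field 1 q u) - cos (p $ 0) * coordinate_field i p (\<lambda>q. coordinate_field 2 q u)
        + (if i = 0 then cos (p $ 0) * coordinate_field 1 p u + sin (p $ 0) * coordinate_field 2 p u else 0)" by simp
  qed
  define A where "A = (\<lambda>(i::3) (k::3) (p :: real ^ 3). if i = 1 then (if k = 0 then 1 else 0)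
    else if i = 2 then (if k = 0 then 0 else if k = 1 then cos (p $ 0) else sin (p $ 0))
    else (if k = 0 then 0 else if k = 1 then sin (p $ 0) else - cos (p $ 0)))"
  have ex3: "P i k" if "P 0 0" "P 0 1" "P 0 2" "P 1 0" "P 1 1" "P 1 2" "P 2 0" "P 2 1" "P 2 2"
    for P :: "3 \<Rightarrow> 3 \<Rightarrow> bool" and i k
    using that forall_3'[of "\<lambda>i. \<forall>k. P i k"] forall_3' by metis
  have sA: "smooth_fun affine_space UNIV (A i k)" for i k
    by (rule ex3[of "\<lambda>i k. smooth_fun affine_space UNIV (A i k)"])
      (simp_all add: A_def K.smooth_fun_const[OF UN] K.smooth_fun_uminus[OF UN] sc)
  have cs2: "cos t * cos t + sin t * sin t = 1" "sin t * sin t + cos t * cos t = 1" for t :: real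
    using sin_cos_squared_add[of t] by (simp_all add: power2_eq_square)
  have sf: "smooth_frame affine_space UNIV motion_frame"
  proof (rule K.smooth_frame_change(1)[OF K.smooth_frame_axioms sA, where B = "\<lambda>i k. A k i"])
    show "smooth_fun affine_space UNIV (A k i)" for i k by (rule sA)
    show "(\<Sum>j\<in>UNIV. A i j p * A k j p) = (if i = k then 1 else 0)" for p i k
      by (rule ex3[of "\<lambda>i k. (\<Sum>j\<in>UNIV. A i j p * A k j p) = (if i = k then 1 else 0)"])
        (simp_all add: sum_3' A_def cs2)
    show "(\<Sum>j\<in>UNIV. A j i p * A j k p) = (if i = k then 1 else 0)" for p i k
      by (rule ex3[of "\<lambda>i k. (\<Sum>j\<in>UNIV. A j i p * A j k p) = (if i = k then 1 else 0)"])
        (simp_all add: sum_3' A_def cs2)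
    have "\<forall>i. motion_frame i p u = (\<Sum>k\<in>UNIV. A i k p * coordinate_field k p u)" for p u
      unfolding forall_3' by (simp add: sum_3' A_def motion_frame_def)
    then show "motion_frame i p u = (\<Sum>k\<in>UNIV. A i k p * coordinate_field k p u)" for i p u by blast
  qed
  have m: "motion_frame 1 = coordinate_field 0"
    "motion_frame 2 = (\<lambda>p u. cos (p $ 0) * coordinate_field 1 p u + sin (p $ 0) * coordinate_field 2 p u)"
    "motion_frame 0 = (\<lambda>p u. sin (p $ 0) * coordinate_field 1 p u - cos (p $ 0) * coordinate_field 2 p u)"
    by (simp_all add: motion_frame_def)
  have b: "motion_frame 2 p (\<lambda>q. motion_frame 1 q u) - motion_frame 1 p (\<lambda>q. motion_frame 2 q u)
      = motion_frame 0 p u + 0 * motion_frame 1 p u + 0 * motion_frame 2 p u"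
    "motion_frame 1 p (\<lambda>q. motion_frame 0 q u) - motion_frame 0 p (\<lambda>q. motion_frame 1 q u)
      = 0 * motion_frame 1 p u + 1 * motion_frame 2 p u"
    "motion_frame 2 p (\<lambda>q. motion_frame 0 q u) - motion_frame 0 p (\<lambda>q. motion_frame 2 q u)
      = 0 * motion_frame 1 p u + 0 * motion_frame 2 p u" if u: "smooth_near affine_space p u" for p u
    unfolding m
    by (simp_all only: dc[OF u] com[OF u, of 1 0] com[OF u, of 2 0] com[OF u, of 2 1]) (simp_all add: algebra_simps)
  note main = contact_frame_coefficients[OF sf b]
  show "contact_frame affine_space UNIV motion_frame" by (rule main(1))
  show "c12 affine_space motion_frame 1 = (\<lambda>p. 0)" "c12 affine_space motion_frame 2 = (\<lambda>p. 0)"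
    "c10 affine_space motion_frame 1 = (\<lambda>p. 0)" "c10 affine_space motion_frame 2 = (\<lambda>p. 1)"
    "c20 affine_space motion_frame 1 = (\<lambda>p. 0)" "c20 affine_space motion_frame 2 = (\<lambda>p. 0)"
    by (simp_all add: main(2-7) fun_eq_iff)
qed

text \<open>The example has \<open>\<alpha> = - 3 / 8\<close> and \<open>\<beta> = 0\<close>; rotating its frame by an eighth of a full turn gives \<open>\<alpha> = 0\<close> and
  \<open>\<beta> \<noteq> 0\<close>, so that no linear relation with constant coefficients can hold.\<close>

lemma invariants_independent:
  assumes "\<forall>(N :: (real ^ 3, real ^ 3) manifold) \<Delta>N gN \<mu>N V h.
    contact_sub_Riemannian N \<Delta>N gN \<mu>N \<and> adapted_frame N \<Delta>N gN \<mu>N V h \<longrightarrow>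
    (\<forall>q\<in>V. a * fef_alpha N h q + b * fef_beta N h q = 0)"
  shows "a = 0 \<and> b = 0"
proof -
  let ?N = affine_space
  interpret f: contact_frame affine_space UNIV motion_frame by (rule motion_frame(1))
  have top: "UNIV = topspace (mtop affine_space)" by (simp add: affine_space_def)
  have con: "connected_space (mtop affine_space)"
    using connectedin_topspace[of "euclidean :: (real ^ 3) topology"] by (simp add: affine_space_def connected_UNIV)
  note gl = f.global_contact_frame[OF smooth_manifold_affine con top]
  have z: "motion_frame i p (\<lambda>q. c) = 0" for i p c by (rule f.tangent_const[OF f.F_tangent]) simp
  have inv: "fef_alpha ?N motion_frame p = - 3 / 8" "fef_beta ?N motion_frame p = 0" for p
    unfolding fef_alpha_def fef_beta_def Let_def motion_frame(2-7) by (simp_all add: z)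
  have "a = 0"
    using assms[rule_format, OF conjI[OF gl], of 0] by (simp add: inv)
  moreover have "b = 0"
  proof -
    define c where "c = sqrt (1 / 2)"
    have c: "c * c = 1 / 2" by (simp add: c_def)
    have sc: "smooth_fun ?N UNIV (\<lambda>p. c)" by (rule f.smooth_fun_const[OF f.U_open])
    have cc: "c * c + c * c = 1" using c by simp
    note ad = rotated_adapted[OF gl sc sc cc]
    show "b = 0"
      using assms[rule_format, OF conjI[OF gl(1) ad], of 0] \<open>a = 0\<close>
        f.rotated_invariants(2)[OF sc sc cc, of 0] c by (simp add: inv)
  qed
  ultimately show ?thesis ..
qed

section \<open>The circle bundle\<close>

abbreviation unit_circle :: "complex set" where "unit_circle \<equiv> sphere 0 1"

text \<open>A continuous branch of the angle differs from \<open>s\<close>, along \<open>cis s\<close>, by a multiple of \<open>2 \<pi>\<close> that is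
  continuous, hence locally constant. This is why the image of a chart of the circle is open.\<close>

lemma circle_chart:
  assumes c: "(W, \<psi>) \<in> charts circle"
  shows "W \<subseteq> unit_circle" "openin (top_of_set unit_circle) W" "continuous_on W \<psi>" "\<And>z. z \<in> W \<Longrightarrow> cis (\<psi> z) = z"
    "open (\<psi> ` W)" "\<And>s. s \<in> \<psi> ` W \<Longrightarrow> inv_into W \<psi> s = cis s" "\<And>s. s \<in> \<psi> ` W \<Longrightarrow> cis s \<in> W \<and> \<psi> (cis s) = s"
proof -
  show W: "openin (top_of_set unit_circle) W" and cont: "continuous_on W \<psi>" and cis: "\<And>z. z \<in> W \<Longrightarrow> cis (\<psi> z) = z"
    using c unfolding circle_def by simp_all
  show WS: "W \<subseteq> unit_circle" using W openin_imp_subset by blast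
  show inv2: "cis s \<in> W \<and> \<psi> (cis s) = s" if "s \<in> \<psi> ` W" for s using that cis by auto
  show "inv_into W \<psi> s = cis s" if "s \<in> \<psi> ` W" for s
    using that cis by (metis f_inv_into_f inv_into_into)
  show "open (\<psi> ` W)"
    unfolding open_dist
  proof
    fix s0 assume "s0 \<in> \<psi> ` W"
    then obtain z0 where z0: "z0 \<in> W" "s0 = \<psi> z0" by blast
    obtain T where T: "open T" "W = unit_circle \<inter> T" using W by (auto simp: openin_open)
    have "continuous_on UNIV cis" by (intro continuous_intros)
    then have cc: "isCont cis s" for s by (simp add: continuous_on_eq_continuous_at)
    have "cis s0 \<in> T" using z0 cis T by auto
    then obtain d1 where d1: "d1 > 0" "\<And>s. dist s s0 < d1 \<Longrightarrow> cis s \<in> T"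
      using cc[of s0] T(1) unfolding continuous_at_eps_delta open_dist by (metis dist_commute)
    have inW: "cis s \<in> W" if "dist s s0 < d1" for s using d1(2)[OF that] T(2) by simp
    have "continuous_on (ball s0 d1) (\<lambda>s. \<psi> (cis s) - s)"
      by (intro continuous_intros continuous_on_compose2[OF cont]) (auto simp: dist_commute intro: inW)
    then have "isCont (\<lambda>s. \<psi> (cis s) - s) s0" using d1(1) by (simp add: continuous_on_eq_continuous_at)
    moreover have "\<psi> (cis s0) - s0 = 0" using z0 cis by simp
    ultimately obtain d2 where d2: "d2 > 0" "\<And>s. dist s s0 < d2 \<Longrightarrow> \<bar>\<psi> (cis s) - s\<bar> < pi"
      unfolding continuous_at_eps_delta dist_real_def using pi_gt_zero by (metis diff_0_right)
    have "s \<in> \<psi> ` W" if s: "dist s s0 < min d1 d2" for s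
    proof -
      have "cis (\<psi> (cis s) - s) = 1"
        using cis[OF inW] s by (simp add: cis_divide[symmetric])
      moreover have "\<psi> (cis s) - s \<in> {- pi<..pi}" using d2(2)[of s] s by auto
      ultimately have "\<psi> (cis s) - s = Arg 1" using Arg_cis by metis
      then have "\<psi> (cis s) = s" by simp
      then show ?thesis using inW[of s] s by (metis image_eqI min_less_iff_conj)
    qed
    then show "\<exists>e>0. \<forall>y. dist y s0 < e \<longrightarrow> y \<in> \<psi> ` W" using d1(1) d2(1) by (intro exI[of _ "min d1 d2"]) auto
  qed
qed

lemma circle_chart_exists:
  assumes z0: "z0 \<in> unit_circle" shows "\<exists>W \<psi>. (W, \<psi>) \<in> charts circle \<and> z0 \<in> W"
proof -
  define W where "W = unit_circle \<inter> {z. Re (z / z0) > 0}"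
  define \<psi> where "\<psi> = (\<lambda>z. Arg z0 + Im (Ln (z / z0)))"
  have n: "z0 \<noteq> 0" "norm z0 = 1" using z0 by auto
  have "open {z. Re (z / z0) > 0}"
    by (intro open_Collect_less continuous_intros) (use n in simp)
  then have "openin (top_of_set unit_circle) W" unfolding W_def by (rule openin_open_Int)
  moreover have "continuous_on W \<psi>"
    unfolding \<psi>_def W_def using n by (intro continuous_intros) (simp_all add: complex_nonpos_Reals_iff)
  moreover have "cis (\<psi> z) = z" if "z \<in> W" for z
  proof -
    have "norm (z / z0) = 1" "z / z0 \<noteq> 0" using that n by (auto simp: W_def norm_divide)
    then have "exp (Ln (z / z0)) = z / z0" "Re (Ln (z / z0)) = 0" by (simp_all add: Re_Ln)
    then have "cis (Im (Ln (z / z0))) = z / z0" by (metis exp_eq_polar exp_zero mult_1 of_real_1)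
    moreover have "cis (Arg z0) = z0" using cis_Arg[OF n(1)] n(2) by (simp add: sgn_eq)
    ultimately show ?thesis using n by (simp add: \<psi>_def cis_mult[symmetric])
  qed
  moreover have "z0 \<in> W" using z0 n by (simp add: W_def)
  ultimately show ?thesis by (intro exI[of _ W] exI[of _ \<psi>]) (simp add: circle_def)
qed

context smooth_atlas
begin

abbreviation "N \<equiv> circle_bundle M"

lemma bundle_charts:
  "(Q, \<eta>) \<in> charts N \<longleftrightarrow> (\<exists>V \<phi> W \<psi>. Q = V \<times> W \<and> \<eta> = (\<lambda>(p, q). (\<phi> p, \<psi> q)) \<and> (V, \<phi>) \<in> charts M \<and> (W, \<psi>) \<in> charts circle)"
  by (auto simp: circle_bundle_def prod_manifold_def)

lemma bundle_top: "mtop N = prod_topology (mtop M) (top_of_set unit_circle)"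
  by (simp add: circle_bundle_def prod_manifold_def circle_def)

lemma bundle_chart_system: "chart_system N"
proof
  fix Q and \<eta> :: "'a \<times> complex \<Rightarrow> 'e \<times> real" assume "(Q, \<eta>) \<in> charts N"
  then obtain V \<phi> W \<psi> where Q: "Q = V \<times> W" "\<eta> = (\<lambda>(p, q). (\<phi> p, \<psi> q))"
    and c: "(V, \<phi>) \<in> charts M" and cc: "(W, \<psi>) \<in> charts circle" unfolding bundle_charts by blast
  note C = circle_chart[OF cc]
  show "openin (mtop N) Q" unfolding Q bundle_top openin_prod_Times_iff using chart_openin[OF c] C(2) by blast
  have img: "\<eta> ` Q = \<phi> ` V \<times> \<psi> ` W" unfolding Q by auto
  show "open (\<eta> ` Q)" unfolding img by (intro open_Times chart_image[OF c] C(5))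
  obtain \<phi>i where m1: "homeomorphic_maps (subtopology (mtop M) V) (top_of_set (\<phi> ` V)) \<phi> \<phi>i"
    using chart_homeo[OF c] homeomorphic_map_maps by blast
  have m2: "homeomorphic_maps (top_of_set W) (top_of_set (\<psi> ` W)) \<psi> cis"
    unfolding homeomorphic_maps_def
  proof (intro conjI)
    show "continuous_map (top_of_set W) (top_of_set (\<psi> ` W)) \<psi>"
      using C(3) by (simp add: continuous_map_in_subtopology)
    have "continuous_on (\<psi> ` W) cis" by (intro continuous_intros)
    then show "continuous_map (top_of_set (\<psi> ` W)) (top_of_set W) cis"
      using C(7) by (auto simp: continuous_map_in_subtopology)
  qed (use C(4,7) in auto)
  have WW: "subtopology (top_of_set unit_circle) W = top_of_set W"
    using C(1) by (simp add: subtopology_subtopology Int_absorb1)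
  have "homeomorphic_maps (prod_topology (subtopology (mtop M) V) (top_of_set W))
     (prod_topology (top_of_set (\<phi> ` V)) (top_of_set (\<psi> ` W))) (\<lambda>(p, q). (\<phi> p, \<psi> q)) (\<lambda>(s, t). (\<phi>i s, cis t))"
    unfolding homeomorphic_maps_prod using m1 m2 by blast
  moreover have "subtopology (mtop N) Q = prod_topology (subtopology (mtop M) V) (top_of_set W)"
    by (simp add: bundle_top Q(1) subtopology_Times WW)
  moreover have "top_of_set (\<eta> ` Q) = prod_topology (top_of_set (\<phi> ` V)) (top_of_set (\<psi> ` W))"
    unfolding img by simp
  ultimately have "homeomorphic_maps (subtopology (mtop N) Q) (top_of_set (\<eta> ` Q)) \<eta> (\<lambda>(s, t). (\<phi>i s, cis t))"
    unfolding Q(2) by (simp only:)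
  then show "homeomorphic_map (subtopology (mtop N) Q) (top_of_set (\<eta> ` Q)) \<eta>"
    using homeomorphic_map_maps by blast
qed

sublocale circ: chart_system N by (rule bundle_chart_system)

lemma chart_image_memI: "x \<in> \<phi> ` V \<Longrightarrow> inv_into V \<phi> x \<in> U \<Longrightarrow> x \<in> \<phi> ` (U \<inter> V)"
  by (rule image_eqI[of x \<phi> "inv_into V \<phi> x"]) (simp_all add: chart_inv)

lemma lift_near:
  "smooth_near N (q, z) u \<Longrightarrow> lift_vfield M X (q, z) u = X q (\<lambda>q'. u (q', z))"
  "\<not> smooth_near N (q, z) u \<Longrightarrow> lift_vfield M X (q, z) u = 0"
  by (simp_all add: lift_vfield_def)

text \<open>All charts of the circle have the inverse \<open>cis\<close>, so that one formula serves for all of them.\<close>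

definition coord :: "('a set \<times> ('a \<Rightarrow> 'e)) \<Rightarrow> ('a \<times> complex \<Rightarrow> real) \<Rightarrow> 'e \<times> real \<Rightarrow> real" where
  "coord c u = (\<lambda>(x, s). u (inv_into (fst c) (snd c) x, cis s))"

lemma bundle_chartE:
  assumes "(Q, \<eta>) \<in> charts N"
  obtains V \<phi> W \<psi> where "(V, \<phi>) \<in> charts M" "(W, \<psi>) \<in> charts circle" "Q = V \<times> W" "\<eta> = (\<lambda>(p, q). (\<phi> p, \<psi> q))"
    "\<And>S. \<eta> ` (S \<inter> Q) = {(x, s). x \<in> \<phi> ` V \<and> s \<in> \<psi> ` W \<and> (inv_into V \<phi> x, cis s) \<in> S}"
    "\<And>u x. x \<in> \<phi> ` V \<times> \<psi> ` W \<Longrightarrow> (u \<circ> inv_into Q \<eta>) x = coord (V, \<phi>) u x"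
proof -
  obtain V \<phi> W \<psi> where Q: "Q = V \<times> W" "\<eta> = (\<lambda>(p, q). (\<phi> p, \<psi> q))"
    and c: "(V, \<phi>) \<in> charts M" and cc: "(W, \<psi>) \<in> charts circle" using assms unfolding bundle_charts by blast
  note C = circle_chart[OF cc]
  have I: "\<eta> ` (S \<inter> Q) = {(x, s). x \<in> \<phi> ` V \<and> s \<in> \<psi> ` W \<and> (inv_into V \<phi> x, cis s) \<in> S}" for S
  proof (intro equalityI subsetI)
    fix y assume "y \<in> \<eta> ` (S \<inter> Q)"
    then show "y \<in> {(x, s). x \<in> \<phi> ` V \<and> s \<in> \<psi> ` W \<and> (inv_into V \<phi> x, cis s) \<in> S}"
      using inv_chart[OF c] C(4) by (auto simp: Q)
  next
    fix y assume "y \<in> {(x, s). x \<in> \<phi> ` V \<and> s \<in> \<psi> ` W \<and> (inv_into V \<phi> x, cis s) \<in> S}"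
    then obtain x s where y: "y = (x, s)" "x \<in> \<phi> ` V" "s \<in> \<psi> ` W" "(inv_into V \<phi> x, cis s) \<in> S" by auto
    then have "y = \<eta> (inv_into V \<phi> x, cis s)" "(inv_into V \<phi> x, cis s) \<in> S \<inter> Q"
      using C(7)[OF y(3)] chart_inv[OF y(2)] by (auto simp: Q)
    then show "y \<in> \<eta> ` (S \<inter> Q)" by blast
  qed
  have "(u \<circ> inv_into Q \<eta>) x = coord (V, \<phi>) u x" if x: "x \<in> \<phi> ` V \<times> \<psi> ` W" for u x
  proof -
    obtain y s where ys: "x = (y, s)" "y \<in> \<phi> ` V" "s \<in> \<psi> ` W" using x by auto
    have "x = \<eta> (inv_into V \<phi> y, cis s)" "(inv_into V \<phi> y, cis s) \<in> Q"
      using C(7)[OF ys(3)] chart_inv[OF ys(2)] by (auto simp: Q ys)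
    then have "inv_into Q \<eta> x = (inv_into V \<phi> y, cis s)" using circ.inv_chart[OF assms] by simp
    then show ?thesis by (simp add: coord_def ys)
  qed
  then show thesis by (rule that[OF c cc Q I])
qed

lemma bundle_chartI:
  assumes "(V, \<phi>) \<in> charts M" "(W, \<psi>) \<in> charts circle"
  shows "(V \<times> W, \<lambda>(p, q). (\<phi> p, \<psi> q)) \<in> charts N"
  using assms unfolding bundle_charts by blast

lemma coord_smooth:
  assumes u: "smooth_fun N O' u" and O: "openin (mtop N) O'"
    and c: "(V, \<phi>) \<in> charts M" and cc: "(W, \<psi>) \<in> charts circle"
  defines "S \<equiv> {(x, s). x \<in> \<phi> ` V \<and> s \<in> \<psi> ` W \<and> (inv_into V \<phi> x, cis s) \<in> O'}"
  shows "open S" "smooth_on S (coord (V, \<phi>) u)"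
proof -
  let ?\<eta> = "\<lambda>(p, q). (\<phi> p, \<psi> q)" and ?Q = "V \<times> W"
  have ch: "(?Q, ?\<eta>) \<in> charts N" by (rule bundle_chartI[OF c cc])
  note C = circle_chart[OF cc]
  have I: "?\<eta> ` (O' \<inter> ?Q) = S"
  proof (rule bundle_chartE[OF ch])
    fix V' \<phi>' W' \<psi>' assume h: "?Q = V' \<times> W'" "?\<eta> = (\<lambda>(p, q). (\<phi>' p, \<psi>' q))"
      "\<And>S. ?\<eta> ` (S \<inter> ?Q) = {(x, s). x \<in> \<phi>' ` V' \<and> s \<in> \<psi>' ` W' \<and> (inv_into V' \<phi>' x, cis s) \<in> S}"
    show ?thesis
    proof (intro equalityI subsetI)
      fix y assume "y \<in> ?\<eta> ` (O' \<inter> ?Q)"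
      then show "y \<in> S" using inv_chart[OF c] C(4) by (auto simp: S_def)
    next
      fix y assume "y \<in> S"
      then obtain x s where y: "y = (x, s)" "x \<in> \<phi> ` V" "s \<in> \<psi> ` W" "(inv_into V \<phi> x, cis s) \<in> O'" by (auto simp: S_def)
      then have "y = ?\<eta> (inv_into V \<phi> x, cis s)" "(inv_into V \<phi> x, cis s) \<in> O' \<inter> ?Q"
        using C(7)[OF y(3)] chart_inv[OF y(2)] by auto
      then show "y \<in> ?\<eta> ` (O' \<inter> ?Q)" by blast
    qed
  qed
  show o: "open S" using circ.open_chart_image[OF ch O] I by simp
  have e: "(u \<circ> inv_into ?Q ?\<eta>) y = coord (V, \<phi>) u y" if y: "y \<in> S" for y
  proof -
    obtain x s where ys: "y = (x, s)" "x \<in> \<phi> ` V" "s \<in> \<psi> ` W" using y by (auto simp: S_def)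
    have "y = ?\<eta> (inv_into V \<phi> x, cis s)" "(inv_into V \<phi> x, cis s) \<in> ?Q"
      using C(7)[OF ys(3)] chart_inv[OF ys(2)] by (auto simp: ys)
    then have "inv_into ?Q ?\<eta> y = (inv_into V \<phi> x, cis s)"
      using circ.inv_chart[OF ch, of "(inv_into V \<phi> x, cis s)"] by (simp only:)
    then show ?thesis by (simp add: coord_def ys)
  qed
  show "smooth_on S (coord (V, \<phi>) u)"
    by (rule iffD1[OF smooth_on_cong[OF o e] circ.smooth_funD[OF u ch, unfolded I]])
qed

lemma bundle_smooth_funI:
  assumes O: "openin (mtop N) O'"
    and "\<And>V \<phi> W \<psi>. (V, \<phi>) \<in> charts M \<Longrightarrow> (W, \<psi>) \<in> charts circle \<Longrightarrow>
      smooth_on {(x, s). x \<in> \<phi> ` V \<and> s \<in> \<psi> ` W \<and> (inv_into V \<phi> x, cis s) \<in> O'} (coord (V, \<phi>) u)"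
  shows "smooth_fun N O' u"
proof (rule circ.smooth_funI)
  fix Q and \<eta> :: "'a \<times> complex \<Rightarrow> 'e \<times> real" assume ch: "(Q, \<eta>) \<in> charts N"
  obtain V \<phi> W \<psi> where c: "(V, \<phi>) \<in> charts M" "(W, \<psi>) \<in> charts circle"
    and I: "\<And>S. \<eta> ` (S \<inter> Q) = {(x, s). x \<in> \<phi> ` V \<and> s \<in> \<psi> ` W \<and> (inv_into V \<phi> x, cis s) \<in> S}"
    and u: "\<And>u x. x \<in> \<phi> ` V \<times> \<psi> ` W \<Longrightarrow> (u \<circ> inv_into Q \<eta>) x = coord (V, \<phi>) u x"
    by (rule bundle_chartE[OF ch]) blast
  have o: "open (\<eta> ` (O' \<inter> Q))" by (rule circ.open_chart_image[OF ch O])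
  have "smooth_on (\<eta> ` (O' \<inter> Q)) (coord (V, \<phi>) u)" unfolding I by (rule assms(2)[OF c])
  moreover have "(u \<circ> inv_into Q \<eta>) y = coord (V, \<phi>) u y" if "y \<in> \<eta> ` (O' \<inter> Q)" for y
    using that u[of y] unfolding I by auto
  ultimately show "smooth_on (\<eta> ` (O' \<inter> Q)) (u \<circ> inv_into Q \<eta>)"
    using smooth_on_cong[OF o] by metis
qed

lemma openin_slice:
  assumes "openin (mtop N) O'" "z \<in> unit_circle" shows "openin (mtop M) {q. (q, z) \<in> O'}"
proof -
  have "openin (mtop M) {q \<in> topspace (mtop M). (q, z) \<in> O'}"
  proof (rule openin_continuous_map_preimage[of _ "mtop N"])
    show "continuous_map (mtop M) (mtop N) (\<lambda>q. (q, z))"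
      unfolding bundle_top using assms(2) by (intro continuous_map_pairedI) auto
  qed (rule assms(1))
  moreover have "O' \<subseteq> topspace (mtop N)" using assms(1) openin_subset by blast
  then have "{q \<in> topspace (mtop M). (q, z) \<in> O'} = {q. (q, z) \<in> O'}" by (auto simp: bundle_top)
  ultimately show ?thesis by simp
qed

lemma smooth_slice:
  assumes u: "smooth_fun N O' u" and O: "openin (mtop N) O'" and z: "z \<in> unit_circle"
  shows "smooth_fun M {q. (q, z) \<in> O'} (\<lambda>q. u (q, z))"
proof (rule smooth_funI)
  fix V \<phi> assume c: "(V, \<phi>) \<in> charts M"
  obtain W \<psi> where cc: "(W, \<psi>) \<in> charts circle" "z \<in> W" using circle_chart_exists[OF z] by blast
  note C = circle_chart[OF cc(1)]
  note S = coord_smooth[OF u O c cc(1)]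
  let ?S = "{(x, s). x \<in> \<phi> ` V \<and> s \<in> \<psi> ` W \<and> (inv_into V \<phi> x, cis s) \<in> O'}"
  have o: "open (\<phi> ` ({q. (q, z) \<in> O'} \<inter> V))" by (rule open_chart_image[OF c openin_slice[OF O z]])
  have bl: "bounded_linear (\<lambda>x. (x, 0 :: real))" by (intro bounded_linear_Pair bounded_linear_ident bounded_linear_zero)
  have "Ck_on k (\<phi> ` ({q. (q, z) \<in> O'} \<inter> V)) (\<lambda>x. coord (V, \<phi>) u ((x, 0) + (0, \<psi> z)))" for k
    by (rule Ck_on_affine[OF S(1) o bl]) (use S(2) inv_chart[OF c] cc C(4) in \<open>auto simp: smooth_on_def\<close>)
  then have "smooth_on (\<phi> ` ({q. (q, z) \<in> O'} \<inter> V)) (\<lambda>x. coord (V, \<phi>) u ((x, 0) + (0, \<psi> z)))"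
    by (simp add: smooth_on_def)
  then show "smooth_on (\<phi> ` ({q. (q, z) \<in> O'} \<inter> V)) ((\<lambda>q. u (q, z)) \<circ> inv_into V \<phi>)"
    by (simp add: coord_def comp_def C(4)[OF cc(2)])
qed

lemma near_slice:
  assumes "smooth_near N (q, z) u" "z \<in> unit_circle" shows "smooth_near M q (\<lambda>q. u (q, z))"
proof -
  obtain O' where O: "openin (mtop N) O'" "(q, z) \<in> O'" "smooth_fun N O' u"
    using assms(1) unfolding smooth_near_def by blast
  show ?thesis by (rule smooth_nearI[OF smooth_slice[OF O(3,1) assms(2)] openin_slice[OF O(1) assms(2)]]) (use O in simp)
qed

lemma coord_derivative:
  assumes u: "smooth_near N (q, z) u" and c: "(V, \<phi>) \<in> charts M" "q \<in> V" and cc: "(W, \<psi>) \<in> charts circle" "z \<in> W"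
  shows "(coord (V, \<phi>) u has_derivative frechet_derivative (coord (V, \<phi>) u) (at (\<phi> q, \<psi> z))) (at (\<phi> q, \<psi> z))"
proof -
  obtain O' where O: "openin (mtop N) O'" "(q, z) \<in> O'" "smooth_fun N O' u"
    using u unfolding smooth_near_def by blast
  note S = coord_smooth[OF O(3,1) c(1) cc(1)]
  show ?thesis
    by (rule smooth_on_has_derivative[OF S(2,1)]) (use O(2) c cc inv_chart circle_chart(4)[OF cc(1)] in auto)
qed

lemma slice_derivative:
  assumes u: "smooth_near N (q, z) u" and c: "(V, \<phi>) \<in> charts M" "q \<in> V" and cc: "(W, \<psi>) \<in> charts circle" "z \<in> W"
  shows "frechet_derivative ((\<lambda>q. u (q, z)) \<circ> inv_into V \<phi>) (at (\<phi> q)) h = frechet_derivative (coord (V, \<phi>) u) (at (\<phi> q, \<psi> z)) (h, 0)"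
    "((\<lambda>t. coord (V, \<phi>) u (\<phi> q, \<psi> z + t)) has_real_derivative frechet_derivative (coord (V, \<phi>) u) (at (\<phi> q, \<psi> z)) (0, 1)) (at 0)"
proof -
  note D = coord_derivative[OF assms]
  have e: "(\<lambda>q. u (q, z)) \<circ> inv_into V \<phi> = (\<lambda>x. coord (V, \<phi>) u (x, \<psi> z))"
    using circle_chart(4)[OF cc] by (simp add: coord_def comp_def)
  have "((\<lambda>x. (x, \<psi> z)) has_derivative (\<lambda>h. (h, 0))) (at (\<phi> q))" by (auto intro!: derivative_eq_intros)
  from has_derivative_compose[OF this D]
  have "((\<lambda>x. coord (V, \<phi>) u (x, \<psi> z)) has_derivative (\<lambda>h. frechet_derivative (coord (V, \<phi>) u) (at (\<phi> q, \<psi> z)) (h, 0))) (at (\<phi> q))" .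
  from frechet_derivative_at[OF this]
  show "frechet_derivative ((\<lambda>q. u (q, z)) \<circ> inv_into V \<phi>) (at (\<phi> q)) h = frechet_derivative (coord (V, \<phi>) u) (at (\<phi> q, \<psi> z)) (h, 0)"
    unfolding e by metis
  have 1: "((\<lambda>t. (\<phi> q, \<psi> z + t)) has_derivative (\<lambda>t. (0, t))) (at 0)" by (auto intro!: derivative_eq_intros)
  have D0: "(coord (V, \<phi>) u has_derivative frechet_derivative (coord (V, \<phi>) u) (at (\<phi> q, \<psi> z))) (at (\<phi> q, \<psi> z + 0))"
    using D by simp
  have "((\<lambda>t. coord (V, \<phi>) u (\<phi> q, \<psi> z + t)) has_derivative (\<lambda>t. frechet_derivative (coord (V, \<phi>) u) (at (\<phi> q, \<psi> z)) (0, t))) (at 0)"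
    by (rule has_derivative_compose[OF 1 D0])
  moreover have "(\<lambda>t. frechet_derivative (coord (V, \<phi>) u) (at (\<phi> q, \<psi> z)) (0, t)) = (*) (frechet_derivative (coord (V, \<phi>) u) (at (\<phi> q, \<psi> z)) (0, 1))"
  proof
    fix t show "frechet_derivative (coord (V, \<phi>) u) (at (\<phi> q, \<psi> z)) (0, t) = frechet_derivative (coord (V, \<phi>) u) (at (\<phi> q, \<psi> z)) (0, 1) * t"
      using linear_scale[OF has_derivative_linear[OF D], of t "(0, 1)"] by (simp add: mult.commute)
  qed
  ultimately show "((\<lambda>t. coord (V, \<phi>) u (\<phi> q, \<psi> z + t)) has_real_derivative frechet_derivative (coord (V, \<phi>) u) (at (\<phi> q, \<psi> z)) (0, 1)) (at 0)"
    unfolding has_field_derivative_def by (simp only:)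
qed

lemma d_gamma_coord:
  assumes u: "smooth_near N (q, z) u" and c: "(V, \<phi>) \<in> charts M" "q \<in> V" and cc: "(W, \<psi>) \<in> charts circle" "z \<in> W"
  shows "d_gamma M (q, z) u = frechet_derivative (coord (V, \<phi>) u) (at (\<phi> q, \<psi> z)) (0, 1)"
proof -
  have "u (q, z * cis t) = coord (V, \<phi>) u (\<phi> q, \<psi> z + t)" for t
    using circle_chart(4)[OF cc] inv_chart[OF c] by (simp add: coord_def cis_mult[symmetric])
  then show ?thesis using DERIV_imp_deriv[OF slice_derivative(2)[OF assms]] u by (simp add: d_gamma_def)
qed

lemma lift_coord:
  assumes X: "X q \<in> tangent_space M q" and u: "smooth_near N (q, z) u"
    and c: "(V, \<phi>) \<in> charts M" "q \<in> V" and cc: "(W, \<psi>) \<in> charts circle" "z \<in> W"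
  shows "lift_vfield M X (q, z) u
    = (\<Sum>b\<in>Basis. X q (\<lambda>q. \<phi> q \<bullet> b) * frechet_derivative (coord (V, \<phi>) u) (at (\<phi> q, \<psi> z)) (b, 0))"
proof -
  have z: "z \<in> unit_circle" using circle_chart(1)[OF cc(1)] cc(2) by blast
  show ?thesis
    using tangent_coordinates[OF X c near_slice[OF u z]] u
    by (simp add: lift_vfield_def slice_derivative(1)[OF u c cc])
qed

lemma bundle_tangentI:
  assumes c: "(V, \<phi>) \<in> charts M" "q \<in> V" and cc: "(W, \<psi>) \<in> charts circle" "z \<in> W"
    and "\<And>u. \<not> smooth_near N (q, z) u \<Longrightarrow> v u = 0"
    and "\<And>u. smooth_near N (q, z) u \<Longrightarrow> v u = frechet_derivative (coord (V, \<phi>) u) (at (\<phi> q, \<psi> z)) h"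
  shows "v \<in> tangent_space N (q, z)"
proof -
  let ?\<eta> = "\<lambda>(p, q). (\<phi> p, \<psi> q)" and ?Q = "V \<times> W"
  have ch: "(?Q, ?\<eta>) \<in> charts N" by (rule bundle_chartI[OF c(1) cc(1)])
  have e: "coord (V, \<phi>) u y = (u \<circ> inv_into ?Q ?\<eta>) y" if y: "y \<in> ?\<eta> ` ?Q" for u y
  proof -
    obtain p s where p: "p \<in> V" "s \<in> W" "y = (\<phi> p, \<psi> s)" using y by auto
    then have "inv_into ?Q ?\<eta> y = (p, s)" using circ.inv_chart[OF ch, of "(p, s)"] by simp
    then show ?thesis using inv_chart[OF c(1) p(1)] circle_chart(4)[OF cc(1) p(2)] p(3) by (simp add: coord_def)
  qed
  have fe: "frechet_derivative (coord (V, \<phi>) u) (at (\<phi> q, \<psi> z)) = frechet_derivative (u \<circ> inv_into ?Q ?\<eta>) (at (?\<eta> (q, z)))" for u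
    using frechet_derivative_cong(1)[OF circ.chart_image[OF ch], of "(\<phi> q, \<psi> z)" "coord (V, \<phi>) u"] e c cc by force
  have "v = (\<lambda>u. if smooth_near N (q, z) u then frechet_derivative (u \<circ> inv_into ?Q ?\<eta>) (at (?\<eta> (q, z))) h else 0)"
    using assms(5,6) unfolding fe by auto
  then show ?thesis using ch c cc unfolding tangent_space_def by blast
qed

lemma lift_tangent:
  assumes X: "X q \<in> tangent_space M q" and z: "z \<in> unit_circle"
  shows "lift_vfield M X (q, z) \<in> tangent_space N (q, z)"
proof -
  obtain V \<phi> where c: "(V, \<phi>) \<in> charts M" "q \<in> V" using chart_cover tangent_topspace[OF X] by blast
  obtain W \<psi> where cc: "(W, \<psi>) \<in> charts circle" "z \<in> W" using circle_chart_exists[OF z] by blast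
  show ?thesis
  proof (rule bundle_tangentI[OF c cc, where h = "(\<Sum>b\<in>Basis. X q (\<lambda>q. \<phi> q \<bullet> b) *\<^sub>R (b, 0))"])
    fix u assume u: "smooth_near N (q, z) u"
    note l = has_derivative_linear[OF coord_derivative[OF u c cc]]
    show "lift_vfield M X (q, z) u = frechet_derivative (coord (V, \<phi>) u) (at (\<phi> q, \<psi> z)) (\<Sum>b\<in>Basis. X q (\<lambda>q. \<phi> q \<bullet> b) *\<^sub>R (b, 0))"
      unfolding lift_coord[where X=X, OF X u c cc] linear_sum[OF l] linear_scale[OF l] by simp
  qed (simp add: lift_vfield_def)
qed

lemma d_gamma_tangent:
  assumes q: "q \<in> topspace (mtop M)" and z: "z \<in> unit_circle"
  shows "d_gamma M (q, z) \<in> tangent_space N (q, z)"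
proof -
  obtain V \<phi> where c: "(V, \<phi>) \<in> charts M" "q \<in> V" using chart_cover q by blast
  obtain W \<psi> where cc: "(W, \<psi>) \<in> charts circle" "z \<in> W" using circle_chart_exists[OF z] by blast
  show ?thesis
    by (rule bundle_tangentI[OF c cc, where h = "(0, 1)"]) (simp add: d_gamma_def, rule d_gamma_coord[OF _ c cc])
qed

lemma bundle_tangent_cases:
  assumes v: "v \<in> tangent_space N (q, z)"
  obtains v0 s where "v0 \<in> tangent_space M q" "z \<in> unit_circle" "q \<in> topspace (mtop M)"
    "\<And>u. v u = lift_vfield M (\<lambda>_. v0) (q, z) u + s * d_gamma M (q, z) u"
proof -
  obtain Q \<eta> h where ch: "(Q, \<eta>) \<in> charts N" and qz: "(q, z) \<in> Q"
    and v': "v = (\<lambda>u. if smooth_near N (q, z) u then frechet_derivative (u \<circ> inv_into Q \<eta>) (at (\<eta> (q, z))) h else 0)"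
    by (rule circ.tangent_cases[OF v]) (rule that)
  obtain V \<phi> W \<psi> where c: "(V, \<phi>) \<in> charts M" and cc: "(W, \<psi>) \<in> charts circle"
    and Q: "Q = V \<times> W" "\<eta> = (\<lambda>(p, q). (\<phi> p, \<psi> q))"
    and e: "\<And>u x. x \<in> \<phi> ` V \<times> \<psi> ` W \<Longrightarrow> (u \<circ> inv_into Q \<eta>) x = coord (V, \<phi>) u x"
    by (rule bundle_chartE[OF ch]) blast
  have q: "q \<in> V" and z: "z \<in> W" using qz by (auto simp: Q)
  have o: "open (\<phi> ` V \<times> \<psi> ` W)" by (intro open_Times chart_image[OF c] circle_chart(5)[OF cc])
  have fe: "frechet_derivative (u \<circ> inv_into Q \<eta>) (at (\<eta> (q, z))) = frechet_derivative (coord (V, \<phi>) u) (at (\<phi> q, \<psi> z))" for u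
    using frechet_derivative_cong(1)[OF o, of "(\<phi> q, \<psi> z)" "u \<circ> inv_into Q \<eta>" "coord (V, \<phi>) u"] e q z by (auto simp: Q(2))
  define v0 where "v0 = (\<lambda>u. if smooth_near M q u then frechet_derivative (u \<circ> inv_into V \<phi>) (at (\<phi> q)) (fst h) else 0)"
  have v0: "v0 \<in> tangent_space M q" unfolding tangent_space_def v0_def using c q by blast
  have zc: "z \<in> unit_circle" using circle_chart(1)[OF cc] z by blast
  have "v u = lift_vfield M (\<lambda>_. v0) (q, z) u + snd h * d_gamma M (q, z) u" for u
  proof (cases "smooth_near N (q, z) u")
    case True
    note l = has_derivative_linear[OF coord_derivative[OF True c q cc z]]
    have "h = (fst h, 0) + snd h *\<^sub>R (0, 1)" by (simp add: prod_eq_iff)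
    then have "v u = frechet_derivative (coord (V, \<phi>) u) (at (\<phi> q, \<psi> z)) ((fst h, 0) + snd h *\<^sub>R (0, 1))"
      using True by (simp add: v' fe)
    also have "\<dots> = frechet_derivative (coord (V, \<phi>) u) (at (\<phi> q, \<psi> z)) (fst h, 0)
        + snd h * frechet_derivative (coord (V, \<phi>) u) (at (\<phi> q, \<psi> z)) (0, 1)"
      unfolding linear_add[OF l] linear_scale[OF l] by simp
    finally show ?thesis
      using True near_slice[OF True zc]
      by (simp add: lift_vfield_def v0_def slice_derivative(1)[OF True c q cc z] d_gamma_coord[OF True c q cc z])
  qed (simp add: v' lift_vfield_def d_gamma_def)
  then show thesis using that v0 zc chart_openin[OF c] openin_subset q by blast
qed

lemma lift_vector_field:
  assumes X: "vector_field M U X" and U: "openin (mtop M) U"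
  shows "vector_field N (U \<times> unit_circle) (lift_vfield M X)"
  unfolding vector_field_def
proof (intro conjI ballI allI impI; (elim conjE)?)
  fix p assume "p \<in> U \<times> unit_circle"
  then show "lift_vfield M X p \<in> tangent_space N p"
    using lift_tangent vector_field_tangent[OF X] by (cases p) auto
next
  fix O' u assume O: "openin (mtop N) O'" "O' \<subseteq> U \<times> unit_circle" and u: "smooth_fun N O' u"
  show "smooth_fun N O' (\<lambda>p. lift_vfield M X p u)"
  proof (rule bundle_smooth_funI[OF O(1)])
    fix V \<phi> W \<psi> assume c: "(V, \<phi>) \<in> charts M" and cc: "(W, \<psi>) \<in> charts circle"
    let ?S = "{(x, s). x \<in> \<phi> ` V \<and> s \<in> \<psi> ` W \<and> (inv_into V \<phi> x, cis s) \<in> O'}"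
    note S = coord_smooth[OF u O(1) c cc] and C = circle_chart[OF cc]
    let ?g = "\<lambda>y. \<Sum>b\<in>Basis. X (inv_into V \<phi> (fst y)) (\<lambda>q. \<phi> q \<bullet> b) * frechet_derivative (coord (V, \<phi>) u) (at y) (b, 0)"
    have oUV: "openin (mtop M) (U \<inter> V)" using U chart_openin[OF c] by blast
    have "smooth_on ?S ?g"
    proof (intro smooth_on_sum smooth_on_mult S(1) smooth_on_frechet S(2) finite_Basis)
      fix b :: 'e assume "b \<in> Basis"
      have "smooth_fun M (U \<inter> V) (\<lambda>q. X q (\<lambda>q. \<phi> q \<bullet> b))"
        by (rule vector_field_smooth[OF X oUV _ smooth_fun_subset[OF smooth_coordinate[OF c] chart_openin[OF c] oUV]]) auto
      from smooth_funD[OF this c]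
      have s: "smooth_on (\<phi> ` (U \<inter> V)) (\<lambda>x. X (inv_into V \<phi> x) (\<lambda>q. \<phi> q \<bullet> b))" by (simp add: comp_def Int_assoc)
      have "Ck_on k ?S (\<lambda>y. X (inv_into V \<phi> (fst y + 0)) (\<lambda>q. \<phi> q \<bullet> b))" for k
      proof (rule Ck_on_affine[OF open_chart_image[OF c U] S(1) bounded_linear_fst])
        fix y assume "y \<in> ?S"
        then have "fst y \<in> \<phi> ` V" "inv_into V \<phi> (fst y) \<in> U" using O(2) by auto
        then show "fst y + 0 \<in> \<phi> ` (U \<inter> V)" by (simp add: chart_image_memI)
      qed (use s in \<open>simp add: smooth_on_def\<close>)
      then show "smooth_on ?S (\<lambda>y. X (inv_into V \<phi> (fst y)) (\<lambda>q. \<phi> q \<bullet> b))" by (simp add: smooth_on_def)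
    qed
    moreover have "coord (V, \<phi>) (\<lambda>p. lift_vfield M X p u) y = ?g y" if y: "y \<in> ?S" for y
    proof -
      obtain x s where xs: "y = (x, s)" "x \<in> \<phi> ` V" "s \<in> \<psi> ` W" "(inv_into V \<phi> x, cis s) \<in> O'" using y by auto
      have t: "X (inv_into V \<phi> x) \<in> tangent_space M (inv_into V \<phi> x)" using vector_field_tangent[OF X] xs(4) O(2) by auto
      show ?thesis
        using lift_coord[where X=X, OF t circ.smooth_nearI[OF u O(1) xs(4)] c chart_inv(2)[OF xs(2)] cc] C(7)[OF xs(3)] chart_inv(1)[OF xs(2)]
        by (simp add: coord_def[of _ "\<lambda>p. lift_vfield M X p u"] xs(1))
    qed
    ultimately show "smooth_on ?S (coord (V, \<phi>) (\<lambda>p. lift_vfield M X p u))"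
      using smooth_on_cong[OF S(1), of "coord (V, \<phi>) (\<lambda>p. lift_vfield M X p u)" ?g] by blast
  qed
qed

lemma d_gamma_vector_field:
  assumes U: "openin (mtop M) U"
  shows "vector_field N (U \<times> unit_circle) (d_gamma M)"
  unfolding vector_field_def
proof (intro conjI ballI allI impI; (elim conjE)?)
  fix p assume "p \<in> U \<times> unit_circle"
  then show "d_gamma M p \<in> tangent_space N p"
    using d_gamma_tangent openin_subset[OF U] by (cases p) auto
next
  fix O' u assume O: "openin (mtop N) O'" "O' \<subseteq> U \<times> unit_circle" and u: "smooth_fun N O' u"
  show "smooth_fun N O' (\<lambda>p. d_gamma M p u)"
  proof (rule bundle_smooth_funI[OF O(1)])
    fix V \<phi> W \<psi> assume c: "(V, \<phi>) \<in> charts M" and cc: "(W, \<psi>) \<in> charts circle"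
    let ?S = "{(x, s). x \<in> \<phi> ` V \<and> s \<in> \<psi> ` W \<and> (inv_into V \<phi> x, cis s) \<in> O'}"
    note S = coord_smooth[OF u O(1) c cc] and C = circle_chart[OF cc]
    have "coord (V, \<phi>) (\<lambda>p. d_gamma M p u) y = frechet_derivative (coord (V, \<phi>) u) (at y) (0, 1)" if y: "y \<in> ?S" for y
    proof -
      obtain x s where xs: "y = (x, s)" "x \<in> \<phi> ` V" "s \<in> \<psi> ` W" "(inv_into V \<phi> x, cis s) \<in> O'" using y by auto
      show ?thesis
        using d_gamma_coord[OF circ.smooth_nearI[OF u O(1) xs(4)] c chart_inv(2)[OF xs(2)] cc] C(7)[OF xs(3)] chart_inv(1)[OF xs(2)]
        by (simp add: coord_def[of _ "\<lambda>p. d_gamma M p u"] xs(1))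
    qed
    then show "smooth_on ?S (coord (V, \<phi>) (\<lambda>p. d_gamma M p u))"
      using smooth_on_cong[OF S(1), of "coord (V, \<phi>) (\<lambda>p. d_gamma M p u)" "\<lambda>y. frechet_derivative (coord (V, \<phi>) u) (at y) (0, 1)"]
        smooth_on_frechet[OF S(2,1)] by blast
  qed
qed

lemma pullback_smooth:
  assumes u: "smooth_fun M U u" and U: "openin (mtop M) U"
  shows "smooth_fun N (U \<times> unit_circle) (\<lambda>p. u (fst p))" "openin (mtop N) (U \<times> unit_circle)"
proof -
  show O: "openin (mtop N) (U \<times> unit_circle)" unfolding bundle_top openin_prod_Times_iff using U by simp
  show "smooth_fun N (U \<times> unit_circle) (\<lambda>p. u (fst p))"
  proof (rule bundle_smooth_funI[OF O])
    fix V \<phi> W \<psi> assume c: "(V, \<phi>) \<in> charts M" and cc: "(W, \<psi>) \<in> charts circle"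
    let ?S = "{(x, s). x \<in> \<phi> ` V \<and> s \<in> \<psi> ` W \<and> (inv_into V \<phi> x, cis s) \<in> U \<times> unit_circle}"
    have e: "?S = \<phi> ` (U \<inter> V) \<times> \<psi> ` W"
      using inv_chart[OF c] chart_inv by (auto simp: image_iff)
    have o: "open ?S" unfolding e by (intro open_Times open_chart_image[OF c U] circle_chart(5)[OF cc])
    have "Ck_on k ?S (\<lambda>y. (u \<circ> inv_into V \<phi>) (fst y + 0))" for k
    proof (rule Ck_on_affine[OF open_chart_image[OF c U] o bounded_linear_fst])
      fix y assume "y \<in> ?S"
      then have "y \<in> \<phi> ` (U \<inter> V) \<times> \<psi> ` W" unfolding e .
      then show "fst y + 0 \<in> \<phi> ` (U \<inter> V)" by (simp add: mem_Times_iff)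
    qed (use smooth_funD[OF u c, unfolded smooth_on_def] in blast)
    then show "smooth_on ?S (coord (V, \<phi>) (\<lambda>p. u (fst p)))"
      by (simp add: smooth_on_def coord_def case_prod_beta')
  qed
qed

lemma lie_lift:
  assumes X: "vector_field M U X" and Y: "vector_field M U Y" and U: "openin (mtop M) U" and q: "q \<in> U" and z: "z \<in> unit_circle"
  shows "lie N (lift_vfield M X) (lift_vfield M Y) (q, z) u = lift_vfield M (lie M X Y) (q, z) u"
proof (cases "smooth_near N (q, z) u")
  case True
  have oU: "openin (mtop N) (U \<times> unit_circle)" unfolding bundle_top openin_prod_Times_iff using U by simp
  obtain O' where O: "openin (mtop N) O'" "(q, z) \<in> O'" "O' \<subseteq> U \<times> unit_circle" "smooth_fun N O' u"
    using circ.smooth_near_within[OF True oU] q z by blast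
  let ?O = "{q. (q, z) \<in> O'}"
  have o: "openin (mtop M) ?O" "q \<in> ?O" using openin_slice[OF O(1) z] O(2) by auto
  have inner: "X' q (\<lambda>q'. lift_vfield M Y' (q', z) u) = X' q (\<lambda>q'. Y' q' (\<lambda>q. u (q, z)))"
    if "vector_field M U X'" for X' Y'
    by (rule tangent_local[OF vector_field_tangent[OF that q] o])
      (use circ.smooth_nearI[OF O(4,1)] in \<open>auto simp: lift_vfield_def\<close>)
  have n: "smooth_near N (q, z) (\<lambda>p. lift_vfield M X p u)" "smooth_near N (q, z) (\<lambda>p. lift_vfield M Y p u)"
    by (rule circ.smooth_nearI[OF circ.vector_field_smooth[OF lift_vector_field[OF X U] O(1,3,4)] O(1,2)]
        circ.smooth_nearI[OF circ.vector_field_smooth[OF lift_vector_field[OF Y U] O(1,3,4)] O(1,2)])+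
  have "smooth_near M q (\<lambda>q. u (q, z))" by (rule near_slice[OF True z])
  then show ?thesis using True n inner[OF X, of Y] inner[OF Y, of X]
    by (simp add: lie_def lift_near)
qed (simp add: lie_def lift_vfield_def)

text \<open>In coordinates the coefficients of the lift do not depend on the angle, so the bracket vanishes by
  the symmetry of second derivatives.\<close>

lemma lie_lift_gamma:
  assumes X: "vector_field M U X" and U: "openin (mtop M) U" and q: "q \<in> U" and z: "z \<in> unit_circle"
  shows "lie N (lift_vfield M X) (d_gamma M) (q, z) u = 0"
proof (cases "smooth_near N (q, z) u")
  case True
  have oU: "openin (mtop N) (U \<times> unit_circle)" unfolding bundle_top openin_prod_Times_iff using U by simp
  obtain O' where O: "openin (mtop N) O'" "(q, z) \<in> O'" "O' \<subseteq> U \<times> unit_circle" "smooth_fun N O' u"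
    using circ.smooth_near_within[OF True oU] q z by blast
  have Xq: "X q \<in> tangent_space M q" by (rule vector_field_tangent[OF X q])
  obtain V \<phi> where c: "(V, \<phi>) \<in> charts M" "q \<in> V" using chart_cover tangent_topspace[OF Xq] by blast
  obtain W \<psi> where cc: "(W, \<psi>) \<in> charts circle" "z \<in> W" using circle_chart_exists[OF z] by blast
  note C = circle_chart[OF cc(1)] and S = coord_smooth[OF O(4,1) c(1) cc(1)]
  define S where "S = {(x, s). x \<in> \<phi> ` V \<and> s \<in> \<psi> ` W \<and> (inv_into V \<phi> x, cis s) \<in> O'}"
  have oS: "open S" and sS: "smooth_on S (coord (V, \<phi>) u)" using S by (simp_all add: S_def)
  have yS: "(\<phi> q, \<psi> z) \<in> S" using c cc O(2) inv_chart C(4) by (auto simp: S_def)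
  let ?d = "\<lambda>h y. frechet_derivative (coord (V, \<phi>) u) (at y) h"
  have pt: "x \<in> \<phi> ` V" "s \<in> \<psi> ` W" "(inv_into V \<phi> x, cis s) \<in> O'" if "(x, s) \<in> S" for x s using that by (simp_all add: S_def)
  have ng: "smooth_near N (q, z) (\<lambda>p. d_gamma M p u)" "smooth_near N (q, z) (\<lambda>p. lift_vfield M X p u)"
    by (rule circ.smooth_nearI[OF circ.vector_field_smooth[OF d_gamma_vector_field[OF U] O(1,3,4)] O(1,2)]
        circ.smooth_nearI[OF circ.vector_field_smooth[OF lift_vector_field[OF X U] O(1,3,4)] O(1,2)])+
  have g: "coord (V, \<phi>) (\<lambda>p. d_gamma M p u) y = ?d (0, 1) y" if y: "y \<in> S" for y
  proof -
    obtain x s where xs: "y = (x, s)" by fastforce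
    note p = pt[OF y[unfolded xs]]
    show ?thesis
      using d_gamma_coord[OF circ.smooth_nearI[OF O(4,1) p(3)] c(1) chart_inv(2)[OF p(1)] cc(1)] C(7)[OF p(2)] chart_inv(1)[OF p(1)]
      by (simp add: coord_def[of _ "\<lambda>p. d_gamma M p u"] xs)
  qed
  have "lift_vfield M X (q, z) (\<lambda>p. d_gamma M p u)
      = (\<Sum>b\<in>Basis. X q (\<lambda>q. \<phi> q \<bullet> b) * frechet_derivative (?d (0, 1)) (at (\<phi> q, \<psi> z)) (b, 0))"
    unfolding lift_coord[where X=X, OF Xq ng(1) c cc] by (subst frechet_derivative_cong(1)[OF oS yS g]) simp_all
  moreover have "d_gamma M (q, z) (\<lambda>p. lift_vfield M X p u)
      = (\<Sum>b\<in>Basis. X q (\<lambda>q. \<phi> q \<bullet> b) * frechet_derivative (?d (b, 0)) (at (\<phi> q, \<psi> z)) (0, 1))"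
  proof -
    let ?T = "{t. (\<phi> q, \<psi> z + t) \<in> S}"
    have oT: "open ?T"
    proof -
      have "continuous_on UNIV (\<lambda>t. (\<phi> q, \<psi> z + t))" by (intro continuous_intros)
      from open_vimage[OF oS this] show ?thesis by (simp add: vimage_def)
    qed
    have eq: "lift_vfield M X (q, z * cis t) u = (\<Sum>b\<in>Basis. X q (\<lambda>q. \<phi> q \<bullet> b) * ?d (b, 0) (\<phi> q, \<psi> z + t))" if t: "t \<in> ?T" for t
    proof -
      have p: "\<phi> q \<in> \<phi> ` V" "\<psi> z + t \<in> \<psi> ` W" "(q, cis (\<psi> z + t)) \<in> O'"
        using pt[of "\<phi> q" "\<psi> z + t"] t inv_chart[OF c] by simp_all
      have "z * cis t = cis (\<psi> z + t)" using C(4)[OF cc(2)] by (simp add: cis_mult[symmetric])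
      then show ?thesis
        using lift_coord[where X=X, OF Xq circ.smooth_nearI[OF O(4,1) p(3)] c cc(1)] C(7)[OF p(2)] by simp
    qed
    have "((\<lambda>t. \<Sum>b\<in>Basis. X q (\<lambda>q. \<phi> q \<bullet> b) * ?d (b, 0) (\<phi> q, \<psi> z + t)) has_real_derivative
        (\<Sum>b\<in>Basis. X q (\<lambda>q. \<phi> q \<bullet> b) * frechet_derivative (?d (b, 0)) (at (\<phi> q, \<psi> z)) (0, 1))) (at 0)"
    proof (intro DERIV_sum DERIV_cmult)
      fix b :: 'e
      have D: "(?d (b, 0) has_derivative frechet_derivative (?d (b, 0)) (at (\<phi> q, \<psi> z))) (at (\<phi> q, \<psi> z))"
        by (rule smooth_on_has_derivative[OF smooth_on_frechet[OF sS oS] oS yS])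
      have 1: "((\<lambda>t. (\<phi> q, \<psi> z + t)) has_derivative (\<lambda>t. (0, t))) (at 0)" by (auto intro!: derivative_eq_intros)
      have D0: "(?d (b, 0) has_derivative frechet_derivative (?d (b, 0)) (at (\<phi> q, \<psi> z))) (at (\<phi> q, \<psi> z + 0))"
        using D by simp
      have "((\<lambda>t. ?d (b, 0) (\<phi> q, \<psi> z + t)) has_derivative (\<lambda>t. frechet_derivative (?d (b, 0)) (at (\<phi> q, \<psi> z)) (0, t))) (at 0)"
        by (rule has_derivative_compose[OF 1 D0])
      moreover have "(\<lambda>t. frechet_derivative (?d (b, 0)) (at (\<phi> q, \<psi> z)) (0, t)) = (*) (frechet_derivative (?d (b, 0)) (at (\<phi> q, \<psi> z)) (0, 1))"
      proof
        fix t show "frechet_derivative (?d (b, 0)) (at (\<phi> q, \<psi> z)) (0, t) = frechet_derivative (?d (b, 0)) (at (\<phi> q, \<psi> z)) (0, 1) * t"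
          using linear_scale[OF has_derivative_linear[OF D], of t "(0, 1)"] by (simp add: mult.commute)
      qed
      ultimately show "((\<lambda>t. ?d (b, 0) (\<phi> q, \<psi> z + t)) has_real_derivative frechet_derivative (?d (b, 0)) (at (\<phi> q, \<psi> z)) (0, 1)) (at 0)"
        unfolding has_field_derivative_def by (simp only:)
    qed
    then have "((\<lambda>t. lift_vfield M X (q, z * cis t) u) has_real_derivative
        (\<Sum>b\<in>Basis. X q (\<lambda>q. \<phi> q \<bullet> b) * frechet_derivative (?d (b, 0)) (at (\<phi> q, \<psi> z)) (0, 1))) (at 0)"
      by (rule has_field_derivative_transform_within_open[OF _ oT]) (use yS eq in auto)
    from DERIV_imp_deriv[OF this] show ?thesis using ng(2) by (simp add: d_gamma_def)
  qed
  moreover have "frechet_derivative (?d (0, 1)) (at (\<phi> q, \<psi> z)) (b, 0) = frechet_derivative (?d (b, 0)) (at (\<phi> q, \<psi> z)) (0, 1)" for b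
    by (rule frechet_derivative_commute[OF oS yS]) (use sS in \<open>simp add: smooth_on_def\<close>)
  ultimately show ?thesis using True by (simp add: lie_def)
qed (simp add: lie_def)

end

section \<open>The Levi-Civita connection in a moving frame\<close>

lemma matrix_inv_eqI:
  assumes "A ** B = mat 1" "B ** A = mat 1" shows "matrix_inv A = (B :: real ^ 'm ^ 'm)"
proof -
  have "A ** matrix_inv A = mat 1 \<and> matrix_inv A ** A = mat 1"
    unfolding matrix_inv_def by (rule someI[of _ B]) (use assms in blast)
  then have "matrix_inv A = B ** A ** matrix_inv A" "B ** (A ** matrix_inv A) = B" using assms by simp_all
  then show ?thesis by (simp add: matrix_mul_assoc)
qed

text \<open>Here \<open>G\<close> and \<open>H\<close> are the metric and its inverse in the frame and \<open>C\<close> are the structure functions. The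
  connection \<open>D\<close> acts on vector fields given on all of \<open>U\<close>.\<close>

locale metric_frame = frame_field N U F
  for N :: "('a, 'e::euclidean_space) manifold" and U :: "'a set" and F :: "'n::finite \<Rightarrow> 'a vfield" +
  fixes G H :: "'a \<Rightarrow> 'n \<Rightarrow> 'n \<Rightarrow> real" and C :: "'a \<Rightarrow> 'n \<Rightarrow> 'n \<Rightarrow> 'n \<Rightarrow> real"
    and g :: "'a form2" and D :: "'a vfield \<Rightarrow> 'a vfield \<Rightarrow> 'a vfield"
  assumes F_field: "vector_field N U (F i)"
    and G_smooth: "smooth_fun N U (\<lambda>p. G p i j)"
    and C_smooth: "smooth_fun N U (\<lambda>p. C p i j k)"
    and G_sym: "G p i j = G p j i"
    and H_inverse: "p \<in> U \<Longrightarrow> (\<Sum>m\<in>UNIV. G p i m * H p m j) = (if i = j then 1 else 0)"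
    and lie_F: "p \<in> U \<Longrightarrow> lie N (F i) (F j) p = (\<lambda>u. \<Sum>m\<in>UNIV. C p i j m * F m p u)"
    and lie_field: "vector_field N U (lie N (F i) (F j))"
    and g_def: "p \<in> U \<Longrightarrow> g p v w = (\<Sum>i\<in>UNIV. \<Sum>j\<in>UNIV. G p i j * coframe F p v $ i * coframe F p w $ j)"
    and lc: "levi_civita N U g D"
begin

abbreviation "vf \<equiv> vector_field N U"

lemma D_field: "vf X \<Longrightarrow> vf Y \<Longrightarrow> vf (D X Y)"
  using lc unfolding levi_civita_def by blast

lemma lc_rules:
  assumes "vf X" "vf Y" "vf W" "p \<in> U"
  shows "W p (\<lambda>q. g q (X q) (Y q)) = g p (D W X p) (Y p) + g p (X p) (D W Y p)"
    "(\<lambda>u. D X Y p u - D Y X p u) = lie N X Y p"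
proof -
  have "vf X \<and> vf Y \<and> vf W \<and> smooth_fun N U (\<lambda>q. 0)" using assms smooth_fun_const[OF U_open] by blast
  from lc[unfolded levi_civita_def, THEN conjunct2, rule_format, OF this assms(4)]
  show "W p (\<lambda>q. g q (X q) (Y q)) = g p (D W X p) (Y p) + g p (X p) (D W Y p)"
    "(\<lambda>u. D X Y p u - D Y X p u) = lie N X Y p" by (simp_all only: conj_assoc)
qed

text \<open>Lowering the index: the metric is nondegenerate, so these numbers determine a tangent vector, and
  they are what the connection axioms speak about.\<close>

definition low :: "'a \<Rightarrow> 'a tvec \<Rightarrow> 'n \<Rightarrow> real" where "low p v k = g p v (F k p)"

lemma low_eq: "p \<in> U \<Longrightarrow> low p v k = (\<Sum>i\<in>UNIV. G p i k * coframe F p v $ i)"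
  by (simp add: low_def g_def coframe_F axis_def if_distrib[of "\<lambda>x. _ * x"] cong: if_cong)

lemma g_sym: "p \<in> U \<Longrightarrow> g p v w = g p w v"
proof -
  assume p: "p \<in> U"
  have "g p v w = (\<Sum>i\<in>UNIV. \<Sum>j\<in>UNIV. G p j i * coframe F p v $ j * coframe F p w $ i)"
    unfolding g_def[OF p] by (rule sum.swap)
  then show ?thesis unfolding g_def[OF p] by (simp add: G_sym[of p] mult_ac)
qed

lemma g_FF: "p \<in> U \<Longrightarrow> g p (F i p) (F j p) = G p i j"
  unfolding low_def[symmetric] by (simp add: low_eq coframe_F axis_def if_distrib[of "\<lambda>x. _ * x"] cong: if_cong)

lemma coframe_low: "p \<in> U \<Longrightarrow> coframe F p v $ m = (\<Sum>n\<in>UNIV. low p v n * H p n m)"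
proof -
  assume p: "p \<in> U"
  have "(\<Sum>n\<in>UNIV. low p v n * H p n m) = (\<Sum>n\<in>UNIV. \<Sum>i\<in>UNIV. coframe F p v $ i * (G p i n * H p n m))"
    by (simp add: low_eq[OF p] sum_distrib_left mult_ac)
  also have "\<dots> = (\<Sum>i\<in>UNIV. coframe F p v $ i * (\<Sum>n\<in>UNIV. G p i n * H p n m))"
    by (subst sum.swap) (simp add: sum_distrib_left)
  also have "\<dots> = coframe F p v $ m" by (simp add: H_inverse[OF p] if_distrib[of "\<lambda>x. _ * x"] cong: if_cong)
  finally show ?thesis by simp
qed

lemma g_low: "p \<in> U \<Longrightarrow> g p v w = (\<Sum>m\<in>UNIV. \<Sum>n\<in>UNIV. H p n m * low p v m * low p w n)"
proof -
  assume p: "p \<in> U"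
  have "g p v w = (\<Sum>m\<in>UNIV. low p v m * coframe F p w $ m)"
    unfolding g_def[OF p] by (subst sum.swap) (simp add: low_eq[OF p] sum_distrib_right)
  then show ?thesis by (simp add: coframe_low[OF p] sum_distrib_left mult_ac)
qed

lemma coframe_diff:
  assumes p: "p \<in> U" and v: "v \<in> tangent_space N p" and w: "w \<in> tangent_space N p" and z: "z \<in> tangent_space N p"
  shows "coframe F p (\<lambda>u. v u - w u - z u) = coframe F p v - coframe F p w - coframe F p z"
  by (rule coframe_eqI[OF p])
    (simp_all add: coframe_expand[OF p v] coframe_expand[OF p w] coframe_expand[OF p z] left_diff_distrib sum_subtractf
      tangent_not_smooth[OF F_tangent[OF p]])

lemma low_diff:
  assumes p: "p \<in> U" and v: "v \<in> tangent_space N p" and w: "w \<in> tangent_space N p" and z: "z \<in> tangent_space N p"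
  shows "low p (\<lambda>u. v u - w u - z u) k = low p v k - low p w k - low p z k"
  by (simp add: low_eq[OF p] coframe_diff[OF assms] right_diff_distrib sum_subtractf)

lemma low_combination:
  assumes p: "p \<in> U" and v: "\<And>u. smooth_near N p u \<Longrightarrow> v u = (\<Sum>m\<in>UNIV. a m * F m p u)" "\<And>u. \<not> smooth_near N p u \<Longrightarrow> v u = 0"
  shows "low p v k = (\<Sum>m\<in>UNIV. a m * G p m k)"
proof -
  have "coframe F p v = (\<chi> m. a m)" by (rule coframe_eqI[OF p]) (use v in simp_all)
  then show ?thesis by (simp add: low_eq[OF p] mult.commute)
qed

definition \<Gamma> :: "'a \<Rightarrow> 'n \<Rightarrow> 'n \<Rightarrow> 'n \<Rightarrow> real" where "\<Gamma> p i j k = g p (D (F i) (F j) p) (F k p)"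

definition C\<^sub>l :: "'a \<Rightarrow> 'n \<Rightarrow> 'n \<Rightarrow> 'n \<Rightarrow> real" where "C\<^sub>l p i j k = (\<Sum>m\<in>UNIV. C p i j m * G p m k)"

lemma metric_\<Gamma>: assumes p: "p \<in> U" shows "F i p (\<lambda>q. G q j k) = \<Gamma> p i j k + \<Gamma> p i k j"
proof -
  have "F i p (\<lambda>q. G q j k) = F i p (\<lambda>q. g q (F j q) (F k q))"
    by (rule tangent_local[OF F_tangent[OF p] U_open p]) (simp add: g_FF)
  then show ?thesis
    unfolding lc_rules(1)[OF F_field F_field F_field p] \<Gamma>_def g_sym[OF p, of "F j p"] .
qed

lemma torsion_\<Gamma>: assumes p: "p \<in> U" shows "\<Gamma> p i j k - \<Gamma> p j i k = C\<^sub>l p i j k"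
proof -
  have t: "D (F i) (F j) p \<in> tangent_space N p" for i j by (rule vector_field_tangent[OF D_field[OF F_field F_field] p])
  have "low p (lie N (F i) (F j) p) k = C\<^sub>l p i j k"
    unfolding C\<^sub>l_def by (rule low_combination[OF p])
      (simp_all add: lie_F[OF p] tangent_not_smooth[OF F_tangent[OF p]])
  moreover have "low p (\<lambda>u. D (F i) (F j) p u - D (F j) (F i) p u - (\<lambda>u. 0 * F i p u + 0 * F i p u) u) k
      = \<Gamma> p i j k - \<Gamma> p j i k"
  proof -
    have "coframe F p (\<lambda>u. D (F i) (F j) p u - D (F j) (F i) p u) = coframe F p (D (F i) (F j) p) - coframe F p (D (F j) (F i) p)"
      using coframe_lincomb[OF p t t, where a = 1 and b = "- 1"] by simp
    then show ?thesis by (simp add: \<Gamma>_def low_def[symmetric] low_eq[OF p] right_diff_distrib sum_subtractf)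
  qed
  ultimately show ?thesis using lc_rules(2)[OF F_field F_field F_field p] by simp
qed

text \<open>The Koszul formula: a connection that is metric and torsion free is determined by the metric.\<close>

lemma koszul:
  assumes p: "p \<in> U"
  shows "\<Gamma> p i j k = (F i p (\<lambda>q. G q j k) + F j p (\<lambda>q. G q i k) - F k p (\<lambda>q. G q i j)
    + C\<^sub>l p i j k - C\<^sub>l p j k i + C\<^sub>l p k i j) / 2"
  unfolding metric_\<Gamma>[OF p] torsion_\<Gamma>[OF p, symmetric] by simp

lemma near:
  assumes "p \<in> U" "smooth_near N p u" shows "smooth_near N p (\<lambda>q. F i q u)"
proof -
  obtain W where W: "openin (mtop N) W" "p \<in> W" "W \<subseteq> U" "smooth_fun N W u"
    using smooth_near_within[OF assms(2) U_open assms(1)] .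
  show ?thesis by (rule smooth_nearI[OF vector_field_smooth[OF F_field W(1,3,4)] W(1,2)])
qed

lemma smooth_near_sum:
  assumes "finite A" "p \<in> U" "\<And>i. i \<in> A \<Longrightarrow> smooth_near N p (u i)"
  shows "smooth_near N p (\<lambda>q. \<Sum>i\<in>A. u i q)"
  using assms(1,3)
proof (induction A rule: finite_induct)
  case empty then show ?case using smooth_nearI[OF smooth_fun_const[OF U_open] U_open assms(2)] by simp
qed (simp add: smooth_near_add)

lemma tangent_sum:
  assumes "finite A" "p \<in> U" "v \<in> tangent_space N p" "\<And>i. i \<in> A \<Longrightarrow> smooth_near N p (u i)"
  shows "v (\<lambda>q. \<Sum>i\<in>A. u i q) = (\<Sum>i\<in>A. v (u i))"
  using assms(1,4)
proof (induction A rule: finite_induct)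
  case empty then show ?case using tangent_const[OF assms(3)] by simp
next
  case (insert i A)
  then show ?case using tangent_add[OF assms(3), of "u i" "\<lambda>q. \<Sum>i\<in>A. u i q"] smooth_near_sum[OF insert(1) assms(2)] by simp
qed

lemma lie_lie:
  assumes p: "p \<in> U"
  shows "low p (lie N (lie N (F k) (F l)) (F j) p) i
    = (\<Sum>m\<in>UNIV. C p k l m * C\<^sub>l p m j i) - (\<Sum>m\<in>UNIV. F j p (\<lambda>q. C q k l m) * G p m i)"
proof -
  have Cn: "smooth_near N p (\<lambda>q. C q k l m)" for m by (rule smooth_nearI[OF C_smooth U_open p])
  let ?a = "\<lambda>n. (\<Sum>m\<in>UNIV. C p k l m * C p m j n) - F j p (\<lambda>q. C q k l n)"
  have "low p (lie N (lie N (F k) (F l)) (F j) p) i = (\<Sum>n\<in>UNIV. ?a n * G p n i)"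
  proof (rule low_combination[OF p])
    fix u assume u: "smooth_near N p u"
    have "F j p (\<lambda>q. lie N (F k) (F l) q u) = F j p (\<lambda>q. \<Sum>m\<in>UNIV. C q k l m * F m q u)"
      by (rule tangent_local[OF F_tangent[OF p] U_open p]) (simp add: lie_F)
    also have "\<dots> = (\<Sum>m\<in>UNIV. F j p (\<lambda>q. C q k l m) * F m p u + C p k l m * F j p (\<lambda>q. F m q u))"
      by (subst tangent_sum[OF _ p F_tangent[OF p]])
        (simp_all add: smooth_near_mult[OF Cn near[OF p u]] tangent_mult[OF F_tangent[OF p] Cn near[OF p u]])
    finally have "lie N (lie N (F k) (F l)) (F j) p u
        = (\<Sum>m\<in>UNIV. C p k l m * lie N (F m) (F j) p u - F j p (\<lambda>q. C q k l m) * F m p u)"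
      using u by (simp add: lie_def[of _ "lie N (F k) (F l)"] lie_def[of _ "F _" "F j"] lie_F[OF p] sum_subtractf sum.distrib right_diff_distrib)
    also have "\<dots> = (\<Sum>n\<in>UNIV. ?a n * F n p u)"
    proof -
      have "(\<Sum>m\<in>UNIV. C p k l m * (\<Sum>n\<in>UNIV. C p m j n * F n p u)) = (\<Sum>n\<in>UNIV. (\<Sum>m\<in>UNIV. C p k l m * C p m j n) * F n p u)"
        unfolding sum_distrib_left sum_distrib_right by (subst sum.swap) (simp add: mult_ac)
      then show ?thesis by (simp add: lie_F[OF p] sum_subtractf left_diff_distrib)
    qed
    finally show "lie N (lie N (F k) (F l)) (F j) p u = (\<Sum>n\<in>UNIV. ?a n * F n p u)" .
  qed (simp add: lie_def)
  moreover have "(\<Sum>n\<in>UNIV. (\<Sum>m\<in>UNIV. C p k l m * C p m j n) * G p n i) = (\<Sum>m\<in>UNIV. C p k l m * C\<^sub>l p m j i)"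
    unfolding C\<^sub>l_def sum_distrib_left sum_distrib_right by (subst sum.swap) (simp add: mult_ac)
  ultimately show ?thesis by (simp add: left_diff_distrib sum_subtractf)
qed

text \<open>The bracket is a vector field whose expansion in the frame has variable coefficients. Vanishing
  torsion moves it to the second argument of \<open>D\<close>, where metric compatibility applies.\<close>

lemma low_D_lie:
  assumes p: "p \<in> U"
  shows "low p (D (lie N (F k) (F l)) (F j) p) i = (\<Sum>m\<in>UNIV. C p k l m * \<Gamma> p m j i)"
proof -
  let ?X = "lie N (F k) (F l)"
  have t: "D ?X (F j) p \<in> tangent_space N p" "D (F j) ?X p \<in> tangent_space N p"
    by (rule vector_field_tangent[OF D_field[OF lie_field F_field] p] vector_field_tangent[OF D_field[OF F_field lie_field] p])+
  have gX: "g q (?X q) w = (\<Sum>m\<in>UNIV. C q k l m * low q w m)" if "q \<in> U" for q w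
  proof -
    have "coframe F q (?X q) = (\<chi> m. C q k l m)"
      by (rule coframe_eqI[OF that]) (simp_all add: lie_F[OF that] tangent_not_smooth[OF F_tangent[OF that]])
    then have "g q w (?X q) = (\<Sum>j\<in>UNIV. \<Sum>i\<in>UNIV. G q i j * coframe F q w $ i * C q k l j)"
      unfolding g_def[OF that] by (subst sum.swap) simp
    then show ?thesis by (simp add: g_sym[OF that, of "?X q"] low_eq[OF that] sum_distrib_left mult_ac)
  qed
  have Cn: "smooth_near N p (\<lambda>q. C q k l m)" "smooth_near N p (\<lambda>q. G q m i)" for m
    by (rule smooth_nearI[OF C_smooth U_open p] smooth_nearI[OF G_smooth U_open p])+
  have "F j p (\<lambda>q. g q (?X q) (F i q)) = F j p (\<lambda>q. \<Sum>m\<in>UNIV. C q k l m * G q m i)"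
    by (rule tangent_local[OF F_tangent[OF p] U_open p]) (simp add: gX low_def g_FF G_sym[of _ i])
  also have "\<dots> = (\<Sum>m\<in>UNIV. F j p (\<lambda>q. C q k l m) * G p m i + C p k l m * F j p (\<lambda>q. G q m i))"
    by (subst tangent_sum[OF _ p F_tangent[OF p]])
      (simp_all add: smooth_near_mult[OF Cn] tangent_mult[OF F_tangent[OF p] Cn])
  finally have 1: "low p (D (F j) ?X p) i + (\<Sum>m\<in>UNIV. C p k l m * \<Gamma> p j i m)
      = (\<Sum>m\<in>UNIV. F j p (\<lambda>q. C q k l m) * G p m i) + (\<Sum>m\<in>UNIV. C p k l m * (\<Gamma> p j m i + \<Gamma> p j i m))"
    unfolding lc_rules(1)[OF lie_field F_field F_field p] gX[OF p] metric_\<Gamma>[OF p]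
    by (simp add: low_def \<Gamma>_def sum.distrib)
  have 2: "low p (D ?X (F j) p) i - low p (D (F j) ?X p) i = low p (lie N ?X (F j) p) i"
  proof -
    have "coframe F p (lie N ?X (F j) p) = coframe F p (D ?X (F j) p) - coframe F p (D (F j) ?X p)"
      using coframe_lincomb[OF p t, where a = 1 and b = "- 1"] lc_rules(2)[OF lie_field F_field F_field p] by simp
    then show ?thesis by (simp add: low_eq[OF p] right_diff_distrib sum_subtractf)
  qed
  have "C\<^sub>l p m j i = \<Gamma> p m j i - \<Gamma> p j m i" for m using torsion_\<Gamma>[OF p, of m j i] by simp
  with 1 2 lie_lie[OF p, of k l j i] show ?thesis by (simp add: right_diff_distrib distrib_left sum_subtractf sum.distrib)
qed

text \<open>Metric compatibility turns the inner product of a second covariant derivative with \<open>F i\<close> into the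
  derivative of a connection coefficient and an inner product of two first covariant derivatives.\<close>

lemma Riemann_eq:
  assumes p: "p \<in> U"
  shows "Riemann N g D F p i j k l
    = F k p (\<lambda>q. \<Gamma> q l j i) - F l p (\<lambda>q. \<Gamma> q k j i)
      - (\<Sum>m\<in>UNIV. \<Sum>n\<in>UNIV. H p n m * \<Gamma> p l j m * \<Gamma> p k i n)
      + (\<Sum>m\<in>UNIV. \<Sum>n\<in>UNIV. H p n m * \<Gamma> p k j m * \<Gamma> p l i n)
      - (\<Sum>m\<in>UNIV. C p k l m * \<Gamma> p m j i)"
    and "Riemann_up N D F p i j k l = (\<Sum>n\<in>UNIV. Riemann N g D F p n j k l * H p n i)"
proof -
  have second: "low p (D (F k) (D (F l) (F j)) p) i
      = F k p (\<lambda>q. \<Gamma> q l j i) - (\<Sum>m\<in>UNIV. \<Sum>n\<in>UNIV. H p n m * \<Gamma> p l j m * \<Gamma> p k i n)" for k l i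
    using lc_rules(1)[OF D_field[OF F_field[of l] F_field[of j]] F_field[of i] F_field[of k] p]
      g_low[OF p, of "D (F l) (F j) p" "D (F k) (F i) p"] by (simp add: low_def \<Gamma>_def)
  have t: "D (F k) (D (F l) (F j)) p \<in> tangent_space N p" "D (F l) (D (F k) (F j)) p \<in> tangent_space N p"
      "D (lie N (F k) (F l)) (F j) p \<in> tangent_space N p"
    by (rule vector_field_tangent[OF D_field[OF F_field D_field[OF F_field F_field]] p]
        vector_field_tangent[OF D_field[OF lie_field F_field] p])+
  have low: "Riemann N g D F p i j k l = low p (curvature N D (F k) (F l) (F j) p) i" for i
    by (simp add: Riemann_def Riemann_up_def metric_comp_def low_eq[OF p] g_FF[OF p] G_sym[of p i])
  show "Riemann N g D F p i j k l
    = F k p (\<lambda>q. \<Gamma> q l j i) - F l p (\<lambda>q. \<Gamma> q k j i)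
      - (\<Sum>m\<in>UNIV. \<Sum>n\<in>UNIV. H p n m * \<Gamma> p l j m * \<Gamma> p k i n)
      + (\<Sum>m\<in>UNIV. \<Sum>n\<in>UNIV. H p n m * \<Gamma> p k j m * \<Gamma> p l i n)
      - (\<Sum>m\<in>UNIV. C p k l m * \<Gamma> p m j i)"
    unfolding low curvature_def low_diff[OF p t] second low_D_lie[OF p] by simp
  show "Riemann_up N D F p i j k l = (\<Sum>n\<in>UNIV. Riemann N g D F p n j k l * H p n i)"
    unfolding low Riemann_up_def by (rule coframe_low[OF p])
qed

lemma metric_inverse: assumes p: "p \<in> U" shows "matrix_inv (metric_comp g F p) = (\<chi> i j. H p i j)"
proof -
  let ?A = "metric_comp g F p" and ?B = "\<chi> i j. H p i j"
  have "?A ** ?B = mat 1"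
    by (simp add: metric_comp_def g_FF[OF p] matrix_matrix_mult_def H_inverse[OF p] mat_def vec_eq_iff)
  moreover from this have "?B ** ?A = mat 1" using matrix_left_right_inverse by metis
  ultimately show ?thesis by (rule matrix_inv_eqI)
qed

end

section \<open>The frame of the circle bundle\<close>

lemma UNIV_index: "(UNIV :: 3 option set) = {Some 0, Some 1, Some 2, None}"
  unfolding UNIV_option_conv UNIV_3' by auto

lemma sum_index: "(\<Sum>i\<in>(UNIV :: 3 option set). t i) = t (Some 0) + t (Some 1) + t (Some 2) + t None"
proof -
  have "(\<Sum>i\<in>(UNIV :: 3 option set). t i) = (\<Sum>i\<in>{Some 0, Some 1, Some 2, None :: 3 option}. t i)" by (simp only: UNIV_index)
  also have "\<dots> = t (Some 0) + t (Some 1) + t (Some 2) + t None" by (simp add: add.assoc)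
  finally show ?thesis .
qed

lemma forall_index: "(\<forall>i :: 3 option. P i) \<longleftrightarrow> P (Some 0) \<and> P (Some 1) \<and> P (Some 2) \<and> P None"
proof -
  have "(\<forall>i :: 3 option. P i) \<longleftrightarrow> (\<forall>i\<in>{Some 0, Some 1, Some 2, None}. P i)" unfolding UNIV_index[symmetric] by simp
  then show ?thesis by simp
qed

context smooth_atlas
begin

text \<open>Functions on the base do not distinguish \<open>\<partial>\<^sub>\<gamma>\<close> from \<open>0\<close>. The sine of the angle does, and this gives the
  linear independence of the frame.\<close>

lemma angle_function:
  assumes q: "q \<in> topspace (mtop M)" and z: "z \<in> unit_circle"
  shows "smooth_near N (q, z) (\<lambda>p. Im (snd p / z))" "d_gamma M (q, z) (\<lambda>p. Im (snd p / z)) = 1"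
proof -
  have z0: "z \<noteq> 0" "norm z = 1" using z by auto
  then obtain \<theta> where th: "z = cis \<theta>" using cis_Arg[of z] by (metis div_by_1 of_real_1 sgn_eq)
  have O: "openin (mtop N) (topspace (mtop M) \<times> unit_circle)" unfolding bundle_top openin_prod_Times_iff by simp
  have "smooth_fun N (topspace (mtop M) \<times> unit_circle) (\<lambda>p. Im (snd p / z))"
  proof (rule bundle_smooth_funI[OF O])
    fix V \<phi> W \<psi> assume c: "(V, \<phi>) \<in> charts M" and cc: "(W, \<psi>) \<in> charts circle"
    let ?S = "{(x, s). x \<in> \<phi> ` V \<and> s \<in> \<psi> ` W \<and> (inv_into V \<phi> x, cis s) \<in> topspace (mtop M) \<times> unit_circle}"
    have e: "?S = \<phi> ` V \<times> \<psi> ` W"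
      using inv_chart[OF c] openin_subset[OF chart_openin[OF c]] by auto
    have o: "open ?S" unfolding e by (intro open_Times chart_image[OF c] circle_chart(5)[OF cc])
    have G: "((\<lambda>t. sin (t + real n * (pi / 2) - \<theta>)) has_real_derivative sin (t + real (Suc n) * (pi / 2) - \<theta>)) (at t)" for n t
    proof -
      have "sin (t + real (Suc n) * (pi / 2) - \<theta>) = cos (t + real n * (pi / 2) - \<theta>)"
      proof -
        have "t + real (Suc n) * (pi / 2) - \<theta> = (t + real n * (pi / 2) - \<theta>) + pi / 2" by (simp add: field_simps)
        then show ?thesis by (simp only: sin_add) simp
      qed
      then show ?thesis by (auto intro!: derivative_eq_intros)
    qed
    have "Ck_on k ?S (\<lambda>y. sin (snd y + real 0 * (pi / 2) - \<theta>))" for k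
      by (rule Ck_on_compose_real[where G = "\<lambda>n t. sin (t + real n * (pi / 2) - \<theta>)", OF o G Ck_on_linear[OF o bounded_linear_snd]])
    moreover have "coord (V, \<phi>) (\<lambda>p. Im (snd p / z)) = (\<lambda>y. sin (snd y + real 0 * (pi / 2) - \<theta>))"
      by (rule ext) (simp add: coord_def th cis_divide split: prod.splits)
    ultimately show "smooth_on ?S (coord (V, \<phi>) (\<lambda>p. Im (snd p / z)))" by (simp add: smooth_on_def)
  qed
  from circ.smooth_nearI[OF this O] show n: "smooth_near N (q, z) (\<lambda>p. Im (snd p / z))" using q z by simp
  have "(sin has_real_derivative 1) (at 0)" using DERIV_sin[of 0] by simp
  from DERIV_imp_deriv[OF this] show "d_gamma M (q, z) (\<lambda>p. Im (snd p / z)) = 1"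
    using n z0(1) by (simp add: d_gamma_def)
qed

lemma near_pullback:
  assumes "smooth_near M q u" "z \<in> unit_circle" shows "smooth_near N (q, z) (\<lambda>p. u (fst p))"
proof -
  obtain V where V: "openin (mtop M) V" "q \<in> V" "smooth_fun M V u" using assms(1) unfolding smooth_near_def by blast
  show ?thesis by (rule circ.smooth_nearI[OF pullback_smooth[OF V(3,1)]]) (use V assms in simp)
qed

end

context contact_frame
begin

abbreviation UU where "UU \<equiv> U \<times> unit_circle"
abbreviation FF where "FF \<equiv> fefferman_frame M f"

lemma FF_eq: "FF (Some k) = lift_vfield M (f k)" "FF None = d_gamma M"
  unfolding fefferman_frame_def by (simp_all add: fun_eq_iff)

lemma UU_open: "openin (mtop N) UU" unfolding bundle_top openin_prod_Times_iff using U_open by simp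

lemma FF_field: "vector_field N UU (FF i)"
  by (cases i) (simp_all add: FF_eq d_gamma_vector_field[OF U_open] lift_vector_field[OF F_field U_open])

definition E :: "3 option \<Rightarrow> ('a \<Rightarrow> real) \<Rightarrow> 'a \<Rightarrow> real" where
  "E i u = (case i of Some k \<Rightarrow> D k u | None \<Rightarrow> (\<lambda>q. 0))"

lemma FF_near:
  assumes q: "q \<in> U" and z: "z \<in> unit_circle" and u: "smooth_near M q u"
  shows "FF (Some k) (q, z) (\<lambda>p. u (fst p)) = f k q u" "FF None (q, z) (\<lambda>p. u (fst p)) = 0"
  using near_pullback[OF u z] by (simp_all add: FF_eq lift_near d_gamma_def)

lemma FF_pullback:
  assumes q: "q \<in> U" and z: "z \<in> unit_circle" and u: "sm u"
  shows "FF i (q, z) (\<lambda>p. u (fst p)) = E i u q"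
  using FF_near[OF q z sm_near[OF q u]] by (cases i) (simp_all add: E_def f_D q)

lemma FF_frame: "frame_field N UU FF"
proof (intro frame_field.intro frame_field_axioms.intro bundle_chart_system UU_open)
  fix p i assume p: "p \<in> UU"
  then show "FF i p \<in> tangent_space N p" using FF_field[of i] unfolding vector_field_def by blast
next
  fix p v assume p: "p \<in> UU" and v: "v \<in> tangent_space N p"
  obtain q z where qz: "p = (q, z)" "q \<in> U" "z \<in> unit_circle" using p by auto
  obtain v0 s where v0: "v0 \<in> tangent_space M q" and vu: "\<And>u. v u = lift_vfield M (\<lambda>_. v0) (q, z) u + s * d_gamma M (q, z) u"
    using bundle_tangent_cases[OF v[unfolded qz]] by metis
  obtain c where c: "v0 = (\<lambda>u. \<Sum>k\<in>UNIV. c $ k * f k q u)" using F_span[OF qz(2) v0] by blast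
  show "\<exists>c. v = (\<lambda>u. \<Sum>i\<in>UNIV. c $ i * FF i p u)"
    by (rule exI[of _ "\<chi> i. case i of Some k \<Rightarrow> c $ k | None \<Rightarrow> s"], rule ext)
      (simp add: vu qz sum_index FF_eq sum_3' lift_vfield_def c)
next
  fix p and c :: "real ^ (3 option)"
  assume p: "p \<in> UU" and z0: "\<And>u. smooth_near N p u \<Longrightarrow> (\<Sum>i\<in>UNIV. c $ i * FF i p u) = 0"
  obtain q z where qz: "p = (q, z)" "q \<in> U" "z \<in> unit_circle" using p by auto
  have "(\<chi> k. c $ Some k) = 0"
  proof (rule F_indep[OF qz(2)])
    fix u assume u: "smooth_near M q u"
    show "(\<Sum>k\<in>UNIV. (\<chi> k. c $ Some k) $ k * f k q u) = 0"
      using z0[unfolded qz, OF near_pullback[OF u qz(3)]] FF_near[OF qz(2,3) u] by (simp add: sum_index sum_3')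
  qed
  then have 1: "c $ Some k = 0" for k by (simp add: vec_eq_iff)
  have "q \<in> topspace (mtop M)" using qz(2) U_open openin_subset by blast
  note an = angle_function[OF this qz(3)]
  have "c $ None = 0" using z0[unfolded qz, OF an(1)] an(2) by (simp add: sum_index 1 FF_eq)
  then show "c = 0" unfolding vec_eq_iff forall_index by (simp add: 1)
qed

text \<open>The structure coefficients of the frame: the brackets with \<open>\<partial>\<^sub>\<gamma>\<close> vanish, the others are those of the
  contact frame.\<close>

definition base_bracket :: "3 \<Rightarrow> 3 \<Rightarrow> 3 \<Rightarrow> 'a \<Rightarrow> real" where
  "base_bracket k l n =
     (if k = 2 \<and> l = 1 then (if n = 0 then (\<lambda>q. 1) else if n = 1 then x else y)
      else if k = 1 \<and> l = 0 then (if n = 0 then (\<lambda>q. 0) else if n = 1 then a else b)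
      else if k = 2 \<and> l = 0 then (if n = 0 then (\<lambda>q. 0) else if n = 1 then d else (\<lambda>q. - a q))
      else (\<lambda>q. 0))"

definition cst3 :: "3 \<Rightarrow> 3 \<Rightarrow> 3 \<Rightarrow> 'a \<Rightarrow> real" where
  "cst3 k l n = (\<lambda>q. base_bracket k l n q - base_bracket l k n q)"

lemma cst3_values:
  "cst3 2 1 0 = (\<lambda>q. 1)" "cst3 2 1 1 = x" "cst3 2 1 2 = y" "cst3 1 0 0 = (\<lambda>q. 0)" "cst3 1 0 1 = a" "cst3 1 0 2 = b"
  "cst3 2 0 0 = (\<lambda>q. 0)" "cst3 2 0 1 = d" "cst3 2 0 2 = (\<lambda>q. - a q)" "cst3 k k n = (\<lambda>q. 0)"
  "cst3 1 2 n = (\<lambda>q. - cst3 2 1 n q)" "cst3 0 1 n = (\<lambda>q. - cst3 1 0 n q)" "cst3 0 2 n = (\<lambda>q. - cst3 2 0 n q)"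
  by (simp_all add: cst3_def base_bracket_def)

lemma coframe_lie:
  assumes q: "q \<in> U" shows "coframe f q (lie M (f k) (f l) q) $ n = cst3 k l n q"
proof -
  have swap: "coframe f q (lie M (f l) (f k) q) = - coframe f q (lie M (f k) (f l) q)" for k l
  proof -
    have "lie M (f l) (f k) q = (\<lambda>u. (- 1) * lie M (f k) (f l) q u + 0 * lie M (f k) (f l) q u)"
      using lie_antisym[of "f l" "f k" q] by (simp add: fun_eq_iff)
    then show ?thesis using coframe_lincomb[OF q lie_tangent[OF q, of k l] lie_tangent[OF q, of k l], of "- 1" 0] by simp
  qed
  have zero: "coframe f q (lie M (f k) (f k) q) $ n = 0" for k n
    using arg_cong[OF swap[of k k], of "\<lambda>v. v $ n"] by simp
  have neg: "coframe f q (lie M (f l) (f k) q) $ n = - (coframe f q (lie M (f k) (f l) q) $ n)" for k l n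
    using arg_cong[OF swap[of k l], of "\<lambda>v. v $ n"] by simp
  have "\<forall>k l n. coframe f q (lie M (f k) (f l) q) $ n = cst3 k l n q"
    unfolding forall_3'
    using c_D(1-6)[OF q] br21[OF q] br10[OF q] br20[OF q]
    by (simp add: cst3_values zero neg[of 2 1] neg[of 1 0] neg[of 2 0] c12_def c10_def c20_def)
  then show ?thesis by blast
qed

definition cst :: "3 option \<Rightarrow> 3 option \<Rightarrow> 3 option \<Rightarrow> 'a \<Rightarrow> real" where
  "cst i j m = (case (i, j, m) of (Some k, Some l, Some n) \<Rightarrow> cst3 k l n | _ \<Rightarrow> (\<lambda>q. 0))"

lemma cst_simps [simp]:
  "cst (Some k) (Some l) (Some n) = cst3 k l n" "cst i j None = (\<lambda>q. 0)" "cst i None m = (\<lambda>q. 0)" "cst None j m = (\<lambda>q. 0)"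
  by (simp_all add: cst_def split: option.splits)

lemma sm_cst: "sm (cst i j m)"
proof -
  have "sm (cst3 k l n)" for k l n unfolding cst3_def base_bracket_def by simp
  then show ?thesis by (cases i; cases j; cases m) simp_all
qed

lemma lie_FF:
  assumes q: "q \<in> U" and z: "z \<in> unit_circle"
  shows "lie N (FF i) (FF j) (q, z) = (\<lambda>u. \<Sum>m\<in>UNIV. cst i j m q * FF m (q, z) u)"
proof
  fix u
  consider (b) k l where "i = Some k" "j = Some l" | (r) k where "i = Some k" "j = None" | (l) k where "i = None" "j = Some k"
    | (n) "i = None" "j = None" by (metis option.exhaust)
  then show "lie N (FF i) (FF j) (q, z) u = (\<Sum>m\<in>UNIV. cst i j m q * FF m (q, z) u)"
  proof cases
    case b
    have "lie M (f k) (f l) q v = (\<Sum>n\<in>UNIV. cst3 k l n q * f n q v)" for v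
      using coframe_expand[OF q lie_tangent[OF q]] by (simp add: coframe_lie[OF q])
    then show ?thesis using lie_lift[OF F_field[of k] F_field[of l] U_open q z, of u]
      by (cases "smooth_near N (q, z) u") (simp_all add: b FF_eq sum_index sum_3' lift_near)
  next
    case r then show ?thesis using lie_lift_gamma[OF F_field U_open q z] by (simp add: FF_eq)
  next
    case l
    have "lie N (d_gamma M) (lift_vfield M (f k)) (q, z) u = - lie N (lift_vfield M (f k)) (d_gamma M) (q, z) u" by (simp add: lie_def)
    then show ?thesis using lie_lift_gamma[OF F_field U_open q z] l by (simp add: FF_eq)
  qed (simp add: lie_def)
qed

lemma lie_FF_field: "vector_field N UU (lie N (FF i) (FF j))"
proof -
  have zero: "vector_field N UU (lift_vfield M (\<lambda>q u. 0))"
  proof (rule lift_vector_field[OF _ U_open])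
    show "vector_field M U (\<lambda>q u. 0)"
      using vector_field_lincomb[OF U_open F_field[of 0] F_field[of 0] smooth_fun_const[OF U_open] smooth_fun_const[OF U_open], of 0 0] by simp
  qed
  show ?thesis
  proof (cases "i = None \<or> j = None")
    case True
    show ?thesis
    proof (rule circ.vector_field_cong[OF UU_open _ zero])
      fix p assume "p \<in> UU"
      then show "lift_vfield M (\<lambda>q u. 0) p = lie N (FF i) (FF j) p"
        using True by (cases p) (auto simp: lie_FF lift_vfield_def)
    qed
  next
    case False
    then obtain k l where kl: "i = Some k" "j = Some l" by auto
    show ?thesis
    proof (rule circ.vector_field_cong[OF UU_open _ lift_vector_field[OF lie_vector_field[OF F_field[of k] F_field[of l] U_open] U_open]])
      fix p assume "p \<in> UU"
      then show "lift_vfield M (lie M (f k) (f l)) p = lie N (FF i) (FF j) p"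
        using lie_lift[OF F_field[of k] F_field[of l] U_open] by (cases p) (auto simp: kl FF_eq)
    qed
  qed
qed

lemma sm_divide [simp]: "sm u \<Longrightarrow> sm (\<lambda>q. u q / c)"
  using smooth_fun_mult[OF U_open, of u "\<lambda>q. 1 / c"] smooth_fun_const[OF U_open] by simp

lemma D_divide: "sm u \<Longrightarrow> D i (\<lambda>q. u q / c) = (\<lambda>q. D i u q / c)"
  using D_simps(5)[of u "\<lambda>q. 1 / c" i] by (simp add: D_simps(1))

text \<open>The component along \<open>f 0\<close>. It is a defined constant, to be treated as an unknown function as long as
  possible: written out, its derivatives would dominate every formula for the curvature.\<close>

definition G0 :: "'a \<Rightarrow> real" where
  "G0 = (\<lambda>q. (b q - d q) / 2 + (x q * x q + y q * y q + D 1 y q - D 2 x q) / 3)"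

definition xy :: "3 \<Rightarrow> 'a \<Rightarrow> real" where "xy k = (if k = 1 then x else y)"

definition gm :: "3 option \<Rightarrow> 3 option \<Rightarrow> 'a \<Rightarrow> real" where
  "gm i j = (case (i, j) of
     (Some k, Some l) \<Rightarrow>
       if k = 0 \<and> l = 0 then G0 else if k = 0 then (\<lambda>q. - (2 / 3) * xy l q) else if l = 0 then (\<lambda>q. - (2 / 3) * xy k q)
       else if k = l then (\<lambda>q. 1) else (\<lambda>q. 0)
   | (Some k, None) \<Rightarrow> (if k = 0 then (\<lambda>q. 2 / 3) else (\<lambda>q. 0))
   | (None, Some k) \<Rightarrow> (if k = 0 then (\<lambda>q. 2 / 3) else (\<lambda>q. 0))
   | (None, None) \<Rightarrow> (\<lambda>q. 0))"

definition hm :: "3 option \<Rightarrow> 3 option \<Rightarrow> 'a \<Rightarrow> real" where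
  "hm i j = (case (i, j) of
     (Some k, Some l) \<Rightarrow> (if k = l \<and> k \<noteq> 0 then (\<lambda>q. 1) else (\<lambda>q. 0))
   | (Some k, None) \<Rightarrow> (if k = 0 then (\<lambda>q. 3 / 2) else xy k)
   | (None, Some k) \<Rightarrow> (if k = 0 then (\<lambda>q. 3 / 2) else xy k)
   | (None, None) \<Rightarrow> (\<lambda>q. x q * x q + y q * y q - 9 / 4 * G0 q))"

lemma sm_G0 [simp]: "sm G0" unfolding G0_def by simp

lemma gm_values:
  "gm (Some 0) (Some 0) = G0" "gm (Some 0) (Some 1) = (\<lambda>q. - (2 / 3) * x q)" "gm (Some 0) (Some 2) = (\<lambda>q. - (2 / 3) * y q)"
  "gm (Some 1) (Some 0) = (\<lambda>q. - (2 / 3) * x q)" "gm (Some 2) (Some 0) = (\<lambda>q. - (2 / 3) * y q)"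
  "gm (Some 1) (Some 1) = (\<lambda>q. 1)" "gm (Some 1) (Some 2) = (\<lambda>q. 0)" "gm (Some 2) (Some 1) = (\<lambda>q. 0)" "gm (Some 2) (Some 2) = (\<lambda>q. 1)"
  "gm (Some 0) None = (\<lambda>q. 2 / 3)" "gm None (Some 0) = (\<lambda>q. 2 / 3)" "gm (Some 1) None = (\<lambda>q. 0)" "gm (Some 2) None = (\<lambda>q. 0)"
  "gm None (Some 1) = (\<lambda>q. 0)" "gm None (Some 2) = (\<lambda>q. 0)" "gm None None = (\<lambda>q. 0)"
  by (simp_all add: gm_def xy_def)

lemma hm_values:
  "hm (Some 0) (Some l) = (\<lambda>q. 0)" "hm (Some l) (Some 0) = (\<lambda>q. 0)" "hm (Some 1) (Some 2) = (\<lambda>q. 0)" "hm (Some 2) (Some 1) = (\<lambda>q. 0)"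
  "hm (Some 1) (Some 1) = (\<lambda>q. 1)" "hm (Some 2) (Some 2) = (\<lambda>q. 1)"
  "hm (Some 0) None = (\<lambda>q. 3 / 2)" "hm None (Some 0) = (\<lambda>q. 3 / 2)" "hm (Some 1) None = x" "hm (Some 2) None = y"
  "hm None (Some 1) = x" "hm None (Some 2) = y" "hm None None = (\<lambda>q. x q * x q + y q * y q - 9 / 4 * G0 q)"
  by (simp_all add: hm_def xy_def)

lemma gm_sym: "gm i j = gm j i"
  by (auto simp: gm_def split: option.splits)

lemma hm_sym: "hm i j = hm j i"
  by (auto simp: hm_def split: option.splits)

lemma sm_gm [simp]: "sm (gm i j)"
proof -
  have "\<forall>i j. sm (gm i j)" unfolding forall_index by (simp add: gm_values)
  then show ?thesis by blast
qed

lemma hm_inverse: "(\<Sum>m\<in>UNIV. gm i m q * hm m j q) = (if i = j then 1 else 0)"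
proof -
  have "\<forall>i j. (\<Sum>m\<in>UNIV. gm i m q * hm m j q) = (if i = j then 1 else 0)"
    unfolding forall_index sum_index by (simp add: gm_values hm_values field_simps)
  then show ?thesis by blast
qed

lemma fefferman_comp_gm:
  assumes q: "q \<in> U" shows "fefferman_comp M f q i j = gm i j q"
proof -
  have "\<forall>i j. fefferman_comp M f q i j = gm i j q"
    unfolding forall_index fefferman_comp_def
    by (simp add: gm_values G0_def c_D f_D q power2_eq_square)
  then show ?thesis by blast
qed

text \<open>With this instance all components of the curvature become functions of the base point.\<close>

lemma fefferman_metric_frame:
  assumes lc: "levi_civita N UU (fefferman_metric M f) K"
  shows "metric_frame N UU FF (\<lambda>p i j. gm i j (fst p)) (\<lambda>p i j. hm i j (fst p)) (\<lambda>p i j m. cst i j m (fst p)) (fefferman_metric M f) K"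
proof (intro metric_frame.intro metric_frame_axioms.intro FF_frame)
  fix p i j v w
  show "fefferman_metric M f p v w = (\<Sum>i\<in>UNIV. \<Sum>j\<in>UNIV. gm i j (fst p) * coframe FF p v $ i * coframe FF p w $ j)" if "p \<in> UU"
    using that by (auto simp: fefferman_metric_def fefferman_comp_gm)
  show "lie N (FF i) (FF j) p = (\<lambda>u. \<Sum>m\<in>UNIV. cst i j m (fst p) * FF m p u)" if "p \<in> UU"
    using that lie_FF by (cases p) simp
qed (simp_all add: FF_field pullback_smooth(1)[OF _ U_open] sm_cst gm_sym hm_inverse lie_FF_field lc)

definition cl :: "3 option \<Rightarrow> 3 option \<Rightarrow> 3 option \<Rightarrow> 'a \<Rightarrow> real" where
  "cl i j k = (\<lambda>q. \<Sum>m\<in>UNIV. cst i j m q * gm m k q)"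

text \<open>The connection and its curvature, Ricci, scalar and Weyl curvature, transcribed into functions on
  the base; signs and the order of indices are those of the definition of \<open>Weyl\<close>.\<close>

definition \<gamma> :: "3 option \<Rightarrow> 3 option \<Rightarrow> 3 option \<Rightarrow> 'a \<Rightarrow> real" where
  "\<gamma> i j k = (\<lambda>q. (E i (gm j k) q + E j (gm i k) q - E k (gm i j) q + cl i j k q - cl j k i q + cl k i j q) / 2)"

definition Rm :: "3 option \<Rightarrow> 3 option \<Rightarrow> 3 option \<Rightarrow> 3 option \<Rightarrow> 'a \<Rightarrow> real" where
  "Rm i j k l = (\<lambda>q. E k (\<gamma> l j i) q - E l (\<gamma> k j i) q
      - (\<Sum>m\<in>UNIV. \<Sum>n\<in>UNIV. hm n m q * \<gamma> l j m q * \<gamma> k i n q)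
      + (\<Sum>m\<in>UNIV. \<Sum>n\<in>UNIV. hm n m q * \<gamma> k j m q * \<gamma> l i n q)
      - (\<Sum>m\<in>UNIV. cst k l m q * \<gamma> m j i q))"

definition Rc :: "3 option \<Rightarrow> 3 option \<Rightarrow> 'a \<Rightarrow> real" where
  "Rc i j = (\<lambda>q. \<Sum>k\<in>UNIV. \<Sum>n\<in>UNIV. Rm n i k j q * hm n k q)"

definition Sc :: "'a \<Rightarrow> real" where
  "Sc = (\<lambda>q. \<Sum>i\<in>UNIV. \<Sum>j\<in>UNIV. hm i j q * Rc j i q)"

definition Wm :: "3 option \<Rightarrow> 3 option \<Rightarrow> 3 option \<Rightarrow> 3 option \<Rightarrow> 'a \<Rightarrow> real" where
  "Wm i j k l = (\<lambda>q. Rm i j k l q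
     - (gm i k q * Rc j l q - gm i l q * Rc j k q - gm j k q * Rc i l q + gm j l q * Rc i k q) / 2
     + Sc q / 6 * (gm i k q * gm j l q - gm i l q * gm j k q))"

lemma sm_E [simp]: "sm u \<Longrightarrow> sm (E i u)"
  by (cases i) (simp_all add: E_def)

lemma sm_sum [simp]: "(\<And>i. i \<in> A \<Longrightarrow> sm (u i)) \<Longrightarrow> finite A \<Longrightarrow> sm (\<lambda>q. \<Sum>i\<in>A. u i q)"
  by (rule smooth_fun_sum[OF U_open]) auto

lemma sm_cl [simp]: "sm (cl i j k)"
  unfolding cl_def by (simp add: sm_cst)

lemma sm_\<gamma> [simp]: "sm (\<gamma> i j k)"
  unfolding \<gamma>_def by simp

lemma Weyl_Wm:
  assumes "levi_civita N UU (fefferman_metric M f) K" and that: "q \<in> U" "z \<in> unit_circle"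
  shows "Weyl N (fefferman_metric M f) K FF (q, z) i j k l = Wm i j k l q"
proof -
  interpret X: metric_frame N UU FF "\<lambda>p i j. gm i j (fst p)" "\<lambda>p i j. hm i j (fst p)" "\<lambda>p i j m. cst i j m (fst p)"
    "fefferman_metric M f" K by (rule fefferman_metric_frame[OF assms(1)])
  have G: "X.\<Gamma> p i j k = \<gamma> i j k (fst p)" if pU: "p \<in> UU" for p i j k
  proof -
    obtain q z where p: "p = (q, z)" "q \<in> U" "z \<in> unit_circle" using pU by (cases p) simp
    show ?thesis
      unfolding X.koszul[OF pU] X.C\<^sub>l_def \<gamma>_def cl_def unfolding p fst_conv by (simp add: FF_pullback[OF p(2,3)])
  qed
  have p: "(q, z) \<in> UU" using that by simp
  have FG: "FF i (q, z) (\<lambda>p. X.\<Gamma> p j k l) = E i (\<gamma> j k l) q" for i j k l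
  proof -
    have "FF i (q, z) (\<lambda>p. X.\<Gamma> p j k l) = FF i (q, z) (\<lambda>p. \<gamma> j k l (fst p))"
      by (rule circ.tangent_local[OF X.F_tangent[OF p] UU_open p G])
    then show ?thesis using FF_pullback[OF that] by simp
  qed
  have R: "Riemann N (fefferman_metric M f) K FF (q, z) i j k l = Rm i j k l q" for i j k l
    unfolding X.Riemann_eq(1)[OF p] FG G[OF p] Rm_def fst_conv ..
  have Ric: "Ricci N K FF (q, z) i j = Rc i j q" for i j
    unfolding Ricci_def X.Riemann_eq(2)[OF p] R Rc_def fst_conv ..
  have S: "scalar_curvature N (fefferman_metric M f) K FF (q, z) = Sc q"
    unfolding scalar_curvature_def X.metric_inverse[OF p] Ric Sc_def by simp
  have g: "metric_comp (fefferman_metric M f) FF (q, z) $ i $ j = gm i j q" for i j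
    by (simp add: metric_comp_def X.g_FF[OF p])
  show ?thesis unfolding Weyl_def Let_def R Ric S g Wm_def ..
qed

end

section \<open>The curvature of the Fefferman metric\<close>

context contact_frame
begin

lemma E_simps: "E (Some k) u = D k u" "E None u = (\<lambda>q. 0)" by (simp_all add: E_def)

lemma E_add: "sm u \<Longrightarrow> sm v \<Longrightarrow> E i (\<lambda>q. u q + v q) = (\<lambda>q. E i u q + E i v q)"
  by (cases i) (simp_all add: E_simps D_simps)

lemma E_commute:
  assumes "sm u" shows "E k (E l u) q - E l (E k u) q = (\<Sum>m\<in>UNIV. cst k l m q * E m u q)"
proof -
  have "\<forall>k l. E k (E l u) q - E l (E k u) q = (\<Sum>m\<in>UNIV. cst k l m q * E m u q)"
    unfolding forall_index sum_index by (simp add: E_simps cst3_values D_commute[OF assms] D_simps(1))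
  then show ?thesis by blast
qed

lemma cst_antisym: "cst j i m q = - cst i j m q"
  by (cases i; cases j; cases m) (simp_all add: cst3_def)

lemma cl_antisym: "cl j i k q = - cl i j k q"
  unfolding cl_def by (simp add: cst_antisym[of j i] sum_negf)

lemma \<gamma>_metric: "(\<lambda>q. \<gamma> l j i q + \<gamma> l i j q) = E l (gm i j)"
proof
  fix q
  show "\<gamma> l j i q + \<gamma> l i j q = E l (gm i j) q"
    unfolding \<gamma>_def gm_sym[of j i] gm_sym[of l i] gm_sym[of l j] cl_antisym[of j i] cl_antisym[of l i] cl_antisym[of l j]
    by (simp add: field_simps)
qed

text \<open>The first two indices of the curvature: the metric is parallel, and the frame satisfies
  its commutation relations on the functions \<open>gm i j\<close>.\<close>

lemma Rm_antisym: "Rm j i k l q = - Rm i j k l q" "Rm i j l k q = - Rm i j k l q"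
proof -
  have e: "E k (\<gamma> l j i) q + E k (\<gamma> l i j) q = E k (E l (gm i j)) q" for k l
    using fun_cong[OF E_add[of "\<gamma> l j i" "\<gamma> l i j" k], of q] by (simp add: \<gamma>_metric)
  have c: "(\<Sum>m\<in>UNIV. cst k l m q * \<gamma> m j i q) + (\<Sum>m\<in>UNIV. cst k l m q * \<gamma> m i j q) = (\<Sum>m\<in>UNIV. cst k l m q * E m (gm i j) q)"
    unfolding \<gamma>_metric[symmetric] by (simp add: sum.distrib distrib_left)
  have s: "(\<Sum>m\<in>UNIV. \<Sum>n\<in>UNIV. hm n m q * \<gamma> l j m q * \<gamma> k i n q) = (\<Sum>m\<in>UNIV. \<Sum>n\<in>UNIV. hm n m q * \<gamma> k i m q * \<gamma> l j n q)" for i j k l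
    by (subst sum.swap) (simp add: hm_sym mult_ac)
  show "Rm j i k l q = - Rm i j k l q"
    using e[of k l] e[of l k] c E_commute[OF sm_gm[of i j], of k l q] s[of l j k i] s[of k j l i]
    unfolding Rm_def by linarith
  show "Rm i j l k q = - Rm i j k l q"
    unfolding Rm_def by (simp add: cst_antisym[of l k] sum_negf)
qed

lemma Rm_diag: "Rm i i k l q = 0" "Rm i j k k q = 0"
  using Rm_antisym(1)[of i i k l q] Rm_antisym(2)[of i j k k q] by simp_all

text \<open>The derivatives of \<open>x\<close> and \<open>y\<close> along \<open>f 0\<close> that occur have been eliminated by the Jacobi identity, so
  these are normal forms, as are the components of the curvature below.\<close>

lemma \<gamma>_values:
  "\<gamma> (Some 0) (Some 0) (Some 0) = (\<lambda>q. D 0 G0 q / 2)"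
  "\<gamma> (Some 0) (Some 0) (Some 1) = (\<lambda>q. - (D 1 G0 q / 2) + 2 * D 2 a q / 3 - 2 * D 1 d q / 3 - 4 * a q * x q / 3 - 2 * b q * y q / 3 - 2 * d q * y q / 3)"
  "\<gamma> (Some 0) (Some 0) (Some 2) = (\<lambda>q. - (D 2 G0 q / 2) + 2 * D 1 a q / 3 + 2 * D 2 b q / 3 + 4 * a q * y q / 3 - 2 * b q * x q / 3 - 2 * d q * x q / 3)"
  "\<gamma> (Some 0) (Some 0) None = (\<lambda>q. 0)"
  "\<gamma> (Some 0) (Some 1) (Some 0) = (\<lambda>q. D 1 G0 q / 2 + 2 * a q * x q / 3 + 2 * b q * y q / 3)"
  "\<gamma> (Some 0) (Some 1) (Some 1) = (\<lambda>q. 0)"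
  "\<gamma> (Some 0) (Some 1) (Some 2) = (\<lambda>q. G0 q / 2 - b q / 2 + d q / 2 + D 2 x q / 3 - D 1 y q / 3 - x q * x q / 3 - y q * y q / 3)"
  "\<gamma> (Some 0) (Some 1) None = (\<lambda>q. 0)"
  "\<gamma> (Some 0) (Some 2) (Some 0) = (\<lambda>q. D 2 G0 q / 2 - 2 * a q * y q / 3 + 2 * d q * x q / 3)"
  "\<gamma> (Some 0) (Some 2) (Some 1) = (\<lambda>q. - (G0 q / 2) + b q / 2 - d q / 2 - D 2 x q / 3 + D 1 y q / 3 + x q * x q / 3 + y q * y q / 3)"
  "\<gamma> (Some 0) (Some 2) (Some 2) = (\<lambda>q. 0)"
  "\<gamma> (Some 0) (Some 2) None = (\<lambda>q. 0)"
  "\<gamma> (Some 0) None (Some 0) = (\<lambda>q. 0)"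
  "\<gamma> (Some 0) None (Some 1) = (\<lambda>q. 0)"
  "\<gamma> (Some 0) None (Some 2) = (\<lambda>q. 0)"
  "\<gamma> (Some 0) None None = (\<lambda>q. 0)"
  "\<gamma> (Some 1) (Some 0) (Some 0) = (\<lambda>q. D 1 G0 q / 2)"
  "\<gamma> (Some 1) (Some 0) (Some 1) = (\<lambda>q. a q)"
  "\<gamma> (Some 1) (Some 0) (Some 2) = (\<lambda>q. G0 q / 2 + b q / 2 + d q / 2 + D 2 x q / 3 - D 1 y q / 3 - x q * x q / 3 - y q * y q / 3)"
  "\<gamma> (Some 1) (Some 0) None = (\<lambda>q. 0)"
  "\<gamma> (Some 1) (Some 1) (Some 0) = (\<lambda>q. - a q - 2 * D 1 x q / 3)"
  "\<gamma> (Some 1) (Some 1) (Some 1) = (\<lambda>q. 0)"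
  "\<gamma> (Some 1) (Some 1) (Some 2) = (\<lambda>q. x q / 3)"
  "\<gamma> (Some 1) (Some 1) None = (\<lambda>q. 0)"
  "\<gamma> (Some 1) (Some 2) (Some 0) = (\<lambda>q. - (G0 q / 2) - b q / 2 - d q / 2 - D 2 x q / 3 - D 1 y q / 3 + x q * x q / 3 + y q * y q / 3)"
  "\<gamma> (Some 1) (Some 2) (Some 1) = (\<lambda>q. - (x q / 3))"
  "\<gamma> (Some 1) (Some 2) (Some 2) = (\<lambda>q. 0)"
  "\<gamma> (Some 1) (Some 2) None = (\<lambda>q. - (1 / 3))"
  "\<gamma> (Some 1) None (Some 0) = (\<lambda>q. 0)"
  "\<gamma> (Some 1) None (Some 1) = (\<lambda>q. 0)"
  "\<gamma> (Some 1) None (Some 2) = (\<lambda>q. 1 / 3)"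
  "\<gamma> (Some 1) None None = (\<lambda>q. 0)"
  "\<gamma> (Some 2) (Some 0) (Some 0) = (\<lambda>q. D 2 G0 q / 2)"
  "\<gamma> (Some 2) (Some 0) (Some 1) = (\<lambda>q. - (G0 q / 2) + b q / 2 + d q / 2 - D 2 x q / 3 + D 1 y q / 3 + x q * x q / 3 + y q * y q / 3)"
  "\<gamma> (Some 2) (Some 0) (Some 2) = (\<lambda>q. - a q)"
  "\<gamma> (Some 2) (Some 0) None = (\<lambda>q. 0)"
  "\<gamma> (Some 2) (Some 1) (Some 0) = (\<lambda>q. G0 q / 2 - b q / 2 - d q / 2 - D 2 x q / 3 - D 1 y q / 3 - x q * x q / 3 - y q * y q / 3)"
  "\<gamma> (Some 2) (Some 1) (Some 1) = (\<lambda>q. 0)"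
  "\<gamma> (Some 2) (Some 1) (Some 2) = (\<lambda>q. y q / 3)"
  "\<gamma> (Some 2) (Some 1) None = (\<lambda>q. 1 / 3)"
  "\<gamma> (Some 2) (Some 2) (Some 0) = (\<lambda>q. a q - 2 * D 2 y q / 3)"
  "\<gamma> (Some 2) (Some 2) (Some 1) = (\<lambda>q. - (y q / 3))"
  "\<gamma> (Some 2) (Some 2) (Some 2) = (\<lambda>q. 0)"
  "\<gamma> (Some 2) (Some 2) None = (\<lambda>q. 0)"
  "\<gamma> (Some 2) None (Some 0) = (\<lambda>q. 0)"
  "\<gamma> (Some 2) None (Some 1) = (\<lambda>q. - (1 / 3))"
  "\<gamma> (Some 2) None (Some 2) = (\<lambda>q. 0)"
  "\<gamma> (Some 2) None None = (\<lambda>q. 0)"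
  "\<gamma> None (Some 0) (Some 0) = (\<lambda>q. 0)"
  "\<gamma> None (Some 0) (Some 1) = (\<lambda>q. 0)"
  "\<gamma> None (Some 0) (Some 2) = (\<lambda>q. 0)"
  "\<gamma> None (Some 0) None = (\<lambda>q. 0)"
  "\<gamma> None (Some 1) (Some 0) = (\<lambda>q. 0)"
  "\<gamma> None (Some 1) (Some 1) = (\<lambda>q. 0)"
  "\<gamma> None (Some 1) (Some 2) = (\<lambda>q. 1 / 3)"
  "\<gamma> None (Some 1) None = (\<lambda>q. 0)"
  "\<gamma> None (Some 2) (Some 0) = (\<lambda>q. 0)"
  "\<gamma> None (Some 2) (Some 1) = (\<lambda>q. - (1 / 3))"
  "\<gamma> None (Some 2) (Some 2) = (\<lambda>q. 0)"
  "\<gamma> None (Some 2) None = (\<lambda>q. 0)"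
  "\<gamma> None None (Some 0) = (\<lambda>q. 0)"
  "\<gamma> None None (Some 1) = (\<lambda>q. 0)"
  "\<gamma> None None (Some 2) = (\<lambda>q. 0)"
  "\<gamma> None None None = (\<lambda>q. 0)"
  by (rule ext, simp add: \<gamma>_def cl_def sum_index gm_values cst3_values E_simps D_simps D_divide D_jacobi field_simps)+

lemmas ring_normal = algebra_simps add_divide_distrib diff_divide_distrib

lemmas Rm_unfold = Rm_def sum_index hm_values cst3_values cst_simps E_simps \<gamma>_values

lemmas D_calculus = D_simps D_divide D_commute D_jacobi

text \<open>The components for the pairs of indices in increasing order; the antisymmetry gives the others.\<close>

lemma Rm_values_01:
  "Rm (Some 0) (Some 1) (Some 0) (Some 1) q = - (D 1 (D 1 G0) q / 2) - D 0 a q + 2 * D 1 (D 2 a) q / 3 - 2 * D 1 (D 1 d) q / 3 + G0 q * G0 q / 4 + G0 q * b q / 2 + G0 q * d q / 2 + G0 q * D 2 x q / 3 - G0 q * D 1 y q / 3 + D 2 G0 q * x q / 6 - a q * a q - 4 * a q * D 1 x q / 3 - 14 * D 1 a q * x q / 9 - 3 * b q * b q / 4 - b q * d q / 2 + b q * D 2 x q / 3 - b q * D 1 y q - 2 * D 1 b q * y q / 3 - 2 * D 2 b q * x q / 9 + d q * d q / 4 + d q * D 2 x q / 3 - d q * D 1 y q - 2 * D 1 d q * y q / 3 + D 2 x q * D 2 x q / 9 - 2 * D 2 x q * D 1 y q / 9 + D 1 y q * D 1 y q / 9 - G0 q * x q * x q / 3 - G0 q * y q * y q / 3 - 4 * a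 q * x q * y q / 9 - b q * x q * x q / 9 - b q * y q * y q / 3 - d q * x q * x q / 9 - d q * y q * y q / 3 - 2 * x q * x q * D 2 x q / 9 + 2 * x q * x q * D 1 y q / 9 - 2 * D 2 x q * y q * y q / 9 + 2 * y q * y q * D 1 y q / 9 + x q * x q * x q * x q / 9 + 2 * x q * x q * y q * y q / 9 + y q * y q * y q * y q / 9"
  "Rm (Some 0) (Some 1) (Some 0) (Some 2) q = - (D 0 G0 q / 4) - D 1 (D 2 G0) q / 2 + D 1 (D 1 a) q / 3 + D 2 (D 2 a) q / 3 - D 0 b q / 2 + D 1 (D 2 b) q / 3 - 5 * D 0 d q / 6 - D 1 (D 2 d) q / 3 - G0 q * a q - D 1 G0 q * x q / 3 - D 2 G0 q * y q / 6 + a q * b q - a q * d q - 4 * a q * D 2 x q / 3 + 4 * a q * D 1 y q / 3 + 5 * D 1 a q * y q / 9 - 5 * D 2 a q * x q / 9 - b q * D 1 x q / 3 - b q * D 2 y q / 3 - D 1 b q * x q / 3 - 4 * D 2 b q * y q / 9 - d q * D 1 x q / 3 - d q * D 2 y q / 3 - 7 * D 1 d q * x q / 9 - 2 * D 2 d q * y q / 3 + 4 * a q * x q * x q / 9 + 4 * a q * y q * y q / 9"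
  "Rm (Some 0) (Some 1) (Some 0) None q = D 2 G0 q / 6 - 2 * D 1 a q / 9 - 2 * D 2 b q / 9 - 4 * a q * y q / 9 + 2 * b q * x q / 9 + 2 * d q * x q / 9"
  "Rm (Some 0) (Some 1) (Some 1) (Some 2) q = 3 * D 1 G0 q / 4 + D 2 a q / 3 - D 1 b q / 2 + D 1 d q / 6 + D 1 (D 2 x) q / 3 - D 1 (D 1 y) q / 3 + G0 q * y q / 6 - a q * x q / 3 - b q * y q / 6 - d q * y q / 6 - 2 * x q * D 1 x q / 3 + D 2 x q * y q / 9 - 7 * y q * D 1 y q / 9 - x q * x q * y q / 9 - y q * y q * y q / 9"
  "Rm (Some 0) (Some 1) (Some 1) None q = - (G0 q / 6) - b q / 6 - d q / 6 - D 2 x q / 9 + D 1 y q / 9 + x q * x q / 9 + y q * y q / 9"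
  "Rm (Some 0) (Some 1) (Some 2) None q = a q / 3"
  by (simp only: Rm_unfold; simp add: D_calculus; simp add: ring_normal)+

lemma Rm_values_02:
  "Rm (Some 0) (Some 2) (Some 0) (Some 1) q = - (D 0 G0 q / 4) - D 1 (D 2 G0) q / 2 + D 1 (D 1 a) q / 3 + D 2 (D 2 a) q / 3 - D 0 b q / 2 + D 1 (D 2 b) q / 3 - 5 * D 0 d q / 6 - D 1 (D 2 d) q / 3 - G0 q * a q - D 1 G0 q * x q / 3 - D 2 G0 q * y q / 6 + a q * b q - a q * d q - 4 * a q * D 2 x q / 3 + 4 * a q * D 1 y q / 3 + 5 * D 1 a q * y q / 9 - 5 * D 2 a q * x q / 9 - b q * D 1 x q / 3 - b q * D 2 y q / 3 - D 1 b q * x q / 3 - 4 * D 2 b q * y q / 9 - d q * D 1 x q / 3 - d q * D 2 y q / 3 - 7 * D 1 d q * x q / 9 - 2 * D 2 d q * y q / 3 + 4 * a q * x q * x q / 9 + 4 * a q * y q * y q / 9"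
  "Rm (Some 0) (Some 2) (Some 0) (Some 2) q = - (D 2 (D 2 G0) q / 2) + 5 * D 0 a q / 3 + 2 * D 1 (D 2 a) q / 3 + 2 * D 2 (D 2 b) q / 3 + G0 q * G0 q / 4 - G0 q * b q / 2 - G0 q * d q / 2 + G0 q * D 2 x q / 3 - G0 q * D 1 y q / 3 - D 1 G0 q * y q / 6 - a q * a q + 4 * a q * D 2 y q / 3 + 2 * D 1 a q * x q / 3 + 20 * D 2 a q * y q / 9 + b q * b q / 4 - b q * d q / 2 - b q * D 2 x q + b q * D 1 y q / 3 - 2 * D 2 b q * x q / 3 - 3 * d q * d q / 4 - d q * D 2 x q + d q * D 1 y q / 3 - 2 * D 1 d q * y q / 9 - 2 * D 2 d q * x q / 3 + D 2 x q * D 2 x q / 9 - 2 * D 2 x q * D 1 y q / 9 + D 1 y q * D 1 y q / 9 - G0 q * x q * x q / 3 - G0 q * y q * y q / 3 - 4 * a q * x q * y q / 9 + b q * x q * x q / 3 + b q * y q * y q / 9 + d q * x q * x q / 3 + d q * y q * y q / 9 - 2 * x q * x q * D 2 x q / 9 + 2 * x q * x q * D 1 y q / 9 - 2 * D 2 x q * y q * y q / 9 + 2 * y q * y q * D 1 y q / 9 + x q * x q * x q * x q / 9 + 2 * x q * x q * y q * y q / 9 + y q * y q * y q * y q / 9"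
  "Rm (Some 0) (Some 2) (Some 0) None q = - (D 1 G0 q / 6) + 2 * D 2 a q / 9 - 2 * D 1 d q / 9 - 4 * a q * x q / 9 - 2 * b q * y q / 9 - 2 * d q * y q / 9"
  "Rm (Some 0) (Some 2) (Some 1) (Some 2) q = 3 * D 2 G0 q / 4 + 2 * D 1 a q / 3 + D 2 b q / 6 + D 2 d q / 2 + D 2 (D 2 x) q / 3 - D 1 (D 2 y) q / 3 - G0 q * x q / 6 + 2 * a q * y q / 3 - b q * x q / 2 - d q * x q / 6 - 7 * x q * D 2 x q / 9 - 2 * x q * D 1 y q / 9 - y q * D 2 y q + x q * x q * x q / 9 + x q * y q * y q / 9"
  "Rm (Some 0) (Some 2) (Some 1) None q = a q / 3"
  "Rm (Some 0) (Some 2) (Some 2) None q = - (G0 q / 6) + b q / 6 + d q / 6 - D 2 x q / 9 + D 1 y q / 9 + x q * x q / 9 + y q * y q / 9"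
  by (simp only: Rm_unfold; simp add: D_calculus; simp add: ring_normal)+

lemma Rm_values_0n:
  "Rm (Some 0) None (Some 0) (Some 1) q = D 2 G0 q / 6 - 2 * D 1 a q / 9 - 2 * D 2 b q / 9 - 4 * a q * y q / 9 + 2 * b q * x q / 9 + 2 * d q * x q / 9"
  "Rm (Some 0) None (Some 0) (Some 2) q = - (D 1 G0 q / 6) + 2 * D 2 a q / 9 - 2 * D 1 d q / 9 - 4 * a q * x q / 9 - 2 * b q * y q / 9 - 2 * d q * y q / 9"
  "Rm (Some 0) None (Some 0) None q = 0"
  "Rm (Some 0) None (Some 1) (Some 2) q = 0"
  "Rm (Some 0) None (Some 1) None q = 0"
  "Rm (Some 0) None (Some 2) None q = 0"
  by (simp only: Rm_unfold; simp add: D_calculus; simp add: ring_normal)+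

lemma Rm_values_12:
  "Rm (Some 1) (Some 2) (Some 0) (Some 1) q = 3 * D 1 G0 q / 4 + D 2 a q / 3 - D 1 b q / 2 + D 1 d q / 6 + D 1 (D 2 x) q / 3 - D 1 (D 1 y) q / 3 + G0 q * y q / 6 - a q * x q / 3 - b q * y q / 6 - d q * y q / 6 - 2 * x q * D 1 x q / 3 + D 2 x q * y q / 9 - 7 * y q * D 1 y q / 9 - x q * x q * y q / 9 - y q * y q * y q / 9"
  "Rm (Some 1) (Some 2) (Some 0) (Some 2) q = 3 * D 2 G0 q / 4 + 2 * D 1 a q / 3 + D 2 b q / 6 + D 2 d q / 2 + D 2 (D 2 x) q / 3 - D 1 (D 2 y) q / 3 - G0 q * x q / 6 + 2 * a q * y q / 3 - b q * x q / 2 - d q * x q / 6 - 7 * x q * D 2 x q / 9 - 2 * x q * D 1 y q / 9 - y q * D 2 y q + x q * x q * x q / 9 + x q * y q * y q / 9"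
  "Rm (Some 1) (Some 2) (Some 0) None q = 0"
  "Rm (Some 1) (Some 2) (Some 1) (Some 2) q = - (3 * G0 q / 4) + b q / 2 - d q / 2 + x q * x q / 9 + y q * y q / 9"
  "Rm (Some 1) (Some 2) (Some 1) None q = - (y q / 9)"
  "Rm (Some 1) (Some 2) (Some 2) None q = x q / 9"
  by (simp only: Rm_unfold; simp add: D_calculus; simp add: ring_normal)+

lemma Rm_values_1n:
  "Rm (Some 1) None (Some 0) (Some 1) q = - (G0 q / 6) - b q / 6 - d q / 6 - D 2 x q / 9 + D 1 y q / 9 + x q * x q / 9 + y q * y q / 9"
  "Rm (Some 1) None (Some 0) (Some 2) q = a q / 3"
  "Rm (Some 1) None (Some 0) None q = 0"
  "Rm (Some 1) None (Some 1) (Some 2) q = - (y q / 9)"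
  "Rm (Some 1) None (Some 1) None q = 1 / 9"
  "Rm (Some 1) None (Some 2) None q = 0"
  by (simp only: Rm_unfold; simp add: D_calculus; simp add: ring_normal)+

lemma Rm_values_2n:
  "Rm (Some 2) None (Some 0) (Some 1) q = a q / 3"
  "Rm (Some 2) None (Some 0) (Some 2) q = - (G0 q / 6) + b q / 6 + d q / 6 - D 2 x q / 9 + D 1 y q / 9 + x q * x q / 9 + y q * y q / 9"
  "Rm (Some 2) None (Some 0) None q = 0"
  "Rm (Some 2) None (Some 1) (Some 2) q = x q / 9"
  "Rm (Some 2) None (Some 1) None q = 0"
  "Rm (Some 2) None (Some 2) None q = 1 / 9"
  by (simp only: Rm_unfold; simp add: D_calculus; simp add: ring_normal)+

lemmas Rm_values = Rm_values_01 Rm_values_02 Rm_values_0n Rm_values_12 Rm_values_1n Rm_values_2n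

lemma Rm_order:
  "Rm (Some 1) (Some 0) k l q = - Rm (Some 0) (Some 1) k l q"
  "Rm (Some 2) (Some 0) k l q = - Rm (Some 0) (Some 2) k l q"
  "Rm None (Some 0) k l q = - Rm (Some 0) None k l q"
  "Rm (Some 2) (Some 1) k l q = - Rm (Some 1) (Some 2) k l q"
  "Rm None (Some 1) k l q = - Rm (Some 1) None k l q"
  "Rm None (Some 2) k l q = - Rm (Some 2) None k l q"
  "Rm i j (Some 1) (Some 0) q = - Rm i j (Some 0) (Some 1) q"
  "Rm i j (Some 2) (Some 0) q = - Rm i j (Some 0) (Some 2) q"
  "Rm i j None (Some 0) q = - Rm i j (Some 0) None q"
  "Rm i j (Some 2) (Some 1) q = - Rm i j (Some 1) (Some 2) q"
  "Rm i j None (Some 1) q = - Rm i j (Some 1) None q"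
  "Rm i j None (Some 2) q = - Rm i j (Some 2) None q"
  by (rule Rm_antisym)+

lemma Rc_values:
  "Rc (Some 0) (Some 0) q = - (D 1 (D 1 G0) q / 2) - D 2 (D 2 G0) q / 2 + 2 * D 0 a q / 3 + 4 * D 1 (D 2 a) q / 3 + 2 * D 2 (D 2 b) q / 3 - 2 * D 1 (D 1 d) q / 3 + G0 q * G0 q / 2 + 2 * G0 q * D 2 x q / 3 - 2 * G0 q * D 1 y q / 3 - D 1 G0 q * y q / 2 + D 2 G0 q * x q / 2 - 2 * a q * a q - 4 * a q * D 1 x q / 3 + 4 * a q * D 2 y q / 3 - 4 * D 1 a q * x q / 3 + 8 * D 2 a q * y q / 3 - b q * b q / 2 - b q * d q - 2 * b q * D 2 x q / 3 - 2 * b q * D 1 y q / 3 - 2 * D 1 b q * y q / 3 - 4 * D 2 b q * x q / 3 - d q * d q / 2 - 2 * d q * D 2 x q / 3 - 2 * d q * D 1 y q / 3 - 4 * D 1 d q * y q / 3 - 2 * D 2 d q * x q / 3 + 2 * D 2 x q * D 2 x q / 9 - 4 * D 2 x q * D 1 y q / 9 + 2 * D 1 y q * D 1 y q / 9 - 2 * G0 q * x q * x q / 3 - 2 * G0 q * y q * y q / 3 - 8 * a q * x q * y q / 3 + 2 * b q * x q * x q / 3 - 2 * b q * y q * y q / 3 + 2 * d q * x q * x q / 3 - 2 * d q * y q * y q / 3 - 4 * x q * x q * D 2 x q / 9 + 4 * x q * x q * D 1 y q / 9 - 4 * D 2 x q * y q * y q / 9 + 4 * y q * y q * D 1 y q /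 9 + 2 * x q * x q * x q * x q / 9 + 4 * x q * x q * y q * y q / 9 + 2 * y q * y q * y q * y q / 9"
  "Rc (Some 0) (Some 1) q = D 2 G0 q / 2 + D 1 a q + D 2 b q / 2 + D 2 d q / 2 + D 2 (D 2 x) q / 3 - D 1 (D 2 y) q / 3 - G0 q * x q / 3 + 5 * a q * y q / 3 - b q * x q - 2 * d q * x q / 3 - 8 * x q * D 2 x q / 9 - x q * D 1 y q / 9 - y q * D 2 y q + 2 * x q * x q * x q / 9 + 2 * x q * y q * y q / 9"
  "Rc (Some 0) (Some 2) q = - (D 1 G0 q / 2) - 2 * D 2 a q / 3 + D 1 b q / 2 + D 1 d q / 6 - D 1 (D 2 x) q / 3 + D 1 (D 1 y) q / 3 - G0 q * y q / 3 + 4 * a q * x q / 3 + 2 * b q * y q / 3 + 2 * d q * y q / 3 + 2 * x q * D 1 x q / 3 - 2 * D 2 x q * y q / 9 + 8 * y q * D 1 y q / 9 + 2 * x q * x q * y q / 9 + 2 * y q * y q * y q / 9"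
  "Rc (Some 0) None q = G0 q / 3 + 2 * D 2 x q / 9 - 2 * D 1 y q / 9 - 2 * x q * x q / 9 - 2 * y q * y q / 9"
  "Rc (Some 1) (Some 0) q = D 2 G0 q / 2 + D 1 a q + D 2 b q / 2 + D 2 d q / 2 + D 2 (D 2 x) q / 3 - D 1 (D 2 y) q / 3 - G0 q * x q / 3 + 5 * a q * y q / 3 - b q * x q - 2 * d q * x q / 3 - 8 * x q * D 2 x q / 9 - x q * D 1 y q / 9 - y q * D 2 y q + 2 * x q * x q * x q / 9 + 2 * x q * y q * y q / 9"
  "Rc (Some 1) (Some 1) q = - (G0 q / 2) + b q + D 2 x q / 3 - D 1 y q / 3 - x q * x q / 9 - y q * y q / 3"
  "Rc (Some 1) (Some 2) q = - a q + 2 * x q * y q / 9"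
  "Rc (Some 1) None q = - (2 * x q / 9)"
  "Rc (Some 2) (Some 0) q = - (D 1 G0 q / 2) - 2 * D 2 a q / 3 + D 1 b q / 2 + D 1 d q / 6 - D 1 (D 2 x) q / 3 + D 1 (D 1 y) q / 3 - G0 q * y q / 3 + 4 * a q * x q / 3 + 2 * b q * y q / 3 + 2 * d q * y q / 3 + 2 * x q * D 1 x q / 3 - 2 * D 2 x q * y q / 9 + 8 * y q * D 1 y q / 9 + 2 * x q * x q * y q / 9 + 2 * y q * y q * y q / 9"
  "Rc (Some 2) (Some 1) q = - a q + 2 * x q * y q / 9"
  "Rc (Some 2) (Some 2) q = - (G0 q / 2) - d q + D 2 x q / 3 - D 1 y q / 3 - x q * x q / 3 - y q * y q / 9"
  "Rc (Some 2) None q = - (2 * y q / 9)"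
  "Rc None (Some 0) q = G0 q / 3 + 2 * D 2 x q / 9 - 2 * D 1 y q / 9 - 2 * x q * x q / 9 - 2 * y q * y q / 9"
  "Rc None (Some 1) q = - (2 * x q / 9)"
  "Rc None (Some 2) q = - (2 * y q / 9)"
  "Rc None None q = 2 / 9"
  by (simp only: Rc_def sum_index hm_values Rm_order Rm_diag Rm_values; simp add: ring_normal)+

lemma Sc_value: "Sc q = - (G0 q / 2) + b q - d q + 4 * D 2 x q / 3 - 4 * D 1 y q / 3 - 4 * x q * x q / 3 - 4 * y q * y q / 3"
  by (simp only: Sc_def sum_index hm_values Rc_values; simp add: ring_normal)

lemma Wm_antisym: "Wm j i k l q = - Wm i j k l q" "Wm i j l k q = - Wm i j k l q"
  unfolding Wm_def Rm_antisym(1)[of j i] Rm_antisym(2)[of i j l k] by (simp_all add: field_simps)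

lemma Wm_diag: "Wm i i k l q = 0" "Wm i j k k q = 0"
  using Wm_antisym(1)[of i i k l q] Wm_antisym(2)[of i j k k q] by simp_all

lemma Wm_order:
  "Wm (Some 1) (Some 0) k l q = - Wm (Some 0) (Some 1) k l q"
  "Wm (Some 2) (Some 0) k l q = - Wm (Some 0) (Some 2) k l q"
  "Wm None (Some 0) k l q = - Wm (Some 0) None k l q"
  "Wm (Some 2) (Some 1) k l q = - Wm (Some 1) (Some 2) k l q"
  "Wm None (Some 1) k l q = - Wm (Some 1) None k l q"
  "Wm None (Some 2) k l q = - Wm (Some 2) None k l q"
  "Wm i j (Some 1) (Some 0) q = - Wm i j (Some 0) (Some 1) q"
  "Wm i j (Some 2) (Some 0) q = - Wm i j (Some 0) (Some 2) q"
  "Wm i j None (Some 0) q = - Wm i j (Some 0) None q"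
  "Wm i j (Some 2) (Some 1) q = - Wm i j (Some 1) (Some 2) q"
  "Wm i j None (Some 1) q = - Wm i j (Some 1) None q"
  "Wm i j None (Some 2) q = - Wm i j (Some 2) None q"
  by (rule Wm_antisym)+

text \<open>For an arbitrary function \<open>G0\<close> most components of the Weyl tensor do not vanish.\<close>

lemma Wm_values_01:
  "Wm (Some 0) (Some 1) (Some 0) (Some 1) q = - (D 1 (D 1 G0) q / 4) + D 2 (D 2 G0) q / 4 - 4 * D 0 a q / 3 - D 2 (D 2 b) q / 3 - D 1 (D 1 d) q / 3 + G0 q * G0 q / 6 + G0 q * b q / 6 + G0 q * d q / 3 + G0 q * D 2 x q / 18 - G0 q * D 1 y q / 18 + D 1 G0 q * y q / 4 - 5 * D 2 G0 q * x q / 12 - 2 * a q * D 1 x q / 3 - 2 * a q * D 2 y q / 3 - 14 * D 1 a q * x q / 9 - 4 * D 2 a q * y q / 3 - b q * b q / 2 + 2 * b q * D 2 x q / 3 - 2 * b q * D 1 y q / 3 - D 1 b q * y q / 3 + D 2 b q * x q / 9 + d q * d q / 2 + 2 * d q * D 2 x q / 3 - 2 * d q * D 1 y q / 3 - 2 * x q * D 2 (D 2 x) q / 9 + 2 * x q * D 1 (D 2 y) q / 9 + 5 * G0 q * x q * x q / 54 - G0 q * y q * y q / 18 - 2 * a q * x q * y q / 9 + 4 * b q * x q * x q / 27 + 2 * d q * x q * x q / 27 + 40 * x q * x q * D 2 x q / 81 + 14 * x q * x q * D 1 y q / 81 + 2 * x q * y q * D 2 y q / 3 - 4 * x q * x q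 * x q * x q / 81 - 4 * x q * x q * y q * y q / 81"
  "Wm (Some 0) (Some 1) (Some 0) (Some 2) q = - (D 0 G0 q / 4) - D 1 (D 2 G0) q / 2 + D 1 (D 1 a) q / 3 + D 2 (D 2 a) q / 3 - D 0 b q / 2 + D 1 (D 2 b) q / 3 - 5 * D 0 d q / 6 - D 1 (D 2 d) q / 3 - G0 q * a q / 2 - D 1 G0 q * x q / 6 - D 2 G0 q * y q / 3 + a q * b q - a q * d q - 4 * a q * D 2 x q / 3 + 4 * a q * D 1 y q / 3 + 2 * D 1 a q * y q / 9 - D 2 a q * x q / 3 - b q * D 1 x q / 3 - b q * D 2 y q / 3 - D 1 b q * x q / 2 - 11 * D 2 b q * y q / 18 - d q * D 1 x q / 3 - d q * D 2 y q / 3 - 5 * D 1 d q * x q / 6 - 5 * D 2 d q * y q / 6 + x q * D 1 (D 2 x) q / 9 - x q * D 1 (D 1 y) q / 9 - D 2 (D 2 x) q * y q / 9 + y q * D 1 (D 2 y) q / 9 + 4 * G0 q * x q * y q / 27 - a q * y q * y q / 9 + b q * x q * y q / 27 + 2 * d q * x q * y q / 27 - 2 * x q * x q * D 1 x q / 9 + 22 * x q * D 2 x q * y q / 81 - 13 * x q * y q * D 1 y q / 81 + y q * y q * D 2 y q / 3 - 4 * x q * x q * x q * y q / 81 - 4 * x q * y q * y q * y q / 81"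
  "Wm (Some 0) (Some 1) (Some 0) None q = D 2 G0 q / 3 + D 1 a q / 9 - D 2 b q / 18 + D 2 d q / 6 + D 2 (D 2 x) q / 9 - D 1 (D 2 y) q / 9 - 4 * G0 q * x q / 27 + a q * y q / 9 - b q * x q / 27 - 2 * d q * x q / 27 - 22 * x q * D 2 x q / 81 - 5 * x q * D 1 y q / 81 - y q * D 2 y q / 3 + 4 * x q * x q * x q / 81 + 4 * x q * y q * y q / 81"
  "Wm (Some 0) (Some 1) (Some 1) (Some 2) q = D 1 G0 q / 2 - D 1 b q / 4 + D 1 d q / 4 + D 1 (D 2 x) q / 6 - D 1 (D 1 y) q / 6 + G0 q * y q / 9 - b q * y q / 18 + d q * y q / 18 - x q * D 1 x q / 3 + D 2 x q * y q / 27 - 10 * y q * D 1 y q / 27 - x q * x q * y q / 27 - y q * y q * y q / 27"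
  "Wm (Some 0) (Some 1) (Some 1) None q = - (G0 q / 9) + b q / 18 - d q / 18 - D 2 x q / 27 + D 1 y q / 27 + x q * x q / 27 + y q * y q / 27"
  "Wm (Some 0) (Some 1) (Some 2) None q = 0"
  by (simp only: Wm_def Rm_values Rc_values Sc_value gm_values; simp add: ring_normal)+

lemma Wm_values_02:
  "Wm (Some 0) (Some 2) (Some 0) (Some 1) q = - (D 0 G0 q / 4) - D 1 (D 2 G0) q / 2 + D 1 (D 1 a) q / 3 + D 2 (D 2 a) q / 3 - D 0 b q / 2 + D 1 (D 2 b) q / 3 - 5 * D 0 d q / 6 - D 1 (D 2 d) q / 3 - G0 q * a q / 2 - D 1 G0 q * x q / 6 - D 2 G0 q * y q / 3 + a q * b q - a q * d q - 4 * a q * D 2 x q / 3 + 4 * a q * D 1 y q / 3 + 2 * D 1 a q * y q / 9 - D 2 a q * x q / 3 - b q * D 1 x q / 3 - b q * D 2 y q / 3 - D 1 b q * x q / 2 - 11 * D 2 b q * y q / 18 - d q * D 1 x q / 3 - d q * D 2 y q / 3 - 5 * D 1 d q * x q / 6 - 5 * D 2 d q * y q / 6 + x q * D 1 (D 2 x) q / 9 - x q * D 1 (D 1 y) q / 9 - D 2 (D 2 x) q * y q / 9 + y q * D 1 (D 2 y) q / 9 + 4 * G0 q * x q * y q / 27 - a q * y q * y q / 9 + b q * x q * y q / 27 + 2 * d q * x q * y q / 27 - 2 * x q * x q * D 1 x q / 9 + 22 * x q * D 2 x q * y q / 81 - 13 * x q * y q * D 1 y q / 81 + y q * y q * D 2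 y q / 3 - 4 * x q * x q * x q * y q / 81 - 4 * x q * y q * y q * y q / 81"
  "Wm (Some 0) (Some 2) (Some 0) (Some 2) q = D 1 (D 1 G0) q / 4 - D 2 (D 2 G0) q / 4 + 4 * D 0 a q / 3 + D 2 (D 2 b) q / 3 + D 1 (D 1 d) q / 3 + G0 q * G0 q / 6 - G0 q * b q / 3 - G0 q * d q / 6 + G0 q * D 2 x q / 18 - G0 q * D 1 y q / 18 + 5 * D 1 G0 q * y q / 12 - D 2 G0 q * x q / 4 + 2 * a q * D 1 x q / 3 + 2 * a q * D 2 y q / 3 + 4 * D 1 a q * x q / 3 + 4 * D 2 a q * y q / 3 + b q * b q / 2 - 2 * b q * D 2 x q / 3 + 2 * b q * D 1 y q / 3 - d q * d q / 2 - 2 * d q * D 2 x q / 3 + 2 * d q * D 1 y q / 3 + D 1 d q * y q / 3 - D 2 d q * x q / 3 + 2 * D 1 (D 2 x) q * y q / 9 - 2 * y q * D 1 (D 1 y) q / 9 - G0 q * x q * x q / 18 + 5 * G0 q * y q * y q / 54 - 2 * b q * y q * y q / 27 + 2 * d q * y q * y q / 27 - 4 * x q * D 1 x q * y q / 9 + 4 * D 2 x q * y q * y q / 81 - 40 * y q * y q * D 1 y q / 81 - 4 * x q * x q * y q * y q / 81 - 4 * y q * y q * y q * y q / 81"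
  "Wm (Some 0) (Some 2) (Some 0) None q = - (D 1 G0 q / 3) + D 1 b q / 6 - D 1 d q / 6 - D 1 (D 2 x) q / 9 + D 1 (D 1 y) q / 9 - 4 * G0 q * y q / 27 + 2 * b q * y q / 27 - 2 * d q * y q / 27 + 2 * x q * D 1 x q / 9 - 4 * D 2 x q * y q / 81 + 22 * y q * D 1 y q / 81 + 4 * x q * x q * y q / 81 + 4 * y q * y q * y q / 81"
  "Wm (Some 0) (Some 2) (Some 1) (Some 2) q = D 2 G0 q / 2 + D 1 a q / 6 - D 2 b q / 12 + D 2 d q / 4 + D 2 (D 2 x) q / 6 - D 1 (D 2 y) q / 6 - G0 q * x q / 9 + a q * y q / 6 - b q * x q / 9 - d q * x q / 18 - 10 * x q * D 2 x q / 27 - 7 * x q * D 1 y q / 54 - y q * D 2 y q / 2 + x q * x q * x q / 27 + x q * y q * y q / 27"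
  "Wm (Some 0) (Some 2) (Some 1) None q = 0"
  "Wm (Some 0) (Some 2) (Some 2) None q = - (G0 q / 9) + b q / 18 - d q / 18 - D 2 x q / 27 + D 1 y q / 27 + x q * x q / 27 + y q * y q / 27"
  by (simp only: Wm_def Rm_values Rc_values Sc_value gm_values; simp add: ring_normal)+

lemma Wm_values_0n:
  "Wm (Some 0) None (Some 0) (Some 1) q = D 2 G0 q / 3 + D 1 a q / 9 - D 2 b q / 18 + D 2 d q / 6 + D 2 (D 2 x) q / 9 - D 1 (D 2 y) q / 9 - 4 * G0 q * x q / 27 + a q * y q / 9 - b q * x q / 27 - 2 * d q * x q / 27 - 22 * x q * D 2 x q / 81 - 5 * x q * D 1 y q / 81 - y q * D 2 y q / 3 + 4 * x q * x q * x q / 81 + 4 * x q * y q * y q / 81"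
  "Wm (Some 0) None (Some 0) (Some 2) q = - (D 1 G0 q / 3) + D 1 b q / 6 - D 1 d q / 6 - D 1 (D 2 x) q / 9 + D 1 (D 1 y) q / 9 - 4 * G0 q * y q / 27 + 2 * b q * y q / 27 - 2 * d q * y q / 27 + 2 * x q * D 1 x q / 9 - 4 * D 2 x q * y q / 81 + 22 * y q * D 1 y q / 81 + 4 * x q * x q * y q / 81 + 4 * y q * y q * y q / 81"
  "Wm (Some 0) None (Some 0) None q = 4 * G0 q / 27 - 2 * b q / 27 + 2 * d q / 27 + 4 * D 2 x q / 81 - 4 * D 1 y q / 81 - 4 * x q * x q / 81 - 4 * y q * y q / 81"
  "Wm (Some 0) None (Some 1) (Some 2) q = 0"
  "Wm (Some 0) None (Some 1) None q = 0"
  "Wm (Some 0) None (Some 2) None q = 0"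
  by (simp only: Wm_def Rm_values Rc_values Sc_value gm_values; simp add: ring_normal)+

lemma Wm_values_12:
  "Wm (Some 1) (Some 2) (Some 0) (Some 1) q = D 1 G0 q / 2 - D 1 b q / 4 + D 1 d q / 4 + D 1 (D 2 x) q / 6 - D 1 (D 1 y) q / 6 + G0 q * y q / 9 - b q * y q / 18 + d q * y q / 18 - x q * D 1 x q / 3 + D 2 x q * y q / 27 - 10 * y q * D 1 y q / 27 - x q * x q * y q / 27 - y q * y q * y q / 27"
  "Wm (Some 1) (Some 2) (Some 0) (Some 2) q = D 2 G0 q / 2 + D 1 a q / 6 - D 2 b q / 12 + D 2 d q / 4 + D 2 (D 2 x) q / 6 - D 1 (D 2 y) q / 6 - G0 q * x q / 9 + a q * y q / 6 - b q * x q / 9 - d q * x q / 18 - 10 * x q * D 2 x q / 27 - 7 * x q * D 1 y q / 54 - y q * D 2 y q / 2 + x q * x q * x q / 27 + x q * y q * y q / 27"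
  "Wm (Some 1) (Some 2) (Some 0) None q = 0"
  "Wm (Some 1) (Some 2) (Some 1) (Some 2) q = - (G0 q / 3) + b q / 6 - d q / 6 - D 2 x q / 9 + D 1 y q / 9 + x q * x q / 9 + y q * y q / 9"
  "Wm (Some 1) (Some 2) (Some 1) None q = 0"
  "Wm (Some 1) (Some 2) (Some 2) None q = 0"
  by (simp only: Wm_def Rm_values Rc_values Sc_value gm_values; simp add: ring_normal)+

lemma Wm_values_1n:
  "Wm (Some 1) None (Some 0) (Some 1) q = - (G0 q / 9) + b q / 18 - d q / 18 - D 2 x q / 27 + D 1 y q / 27 + x q * x q / 27 + y q * y q / 27"
  "Wm (Some 1) None (Some 0) (Some 2) q = 0"
  "Wm (Some 1) None (Some 0) None q = 0"
  "Wm (Some 1) None (Some 1) (Some 2) q = 0"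
  "Wm (Some 1) None (Some 1) None q = 0"
  "Wm (Some 1) None (Some 2) None q = 0"
  by (simp only: Wm_def Rm_values Rc_values Sc_value gm_values; simp add: ring_normal)+

lemma Wm_values_2n:
  "Wm (Some 2) None (Some 0) (Some 1) q = 0"
  "Wm (Some 2) None (Some 0) (Some 2) q = - (G0 q / 9) + b q / 18 - d q / 18 - D 2 x q / 27 + D 1 y q / 27 + x q * x q / 27 + y q * y q / 27"
  "Wm (Some 2) None (Some 0) None q = 0"
  "Wm (Some 2) None (Some 1) (Some 2) q = 0"
  "Wm (Some 2) None (Some 1) None q = 0"
  "Wm (Some 2) None (Some 2) None q = 0"
  by (simp only: Wm_def Rm_values Rc_values Sc_value gm_values; simp add: ring_normal)+

lemmas Wm_values = Wm_values_01 Wm_values_02 Wm_values_0n Wm_values_12 Wm_values_1n Wm_values_2n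

lemma D_G0: "D i G0 = (\<lambda>q. (D i b q - D i d q) / 2
    + (2 * (x q * D i x q) + 2 * (y q * D i y q) + D i (D 1 y) q - D i (D 2 x) q) / 3)"
  unfolding G0_def by (rule ext) (simp add: D_simps D_divide mult.commute)

end

context contact_frame
begin

text \<open>For the actual \<open>G0\<close> the remaining components of the Weyl tensor are the two polynomials; normal
  forms are compared as in \<open>cartan_eq\<close>.\<close>

lemma Wm_alpha_1: "q \<in> U \<Longrightarrow> Wm (Some 0) (Some 1) (Some 0) (Some 1) q = fef_alpha M f q"
  unfolding fef_alpha_def Let_def power2_eq_square
  by (simp only: Wm_values D_G0 f_D c_D; simp add: G0_def D_calculus; simp add: ring_normal)

lemma Wm_alpha_2: "q \<in> U \<Longrightarrow> Wm (Some 0) (Some 2) (Some 0) (Some 2) q = - fef_alpha M f q"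
  unfolding fef_alpha_def Let_def power2_eq_square
  by (simp only: Wm_values D_G0 f_D c_D; simp add: G0_def D_calculus; simp add: ring_normal)

lemma Wm_beta_1: "q \<in> U \<Longrightarrow> Wm (Some 0) (Some 1) (Some 0) (Some 2) q = fef_beta M f q"
  unfolding fef_beta_def Let_def power2_eq_square
  by (simp only: Wm_values D_G0 f_D c_D; simp add: G0_def D_calculus; simp add: ring_normal)

lemma Wm_beta_2: "q \<in> U \<Longrightarrow> Wm (Some 0) (Some 2) (Some 0) (Some 1) q = fef_beta M f q"
  unfolding fef_beta_def Let_def power2_eq_square
  by (simp only: Wm_values D_G0 f_D c_D; simp add: G0_def D_calculus; simp add: ring_normal)

text \<open>The coefficients in the definition of \<open>G0\<close> are those for which all these components cancel.\<close>

lemma Wm_zero: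
  "Wm (Some 0) (Some 1) (Some 0) None q = 0"
  "Wm (Some 0) (Some 1) (Some 1) (Some 2) q = 0"
  "Wm (Some 0) (Some 1) (Some 1) None q = 0"
  "Wm (Some 0) (Some 1) (Some 2) None q = 0"
  "Wm (Some 0) (Some 2) (Some 0) None q = 0"
  "Wm (Some 0) (Some 2) (Some 1) (Some 2) q = 0"
  "Wm (Some 0) (Some 2) (Some 1) None q = 0"
  "Wm (Some 0) (Some 2) (Some 2) None q = 0"
  "Wm (Some 0) None (Some 0) (Some 1) q = 0"
  "Wm (Some 0) None (Some 0) (Some 2) q = 0"
  "Wm (Some 0) None (Some 0) None q = 0"
  "Wm (Some 0) None (Some 1) (Some 2) q = 0"
  "Wm (Some 0) None (Some 1) None q = 0"
  "Wm (Some 0) None (Some 2) None q = 0"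
  "Wm (Some 1) (Some 2) (Some 0) (Some 1) q = 0"
  "Wm (Some 1) (Some 2) (Some 0) (Some 2) q = 0"
  "Wm (Some 1) (Some 2) (Some 0) None q = 0"
  "Wm (Some 1) (Some 2) (Some 1) (Some 2) q = 0"
  "Wm (Some 1) (Some 2) (Some 1) None q = 0"
  "Wm (Some 1) (Some 2) (Some 2) None q = 0"
  "Wm (Some 1) None (Some 0) (Some 1) q = 0"
  "Wm (Some 1) None (Some 0) (Some 2) q = 0"
  "Wm (Some 1) None (Some 0) None q = 0"
  "Wm (Some 1) None (Some 1) (Some 2) q = 0"
  "Wm (Some 1) None (Some 1) None q = 0"
  "Wm (Some 1) None (Some 2) None q = 0"
  "Wm (Some 2) None (Some 0) (Some 1) q = 0"
  "Wm (Some 2) None (Some 0) (Some 2) q = 0"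
  "Wm (Some 2) None (Some 0) None q = 0"
  "Wm (Some 2) None (Some 1) (Some 2) q = 0"
  "Wm (Some 2) None (Some 1) None q = 0"
  "Wm (Some 2) None (Some 2) None q = 0"
  by (simp only: Wm_values D_G0; simp add: G0_def D_calculus; simp add: ring_normal)+

lemma Weyl_components:
  assumes K: "levi_civita N UU (fefferman_metric M f) K" and q: "q \<in> U" and z: "z \<in> unit_circle"
  shows "let W = Weyl N (fefferman_metric M f) K FF (q, z) in
    W (Some 0) (Some 1) (Some 0) (Some 1) = fef_alpha M f q \<and>
    W (Some 0) (Some 2) (Some 0) (Some 2) = - fef_alpha M f q \<and>
    W (Some 0) (Some 1) (Some 0) (Some 2) = fef_beta M f q \<and>
    W (Some 0) (Some 2) (Some 0) (Some 1) = fef_beta M f q \<and>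
    (\<forall>i j k l. W j i k l = - W i j k l \<and> W i j l k = - W i j k l) \<and>
    (\<forall>i j k l.
       \<not> (\<exists>a\<in>{1, 2}. \<exists>b\<in>{1, 2}. {i, j} = {Some 0, Some a} \<and> {k, l} = {Some 0, Some b})
       \<longrightarrow> W i j k l = 0)"
proof -
  have "\<forall>i j k l. \<not> (\<exists>a\<in>{1, 2}. \<exists>b\<in>{1, 2}. {i, j} = {Some 0, Some a} \<and> {k, l} = {Some 0, Some b})
      \<longrightarrow> Wm i j k l q = 0"
    unfolding forall_index by (simp add: Wm_zero Wm_order Wm_diag doubleton_eq_iff)
  then show ?thesis
    unfolding Let_def Weyl_Wm[OF K q z]
    by (intro conjI allI Wm_alpha_1[OF q] Wm_alpha_2[OF q] Wm_beta_1[OF q] Wm_beta_2[OF q] Wm_antisym) blast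
qed

end

section \<open>The Weyl tensor and its conformal covariance\<close>

theorem mainTheorem3:
  fixes M :: "('a, real ^ 3) manifold" and M' :: "('b, real ^ 3) manifold"
    and f :: "3 \<Rightarrow> 'a vfield" and f' :: "3 \<Rightarrow> 'b vfield"
  assumes "contact_sub_Riemannian M \<Delta> g \<mu>"
    and "adapted_frame M \<Delta> g \<mu> U f"
  shows
    "(\<forall>D. levi_civita (circle_bundle M) (U \<times> sphere 0 1) (fefferman_metric M f) D \<longrightarrow>
       (\<forall>q\<in>U. \<forall>z\<in>sphere 0 1.
          let W = Weyl (circle_bundle M) (fefferman_metric M f) D (fefferman_frame M f) (q, z) in
            W (Some 0) (Some 1) (Some 0) (Some 1) = fef_alpha M f q \<and>
            W (Some 0) (Some 2) (Some 0) (Some 2) = - fef_alpha M f q \<and>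
            W (Some 0) (Some 1) (Some 0) (Some 2) = fef_beta M f q \<and>
            W (Some 0) (Some 2) (Some 0) (Some 1) = fef_beta M f q \<and>
            (\<forall>i j k l. W j i k l = - W i j k l \<and> W i j l k = - W i j k l) \<and>
            (\<forall>i j k l.
               \<not> (\<exists>a\<in>{1, 2}. \<exists>b\<in>{1, 2}. {i, j} = {Some 0, Some a} \<and> {k, l} = {Some 0, Some b})
               \<longrightarrow> W i j k l = 0))) \<and>
     (\<forall>a b. (\<forall>(N :: (real ^ 3, real ^ 3) manifold) \<Delta>N gN \<mu>N V h.
               contact_sub_Riemannian N \<Delta>N gN \<mu>N \<and> adapted_frame N \<Delta>N gN \<mu>N V h \<longrightarrow>
               (\<forall>q\<in>V. a * fef_alpha N h q + b * fef_beta N h q = 0))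
           \<longrightarrow> a = 0 \<and> b = 0) \<and>
     (\<forall>\<phi>. smooth_fun M U \<phi> \<longrightarrow>
           adapted_frame M \<Delta> (rescale_form \<phi> g) (rescale_form \<phi> \<mu>) U (rescale_frame \<phi> f) \<and>
           (\<forall>q\<in>U.
              fef_alpha M (rescale_frame \<phi> f) q = exp (- 4 * \<phi> q) * fef_alpha M f q \<and>
              fef_beta M (rescale_frame \<phi> f) q = exp (- 4 * \<phi> q) * fef_beta M f q \<and>
              (fef_beta M f q \<noteq> 0 \<longrightarrow>
                 fef_beta M (rescale_frame \<phi> f) q \<noteq> 0 \<and>
                 fef_alpha M (rescale_frame \<phi> f) q / fef_beta M (rescale_frame \<phi> f) q
                   = fef_alpha M f q / fef_beta M f q))) \<and>
     (\<forall>\<Delta>' g' \<mu>' U' \<Psi> \<phi>.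
           contact_sub_Riemannian M' \<Delta>' g' \<mu>' \<and> adapted_frame M' \<Delta>' g' \<mu>' U' f' \<and>
           conformal_equivalence M \<Delta> g \<mu> U M' \<Delta>' g' \<mu>' U' \<Psi> \<phi> \<longrightarrow>
           (\<forall>q\<in>U. \<forall>t.
              pushforward \<Psi> (f 1 q)
                = lincomb (exp (\<phi> q) * cos t) (f' 1 (\<Psi> q)) (exp (\<phi> q) * sin t) (f' 2 (\<Psi> q)) \<longrightarrow>
              (let \<alpha> = fef_alpha M f q; \<beta> = fef_beta M f q;
                   \<alpha>' = fef_alpha M' f' (\<Psi> q); \<beta>' = fef_beta M' f' (\<Psi> q) in
                 cos (2 * t) * \<alpha>' + sin (2 * t) * \<beta>' = exp (- 4 * \<phi> q) * \<alpha> \<and>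
                 cos (2 * t) * \<beta>' - sin (2 * t) * \<alpha>' = exp (- 4 * \<phi> q) * \<beta> \<and>
                 (\<beta> \<noteq> 0 \<and> sin t = 0 \<longrightarrow> \<beta>' \<noteq> 0 \<and> \<alpha>' / \<beta>' = \<alpha> / \<beta>))))"
proof -
  note cs = assms(1) and ad = assms(2)
  interpret contact_frame M U f by (rule adapted_contact_frame(1)[OF cs ad])
  have weyl: "let W = Weyl (circle_bundle M) (fefferman_metric M f) D (fefferman_frame M f) (q, z) in
      W (Some 0) (Some 1) (Some 0) (Some 1) = fef_alpha M f q \<and>
      W (Some 0) (Some 2) (Some 0) (Some 2) = - fef_alpha M f q \<and>
      W (Some 0) (Some 1) (Some 0) (Some 2) = fef_beta M f q \<and>
      W (Some 0) (Some 2) (Some 0) (Some 1) = fef_beta M f q \<and>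
      (\<forall>i j k l. W j i k l = - W i j k l \<and> W i j l k = - W i j k l) \<and>
      (\<forall>i j k l.
         \<not> (\<exists>a\<in>{1, 2}. \<exists>b\<in>{1, 2}. {i, j} = {Some 0, Some a} \<and> {k, l} = {Some 0, Some b})
         \<longrightarrow> W i j k l = 0)"
    if "levi_civita (circle_bundle M) (U \<times> sphere 0 1) (fefferman_metric M f) D" "q \<in> U" "z \<in> sphere 0 1" for D q z
    by (rule Weyl_components[OF that])
  have rescale: "adapted_frame M \<Delta> (rescale_form \<phi> g) (rescale_form \<phi> \<mu>) U (rescale_frame \<phi> f) \<and>
      (\<forall>q\<in>U.
         fef_alpha M (rescale_frame \<phi> f) q = exp (- 4 * \<phi> q) * fef_alpha M f q \<and>
         fef_beta M (rescale_frame \<phi> f) q = exp (- 4 * \<phi> q) * fef_beta M f q \<and>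
         (fef_beta M f q \<noteq> 0 \<longrightarrow>
            fef_beta M (rescale_frame \<phi> f) q \<noteq> 0 \<and>
            fef_alpha M (rescale_frame \<phi> f) q / fef_beta M (rescale_frame \<phi> f) q
              = fef_alpha M f q / fef_beta M f q))"
    if "smooth_fun M U \<phi>" for \<phi>
    using rescaled_adapted[OF cs ad that] by (simp add: rescaled_invariants[OF that])
  have covariant: "let \<alpha> = fef_alpha M f q; \<beta> = fef_beta M f q;
        \<alpha>' = fef_alpha M' f' (\<Psi> q); \<beta>' = fef_beta M' f' (\<Psi> q) in
      cos (2 * t) * \<alpha>' + sin (2 * t) * \<beta>' = exp (- 4 * \<phi> q) * \<alpha> \<and>
      cos (2 * t) * \<beta>' - sin (2 * t) * \<alpha>' = exp (- 4 * \<phi> q) * \<beta> \<and>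
      (\<beta> \<noteq> 0 \<and> sin t = 0 \<longrightarrow> \<beta>' \<noteq> 0 \<and> \<alpha>' / \<beta>' = \<alpha> / \<beta>)"
    if "contact_sub_Riemannian M' \<Delta>' g' \<mu>' \<and> adapted_frame M' \<Delta>' g' \<mu>' U' f' \<and>
        conformal_equivalence M \<Delta> g \<mu> U M' \<Delta>' g' \<mu>' U' \<Psi> \<phi>" and "q \<in> U"
      and "pushforward \<Psi> (f 1 q) = lincomb (exp (\<phi> q) * cos t) (f' 1 (\<Psi> q)) (exp (\<phi> q) * sin t) (f' 2 (\<Psi> q))"
    for \<Delta>' g' \<mu>' U' \<Psi> \<phi> q t
  proof -
    have c: "contact_sub_Riemannian M' \<Delta>' g' \<mu>'" "adapted_frame M' \<Delta>' g' \<mu>' U' f'"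
      "conformal_equivalence M \<Delta> g \<mu> U M' \<Delta>' g' \<mu>' U' \<Psi> \<phi>" using that(1) by blast+
    note e = conformal_covariance[OF cs ad c that(2,3)]
    have "cos (2 * t) = 1" "sin (2 * t) = 0" if "sin t = 0"
      using that by (simp_all add: cos_double_sin sin_double)
    with e have "fef_beta M' f' (\<Psi> q) \<noteq> 0 \<and>
        fef_alpha M' f' (\<Psi> q) / fef_beta M' f' (\<Psi> q) = fef_alpha M f q / fef_beta M f q"
      if "fef_beta M f q \<noteq> 0" "sin t = 0" using that by simp
    with e show ?thesis unfolding Let_def by blast
  qed
  show ?thesis
  proof (intro conjI, goal_cases)
    case 1 show ?case by (intro allI impI ballI) (rule weyl)
    case 2 show ?case by (intro allI impI) (rule invariants_independent)
    case 3 show ?case by (intro allI impI) (rule rescale)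
    case 4 show ?case by (intro allI impI ballI) (rule covariant)
  qed
qed

end
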